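(* Let $A$ be a Fourier Integral Operator on $X$ with phase function $\theta$ satisfying $\partial_3^2\left(\theta|_{X\times X\times\partial B_{\mathbb{R}^N}}\right)(x,y,\xi)\in GL(\mathbb{R}^{N-1})$ whenever $\partial_3\theta(x,y,\xi)=0$ (in a neighborhood of the diagonal), and let $\{\hat\xi^s;\ s\in\{1,\dots,n\}\}$ be the set of stationary points. Furthermore, let $$\forall x\in X\ \forall s\in\{1,\dots,n\}:\ \theta\left(x,x,\hat\xi^s(x,x)\right)\ne0.$$ Then $\left(X\ni x\mapsto k(x,x)\in\mathbb{C}\right)\in C(X)$ and $$\mathrm{tr}\,A=\int_Xk(x,x)\,d\mathrm{vol}_X(x)$$ is well-defined, i.e. $A$ is a Hilbert-Schmidt operator. Furthermore, $\zeta$-functions of such operators have no poles (since the trace integral always exists).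
   Context: $X$ is a compact Riemannian manifold without boundary. $A$ has Schwartz kernel $k(x,y)=\int_{\mathbb{R}^N}e^{i\theta(x,y,\xi)}a(x,y,\xi)\,d\xi$, an oscillatory integral with phase function $\theta$ (homogeneous of degree $1$ in $\xi$) and poly-$\log$-homogeneous amplitude $a=a_0+\sum_{\iota\in I}a_\iota$ ($a_0(x,y,\cdot)$ integrable, each $a_\iota$ of the form $a_\iota(x,y,r\eta)=r^{d_\iota}(\ln r)^{l_\iota}\tilde a_\iota(x,y,\eta)$ for $\eta\in\partial B_{\mathbb{R}^N}$, $d_\iota\in\mathbb{C}$, $l_\iota\in\mathbb{N}_0$). Derivatives $\partial_3$ in the condition on $\theta$ are taken with respect to $\xi$ within the unit sphere $\partial B_{\mathbb{R}^N}$; the stationary points $\hat\xi^s(x,y)\in\partial B_{\mathbb{R}^N}$ are the (finitely many, isolated, smoothly depending on $(x,y)$) points where the derivative of $\theta(x,y,\cdot)|_{\partial B_{\mathbb{R}^N}}$ vanishes. The $\zeta$-function of a holomorphic family $z\mapsto A(z)$ of such operators with the same phase and amplitudes $a(z)$ whose terms $a_\iota(z)$ have degrees of homogeneity $d_\iota+z$ is the meromorphic extension of $z\mapsto\mathrm{tr}\,A(z)$ from $\mathrm{Re}\,z$ sufficiently small.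
   Formalization: Hilbert-Schmidt is claimed only for A with amplitude supported (or cut off) in a compact part of the neighborhood of the diagonal where θ≠0 at all stationary points; a_0 is L^1-continuous in (x,y), other terms are smooth on the sphere, their series L^1-convergent up to finitely many. *)

theory Defs
  imports "HOL-Complex_Analysis.Complex_Analysis"
begin

section \<open>Smooth functions on open subsets of Euclidean spaces\<close>

text \<open>Both notions below are meant for open \<open>S\<close> only.\<close>

primrec Ck_on ::
  "nat \<Rightarrow> 'e::euclidean_space set \<Rightarrow> ('e \<Rightarrow> 'f::real_normed_vector) \<Rightarrow> bool" where
  "Ck_on 0 S f \<longleftrightarrow> continuous_on S f"
| "Ck_on (Suc k) S f \<longleftrightarrow>
     (\<forall>u\<in>S. f differentiable (at u)) \<and>
     (\<forall>v. Ck_on k S (\<lambda>u. frechet_derivative f (at u) v))"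

definition smooth_fun_on ::
  "'e::euclidean_space set \<Rightarrow> ('e \<Rightarrow> 'f::real_normed_vector) \<Rightarrow> bool" where
  "smooth_fun_on S f \<longleftrightarrow> (\<forall>k. Ck_on k S f)"

section \<open>Manifolds without boundary\<close>

text \<open>The manifold is the whole type \<open>'a\<close>. A chart is a pair of its domain and the coordinate
  map; values of the coordinate map outside the domain are irrelevant.\<close>

type_synonym ('a, 'e) chart = "'a set \<times> ('a \<Rightarrow> 'e)"

definition smooth_atlas ::
  "('a::topological_space, 'e::euclidean_space) chart set \<Rightarrow> bool" where
  "smooth_atlas \<A> \<longleftrightarrow>
     (\<Union>(D, \<phi>)\<in>\<A>. D) = UNIV \<and>
     (\<forall>(D, \<phi>)\<in>\<A>. open D \<and> open (\<phi> ` D) \<and> homeomorphism D (\<phi> ` D) \<phi> (inv_into D \<phi>)) \<and>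
     (\<forall>(D, \<phi>)\<in>\<A>. \<forall>(D', \<phi>')\<in>\<A>. smooth_fun_on (\<phi> ` (D \<inter> D')) (\<phi>' \<circ> inv_into D \<phi>))"

definition prod_atlas ::
  "('a, 'e) chart set \<Rightarrow> ('b, 'f) chart set \<Rightarrow> ('a \<times> 'b, 'e \<times> 'f) chart set" where
  "prod_atlas \<A> \<B> = {(D \<times> D', map_prod \<phi> \<psi>) |D \<phi> D' \<psi>. (D, \<phi>) \<in> \<A> \<and> (D', \<psi>) \<in> \<B>}"

definition euclidean_atlas :: "('e, 'e) chart set" where
  "euclidean_atlas = {(UNIV, id)}"

definition mfd_smooth_on ::
  "('a::topological_space, 'e::euclidean_space) chart set \<Rightarrow> 'a set \<Rightarrow>
     ('a \<Rightarrow> 'f::real_normed_vector) \<Rightarrow> bool" where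
  "mfd_smooth_on \<A> W f \<longleftrightarrow>
     open W \<and> (\<forall>(D, \<phi>)\<in>\<A>. smooth_fun_on (\<phi> ` (D \<inter> W)) (f \<circ> inv_into D \<phi>))"

text \<open>A metric assigns to every chart \<open>c\<close> and every point \<open>p\<close> of its domain the Gram matrix
  \<open>g c p\<close> of the coordinate frame; the last conjunct is the transformation law of a
  covariant 2-tensor.\<close>

definition riemannian_metric ::
  "('a::topological_space, real^'m) chart set \<Rightarrow>
     (('a, real^'m) chart \<Rightarrow> 'a \<Rightarrow> real^'m^'m) \<Rightarrow> bool" where
  "riemannian_metric \<A> g \<longleftrightarrow>
     (\<forall>(D, \<phi>)\<in>\<A>.
        smooth_fun_on (\<phi> ` D) (g (D, \<phi>) \<circ> inv_into D \<phi>) \<and>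
        (\<forall>p\<in>D. transpose (g (D, \<phi>) p) = g (D, \<phi>) p \<and>
               (\<forall>v. v \<noteq> 0 \<longrightarrow> 0 < v \<bullet> (g (D, \<phi>) p *v v)))) \<and>
     (\<forall>(D, \<phi>)\<in>\<A>. \<forall>(D', \<phi>')\<in>\<A>. \<forall>p\<in>D \<inter> D'.
        (let J = matrix (frechet_derivative (\<phi>' \<circ> inv_into D \<phi>) (at (\<phi> p)))
         in g (D, \<phi>) p = transpose J ** g (D', \<phi>') p ** J))"

definition riemannian_volume ::
  "('a::topological_space, real^'m) chart set \<Rightarrow>
     (('a, real^'m) chart \<Rightarrow> 'a \<Rightarrow> real^'m^'m) \<Rightarrow> 'a measure \<Rightarrow> bool" where
  "riemannian_volume \<A> g vol \<longleftrightarrow>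
     sets vol = sets borel \<and>
     (\<forall>(D, \<phi>)\<in>\<A>. \<forall>B\<in>sets borel. B \<subseteq> D \<longrightarrow>
        emeasure vol B =
          (\<integral>\<^sup>+ u. ennreal (sqrt (det (g (D, \<phi>) (inv_into D \<phi> u)))) * indicator (\<phi> ` B) u \<partial>lborel))"

definition compact_riemannian_manifold ::
  "('a::{t2_space, second_countable_topology}, real^'m) chart set \<Rightarrow>
     (('a, real^'m) chart \<Rightarrow> 'a \<Rightarrow> real^'m^'m) \<Rightarrow> 'a measure \<Rightarrow> bool" where
  "compact_riemannian_manifold \<A> g vol \<longleftrightarrow>
     compact (UNIV :: 'a set) \<and> smooth_atlas \<A> \<and> riemannian_metric \<A> g \<and>
     riemannian_volume \<A> g vol"

section \<open>Derivatives on the unit sphere\<close>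

text \<open>The derivative of \<open>f\<close> restricted to the unit sphere, represented by a tangent vector.\<close>

definition sphere_gradient :: "(real^'n \<Rightarrow> real) \<Rightarrow> real^'n \<Rightarrow> real^'n" where
  "sphere_gradient f \<eta> =
     (THE v. v \<bullet> \<eta> = 0 \<and> (f has_derivative (\<lambda>w. v \<bullet> w)) (at \<eta> within sphere 0 1))"

definition sphere_stationary :: "(real^'n \<Rightarrow> real) \<Rightarrow> real^'n \<Rightarrow> bool" where
  "sphere_stationary f \<eta> \<longleftrightarrow> \<eta> \<in> sphere 0 1 \<and> sphere_gradient f \<eta> = 0"

text \<open>At a stationary point the second derivative is a well-defined endomorphism of the tangent
  space; only there is this predicate used.\<close>

definition sphere_hessian_invertible :: "(real^'n \<Rightarrow> real) \<Rightarrow> real^'n \<Rightarrow> bool" where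
  "sphere_hessian_invertible f \<eta> \<longleftrightarrow>
     (\<exists>H. (sphere_gradient f has_derivative H) (at \<eta> within sphere 0 1) \<and>
          bij_betw H {v. v \<bullet> \<eta> = 0} {v. v \<bullet> \<eta> = 0})"

section \<open>Phase functions\<close>

definition phase_function ::
  "('a::topological_space, 'e::euclidean_space) chart set \<Rightarrow>
     ('a \<Rightarrow> 'a \<Rightarrow> real^'n \<Rightarrow> real) \<Rightarrow> bool" where
  "phase_function \<A> \<theta> \<longleftrightarrow>
     mfd_smooth_on (prod_atlas \<A> (prod_atlas \<A> euclidean_atlas)) (UNIV \<times> UNIV \<times> - {0})
       (\<lambda>(x, y, \<xi>). \<theta> x y \<xi>) \<and>
     (\<forall>x y r \<xi>. 0 < r \<longrightarrow> \<xi> \<noteq> 0 \<longrightarrow> \<theta> x y (r *\<^sub>R \<xi>) = r * \<theta> x y \<xi>)"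

text \<open>The points \<open>\<sigma> 1 x y, \<dots>, \<sigma> n x y\<close> are the distinct stationary points over \<open>(x, y) \<in> U\<close>.\<close>

definition stationary_points_on ::
  "('a::topological_space, 'e::euclidean_space) chart set \<Rightarrow> ('a \<times> 'a) set \<Rightarrow>
     ('a \<Rightarrow> 'a \<Rightarrow> real^'n \<Rightarrow> real) \<Rightarrow> nat \<Rightarrow> (nat \<Rightarrow> 'a \<Rightarrow> 'a \<Rightarrow> real^'n) \<Rightarrow> bool" where
  "stationary_points_on \<A> U \<theta> n \<sigma> \<longleftrightarrow>
     (\<forall>s\<in>{1..n}. mfd_smooth_on (prod_atlas \<A> \<A>) U (\<lambda>(x, y). \<sigma> s x y)) \<and>
     (\<forall>(x, y)\<in>U. {\<eta>. sphere_stationary (\<theta> x y) \<eta>} = (\<lambda>s. \<sigma> s x y) ` {1..n} \<and>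
                  inj_on (\<lambda>s. \<sigma> s x y) {1..n})"

text \<open>If \<open>\<theta>\<close> does not vanish at the stationary points over the diagonal, this is an open
  neighbourhood of the diagonal.\<close>

definition nonvanishing_region ::
  "('a \<times> 'a) set \<Rightarrow> ('a \<Rightarrow> 'a \<Rightarrow> real^'n \<Rightarrow> real) \<Rightarrow> nat \<Rightarrow>
     (nat \<Rightarrow> 'a \<Rightarrow> 'a \<Rightarrow> real^'n) \<Rightarrow> ('a \<times> 'a) set" where
  "nonvanishing_region U \<theta> n \<sigma> =
     {(x, y). (x, y) \<in> U \<and> (\<forall>s\<in>{1..n}. \<theta> x y (\<sigma> s x y) \<noteq> 0)}"

section \<open>Poly-log-homogeneous amplitudes\<close>

text \<open>Amplitude terms are cut off inside the unit ball, where \<open>r powr d\<close> need not be integrable;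
  the part of the amplitude inside the ball belongs to the integrable term.\<close>

definition log_homogeneous_term ::
  "complex \<Rightarrow> nat \<Rightarrow> ('a \<Rightarrow> 'a \<Rightarrow> real^'n \<Rightarrow> complex) \<Rightarrow> 'a \<Rightarrow> 'a \<Rightarrow> real^'n \<Rightarrow> complex" where
  "log_homogeneous_term d l b x y \<xi> =
     (if 1 \<le> norm \<xi>
      then of_real (norm \<xi>) powr d * of_real (ln (norm \<xi>) ^ l) * b x y (\<xi> /\<^sub>R norm \<xi>)
      else 0)"

text \<open>\<open>L1_continuous\<close>: the map \<open>(x, y) \<mapsto> b x y\<close> is continuous with values in \<open>L\<^sup>1(\<real>\<^sup>N)\<close>.
  \<open>L1_holomorphic\<close>: the map \<open>z \<mapsto> b z\<close> is entire with values in the Banach space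
  \<open>C(X \<times> X; L\<^sup>1(\<real>\<^sup>N))\<close>.\<close>

definition L1_continuous ::
  "('a::topological_space \<Rightarrow> 'a \<Rightarrow> real^'n \<Rightarrow> complex) \<Rightarrow> bool" where
  "L1_continuous b \<longleftrightarrow>
     (\<forall>x y. integrable lborel (b x y)) \<and>
     (\<forall>x0 y0. ((\<lambda>(x, y). LINT \<xi>|lborel. norm (b x y \<xi> - b x0 y0 \<xi>)) \<longlongrightarrow> 0) (at (x0, y0)))"

definition L1_holomorphic ::
  "(complex \<Rightarrow> 'a::topological_space \<Rightarrow> 'a \<Rightarrow> real^'n \<Rightarrow> complex) \<Rightarrow> bool" where
  "L1_holomorphic b \<longleftrightarrow>
     (\<forall>z. L1_continuous (b z)) \<and>
     (\<forall>z. \<exists>b'. L1_continuous b' \<and>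
        uniform_limit UNIV
          (\<lambda>w (x, y). LINT \<xi>|lborel. norm ((b w x y \<xi> - b z x y \<xi>) / (w - z) - b' x y \<xi>))
          (\<lambda>_. 0) (at z))"

text \<open>A series over \<open>J\<close> converging absolutely in \<open>L\<^sup>1(\<real>\<^sup>N)\<close>, uniformly in \<open>(x, y)\<close> and in the
  parameter \<open>z \<in> K\<close>.\<close>

definition L1_summable ::
  "complex set \<Rightarrow> nat set \<Rightarrow>
     (complex \<Rightarrow> nat \<Rightarrow> 'a \<Rightarrow> 'a \<Rightarrow> real^'n \<Rightarrow> complex) \<Rightarrow> bool" where
  "L1_summable K J t \<longleftrightarrow>
     (\<exists>M. M summable_on J \<and>
        (\<forall>\<iota>\<in>J. \<forall>z\<in>K. \<forall>x y. integrable lborel (t z \<iota> x y) \<and>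
            (LINT \<xi>|lborel. norm (t z \<iota> x y \<xi>)) \<le> M \<iota>))"

text \<open>The angular parts \<open>b \<iota>\<close> are smooth on \<open>X \<times> X \<times> S\<close> with \<open>S\<close> the unit sphere; this is
  expressed by smoothness of their extensions of degree 0 to nonzero covectors. The index set
  \<open>I\<close> may be infinite: up to finitely many terms, the series has to converge in \<open>L\<^sup>1\<close>.\<close>

definition poly_log_homogeneous ::
  "('a::topological_space, 'e::euclidean_space) chart set \<Rightarrow>
     ('a \<Rightarrow> 'a \<Rightarrow> real^'n \<Rightarrow> complex) \<Rightarrow> bool" where
  "poly_log_homogeneous \<A> a \<longleftrightarrow>
     (\<exists>I d l a0 b.
        L1_continuous a0 \<and>
        (\<forall>\<iota>\<in>I. mfd_smooth_on (prod_atlas \<A> (prod_atlas \<A> euclidean_atlas))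
                  (UNIV \<times> UNIV \<times> - {0}) (\<lambda>(x, y, \<xi>). b \<iota> x y (\<xi> /\<^sub>R norm \<xi>))) \<and>
        (\<exists>F. finite F \<and> F \<subseteq> I \<and>
             L1_summable {0} (I - F) (\<lambda>_ \<iota>. log_homogeneous_term (d \<iota>) (l \<iota>) (b \<iota>))) \<and>
        (\<forall>x y \<xi>. a x y \<xi> =
           a0 x y \<xi> + (\<Sum>\<^sub>\<infinity>\<iota>\<in>I. log_homogeneous_term (d \<iota>) (l \<iota>) (b \<iota>) x y \<xi>)))"

definition holomorphic_poly_log_family ::
  "('a::topological_space, 'e::euclidean_space) chart set \<Rightarrow>
     (complex \<Rightarrow> 'a \<Rightarrow> 'a \<Rightarrow> real^'n \<Rightarrow> complex) \<Rightarrow> bool" where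
  "holomorphic_poly_log_family \<A> a \<longleftrightarrow>
     (\<exists>I d l a0 b.
        L1_holomorphic a0 \<and>
        (\<forall>\<iota>\<in>I. mfd_smooth_on
                  (prod_atlas euclidean_atlas (prod_atlas \<A> (prod_atlas \<A> euclidean_atlas)))
                  (UNIV \<times> UNIV \<times> UNIV \<times> - {0})
                  (\<lambda>(z, x, y, \<xi>). b \<iota> z x y (\<xi> /\<^sub>R norm \<xi>)) \<and>
               (\<forall>x y. \<forall>\<eta>\<in>sphere 0 1. (\<lambda>z. b \<iota> z x y \<eta>) holomorphic_on UNIV)) \<and>
        (\<forall>K. compact K \<longrightarrow>
           (\<exists>F. finite F \<and> F \<subseteq> I \<and>
             L1_summable K (I - F) (\<lambda>z \<iota>. log_homogeneous_term (d \<iota> + z) (l \<iota>) (b \<iota> z)))) \<and>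
        (\<forall>z x y \<xi>. a z x y \<xi> =
           a0 z x y \<xi> + (\<Sum>\<^sub>\<infinity>\<iota>\<in>I. log_homogeneous_term (d \<iota> + z) (l \<iota>) (b \<iota> z) x y \<xi>)))"

section \<open>Oscillatory integrals, kernels and traces\<close>

primrec rapidly_decreasing :: "nat \<Rightarrow> (real^'n \<Rightarrow> complex) \<Rightarrow> bool" where
  "rapidly_decreasing 0 f \<longleftrightarrow>
     continuous_on UNIV f \<and> (\<forall>m::nat. bounded (range (\<lambda>u. norm u ^ m *\<^sub>R f u)))"
| "rapidly_decreasing (Suc k) f \<longleftrightarrow>
     (\<forall>u. f differentiable (at u)) \<and>
     (\<forall>v. rapidly_decreasing k (\<lambda>u. frechet_derivative f (at u) v))"

definition schwartz :: "(real^'n \<Rightarrow> complex) \<Rightarrow> bool" where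
  "schwartz f \<longleftrightarrow> (\<forall>k. rapidly_decreasing k f)"

text \<open>The value of the oscillatory integral of \<open>e\<^sup>i\<^sup>\<theta> a\<close> is its limit under every regularisation
  \<open>\<kappa>(\<epsilon>\<xi>)\<close> with a Schwartz function \<open>\<kappa>\<close>, \<open>\<kappa>(0) = 1\<close>.\<close>

definition has_oscillatory_integral ::
  "(real^'n \<Rightarrow> real) \<Rightarrow> (real^'n \<Rightarrow> complex) \<Rightarrow> complex \<Rightarrow> bool" where
  "has_oscillatory_integral \<theta> a c \<longleftrightarrow>
     (\<forall>\<kappa>. schwartz \<kappa> \<and> \<kappa> 0 = 1 \<longrightarrow>
        (\<forall>\<epsilon>>0. integrable lborel (\<lambda>\<xi>. \<kappa> (\<epsilon> *\<^sub>R \<xi>) * exp (\<i> * of_real (\<theta> \<xi>)) * a \<xi>)) \<and>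
        ((\<lambda>\<epsilon>. LINT \<xi>|lborel. \<kappa> (\<epsilon> *\<^sub>R \<xi>) * exp (\<i> * of_real (\<theta> \<xi>)) * a \<xi>) \<longlongrightarrow> c)
          (at_right 0))"

text \<open>The kernel \<open>k(x,y)\<close>; it is meaningful only where the oscillatory integral exists.\<close>

definition fio_kernel ::
  "('a \<Rightarrow> 'a \<Rightarrow> real^'n \<Rightarrow> real) \<Rightarrow> ('a \<Rightarrow> 'a \<Rightarrow> real^'n \<Rightarrow> complex) \<Rightarrow> 'a \<Rightarrow> 'a \<Rightarrow> complex" where
  "fio_kernel \<theta> a x y = (THE c. has_oscillatory_integral (\<theta> x y) (a x y) c)"

definition fio_trace_exists ::
  "'a measure \<Rightarrow> ('a \<Rightarrow> 'a \<Rightarrow> real^'n \<Rightarrow> real) \<Rightarrow> ('a \<Rightarrow> 'a \<Rightarrow> real^'n \<Rightarrow> complex) \<Rightarrow> bool" where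
  "fio_trace_exists vol \<theta> a \<longleftrightarrow>
     (\<forall>x. \<exists>c. has_oscillatory_integral (\<theta> x x) (a x x) c) \<and>
     integrable vol (\<lambda>x. fio_kernel \<theta> a x x)"

definition fio_trace ::
  "'a measure \<Rightarrow> ('a \<Rightarrow> 'a \<Rightarrow> real^'n \<Rightarrow> real) \<Rightarrow> ('a \<Rightarrow> 'a \<Rightarrow> real^'n \<Rightarrow> complex) \<Rightarrow> complex" where
  "fio_trace vol \<theta> a = (LINT x|vol. fio_kernel \<theta> a x x)"

text \<open>The zeta function is only determined up to its values at isolated (removable or polar)
  singularities, since \<open>meromorphic_on\<close> leaves these values unconstrained.\<close>

definition is_zeta_function ::
  "'a measure \<Rightarrow> ('a \<Rightarrow> 'a \<Rightarrow> real^'n \<Rightarrow> real) \<Rightarrow>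
     (complex \<Rightarrow> 'a \<Rightarrow> 'a \<Rightarrow> real^'n \<Rightarrow> complex) \<Rightarrow> (complex \<Rightarrow> complex) \<Rightarrow> bool" where
  "is_zeta_function vol \<theta> a \<zeta> \<longleftrightarrow>
     \<zeta> meromorphic_on UNIV \<and>
     (\<exists>R. \<forall>z. Re z < R \<longrightarrow> fio_trace_exists vol \<theta> (a z) \<and> \<zeta> z = fio_trace vol \<theta> (a z))"

section \<open>Hilbert-Schmidt operators\<close>

text \<open>Elements of \<open>L\<^sup>2\<close> are represented by functions, with equality almost everywhere.\<close>

definition L2_fun :: "'a measure \<Rightarrow> ('a \<Rightarrow> complex) set" where
  "L2_fun M = {f. f \<in> borel_measurable M \<and> integrable M (\<lambda>x. (norm (f x))\<^sup>2)}"

definition L2_inner :: "'a measure \<Rightarrow> ('a \<Rightarrow> complex) \<Rightarrow> ('a \<Rightarrow> complex) \<Rightarrow> complex" where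
  "L2_inner M f g = (LINT x|M. f x * cnj (g x))"

definition L2_norm_fun :: "'a measure \<Rightarrow> ('a \<Rightarrow> complex) \<Rightarrow> real" where
  "L2_norm_fun M f = sqrt (LINT x|M. (norm (f x))\<^sup>2)"

definition L2_orthonormal_basis :: "'a measure \<Rightarrow> ('a \<Rightarrow> complex) set \<Rightarrow> bool" where
  "L2_orthonormal_basis M E \<longleftrightarrow>
     E \<subseteq> L2_fun M \<and>
     (\<forall>e\<in>E. \<forall>f\<in>E. L2_inner M e f = (if e = f then 1 else 0)) \<and>
     (\<forall>f\<in>L2_fun M. (\<forall>e\<in>E. L2_inner M f e = 0) \<longrightarrow> (AE x in M. f x = 0))"

definition L2_bounded_operator ::
  "'a measure \<Rightarrow> (('a \<Rightarrow> complex) \<Rightarrow> 'a \<Rightarrow> complex) \<Rightarrow> bool" where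
  "L2_bounded_operator M T \<longleftrightarrow>
     (\<forall>f\<in>L2_fun M. T f \<in> L2_fun M) \<and>
     (\<forall>f\<in>L2_fun M. \<forall>g\<in>L2_fun M. \<forall>c.
        AE x in M. T (\<lambda>x. c * f x + g x) x = c * T f x + T g x) \<and>
     (\<exists>C. \<forall>f\<in>L2_fun M. L2_norm_fun M (T f) \<le> C * L2_norm_fun M f)"

definition hilbert_schmidt ::
  "'a measure \<Rightarrow> (('a \<Rightarrow> complex) \<Rightarrow> 'a \<Rightarrow> complex) \<Rightarrow> bool" where
  "hilbert_schmidt M T \<longleftrightarrow>
     L2_bounded_operator M T \<and>
     (\<exists>E. L2_orthonormal_basis M E \<and> (\<lambda>e. (L2_norm_fun M (T e))\<^sup>2) summable_on E)"

text \<open>The Fourier integral operator with phase \<open>\<theta>\<close> and amplitude \<open>a\<close> maps a test function \<open>f\<close> to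
  the distribution whose pairing with \<open>h\<close> is the (distributional) oscillatory integral of
  \<open>e\<^sup>i\<^sup>\<theta> a(x,y,\<xi>) f(y) h(x)\<close>. It is a Hilbert-Schmidt operator if it is induced by one on
  \<open>L\<^sup>2(X)\<close>.\<close>

definition fio_pairing ::
  "'a measure \<Rightarrow> ('a \<Rightarrow> 'a \<Rightarrow> real^'n \<Rightarrow> real) \<Rightarrow> ('a \<Rightarrow> 'a \<Rightarrow> real^'n \<Rightarrow> complex) \<Rightarrow>
     (real^'n \<Rightarrow> complex) \<Rightarrow> real \<Rightarrow> ('a \<Rightarrow> complex) \<Rightarrow> ('a \<Rightarrow> complex) \<Rightarrow> complex" where
  "fio_pairing vol \<theta> a \<kappa> \<epsilon> f h =
     (LINT x|vol. LINT y|vol. LINT \<xi>|lborel.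
        \<kappa> (\<epsilon> *\<^sub>R \<xi>) * exp (\<i> * of_real (\<theta> x y \<xi>)) * a x y \<xi> * f y * h x)"

definition fio_hilbert_schmidt ::
  "('a::topological_space, 'e::euclidean_space) chart set \<Rightarrow> 'a measure \<Rightarrow>
     ('a \<Rightarrow> 'a \<Rightarrow> real^'n \<Rightarrow> real) \<Rightarrow> ('a \<Rightarrow> 'a \<Rightarrow> real^'n \<Rightarrow> complex) \<Rightarrow> bool" where
  "fio_hilbert_schmidt \<A> vol \<theta> a \<longleftrightarrow>
     (\<exists>T. hilbert_schmidt vol T \<and>
        (\<forall>f h \<kappa>. mfd_smooth_on \<A> UNIV f \<and> mfd_smooth_on \<A> UNIV h \<and> schwartz \<kappa> \<and> \<kappa> 0 = 1 \<longrightarrow>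
           ((\<lambda>\<epsilon>. fio_pairing vol \<theta> a \<kappa> \<epsilon> f h) \<longlongrightarrow> (LINT x|vol. T f x * h x)) (at_right 0)))"

end

theory Submission
  imports Defs
begin

text \<open>The theorem is an instance of the principle of non-stationary phase. By Euler's relation the
radial derivative of \<open>\<theta> x y\<close> at a unit vector is the value of \<open>\<theta> x y\<close> there. Hence if \<open>\<theta> x y\<close> does not
vanish at the stationary points of its restriction to the sphere, then its full gradient in \<open>\<xi>\<close> has no
zero at all: a zero \<open>\<xi>\<close> would make \<open>\<xi> /\<^sub>R norm \<xi>\<close> a stationary point at which \<open>\<theta> x y\<close> vanishes
(\<open>phase_no_critical_points\<close>). The gradient is homogeneous of degree 0, so it is bounded away from 0
uniformly over a compact set of pairs \<open>(x, y)\<close>.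

Dividing the gradient by its square gives a vector field \<open>V\<close>, with symbols of order 0 as coefficients,
such that \<open>-i V\<close> reproduces \<open>exp (i \<theta>)\<close>. Each integration by parts with \<open>V\<close> lowers the order of
the amplitude by one (\<open>integration_by_parts_step\<close>), and after finitely many of them the
integral converges absolutely. A regularising factor \<open>\<kappa> (\<epsilon> \<xi>)\<close> does not disturb this: it is a symbol of
order 0 uniformly in \<open>\<epsilon> \<ge> 0\<close>. The regularised integrals, continued to \<open>\<epsilon> = 0\<close> by the value of the
oscillatory integral, are therefore jointly continuous in \<open>\<epsilon>\<close> and all parameters
(\<open>osc_continuous_symbol\<close>). This one statement contains the existence of the oscillatory
integral, its continuity in the parameters, and the uniform convergence of the regularisations over
compact parameter sets.

The terms of the amplitude are symbols, even with the complex variable \<open>z\<close> of a holomorphic family as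
an additional parameter; the integrable term and the series that converges in \<open>L\<^sup>1\<close> need no
oscillation, only dominated convergence and the Weierstrass criterion. Uniform limits preserve
holomorphy in \<open>z\<close>. Over the compact diagonal the kernel is thus continuous in \<open>x\<close> and entire
in \<open>z\<close>, and the volume is finite (\<open>riemannian_volume_finite\<close>), so the trace exists and is an entire function of \<open>z\<close>. By the
identity theorem a meromorphic function that agrees with it on a half-plane has no poles
(\<open>meromorphic_extension_no_pole\<close>).

Over a compact subset of the region in which \<open>\<theta>\<close> is nonzero at its stationary points, the kernel is
bounded. On a finite measure space an operator with bounded kernel is a Hilbert-Schmidt
operator, by Bessel's inequality for each row of the kernel (\<open>kernel_op_hilbert_schmidt\<close>), and it
is the given Fourier integral operator because the regularised kernels converge to it uniformly.\<close>

section \<open>Symbols depending on a parameter\<close>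

definition dir_deriv :: "'v::real_normed_vector \<Rightarrow> ('q \<Rightarrow> 'v \<Rightarrow> 'b::real_normed_vector) \<Rightarrow> 'q \<Rightarrow> 'v \<Rightarrow> 'b" where
  "dir_deriv v f q \<xi> = vector_derivative (\<lambda>t. f q (\<xi> + t *\<^sub>R v)) (at 0)"

definition has_dir_deriv ::
  "('q \<Rightarrow> 'v::real_normed_vector \<Rightarrow> 'b::real_normed_vector) \<Rightarrow> 'v \<Rightarrow> 'q \<Rightarrow> 'v \<Rightarrow> 'b \<Rightarrow> bool" where
  "has_dir_deriv f v q \<xi> d \<longleftrightarrow> ((\<lambda>t. f q (\<xi> + t *\<^sub>R v)) has_vector_derivative d) (at 0)"

lemma dir_deriv_eqI: "has_dir_deriv f v q \<xi> d \<Longrightarrow> dir_deriv v f q \<xi> = d"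
  by (simp add: has_dir_deriv_def dir_deriv_def vector_derivative_at)

lemma has_dir_deriv_dir_deriv: "has_dir_deriv f v q \<xi> d \<Longrightarrow> has_dir_deriv f v q \<xi> (dir_deriv v f q \<xi>)"
  by (simp add: dir_deriv_eqI)

lemma eventually_line_in_open:
  fixes \<xi> v :: "'v::real_normed_vector"
  assumes "open S" "\<xi> \<in> S"
  shows "\<forall>\<^sub>F t in nhds (0::real). \<xi> + t *\<^sub>R v \<in> S"
proof -
  have "((\<lambda>t::real. \<xi> + t *\<^sub>R v) \<longlongrightarrow> \<xi> + 0 *\<^sub>R v) (nhds 0)"
    by (intro tendsto_add tendsto_scaleR tendsto_const) (simp add: tendsto_ident_at filterlim_def)
  then show ?thesis using assms by (auto dest: topological_tendstoD)
qed

lemma has_dir_deriv_cong: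
  assumes "open S" "\<xi> \<in> S" "\<And>\<eta>. \<eta> \<in> S \<Longrightarrow> f q \<eta> = g q \<eta>"
  shows "has_dir_deriv f v q \<xi> d \<longleftrightarrow> has_dir_deriv g v q \<xi> d"
proof -
  have "\<forall>\<^sub>F t in nhds 0. f q (\<xi> + t *\<^sub>R v) = g q (\<xi> + t *\<^sub>R v)"
    using eventually_line_in_open[OF assms(1,2)] by eventually_elim (rule assms(3))
  then show ?thesis unfolding has_dir_deriv_def
    by (intro has_vector_derivative_cong_ev) (auto elim: eventually_mono dest: eventually_nhds_x_imp_x)
qed

lemma dir_deriv_cong:
  assumes "open S" "\<xi> \<in> S" "\<And>\<eta>. \<eta> \<in> S \<Longrightarrow> f q \<eta> = g q \<eta>"
  shows "dir_deriv v f q \<xi> = dir_deriv v g q \<xi>"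
  using has_dir_deriv_cong[of S \<xi> f q g v, OF assms]
  unfolding dir_deriv_def vector_derivative_def has_dir_deriv_def by simp

lemma has_dir_deriv_mult:
  fixes f g :: "'q \<Rightarrow> 'v::real_normed_vector \<Rightarrow> 'b::real_normed_algebra"
  assumes "has_dir_deriv f v q \<xi> d" "has_dir_deriv g v q \<xi> e"
  shows "has_dir_deriv (\<lambda>q \<xi>. f q \<xi> * g q \<xi>) v q \<xi> (f q \<xi> * e + d * g q \<xi>)"
  using has_vector_derivative_mult[OF assms[unfolded has_dir_deriv_def]]
  by (simp add: has_dir_deriv_def)

lemma has_dir_deriv_add:
  assumes "has_dir_deriv f v q \<xi> d" "has_dir_deriv g v q \<xi> e"
  shows "has_dir_deriv (\<lambda>q \<xi>. f q \<xi> + g q \<xi>) v q \<xi> (d + e)"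
  using assms unfolding has_dir_deriv_def by (intro derivative_intros)

text \<open>Amplitudes live on \<open>norm \<xi> \<ge> 1\<close>. The slightly larger open set makes two-sided derivatives available on the
unit sphere itself.\<close>

abbreviation outer :: "'v::real_normed_vector set" where "outer \<equiv> {\<xi>. 1/2 < norm \<xi>}"

lemma open_outer: "open outer"
  by (intro open_Collect_less continuous_intros)

lemma outer_nz: "\<xi> \<in> outer \<Longrightarrow> \<xi> \<noteq> 0" by auto

definition symbol_bound :: "'q::topological_space set \<Rightarrow> real \<Rightarrow> ('q \<Rightarrow> 'v::real_normed_vector \<Rightarrow> complex) \<Rightarrow> bool" where
  "symbol_bound Q m f \<longleftrightarrow> continuous_on (Q \<times> outer) (\<lambda>(q, \<xi>). f q \<xi>) \<and>
     (\<exists>C. \<forall>q\<in>Q. \<forall>\<xi>\<in>outer. norm (f q \<xi>) \<le> C * norm \<xi> powr m)"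

text \<open>Symbols of order \<open>m\<close> with \<open>k\<close> derivatives controlled: every derivative in \<open>\<xi>\<close> lowers the order by
one. The parameter enters only continuously, and the bounds are uniform in it; all parameters of the
problem (the points \<open>x\<close> and \<open>y\<close>, the family variable \<open>z\<close>, the regularisation \<open>\<epsilon>\<close>) are treated in this
way. The number \<open>k\<close> stays visible because the cutoff functions used below are differentiable only
finitely often.\<close>

primrec symbol :: "nat \<Rightarrow> 'q::topological_space set \<Rightarrow> real \<Rightarrow> ('q \<Rightarrow> 'v::real_normed_vector \<Rightarrow> complex) \<Rightarrow> bool" where
  "symbol 0 Q m f \<longleftrightarrow> symbol_bound Q m f"
| "symbol (Suc k) Q m f \<longleftrightarrow> symbol_bound Q m f \<and>
     (\<forall>v. (\<forall>q\<in>Q. \<forall>\<xi>\<in>outer. \<exists>d. has_dir_deriv f v q \<xi> d) \<and> symbol k Q (m - 1) (dir_deriv v f))"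

lemma symbol_Suc:
  "symbol (Suc k) Q m f \<longleftrightarrow> symbol 0 Q m f \<and>
     (\<forall>v. (\<forall>q\<in>Q. \<forall>\<xi>\<in>outer. \<exists>d. has_dir_deriv f v q \<xi> d) \<and> symbol k Q (m - 1) (dir_deriv v f))"
  by simp

lemma symbol_0_iff:
  "symbol 0 Q m f \<longleftrightarrow> continuous_on (Q \<times> outer) (\<lambda>(q, \<xi>). f q \<xi>) \<and>
     (\<exists>C. \<forall>q\<in>Q. \<forall>\<xi>\<in>outer. norm (f q \<xi>) \<le> C * norm \<xi> powr m)"
  by (simp add: symbol_bound_def)

declare symbol.simps [simp del]

lemma symbol_0I:
  assumes "continuous_on (Q \<times> outer) (\<lambda>(q, \<xi>). f q \<xi>)"
    "\<And>q \<xi>. q \<in> Q \<Longrightarrow> \<xi> \<in> outer \<Longrightarrow> norm (f q \<xi>) \<le> C * norm \<xi> powr m"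
  shows "symbol 0 Q m f"
  using assms by (auto simp: symbol_0_iff)

lemma symbol_0E:
  assumes "symbol 0 Q m f"
  obtains C where "C > 0" "continuous_on (Q \<times> outer) (\<lambda>(q, \<xi>). f q \<xi>)"
    "\<And>q \<xi>. q \<in> Q \<Longrightarrow> \<xi> \<in> outer \<Longrightarrow> norm (f q \<xi>) \<le> C * norm \<xi> powr m"
proof -
  obtain C where C: "\<And>q \<xi>. q \<in> Q \<Longrightarrow> \<xi> \<in> outer \<Longrightarrow> norm (f q \<xi>) \<le> C * norm \<xi> powr m"
    and cont: "continuous_on (Q \<times> outer) (\<lambda>(q, \<xi>). f q \<xi>)"
    using assms by (auto simp: symbol_0_iff)
  have "norm (f q \<xi>) \<le> (\<bar>C\<bar> + 1) * norm \<xi> powr m" if "q \<in> Q" "\<xi> \<in> outer" for q \<xi>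
  proof -
    have "C * norm \<xi> powr m \<le> (\<bar>C\<bar> + 1) * norm \<xi> powr m"
      by (intro mult_right_mono) auto
    then show ?thesis using C[OF that] by linarith
  qed
  then show ?thesis using that[of "\<bar>C\<bar> + 1"] cont by auto
qed

lemma symbol_cong:
  assumes "\<And>q \<xi>. q \<in> Q \<Longrightarrow> \<xi> \<in> outer \<Longrightarrow> f q \<xi> = g q \<xi>"
  shows "symbol k Q m f \<longleftrightarrow> symbol k Q m g"
  using assms
proof (induction k arbitrary: m f g)
  case 0
  have "continuous_on (Q \<times> outer) (\<lambda>(q, \<xi>). f q \<xi>) \<longleftrightarrow> continuous_on (Q \<times> outer) (\<lambda>(q, \<xi>). g q \<xi>)"
    by (rule continuous_on_cong) (use 0 in auto)
  then show ?case using 0 by (simp add: symbol_0_iff)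
next
  case (Suc k)
  have 0: "symbol 0 Q m f \<longleftrightarrow> symbol 0 Q m g"
  proof -
    have "continuous_on (Q \<times> outer) (\<lambda>(q, \<xi>). f q \<xi>) \<longleftrightarrow> continuous_on (Q \<times> outer) (\<lambda>(q, \<xi>). g q \<xi>)"
      by (rule continuous_on_cong) (use Suc.prems in auto)
    then show ?thesis using Suc.prems by (simp add: symbol_0_iff)
  qed
  have 1: "has_dir_deriv f v q \<xi> d \<longleftrightarrow> has_dir_deriv g v q \<xi> d" if "q \<in> Q" "\<xi> \<in> outer" for v q \<xi> d
    using open_outer that(2) Suc.prems[OF that(1)] by (rule has_dir_deriv_cong)
  have 2: "dir_deriv v f q \<xi> = dir_deriv v g q \<xi>" if "q \<in> Q" "\<xi> \<in> outer" for v q \<xi>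
    using open_outer that(2) Suc.prems[OF that(1)] by (rule dir_deriv_cong)
  show ?case using 0 1 Suc.IH[OF 2] by (simp add: symbol_Suc)
qed

lemma symbol_SucI:
  assumes "symbol 0 Q m f"
    and "\<And>v q \<xi>. q \<in> Q \<Longrightarrow> \<xi> \<in> outer \<Longrightarrow> has_dir_deriv f v q \<xi> (f' v q \<xi>)"
    and "\<And>v. symbol k Q (m - 1) (f' v)"
  shows "symbol (Suc k) Q m f"
proof -
  have "symbol k Q (m - 1) (dir_deriv v f)" for v
    using assms(3)[of v] symbol_cong[of Q "f' v" "dir_deriv v f" k "m - 1"] dir_deriv_eqI[OF assms(2)] by metis
  then show ?thesis using assms(1,2) unfolding symbol_Suc by blast
qed

lemma symbol_Suc_imp_0: "symbol k Q m f \<Longrightarrow> symbol 0 Q m f"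
  by (cases k) (auto simp: symbol_Suc)

lemma symbol_lower: "symbol (Suc k) Q m f \<Longrightarrow> symbol k Q m f"
proof (induction k arbitrary: m f)
  case 0 then show ?case by (simp add: symbol_Suc)
next
  case (Suc k)
  then show ?case unfolding symbol_Suc[of "Suc k"] symbol_Suc[of k Q m f] by blast
qed

lemma symbol_deriv: "symbol (Suc k) Q m f \<Longrightarrow> symbol k Q (m - 1) (dir_deriv v f)"
  by (simp add: symbol_Suc)

lemma symbol_has_deriv:
  assumes "symbol (Suc k) Q m f" "q \<in> Q" "\<xi> \<in> outer"
  shows "has_dir_deriv f v q \<xi> (dir_deriv v f q \<xi>)"
proof -
  obtain d where "has_dir_deriv f v q \<xi> d"
    using assms unfolding symbol_Suc by blast
  then show ?thesis by (rule has_dir_deriv_dir_deriv)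
qed

lemma symbol_0_weaken:
  assumes "symbol 0 Q m f" "m \<le> m'"
  shows "symbol 0 Q m' f"
proof -
  obtain C where C: "C > 0" "continuous_on (Q \<times> outer) (\<lambda>(q, \<xi>). f q \<xi>)"
    "\<And>q \<xi>. q \<in> Q \<Longrightarrow> \<xi> \<in> outer \<Longrightarrow> norm (f q \<xi>) \<le> C * norm \<xi> powr m"
    by (rule symbol_0E[OF assms(1)]) (rule that)
  have "norm (f q \<xi>) \<le> (C * (1/2) powr (m - m')) * norm \<xi> powr m'" if "q \<in> Q" "\<xi> \<in> outer" for q \<xi>
  proof -
    have "norm \<xi> powr m = norm \<xi> powr (m - m') * norm \<xi> powr m'"
      by (simp flip: powr_add)
    also have "\<dots> \<le> (1/2) powr (m - m') * norm \<xi> powr m'"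
      using that assms(2) by (intro mult_right_mono powr_mono2') auto
    finally have "C * norm \<xi> powr m \<le> C * ((1/2) powr (m - m') * norm \<xi> powr m')"
      using C(1) by simp
    then show ?thesis using C(3)[OF that] by simp
  qed
  then show ?thesis using C(2) by (intro symbol_0I) auto
qed

lemma symbol_weaken: "symbol k Q m f \<Longrightarrow> m \<le> m' \<Longrightarrow> symbol k Q m' f"
proof (induction k arbitrary: m m' f)
  case 0 then show ?case by (rule symbol_0_weaken)
next
  case (Suc k)
  have "symbol k Q (m' - 1) (dir_deriv v f)" for v
    using Suc.IH[OF symbol_deriv[OF Suc.prems(1)], of "m' - 1"] Suc.prems(2) by simp
  then show ?case
    using Suc.prems symbol_0_weaken[of Q m f m'] unfolding symbol_Suc by blast
qed

text \<open>Continuity suffices for a change of parameters because symbols are not differentiated in them.\<close>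

lemma symbol_reparam:
  fixes f :: "'q::topological_space \<Rightarrow> 'v::real_normed_vector \<Rightarrow> complex"
  assumes "symbol k Q m f" "continuous_on P h" "h ` P \<subseteq> Q"
  shows "symbol k P m (\<lambda>p. f (h p))"
  using assms(1)
proof (induction k arbitrary: m f)
  case 0
  obtain C where C: "C > 0" "continuous_on (Q \<times> outer) (\<lambda>(q, \<xi>). f q \<xi>)"
    "\<And>q \<xi>. q \<in> Q \<Longrightarrow> \<xi> \<in> outer \<Longrightarrow> norm (f q \<xi>) \<le> C * norm \<xi> powr m"
    by (rule symbol_0E[OF 0]) (rule that)
  have "continuous_on (P \<times> outer) (\<lambda>x. (\<lambda>(q, \<xi>). f q \<xi>) (h (fst x), snd x))"
    by (rule continuous_on_compose2[OF C(2)])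
      (use assms(3) in \<open>auto intro!: continuous_intros continuous_on_compose2[OF assms(2)]\<close>)
  then show ?case using C(3) assms(3) by (intro symbol_0I[where C=C]) (auto simp: case_prod_unfold)
next
  case (Suc k)
  obtain C where C: "C > 0" "continuous_on (Q \<times> outer) (\<lambda>(q, \<xi>). f q \<xi>)"
    "\<And>q \<xi>. q \<in> Q \<Longrightarrow> \<xi> \<in> outer \<Longrightarrow> norm (f q \<xi>) \<le> C * norm \<xi> powr m"
    by (rule symbol_0E[OF symbol_Suc_imp_0[OF Suc.prems]]) (rule that)
  have "continuous_on (P \<times> outer) (\<lambda>x. (\<lambda>(q, \<xi>). f q \<xi>) (h (fst x), snd x))"
    by (rule continuous_on_compose2[OF C(2)])
      (use assms(3) in \<open>auto intro!: continuous_intros continuous_on_compose2[OF assms(2)]\<close>)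
  then have 0: "symbol 0 P m (\<lambda>p. f (h p))"
    using C(3) assms(3) by (intro symbol_0I[where C=C]) (auto simp: case_prod_unfold)
  show ?case
  proof (rule symbol_SucI[OF 0, where f' = "\<lambda>v p. dir_deriv v f (h p)"])
    fix v p and \<xi> :: 'v assume "p \<in> P" "\<xi> \<in> outer"
    then have "has_dir_deriv f v (h p) \<xi> (dir_deriv v f (h p) \<xi>)"
      using symbol_has_deriv[OF Suc.prems] assms(3) by blast
    then show "has_dir_deriv (\<lambda>p. f (h p)) v p \<xi> (dir_deriv v f (h p) \<xi>)"
      by (simp add: has_dir_deriv_def)
  qed (use Suc.IH[OF symbol_deriv[OF Suc.prems]] in auto)
qed

lemma symbol_subset: "symbol k Q m f \<Longrightarrow> Q' \<subseteq> Q \<Longrightarrow> symbol k Q' m f"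
  using symbol_reparam[of k Q m f Q' "\<lambda>q. q"] by simp

lemma symbol_0_mult:
  fixes f g :: "'q::topological_space \<Rightarrow> 'v::real_normed_vector \<Rightarrow> complex"
  assumes "symbol 0 Q m f" "symbol 0 Q l g"
  shows "symbol 0 Q (m + l) (\<lambda>q \<xi>. f q \<xi> * g q \<xi>)"
proof -
  obtain C where C: "C > 0" "continuous_on (Q \<times> outer) (\<lambda>(q, \<xi>). f q \<xi>)"
    "\<And>q \<xi>. q \<in> Q \<Longrightarrow> \<xi> \<in> outer \<Longrightarrow> norm (f q \<xi>) \<le> C * norm \<xi> powr m"
    by (rule symbol_0E[OF assms(1)]) (rule that)
  obtain B where B: "B > 0" "continuous_on (Q \<times> outer) (\<lambda>(q, \<xi>). g q \<xi>)"
    "\<And>q \<xi>. q \<in> Q \<Longrightarrow> \<xi> \<in> outer \<Longrightarrow> norm (g q \<xi>) \<le> B * norm \<xi> powr l"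
    by (rule symbol_0E[OF assms(2)]) (rule that)
  show ?thesis
  proof (rule symbol_0I[where C="C * B"])
    show "continuous_on (Q \<times> outer) (\<lambda>(q, \<xi>). f q \<xi> * g q \<xi>)"
      using C(2) B(2) by (auto simp: case_prod_unfold intro!: continuous_intros)
    fix q and \<xi> :: 'v assume *: "q \<in> Q" "\<xi> \<in> outer"
    have "norm (f q \<xi> * g q \<xi>) \<le> (C * norm \<xi> powr m) * (B * norm \<xi> powr l)"
      unfolding norm_mult using C B * by (intro mult_mono) auto
    then show "norm (f q \<xi> * g q \<xi>) \<le> C * B * norm \<xi> powr (m + l)"
      by (simp add: powr_add mult_ac)
  qed
qed

lemma symbol_0_add:
  fixes f g :: "'q::topological_space \<Rightarrow> 'v::real_normed_vector \<Rightarrow> complex"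
  assumes "symbol 0 Q m f" "symbol 0 Q m g"
  shows "symbol 0 Q m (\<lambda>q \<xi>. f q \<xi> + g q \<xi>)"
proof -
  obtain C where C: "C > 0" "continuous_on (Q \<times> outer) (\<lambda>(q, \<xi>). f q \<xi>)"
    "\<And>q \<xi>. q \<in> Q \<Longrightarrow> \<xi> \<in> outer \<Longrightarrow> norm (f q \<xi>) \<le> C * norm \<xi> powr m"
    by (rule symbol_0E[OF assms(1)]) (rule that)
  obtain B where B: "B > 0" "continuous_on (Q \<times> outer) (\<lambda>(q, \<xi>). g q \<xi>)"
    "\<And>q \<xi>. q \<in> Q \<Longrightarrow> \<xi> \<in> outer \<Longrightarrow> norm (g q \<xi>) \<le> B * norm \<xi> powr m"
    by (rule symbol_0E[OF assms(2)]) (rule that)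
  show ?thesis
  proof (rule symbol_0I[where C="C + B"])
    show "continuous_on (Q \<times> outer) (\<lambda>(q, \<xi>). f q \<xi> + g q \<xi>)"
      using C(2) B(2) by (auto simp: case_prod_unfold intro!: continuous_intros)
    fix q and \<xi> :: 'v assume *: "q \<in> Q" "\<xi> \<in> outer"
    show "norm (f q \<xi> + g q \<xi>) \<le> (C + B) * norm \<xi> powr m"
      using C(3)[OF *] B(3)[OF *] norm_triangle_ineq[of "f q \<xi>" "g q \<xi>"] by (simp add: distrib_right)
  qed
qed

lemma symbol_add:
  "symbol k Q m f \<Longrightarrow> symbol k Q m g \<Longrightarrow> symbol k Q m (\<lambda>q \<xi>. f q \<xi> + g q \<xi>)"
proof (induction k arbitrary: m f g)
  case 0 then show ?case by (rule symbol_0_add)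
next
  case (Suc k)
  show ?case
  proof (rule symbol_SucI[where f' = "\<lambda>v q \<xi>. dir_deriv v f q \<xi> + dir_deriv v g q \<xi>"])
    show "symbol 0 Q m (\<lambda>q \<xi>. f q \<xi> + g q \<xi>)" using Suc.prems by (auto intro: symbol_0_add symbol_Suc_imp_0)
    show "symbol k Q (m - 1) (\<lambda>q \<xi>. dir_deriv v f q \<xi> + dir_deriv v g q \<xi>)" for v
      using Suc.prems by (intro Suc.IH symbol_deriv)
  qed (intro has_dir_deriv_add symbol_has_deriv[OF Suc.prems(1)] symbol_has_deriv[OF Suc.prems(2)])
qed

lemma symbol_mult:
  "symbol k Q m f \<Longrightarrow> symbol k Q l g \<Longrightarrow> symbol k Q (m + l) (\<lambda>q \<xi>. f q \<xi> * g q \<xi>)"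
proof (induction k arbitrary: m l f g)
  case 0 then show ?case by (rule symbol_0_mult)
next
  case (Suc k)
  show ?case
  proof (rule symbol_SucI[where f' = "\<lambda>v q \<xi>. f q \<xi> * dir_deriv v g q \<xi> + dir_deriv v f q \<xi> * g q \<xi>"])
    show "symbol 0 Q (m + l) (\<lambda>q \<xi>. f q \<xi> * g q \<xi>)" using Suc.prems by (auto intro: symbol_0_mult symbol_Suc_imp_0)
    show "symbol k Q (m + l - 1) (\<lambda>q \<xi>. f q \<xi> * dir_deriv v g q \<xi> + dir_deriv v f q \<xi> * g q \<xi>)" for v
    proof (rule symbol_add)
      show "symbol k Q (m + l - 1) (\<lambda>q \<xi>. f q \<xi> * dir_deriv v g q \<xi>)"
        using Suc.IH[OF symbol_lower[OF Suc.prems(1)] symbol_deriv[OF Suc.prems(2)], of v] by (simp add: algebra_simps)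
      show "symbol k Q (m + l - 1) (\<lambda>q \<xi>. dir_deriv v f q \<xi> * g q \<xi>)"
        using Suc.IH[OF symbol_deriv[OF Suc.prems(1)] symbol_lower[OF Suc.prems(2)], of v] by (simp add: algebra_simps)
    qed
  qed (intro has_dir_deriv_mult symbol_has_deriv[OF Suc.prems(1)] symbol_has_deriv[OF Suc.prems(2)])
qed

lemma symbol_param:
  fixes c :: "'q::topological_space \<Rightarrow> complex"
  assumes "continuous_on Q c" "\<And>q. q \<in> Q \<Longrightarrow> norm (c q) \<le> B"
  shows "symbol k Q 0 (\<lambda>q (\<xi>::'v::real_normed_vector). c q)"
proof -
  have zero_order: "symbol 0 Q m (\<lambda>q \<xi>::'v. c q)"
    if "continuous_on Q c" "\<And>q. q \<in> Q \<Longrightarrow> norm (c q) \<le> B" "m \<ge> 0" for c :: "'q \<Rightarrow> complex" and B m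
  proof -
    have "symbol 0 Q 0 (\<lambda>q \<xi>::'v. c q)"
      by (rule symbol_0I[where C=B])
        (use that in \<open>auto simp: case_prod_unfold intro!: continuous_intros continuous_on_compose2[OF that(1)]\<close>)
    then show ?thesis using that(3) symbol_0_weaken by blast
  qed
  have z: "symbol k Q m (\<lambda>q \<xi>::'v. 0)" for k m
  proof (induction k arbitrary: m)
    case 0 show ?case by (rule symbol_0I[where C=0]) auto
  next
    case (Suc k)
    have "symbol 0 Q m (\<lambda>q \<xi>::'v. 0)" by (rule symbol_0I[where C=0]) auto
    then show ?case
      by (rule symbol_SucI[where f' = "\<lambda>v q \<xi>. 0"]) (auto simp: has_dir_deriv_def intro: Suc)
  qed
  show ?thesis
  proof (cases k)
    case 0 then show ?thesis using zero_order[OF assms] by simp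
  next
    case (Suc j)
    show ?thesis unfolding Suc
      by (rule symbol_SucI[OF zero_order[OF assms], where f' = "\<lambda>v q \<xi>. 0"]) (auto simp: has_dir_deriv_def intro: z)
  qed
qed

lemma symbol_const: "symbol k Q 0 (\<lambda>q \<xi>. c)"
  by (rule symbol_param[where B="norm c"]) auto

lemma symbol_cmult: "symbol k Q m f \<Longrightarrow> symbol k Q m (\<lambda>q \<xi>. c * f q \<xi>)"
  using symbol_mult[OF symbol_const[of k Q c], of m f] by simp

lemma symbol_sum:
  assumes "finite A" "A \<noteq> {}" "\<And>i. i \<in> A \<Longrightarrow> symbol k Q m (f i)"
  shows "symbol k Q m (\<lambda>q \<xi>. \<Sum>i\<in>A. f i q \<xi>)"
  using assms
proof (induction rule: finite_ne_induct)
  case (insert x F)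
  then show ?case using symbol_add[of k Q m "f x" "\<lambda>q \<xi>. \<Sum>i\<in>F. f i q \<xi>"] by simp
qed auto

lemma symbol_power: "symbol k Q m f \<Longrightarrow> symbol k Q (of_nat n * m) (\<lambda>q \<xi>. f q \<xi> ^ n)"
proof (induction n)
  case 0 show ?case using symbol_const[of k Q 1] by simp
next
  case (Suc n)
  then show ?case using symbol_mult[of k Q m f "of_nat n * m" "\<lambda>q \<xi>. f q \<xi> ^ n"]
    by (simp add: algebra_simps)
qed

text \<open>Inverses of elliptic symbols, by induction on the number of derivatives: the derivative of \<open>1 / f\<close> is
\<open>- f' (1 / f)\<^sup>2\<close>, in which \<open>1 / f\<close> appears with one derivative less.\<close>

lemma symbol_inverse:
  fixes f :: "'q::topological_space \<Rightarrow> 'v::real_normed_vector \<Rightarrow> complex"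
  assumes "symbol k Q 0 f" "c > 0" "\<And>q \<xi>. q \<in> Q \<Longrightarrow> \<xi> \<in> outer \<Longrightarrow> norm (f q \<xi>) \<ge> c"
  shows "symbol k Q 0 (\<lambda>q \<xi>. inverse (f q \<xi>))"
proof -
  have inv0: "symbol 0 Q 0 (\<lambda>q \<xi>. inverse (f q \<xi>))" if *: "symbol 0 Q 0 f"
  proof -
    have C: "continuous_on (Q \<times> outer) (\<lambda>(q, \<xi>). f q \<xi>)"
      using * by (simp add: symbol_0_iff)
    have nz: "f q \<xi> \<noteq> 0" if "q \<in> Q" "\<xi> \<in> outer" for q \<xi>
      using assms(3)[OF that] \<open>c > 0\<close> by auto
    show ?thesis
    proof (rule symbol_0I[where C="inverse c"])
      show "continuous_on (Q \<times> outer) (\<lambda>(q, \<xi>). inverse (f q \<xi>))"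
        using C nz by (auto simp: case_prod_unfold intro!: continuous_intros)
      fix q and \<xi> :: 'v assume "q \<in> Q" "\<xi> \<in> outer"
      then show "norm (inverse (f q \<xi>)) \<le> inverse c * norm \<xi> powr 0"
        using assms(2,3) outer_nz[of \<xi>] by (auto simp: norm_inverse intro!: le_imp_inverse_le)
    qed
  qed
  show ?thesis using assms(1)
  proof (induction k)
    case 0 then show ?case by (rule inv0)
  next
    case (Suc k)
    have IH: "symbol k Q 0 (\<lambda>q \<xi>. inverse (f q \<xi>))"
      using Suc.IH symbol_lower[OF Suc.prems] by blast
    show ?case
    proof (rule symbol_SucI[where f' = "\<lambda>v q \<xi>. (- 1) * (dir_deriv v f q \<xi> * (inverse (f q \<xi>) * inverse (f q \<xi>)))"])
      show "symbol 0 Q 0 (\<lambda>q \<xi>. inverse (f q \<xi>))" using inv0 symbol_Suc_imp_0[OF Suc.prems] by blast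
      show "symbol k Q (0 - 1) (\<lambda>q \<xi>. (- 1) * (dir_deriv v f q \<xi> * (inverse (f q \<xi>) * inverse (f q \<xi>))))" for v
        using symbol_cmult[OF symbol_mult[OF symbol_deriv[OF Suc.prems, of v] symbol_mult[OF IH IH]], of "-1"] by simp
      fix v q and \<xi> :: 'v assume *: "q \<in> Q" "\<xi> \<in> outer"
      have nz: "f q (\<xi> + 0 *\<^sub>R v) \<noteq> 0"
        using assms(3)[OF *] \<open>c > 0\<close> by auto
      have "((\<lambda>t. inverse (f q (\<xi> + t *\<^sub>R v))) has_vector_derivative
          - (inverse (f q (\<xi> + 0 *\<^sub>R v)) * dir_deriv v f q \<xi> * inverse (f q (\<xi> + 0 *\<^sub>R v)))) (at 0)"
        using Deriv.has_derivative_inverse[OF nz symbol_has_deriv[OF Suc.prems *, of v, unfolded has_dir_deriv_def has_vector_derivative_def]]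
        unfolding has_vector_derivative_def by (simp add: mult_ac)
      then show "has_dir_deriv (\<lambda>q \<xi>. inverse (f q \<xi>)) v q \<xi>
          ((- 1) * (dir_deriv v f q \<xi> * (inverse (f q \<xi>) * inverse (f q \<xi>))))"
        by (simp add: has_dir_deriv_def mult_ac)
    qed
  qed
qed

section \<open>Homogeneous functions as symbols\<close>

text \<open>Smoothness in the fibre variable alone, off the zero section, with derivatives that are jointly
continuous in parameter and fibre variable.\<close>

primrec smooth_in :: "nat \<Rightarrow> 'q::topological_space set \<Rightarrow> ('q \<Rightarrow> 'v::real_normed_vector \<Rightarrow> complex) \<Rightarrow> bool" where
  "smooth_in 0 Q f \<longleftrightarrow> continuous_on (Q \<times> (-{0})) (\<lambda>(q, \<xi>). f q \<xi>)"
| "smooth_in (Suc k) Q f \<longleftrightarrow> continuous_on (Q \<times> (-{0})) (\<lambda>(q, \<xi>). f q \<xi>) \<and>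
     (\<forall>v. (\<forall>q\<in>Q. \<forall>\<xi>\<in>-{0}. \<exists>d. has_dir_deriv f v q \<xi> d) \<and> smooth_in k Q (dir_deriv v f))"

declare smooth_in.simps(2) [simp del]

lemma open_nonzero: "open (- {0::'v::real_normed_vector})"
  by auto

lemma smooth_in_continuous: "smooth_in k Q f \<Longrightarrow> continuous_on (Q \<times> (-{0})) (\<lambda>(q, \<xi>). f q \<xi>)"
  by (cases k) (auto simp: smooth_in.simps)

lemma smooth_in_deriv: "smooth_in (Suc k) Q f \<Longrightarrow> smooth_in k Q (dir_deriv v f)"
  by (simp add: smooth_in.simps)

lemma smooth_in_has_deriv:
  assumes "smooth_in (Suc k) Q f" "q \<in> Q" "\<xi> \<noteq> 0"
  shows "has_dir_deriv f v q \<xi> (dir_deriv v f q \<xi>)"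
proof -
  obtain d where "has_dir_deriv f v q \<xi> d"
    using assms unfolding smooth_in.simps by blast
  then show ?thesis by (rule has_dir_deriv_dir_deriv)
qed

lemma smooth_in_cong:
  assumes "\<And>q \<xi>. q \<in> Q \<Longrightarrow> \<xi> \<noteq> 0 \<Longrightarrow> f q \<xi> = g q \<xi>"
  shows "smooth_in k Q f \<longleftrightarrow> smooth_in k Q g"
  using assms
proof (induction k arbitrary: f g)
  case 0
  have "continuous_on (Q \<times> -{0}) (\<lambda>(q, \<xi>). f q \<xi>) \<longleftrightarrow> continuous_on (Q \<times> -{0}) (\<lambda>(q, \<xi>). g q \<xi>)"
    by (rule continuous_on_cong) (use 0 in auto)
  then show ?case by simp
next
  case (Suc k)
  have 0: "continuous_on (Q \<times> -{0}) (\<lambda>(q, \<xi>). f q \<xi>) \<longleftrightarrow> continuous_on (Q \<times> -{0}) (\<lambda>(q, \<xi>). g q \<xi>)"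
    by (rule continuous_on_cong) (use Suc.prems in auto)
  have 1: "has_dir_deriv f v q \<xi> d \<longleftrightarrow> has_dir_deriv g v q \<xi> d" if "q \<in> Q" "\<xi> \<in> -{0}" for v q \<xi> d
    using open_nonzero that(2) by (rule has_dir_deriv_cong) (use Suc.prems[OF that(1)] in auto)
  have 2: "dir_deriv v f q \<xi> = dir_deriv v g q \<xi>" if "q \<in> Q" "\<xi> \<in> -{0}" for v q \<xi>
    using open_nonzero that(2) by (rule dir_deriv_cong) (use Suc.prems[OF that(1)] in auto)
  have 3: "smooth_in k Q (dir_deriv v f) \<longleftrightarrow> smooth_in k Q (dir_deriv v g)" for v
    by (rule Suc.IH) (use 2 in auto)
  have 4: "(\<forall>q\<in>Q. \<forall>\<xi>\<in>-{0}. \<exists>d. has_dir_deriv f v q \<xi> d) \<longleftrightarrow> (\<forall>q\<in>Q. \<forall>\<xi>\<in>-{0}. \<exists>d. has_dir_deriv g v q \<xi> d)" for v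
    using 1 by blast
  show ?case unfolding smooth_in.simps 0 3 4 ..
qed

lemma smooth_in_SucI:
  assumes "continuous_on (Q \<times> (-{0})) (\<lambda>(q, \<xi>). f q \<xi>)"
    and "\<And>v q \<xi>. q \<in> Q \<Longrightarrow> \<xi> \<noteq> 0 \<Longrightarrow> has_dir_deriv f v q \<xi> (f' v q \<xi>)"
    and "\<And>v. smooth_in k Q (f' v)"
  shows "smooth_in (Suc k) Q f"
proof -
  have "smooth_in k Q (f' v) \<longleftrightarrow> smooth_in k Q (dir_deriv v f)" for v
    by (rule smooth_in_cong) (simp add: dir_deriv_eqI[OF assms(2)])
  then show ?thesis using assms unfolding smooth_in.simps by blast
qed

lemma smooth_in_reparam:
  fixes f :: "'q::topological_space \<Rightarrow> 'v::real_normed_vector \<Rightarrow> complex"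
  assumes "smooth_in k Q f" "continuous_on P h" "h ` P \<subseteq> Q"
  shows "smooth_in k P (\<lambda>p. f (h p))"
proof -
  have cont: "continuous_on (P \<times> -{0}) (\<lambda>(p, \<xi>). f (h p) \<xi>)" if "smooth_in k Q f" for k and f :: "'q \<Rightarrow> 'v \<Rightarrow> complex"
  proof -
    have "continuous_on (P \<times> -{0}) (\<lambda>x. (\<lambda>(q, \<xi>). f q \<xi>) (h (fst x), snd x))"
      by (rule continuous_on_compose2[OF smooth_in_continuous[OF that]])
        (use assms(3) in \<open>auto intro!: continuous_intros continuous_on_compose2[OF assms(2)]\<close>)
    then show ?thesis by (simp add: case_prod_unfold)
  qed
  show ?thesis using assms(1)
  proof (induction k arbitrary: f)
    case 0
    show ?case using cont[OF 0] by simp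
  next
    case (Suc k)
    show ?case
    proof (rule smooth_in_SucI[OF cont[OF Suc.prems], where f' = "\<lambda>v p. dir_deriv v f (h p)"])
      fix v p and \<xi> :: 'v assume "p \<in> P" "\<xi> \<noteq> 0"
      then have "has_dir_deriv f v (h p) \<xi> (dir_deriv v f (h p) \<xi>)"
        using smooth_in_has_deriv[OF Suc.prems] assms(3) by blast
      then show "has_dir_deriv (\<lambda>p. f (h p)) v p \<xi> (dir_deriv v f (h p) \<xi>)"
        by (simp add: has_dir_deriv_def)
    qed (use Suc.IH[OF smooth_in_deriv[OF Suc.prems]] in auto)
  qed
qed

lemma smooth_in_Union:
  fixes f :: "'q::topological_space \<Rightarrow> 'v::real_normed_vector \<Rightarrow> complex"
  assumes "\<And>W. W \<in> \<W> \<Longrightarrow> open W \<and> smooth_in k W f"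
  shows "smooth_in k (\<Union>\<W>) f"
proof -
  have cont: "continuous_on (\<Union>\<W> \<times> -{0}) (\<lambda>(q, \<xi>). f q \<xi>)"
    if "\<And>W. W \<in> \<W> \<Longrightarrow> open W \<and> smooth_in k W f" for k and f :: "'q \<Rightarrow> 'v \<Rightarrow> complex"
  proof -
    have "continuous_on (\<Union>W\<in>\<W>. W \<times> -{0}) (\<lambda>(q, \<xi>). f q \<xi>)"
      using that by (intro continuous_on_open_UN open_Times open_nonzero) (auto dest: smooth_in_continuous)
    moreover have "(\<Union>W\<in>\<W>. W \<times> -{0::'v}) = \<Union>\<W> \<times> -{0}" by auto
    ultimately show ?thesis by simp
  qed
  show ?thesis using assms
  proof (induction k arbitrary: f)
    case 0
    show ?case using cont[OF 0] by simp
  next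
    case (Suc k)
    have "smooth_in k (\<Union>\<W>) (dir_deriv v f)" for v
      using Suc.prems by (intro Suc.IH) (auto dest: smooth_in_deriv)
    moreover have "has_dir_deriv f v q \<xi> (dir_deriv v f q \<xi>)" if q: "q \<in> \<Union>\<W>" and "\<xi> \<noteq> 0" for v q \<xi>
    proof -
      obtain W where "W \<in> \<W>" "q \<in> W" using q by blast
      then show ?thesis using smooth_in_has_deriv Suc.prems \<open>\<xi> \<noteq> 0\<close> by metis
    qed
    ultimately show ?case by (intro smooth_in_SucI[OF cont[OF Suc.prems]])
  qed
qed

text \<open>This lemma transports the chart-wise smoothness of manifolds to smoothness along fibres: in a product chart
the fibre through \<open>q\<close> is the affine map \<open>\<xi> \<mapsto> c q + j \<xi>\<close>, so a derivative in direction \<open>v\<close> is a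
Frechet derivative in direction \<open>j v\<close>.\<close>

lemma smooth_in_Ck_on:
  fixes F :: "'e::euclidean_space \<Rightarrow> 'f::real_normed_vector" and j :: "'v::euclidean_space \<Rightarrow> 'e"
    and f :: "'q::topological_space \<Rightarrow> 'v \<Rightarrow> complex"
  assumes "Ck_on k S F" "continuous_on W c" "bounded_linear j" "bounded_linear L"
    and "\<And>q \<xi>. q \<in> W \<Longrightarrow> \<xi> \<noteq> 0 \<Longrightarrow> c q + j \<xi> \<in> S"
    and "\<And>q \<xi>. q \<in> W \<Longrightarrow> \<xi> \<noteq> 0 \<Longrightarrow> f q \<xi> = L (F (c q + j \<xi>))"
  shows "smooth_in k W f"
proof -
  have cont: "continuous_on (W \<times> -{0}) (\<lambda>(q, \<xi>). f q \<xi>)"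
    if "continuous_on S F" "\<And>q \<xi>. q \<in> W \<Longrightarrow> \<xi> \<noteq> 0 \<Longrightarrow> f q \<xi> = L (F (c q + j \<xi>))"
    for F :: "'e \<Rightarrow> 'f" and f :: "'q \<Rightarrow> 'v \<Rightarrow> complex"
  proof -
    have "continuous_on (W \<times> -{0}) (\<lambda>x. L (F (c (fst x) + j (snd x))))"
      by (intro bounded_linear.continuous_on[OF assms(4)] continuous_on_compose2[OF that(1)]
          continuous_intros bounded_linear.continuous_on[OF assms(3)] continuous_on_compose2[OF assms(2)])
        (auto intro!: assms(5))
    moreover have "continuous_on (W \<times> -{0}) (\<lambda>(q, \<xi>). f q \<xi>) \<longleftrightarrow> 
        continuous_on (W \<times> -{0}) (\<lambda>x. L (F (c (fst x) + j (snd x))))"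
      by (rule continuous_on_cong) (auto intro!: that(2))
    ultimately show ?thesis by simp
  qed
  show ?thesis using assms(1,6)
  proof (induction k arbitrary: F f)
    case 0
    then show ?case using cont[of F f] by simp
  next
    case (Suc k)
    have diff: "(F has_derivative frechet_derivative F (at u)) (at u)" if "u \<in> S" for u
      using Suc.prems(1) that by (simp add: frechet_derivative_works)
    have "continuous_on S F"
      using Suc.prems(1) by (intro continuous_at_imp_continuous_on) (auto intro: differentiable_imp_continuous_within)
    note c = cont[OF this Suc.prems(2)]
    show ?case
    proof (rule smooth_in_SucI[OF c, where f' = "\<lambda>v q \<xi>. L (frechet_derivative F (at (c q + j \<xi>)) (j v))"])
      show "smooth_in k W (\<lambda>q \<xi>. L (frechet_derivative F (at (c q + j \<xi>)) (j v)))" for v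
        by (rule Suc.IH[of "\<lambda>u. frechet_derivative F (at u) (j v)"]) (use Suc.prems(1) in auto)
      fix v q and \<xi> :: 'v assume *: "q \<in> W" "\<xi> \<noteq> 0"
      interpret j: bounded_linear j by (rule assms(3))
      interpret L: bounded_linear L by (rule assms(4))
      have 1: "((\<lambda>t. c q + j (\<xi> + t *\<^sub>R v)) has_derivative (\<lambda>t. t *\<^sub>R j v)) (at 0)"
        unfolding j.add j.scaleR by (auto intro!: derivative_eq_intros)
      have "(F has_derivative frechet_derivative F (at (c q + j \<xi>))) (at (c q + j (\<xi> + 0 *\<^sub>R v)))"
        using diff[OF assms(5)[OF *]] by simp
      from L.has_derivative[OF has_derivative_compose[OF 1 this]]
      have 2: "((\<lambda>t. L (F (c q + j (\<xi> + t *\<^sub>R v)))) has_derivative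
          (\<lambda>t. L (frechet_derivative F (at (c q + j \<xi>)) (t *\<^sub>R j v)))) (at 0)" .
      have "linear (frechet_derivative F (at (c q + j \<xi>)))"
        using diff[OF assms(5)[OF *]] has_derivative_linear by blast
      then have 3: "L (frechet_derivative F (at (c q + j \<xi>)) (t *\<^sub>R j v)) = t *\<^sub>R L (frechet_derivative F (at (c q + j \<xi>)) (j v))" for t
        by (simp add: linear_scale L.scaleR)
      have "has_dir_deriv (\<lambda>q \<xi>. L (F (c q + j \<xi>))) v q \<xi> (L (frechet_derivative F (at (c q + j \<xi>)) (j v)))"
        using 2 unfolding has_dir_deriv_def has_vector_derivative_def 3 .
      then show "has_dir_deriv f v q \<xi> (L (frechet_derivative F (at (c q + j \<xi>)) (j v)))"
        using has_dir_deriv_cong[OF open_nonzero, of \<xi> f q "\<lambda>q \<xi>. L (F (c q + j \<xi>))"] * Suc.prems(2)[OF *(1)] by auto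
    qed
  qed
qed

lemma homogeneous_norm_bound:
  fixes f :: "'q::topological_space \<Rightarrow> 'v::euclidean_space \<Rightarrow> complex"
  assumes "compact Q" "continuous_on (Q \<times> (-{0})) (\<lambda>(q, \<xi>). f q \<xi>)"
    and "\<And>q r \<xi>. q \<in> Q \<Longrightarrow> r > 0 \<Longrightarrow> \<xi> \<noteq> 0 \<Longrightarrow> f q (r *\<^sub>R \<xi>) = of_real (r powr m) * f q \<xi>"
  shows "symbol 0 Q m f"
proof -
  have "compact ((\<lambda>(q, \<xi>). f q \<xi>) ` (Q \<times> sphere 0 1))"
    by (intro compact_continuous_image continuous_on_subset[OF assms(2)] compact_Times assms(1)) auto
  then have "bounded ((\<lambda>(q, \<xi>). f q \<xi>) ` (Q \<times> sphere 0 1))"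
    by (rule compact_imp_bounded)
  then obtain C where "\<forall>x\<in>(\<lambda>(q, \<xi>). f q \<xi>) ` (Q \<times> sphere 0 1). norm x \<le> C"
    unfolding bounded_iff by blast
  then have C: "norm (f q \<xi>) \<le> C" if "q \<in> Q" "norm \<xi> = 1" for q \<xi>
    using that by auto
  show ?thesis
  proof (rule symbol_0I[where C=C])
    show "continuous_on (Q \<times> outer) (\<lambda>(q, \<xi>). f q \<xi>)"
      by (rule continuous_on_subset[OF assms(2)]) auto
    fix q and \<xi> :: 'v assume *: "q \<in> Q" "\<xi> \<in> outer"
    then have nz: "\<xi> \<noteq> 0" by auto
    have "f q \<xi> = of_real (norm \<xi> powr m) * f q (\<xi> /\<^sub>R norm \<xi>)"
      using assms(3)[of q "norm \<xi>" "\<xi> /\<^sub>R norm \<xi>"] * nz by simp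
    moreover have "norm (f q (\<xi> /\<^sub>R norm \<xi>)) \<le> C" using C * nz by simp
    ultimately show "norm (f q \<xi>) \<le> C * norm \<xi> powr m"
      by (simp add: norm_mult mult.commute[of C] mult_left_mono)
  qed
qed

lemma homogeneous_dir_deriv:
  fixes f :: "'q::topological_space \<Rightarrow> 'v::real_normed_vector \<Rightarrow> complex" and r :: real
  assumes smooth: "smooth_in (Suc k) Q f"
    and hom: "\<And>q r \<xi>. q \<in> Q \<Longrightarrow> r > 0 \<Longrightarrow> \<xi> \<noteq> 0 \<Longrightarrow> f q (r *\<^sub>R \<xi>) = of_real (r powr m) * f q \<xi>"
    and *: "q \<in> Q" "r > 0" "\<xi> \<noteq> 0"
  shows "dir_deriv v f q (r *\<^sub>R \<xi>) = of_real (r powr (m - 1)) * dir_deriv v f q \<xi>"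
proof -
  define h where "h q \<xi> = of_real (r powr m) * f q (\<xi> /\<^sub>R r)" for q \<xi>
  have "has_dir_deriv f v q \<xi> (dir_deriv v f q \<xi>)"
    using smooth_in_has_deriv[OF smooth *(1,3)] .
  then have 1: "((\<lambda>t. f q (\<xi> + t *\<^sub>R v)) has_vector_derivative dir_deriv v f q \<xi>) (at (0 / r))"
    by (simp add: has_dir_deriv_def)
  have 2: "((\<lambda>t. t / r) has_vector_derivative (1 / r)) (at 0)"
    using *(2) by (auto intro!: derivative_eq_intros)
  from vector_diff_chain_at[OF 2 1]
  have "((\<lambda>t. f q (\<xi> + (t / r) *\<^sub>R v)) has_vector_derivative dir_deriv v f q \<xi> /\<^sub>R r) (at 0)"
    by (simp add: o_def inverse_eq_divide)
  then have "((\<lambda>t. of_real (r powr m) * f q (\<xi> + (t / r) *\<^sub>R v)) has_vector_derivative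
      of_real (r powr m) * (dir_deriv v f q \<xi> /\<^sub>R r)) (at 0)"
    by (rule has_vector_derivative_mult_right)
  moreover have "(r *\<^sub>R \<xi> + t *\<^sub>R v) /\<^sub>R r = \<xi> + (t / r) *\<^sub>R v" for t
    using *(2) by (simp add: scaleR_add_right field_simps inverse_eq_divide)
  ultimately have "has_dir_deriv h v q (r *\<^sub>R \<xi>) (of_real (r powr m) * (dir_deriv v f q \<xi> /\<^sub>R r))"
    unfolding has_dir_deriv_def h_def by simp
  moreover have "f q \<eta> = h q \<eta>" if "\<eta> \<in> - {0}" for \<eta>
    using hom[of q r "\<eta> /\<^sub>R r"] * that by (simp add: h_def)
  ultimately have "has_dir_deriv f v q (r *\<^sub>R \<xi>) (of_real (r powr m) * (dir_deriv v f q \<xi> /\<^sub>R r))"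
    using has_dir_deriv_cong[OF open_nonzero, of "r *\<^sub>R \<xi>" f q h] * by auto
  then have "dir_deriv v f q (r *\<^sub>R \<xi>) = of_real (r powr m) * (dir_deriv v f q \<xi> /\<^sub>R r)"
    by (rule dir_deriv_eqI)
  also have "\<dots> = of_real (r powr (m - 1)) * dir_deriv v f q \<xi>"
    using *(2) by (simp add: powr_diff scaleR_conv_of_real field_simps)
  finally show ?thesis .
qed

text \<open>For homogeneous functions the symbol estimates reduce, by scaling, to boundedness on the compact
product of the parameter set and the unit sphere; derivatives are homogeneous of one degree less.\<close>

lemma homogeneous_symbol:
  fixes f :: "'q::topological_space \<Rightarrow> 'v::euclidean_space \<Rightarrow> complex"
  assumes "compact Q" "smooth_in k Q f"
    and "\<And>q r \<xi>. q \<in> Q \<Longrightarrow> r > 0 \<Longrightarrow> \<xi> \<noteq> 0 \<Longrightarrow> f q (r *\<^sub>R \<xi>) = of_real (r powr m) * f q \<xi>"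
  shows "symbol k Q m f"
  using assms(2,3)
proof (induction k arbitrary: m f)
  case 0
  then show ?case using homogeneous_norm_bound[OF assms(1), of f m] by simp
next
  case (Suc k)
  have "symbol k Q (m - 1) (dir_deriv v f)" for v
  proof (rule Suc.IH)
    show "smooth_in k Q (dir_deriv v f)" using Suc.prems(1) by (rule smooth_in_deriv)
    fix q and r :: real and \<xi> :: 'v assume *: "q \<in> Q" "r > 0" "\<xi> \<noteq> 0"
    show "dir_deriv v f q (r *\<^sub>R \<xi>) = of_real (r powr (m - 1)) * dir_deriv v f q \<xi>"
      using homogeneous_dir_deriv[OF Suc.prems *] .
  qed
  moreover have "symbol 0 Q m f"
    using homogeneous_norm_bound[OF assms(1) smooth_in_continuous[OF Suc.prems(1)] Suc.prems(2)] .
  moreover have "\<exists>d. has_dir_deriv f v q \<xi> d" if "q \<in> Q" "\<xi> \<in> outer" for v q \<xi>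
    using smooth_in_has_deriv[OF Suc.prems(1) that(1) outer_nz[OF that(2)]] by blast
  ultimately show ?case unfolding symbol_Suc by blast
qed

section \<open>Powers, logarithms, cutoffs and Schwartz functions as symbols\<close>

lemma has_vector_derivative_ln_norm_line:
  fixes \<xi> v :: "'v::euclidean_space"
  assumes "\<xi> \<noteq> 0"
  shows "((\<lambda>t. ln (norm (\<xi> + t *\<^sub>R v))) has_vector_derivative (\<xi> \<bullet> v) / (norm \<xi>)\<^sup>2) (at 0)"
proof -
  have "((\<lambda>t. \<xi> + t *\<^sub>R v) has_derivative (\<lambda>t. t *\<^sub>R v)) (at 0)"
    by (auto intro!: derivative_eq_intros)
  moreover have "(norm has_derivative (\<lambda>h. h \<bullet> sgn \<xi>)) (at (\<xi> + 0 *\<^sub>R v))"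
    using has_derivative_norm[OF assms] by simp
  ultimately have "((\<lambda>t. norm (\<xi> + t *\<^sub>R v)) has_derivative (\<lambda>t. (t *\<^sub>R v) \<bullet> sgn \<xi>)) (at 0)"
    by (rule has_derivative_compose)
  moreover have "(\<lambda>t. (t *\<^sub>R v) \<bullet> sgn \<xi>) = (*) ((\<xi> \<bullet> v) / norm \<xi>)"
    by (auto simp: sgn_div_norm inner_commute divide_inverse mult_ac)
  ultimately have "((\<lambda>t. norm (\<xi> + t *\<^sub>R v)) has_field_derivative (\<xi> \<bullet> v) / norm \<xi>) (at 0)"
    by (simp add: has_field_derivative_def)
  then have "((\<lambda>t. ln (norm (\<xi> + t *\<^sub>R v))) has_field_derivative ((\<xi> \<bullet> v) / norm \<xi>) / norm \<xi>) (at 0)"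
    using assms by (auto intro!: derivative_eq_intros simp: field_simps)
  then show ?thesis
    by (simp add: has_real_derivative_iff_has_vector_derivative power2_eq_square)
qed

lemma has_vector_derivative_complex_of_real:
  "(f has_vector_derivative d) F \<Longrightarrow> ((\<lambda>t. complex_of_real (f t)) has_vector_derivative complex_of_real d) F"
  by (rule bounded_linear.has_vector_derivative[OF bounded_linear_of_real])

lemma symbol_linear:
  fixes v :: "'v::euclidean_space"
  shows "symbol k Q 1 (\<lambda>q \<xi>. of_real (\<xi> \<bullet> v))"
proof -
  have 0: "symbol 0 Q 1 (\<lambda>q \<xi>. of_real (\<xi> \<bullet> v))"
  proof (rule symbol_0I[where C="norm v"])
    show "continuous_on (Q \<times> outer) (\<lambda>(q, \<xi>). complex_of_real (\<xi> \<bullet> v))"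
      by (auto simp: case_prod_unfold intro!: continuous_intros)
    show "norm (complex_of_real (\<xi> \<bullet> v)) \<le> norm v * norm \<xi> powr 1" for \<xi>
      using Cauchy_Schwarz_ineq2[of \<xi> v] by (simp add: mult.commute)
  qed
  show ?thesis
  proof (cases k)
    case (Suc j)
    show ?thesis unfolding Suc
    proof (rule symbol_SucI[OF 0, where f'="\<lambda>w q \<xi>. of_real (w \<bullet> v)"])
      show "symbol j Q (1 - 1) (\<lambda>q (\<xi>::'v). complex_of_real (w \<bullet> v))" for w
        using symbol_const[of j Q] by simp
      show "has_dir_deriv (\<lambda>q \<xi>. complex_of_real (\<xi> \<bullet> v)) w q \<xi> (complex_of_real (w \<bullet> v))" for w q \<xi>
        unfolding has_dir_deriv_def
        by (auto intro!: derivative_eq_intros has_vector_derivative_of_real simp: inner_add_left)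
    qed
  qed (use 0 in simp)
qed

lemma norm_powr_bound:
  assumes "r > 1/2" "Re z \<le> m" "- B \<le> Re z"
  shows "norm (complex_of_real r powr z) \<le> (1/2) powr (- B - m) * r powr m"
proof -
  have "norm (complex_of_real r powr z) = r powr Re z"
    using assms(1) by (subst norm_powr_real_powr) auto
  also have "\<dots> = r powr (Re z - m) * r powr m"
    by (simp flip: powr_add)
  also have "\<dots> \<le> (1/2) powr (Re z - m) * r powr m"
    using assms by (intro mult_right_mono powr_mono2') auto
  also have "\<dots> \<le> (1/2) powr (- B - m) * r powr m"
    using assms by (intro mult_right_mono powr_mono') auto
  finally show ?thesis .
qed

text \<open>The exponent may depend on the parameter: with \<open>z\<close> as parameter this covers the degrees \<open>d + z\<close> of a
holomorphic family. The gradient of the power is \<open>\<delta> q\<close> times the power with exponent \<open>\<delta> q - 2\<close>, times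
\<open>\<xi>\<close>, which gives an induction over all exponents.\<close>

lemma symbol_norm_powr:
  fixes \<delta> :: "'q::topological_space \<Rightarrow> complex"
  assumes "compact Q" "continuous_on Q \<delta>" "\<And>q. q \<in> Q \<Longrightarrow> Re (\<delta> q) \<le> m"
  shows "symbol k Q m (\<lambda>q (\<xi>::'v::euclidean_space). of_real (norm \<xi>) powr \<delta> q)"
proof -
  have base: "symbol 0 Q m (\<lambda>q (\<xi>::'v). of_real (norm \<xi>) powr \<delta> q)"
    if "continuous_on Q \<delta>" "\<And>q. q \<in> Q \<Longrightarrow> Re (\<delta> q) \<le> m" for \<delta> m
  proof -
    have "bounded (\<delta> ` Q)"
      using assms(1) that(1) by (intro compact_imp_bounded compact_continuous_image)
    then obtain B where B: "\<forall>x\<in>\<delta> ` Q. norm x \<le> B" unfolding bounded_iff by blast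
    show ?thesis
    proof (rule symbol_0I)
      show "continuous_on (Q \<times> outer) (\<lambda>(q, \<xi>). complex_of_real (norm \<xi>) powr \<delta> q)"
        unfolding case_prod_unfold
        by (intro continuous_on_powr_complex continuous_intros continuous_on_compose2[OF that(1)]) (auto simp: complex_nonpos_Reals_iff)
      fix q and \<xi> :: 'v assume *: "q \<in> Q" "\<xi> \<in> outer"
      then have "norm (\<delta> q) \<le> B" using B by auto
      then have "- B \<le> Re (\<delta> q)" using abs_Re_le_cmod[of "\<delta> q"] by linarith
      then show "norm (complex_of_real (norm \<xi>) powr \<delta> q) \<le> (1/2) powr (- B - m) * norm \<xi> powr m"
        using * that(2)[OF *(1)] by (intro norm_powr_bound) auto
    qed
  qed
  show ?thesis using assms(2,3)
  proof (induction k arbitrary: m \<delta>)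
    case 0
    then show ?case by (rule base)
  next
    case (Suc k)
    show ?case
    proof (rule symbol_SucI[OF base[OF Suc.prems], where
          f'="\<lambda>v q \<xi>. \<delta> q * (of_real (norm \<xi>) powr (\<delta> q - 2) * of_real (\<xi> \<bullet> v))"])
      fix v :: 'v
      have "bounded (\<delta> ` Q)"
        using assms(1) Suc.prems(1) by (intro compact_imp_bounded compact_continuous_image)
      then obtain B where B: "\<forall>x\<in>\<delta> ` Q. norm x \<le> B" unfolding bounded_iff by blast
      have "symbol k Q 0 (\<lambda>q (\<xi>::'v). \<delta> q)"
        using Suc.prems(1) B by (intro symbol_param[where B=B]) auto
      moreover have "symbol k Q (m - 2) (\<lambda>q (\<xi>::'v). of_real (norm \<xi>) powr (\<delta> q - 2))"
        by (rule Suc.IH) (use Suc.prems in \<open>auto intro!: continuous_intros\<close>)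
      ultimately have "symbol k Q (0 + (m - 2 + 1)) (\<lambda>q \<xi>. \<delta> q * (of_real (norm \<xi>) powr (\<delta> q - 2) * of_real (\<xi> \<bullet> v)))"
        by (intro symbol_mult symbol_linear)
      then show "symbol k Q (m - 1) (\<lambda>q \<xi>. \<delta> q * (of_real (norm \<xi>) powr (\<delta> q - 2) * of_real (\<xi> \<bullet> v)))"
        by simp
    next
      fix v q and \<xi> :: 'v assume "q \<in> Q" "\<xi> \<in> outer"
      then have nz: "\<xi> \<noteq> 0" by auto
      have pe: "complex_of_real (norm \<eta>) powr z = exp (z * of_real (ln (norm \<eta>)))" if "\<eta> \<noteq> 0" for \<eta> :: 'v and z
        using that by (simp add: powr_def Ln_of_real)
      have "((\<lambda>t. complex_of_real (ln (norm (\<xi> + t *\<^sub>R v)))) has_vector_derivative of_real ((\<xi> \<bullet> v) / (norm \<xi>)\<^sup>2)) (at 0)"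
        using has_vector_derivative_ln_norm_line[OF nz]
        by (rule has_vector_derivative_complex_of_real)
      then have "((\<lambda>t. \<delta> q * complex_of_real (ln (norm (\<xi> + t *\<^sub>R v)))) has_vector_derivative \<delta> q * of_real ((\<xi> \<bullet> v) / (norm \<xi>)\<^sup>2)) (at 0)"
        by (rule has_vector_derivative_mult_right)
      from field_vector_diff_chain_at[OF this, of exp "exp (\<delta> q * of_real (ln (norm \<xi>)))"]
      have "has_dir_deriv (\<lambda>q \<xi>. exp (\<delta> q * complex_of_real (ln (norm \<xi>)))) v q \<xi>
         (\<delta> q * of_real ((\<xi> \<bullet> v) / (norm \<xi>)\<^sup>2) * exp (\<delta> q * of_real (ln (norm \<xi>))))"
        by (simp add: has_dir_deriv_def o_def DERIV_exp)
      moreover have "exp (\<delta> q * of_real (ln (norm \<xi>))) = of_real (norm \<xi>) powr (\<delta> q - 2) * of_real ((norm \<xi>)\<^sup>2)"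
        using nz by (simp flip: pe add: powr_diff)
      ultimately have "has_dir_deriv (\<lambda>q \<xi>. exp (\<delta> q * complex_of_real (ln (norm \<xi>)))) v q \<xi>
         (\<delta> q * (of_real (norm \<xi>) powr (\<delta> q - 2) * of_real (\<xi> \<bullet> v)))"
        using nz by (simp add: field_simps)
      then show "has_dir_deriv (\<lambda>q \<xi>. complex_of_real (norm \<xi>) powr \<delta> q) v q \<xi>
         (\<delta> q * (of_real (norm \<xi>) powr (\<delta> q - 2) * of_real (\<xi> \<bullet> v)))"
        using has_dir_deriv_cong[OF open_nonzero, of \<xi> "\<lambda>q \<xi>. complex_of_real (norm \<xi>) powr \<delta> q" q
            "\<lambda>q \<xi>. exp (\<delta> q * complex_of_real (ln (norm \<xi>)))"] nz pe by auto
    qed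
  qed
qed

lemma symbol_norm_powr_const:
  "symbol k Q (Re d) (\<lambda>q (\<xi>::'v::euclidean_space). of_real (norm \<xi>) powr d)"
proof -
  have "symbol k {0::real} (Re d) (\<lambda>q (\<xi>::'v). of_real (norm \<xi>) powr (\<lambda>_. d) q)"
    by (rule symbol_norm_powr) auto
  from symbol_reparam[OF this, of Q "\<lambda>_. 0"] show ?thesis by auto
qed

text \<open>Order 1 is generous, but any finite order serves: amplitudes of all orders have oscillatory
integrals.\<close>

lemma symbol_ln_norm:
  "symbol k Q 1 (\<lambda>q (\<xi>::'v::euclidean_space). of_real (ln (norm \<xi>)))"
proof -
  have 0: "symbol 0 Q 1 (\<lambda>q (\<xi>::'v). of_real (ln (norm \<xi>)))"
  proof (rule symbol_0I[where C=4])
    show "continuous_on (Q \<times> outer) (\<lambda>(q, \<xi>::'v). complex_of_real (ln (norm \<xi>)))"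
      by (auto simp: case_prod_unfold intro!: continuous_intros)
    fix \<xi> :: 'v assume "\<xi> \<in> outer"
    then have r: "norm \<xi> > 1/2" by simp
    have pos: "norm \<xi> > 0" using r by linarith
    have "ln (norm \<xi>) \<le> norm \<xi>" using ln_le_minus_one[OF pos] by linarith
    moreover have "ln (1 / norm \<xi>) \<le> 1 / norm \<xi> - 1" using pos by (intro ln_le_minus_one) simp
    moreover have "1 / norm \<xi> \<le> 2" using r pos by (simp add: field_simps)
    moreover have "ln (1 / norm \<xi>) = - ln (norm \<xi>)" using pos by (simp add: ln_div)
    ultimately have "\<bar>ln (norm \<xi>)\<bar> \<le> 4 * norm \<xi>" using r by linarith
    then show "norm (complex_of_real (ln (norm \<xi>))) \<le> 4 * norm \<xi> powr 1" using r by simp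
  qed
  show ?thesis
  proof (cases k)
    case (Suc j)
    show ?thesis unfolding Suc
    proof (rule symbol_SucI[OF 0, where f'="\<lambda>w q \<xi>. of_real (norm \<xi>) powr (-2) * of_real (\<xi> \<bullet> w)"])
      fix w :: 'v
      have "symbol j Q (Re (-2) + 1) (\<lambda>q (\<xi>::'v). of_real (norm \<xi>) powr (-2) * of_real (\<xi> \<bullet> w))"
        by (intro symbol_mult symbol_norm_powr_const symbol_linear)
      then show "symbol j Q (1 - 1) (\<lambda>q (\<xi>::'v). of_real (norm \<xi>) powr (-2) * of_real (\<xi> \<bullet> w))"
        by (rule symbol_weaken) simp
      fix q and \<xi> :: 'v assume "\<xi> \<in> outer"
      then have nz: "\<xi> \<noteq> 0" by auto
      have "of_real (norm \<xi>) powr (-2) * of_real (\<xi> \<bullet> w) = complex_of_real ((\<xi> \<bullet> w) / (norm \<xi>)\<^sup>2)"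
        using nz by (simp add: powr_minus field_simps)
      then show "has_dir_deriv (\<lambda>q \<xi>. complex_of_real (ln (norm \<xi>))) w q \<xi> (of_real (norm \<xi>) powr (-2) * of_real (\<xi> \<bullet> w))"
        unfolding has_dir_deriv_def 
        using has_vector_derivative_complex_of_real[OF has_vector_derivative_ln_norm_line[OF nz, of w]] by simp
    qed
  qed (use 0 in simp)
qed

lemma has_derivative_pos_part_power:
  "((\<lambda>x::real. max 0 x ^ (n + 2)) has_real_derivative (of_nat (n + 2) * max 0 x ^ (n + 1))) (at x)"
proof -
  consider "x > 0" | "x < 0" | "x = 0" by linarith
  then show ?thesis
  proof cases
    case 1
    have "((\<lambda>x::real. max 0 x ^ (n + 2)) has_real_derivative (of_nat (n + 2) * x ^ (n + 1))) (at x)"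
      by (rule has_field_derivative_transform_within_open[where S="{0<..}" and f="\<lambda>x. x ^ (n + 2)"])
        (use DERIV_pow[of "n + 2" x] 1 in auto)
    then show ?thesis using 1 by simp
  next
    case 2
    have "((\<lambda>x::real. max 0 x ^ (n + 2)) has_real_derivative 0) (at x)"
      by (rule has_field_derivative_transform_within_open[where S="{..<0}" and f="\<lambda>x. 0"])
        (use 2 in auto)
    then show ?thesis using 2 by simp
  next
    case 3
    have "((\<lambda>h::real. max 0 h ^ (n + 2) / h) \<longlongrightarrow> 0) (at 0)"
    proof (rule Lim_null_comparison)
      show "\<forall>\<^sub>F h in at (0::real). norm (max 0 h ^ (n + 2) / h) \<le> \<bar>h\<bar> ^ (n + 1)"
      proof (rule always_eventually, rule allI)
        fix h :: real
        show "norm (max 0 h ^ (n + 2) / h) \<le> \<bar>h\<bar> ^ (n + 1)"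
        proof (cases "h > 0")
          case False
          then have "max 0 h = 0" by simp
          then have "max 0 h ^ (n + 2) / h = 0" by simp
          then show ?thesis by (simp only: norm_zero zero_le_power abs_ge_zero)
        qed simp
      qed
      show "((\<lambda>h::real. \<bar>h\<bar> ^ (n + 1)) \<longlongrightarrow> 0) (at 0)"
        by (auto intro!: tendsto_eq_intros)
    qed
    then show ?thesis using 3 by (simp add: DERIV_def)
  qed
qed

lemma has_dir_deriv_real:
  assumes "has_dir_deriv (\<lambda>q \<xi>. complex_of_real (w q \<xi>)) v q \<xi> d"
  shows "d = of_real (Re d)"
proof -
  have "((\<lambda>t. Im (complex_of_real (w q (\<xi> + t *\<^sub>R v)))) has_vector_derivative Im d) (at 0)"
    using bounded_linear.has_vector_derivative[OF bounded_linear_Im assms[unfolded has_dir_deriv_def]] .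
  then have "((\<lambda>t::real. 0) has_vector_derivative Im d) (at 0)" by simp
  then have "Im d = 0"
    using vector_derivative_unique_at has_vector_derivative_const by blast
  then show ?thesis by (simp add: complex_eq_iff)
qed

text \<open>The function \<open>(max 0 t)^(k + 1)\<close> is \<open>k\<close> times continuously differentiable. Composed with a symbol of order 0 it
yields cutoff functions with as many symbol estimates as needed, without smooth bump functions.\<close>

lemma symbol_pos_part_power:
  fixes w :: "'q::topological_space \<Rightarrow> 'v::real_normed_vector \<Rightarrow> real"
  assumes "symbol k Q 0 (\<lambda>q \<xi>. of_real (w q \<xi>))"
  shows "symbol k Q 0 (\<lambda>q \<xi>. of_real (max 0 (w q \<xi>) ^ (k + 1)))"
proof -
  have base: "symbol 0 Q 0 (\<lambda>q \<xi>. of_real (max 0 (w q \<xi>) ^ (n + 1)))" for n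
  proof -
    obtain C where C: "C > 0" "continuous_on (Q \<times> outer) (\<lambda>(q, \<xi>). complex_of_real (w q \<xi>))"
      "\<And>q \<xi>. q \<in> Q \<Longrightarrow> \<xi> \<in> outer \<Longrightarrow> norm (complex_of_real (w q \<xi>)) \<le> C * norm \<xi> powr 0"
      by (rule symbol_0E[OF symbol_Suc_imp_0[OF assms]]) (rule that)
    have c: "continuous_on (Q \<times> outer) (\<lambda>x. w (fst x) (snd x))"
      using continuous_on_Re[OF C(2)] by (simp add: case_prod_unfold)
    show ?thesis
    proof (rule symbol_0I[where C="C ^ (n + 1)"])
      show "continuous_on (Q \<times> outer) (\<lambda>(q, \<xi>). complex_of_real (max 0 (w q \<xi>) ^ (n + 1)))"
        using c unfolding case_prod_unfold by (intro continuous_intros)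
      fix q and \<xi> :: 'v assume *: "q \<in> Q" "\<xi> \<in> outer"
      then have "\<bar>w q \<xi>\<bar> \<le> C" using C(3)[OF *] outer_nz[OF *(2)] by simp
      then have "max 0 (w q \<xi>) ^ (n + 1) \<le> C ^ (n + 1)" using C(1) by (intro power_mono) auto
      then show "norm (complex_of_real (max 0 (w q \<xi>) ^ (n + 1))) \<le> C ^ (n + 1) * norm \<xi> powr 0"
        using outer_nz[OF *(2)] by (simp add: norm_power norm_mult)
    qed
  qed
  show ?thesis using assms
  proof (induction k)
    case 0 then show ?case using base[of 0] by simp
  next
    case (Suc k)
    have IH: "symbol k Q 0 (\<lambda>q \<xi>. of_real (max 0 (w q \<xi>) ^ (k + 1)))"
      using Suc.IH symbol_lower[OF Suc.prems] .
    have "symbol (Suc k) Q 0 (\<lambda>q \<xi>. of_real (max 0 (w q \<xi>) ^ (k + 2)))"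
    proof (rule symbol_SucI[where f'="\<lambda>v q \<xi>. of_nat (k + 2) * (of_real (max 0 (w q \<xi>) ^ (k + 1)) * dir_deriv v (\<lambda>q \<xi>. of_real (w q \<xi>)) q \<xi>)"])
      show "symbol 0 Q 0 (\<lambda>q \<xi>. of_real (max 0 (w q \<xi>) ^ (k + 2)))"
        using base[of "k + 1"] by simp
      show "symbol k Q (0 - 1) (\<lambda>q \<xi>. of_nat (k + 2) * (of_real (max 0 (w q \<xi>) ^ (k + 1)) * dir_deriv v (\<lambda>q \<xi>. complex_of_real (w q \<xi>)) q \<xi>))" for v
        using symbol_cmult[OF symbol_mult[OF IH symbol_deriv[OF Suc.prems, of v]], of "of_nat (k + 2)"] by simp
      fix v q and \<xi> :: 'v assume *: "q \<in> Q" "\<xi> \<in> outer"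
      define d where "d = dir_deriv v (\<lambda>q \<xi>. complex_of_real (w q \<xi>)) q \<xi>"
      have d: "((\<lambda>t. complex_of_real (w q (\<xi> + t *\<^sub>R v))) has_vector_derivative d) (at 0)"
        using symbol_has_deriv[OF Suc.prems *, of v] by (simp add: has_dir_deriv_def d_def)
      have re: "((\<lambda>t. w q (\<xi> + t *\<^sub>R v)) has_vector_derivative Re d) (at 0)"
        using bounded_linear.has_vector_derivative[OF bounded_linear_Re d] by simp
      have dr: "d = of_real (Re d)"
        using symbol_has_deriv[OF Suc.prems *, of v] unfolding d_def by (rule has_dir_deriv_real)
      have "((\<lambda>t. max 0 (w q (\<xi> + t *\<^sub>R v)) ^ (k + 2)) has_field_derivative
          (of_nat (k + 2) * max 0 (w q (\<xi> + 0 *\<^sub>R v)) ^ (k + 1)) * Re d) (at 0)"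
        by (rule DERIV_chain2[OF has_derivative_pos_part_power])
          (use re in \<open>simp add: has_real_derivative_iff_has_vector_derivative\<close>)
      then have "((\<lambda>t. complex_of_real (max 0 (w q (\<xi> + t *\<^sub>R v)) ^ (k + 2))) has_vector_derivative
          of_real ((of_nat (k + 2) * max 0 (w q \<xi>) ^ (k + 1)) * Re d)) (at 0)"
        by (intro has_vector_derivative_complex_of_real)
          (simp add: has_real_derivative_iff_has_vector_derivative)
      moreover have "complex_of_real ((of_nat (k + 2) * max 0 (w q \<xi>) ^ (k + 1)) * Re d)
          = of_nat (k + 2) * (of_real (max 0 (w q \<xi>) ^ (k + 1)) * d)"
        by (subst (2) dr) simp
      ultimately show "has_dir_deriv (\<lambda>q \<xi>. complex_of_real (max 0 (w q \<xi>) ^ (k + 2))) v q \<xi>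
         (of_nat (k + 2) * (of_real (max 0 (w q \<xi>) ^ (k + 1)) * dir_deriv v (\<lambda>q \<xi>. complex_of_real (w q \<xi>)) q \<xi>))"
        by (simp only: has_dir_deriv_def d_def)
    qed
    then show ?case by simp
  qed
qed

text \<open>This cutoff vanishes to order \<open>k + 1\<close> at the unit sphere, so that products with it extend by 0 into the ball
as \<open>k\<close> times differentiable functions, and it differs from 1 by at most a multiple of \<open>norm \<xi> powr (- M)\<close>, so that the
remainder of an amplitude is integrable for large \<open>M\<close>.\<close>

definition radial_cutoff :: "nat \<Rightarrow> real \<Rightarrow> 'v::real_normed_vector \<Rightarrow> real" where
  "radial_cutoff k M \<xi> = (if norm \<xi> < 1 then 0 else (1 - norm \<xi> powr (- M)) ^ (k + 1))"

lemma symbol_radial_cutoff: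
  assumes "M > 0"
  shows "symbol k Q 0 (\<lambda>q (\<xi>::'v::euclidean_space). of_real (radial_cutoff k M \<xi>))"
proof -
  have "symbol k Q 0 (\<lambda>q (\<xi>::'v). 1 + (-1) * of_real (norm \<xi>) powr (- of_real M))"
    by (intro symbol_add symbol_const symbol_cmult symbol_weaken[OF symbol_norm_powr_const]) (use assms in auto)
  moreover have "1 + (-1) * complex_of_real (norm \<xi>) powr (- of_real M) = of_real (1 - norm \<xi> powr (- M))" for \<xi> :: 'v
    by (simp flip: powr_of_real of_real_minus)
  ultimately have "symbol k Q 0 (\<lambda>q (\<xi>::'v). of_real (1 - norm \<xi> powr (- M)))"
    by simp
  then have "symbol k Q 0 (\<lambda>q (\<xi>::'v). of_real (max 0 (1 - norm \<xi> powr (- M)) ^ (k + 1)))"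
    by (rule symbol_pos_part_power)
  moreover have "max 0 (1 - norm \<xi> powr (- M)) ^ (k + 1) = radial_cutoff k M \<xi>" if "\<xi> \<in> outer" for \<xi> :: 'v
  proof (cases "norm \<xi> < 1")
    case True
    then have "norm \<xi> powr (- M) \<ge> 1"
      using outer_nz[OF that] assms powr_mono2'[of "-M" "norm \<xi>" 1] by auto
    then show ?thesis using True by (simp add: radial_cutoff_def)
  next
    case False
    then have "norm \<xi> powr (- M) \<le> 1"
      using that assms powr_mono2'[of "-M" 1 "norm \<xi>"] by auto
    then show ?thesis using False by (simp add: radial_cutoff_def)
  qed
  ultimately show ?thesis
    using symbol_cong[of Q "\<lambda>q (\<xi>::'v). of_real (max 0 (1 - norm \<xi> powr (- M)) ^ (k + 1))"
        "\<lambda>q \<xi>. of_real (radial_cutoff k M \<xi>)" k 0] by auto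
qed

text \<open>Bernoulli's inequality.\<close>

lemma radial_cutoff_near_1:
  assumes "M > 0" "norm \<xi> \<ge> 1"
  shows "\<bar>1 - radial_cutoff k M \<xi>\<bar> \<le> (real k + 1) * norm \<xi> powr (- M)"
proof -
  define u where "u = norm \<xi> powr (- M)"
  have u: "0 \<le> u" "u \<le> 1"
    using assms powr_mono2'[of "-M" 1 "norm \<xi>"] by (auto simp: u_def)
  have "1 + real (k + 1) * (- u) \<le> (1 + (- u)) ^ (k + 1)"
    by (rule Bernoulli_inequality) (use u in auto)
  moreover have "(1 - u) ^ (k + 1) \<le> 1" using u by (intro power_le_one) auto
  ultimately show ?thesis
    using assms u by (simp add: radial_cutoff_def flip: u_def) (simp add: algebra_simps)
qed

lemma schwartz_deriv: "schwartz \<kappa> \<Longrightarrow> schwartz (\<lambda>u. frechet_derivative \<kappa> (at u) v)"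
  unfolding schwartz_def using rapidly_decreasing.simps(2) by blast

lemma schwartz_differentiable: "schwartz \<kappa> \<Longrightarrow> \<kappa> differentiable (at u)"
  unfolding schwartz_def using rapidly_decreasing.simps(2) by blast

lemma schwartz_continuous: "schwartz \<kappa> \<Longrightarrow> continuous_on S \<kappa>"
  unfolding schwartz_def by (metis rapidly_decreasing.simps(1) continuous_on_subset subset_UNIV)

lemma schwartz_decay:
  assumes "schwartz \<kappa>"
  obtains C where "C > 0" "\<And>u. norm u ^ m * norm (\<kappa> u) \<le> C"
proof -
  have "bounded (range (\<lambda>u. norm u ^ m *\<^sub>R \<kappa> u))"
    using assms unfolding schwartz_def by (metis rapidly_decreasing.simps(1))
  then obtain C where "\<forall>x. norm (norm x ^ m *\<^sub>R \<kappa> x) \<le> C" unfolding bounded_iff by auto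
  then have C: "norm u ^ m * norm (\<kappa> u) \<le> C" for u by auto
  have "norm u ^ m * norm (\<kappa> u) \<le> \<bar>C\<bar> + 1" for u using C[of u] by linarith
  then show ?thesis using that[of "\<bar>C\<bar> + 1"] by auto
qed

text \<open>The regularising factor \<open>\<kappa> (\<epsilon> \<xi>)\<close> is a symbol of order 0 uniformly in \<open>\<epsilon> \<ge> 0\<close> (take \<open>j = M = 0\<close>), and of
any negative order \<open>- M\<close> for a single \<open>\<epsilon> > 0\<close> (take \<open>j = 0\<close> and \<open>c = \<epsilon>^(- M)\<close>). A derivative produces one more
factor \<open>\<epsilon>\<close>, which turns the condition for \<open>(j, M)\<close> into the one for \<open>(j + 1, M + 1)\<close>; the general form
is what makes the induction close.\<close>

lemma symbol_scaled_schwartz: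
  fixes \<kappa> :: "real^'n \<Rightarrow> complex" and Q :: "'q::topological_space set"
  assumes "schwartz \<kappa>" "\<And>\<epsilon>. \<epsilon> \<in> E \<Longrightarrow> 0 \<le> \<epsilon> \<and> \<epsilon> ^ j \<le> c * \<epsilon> ^ M"
  shows "symbol k (E \<times> Q) (- real M) (\<lambda>p \<xi>. of_real (fst p) ^ j * \<kappa> (fst p *\<^sub>R \<xi>))"
proof -
  have base: "symbol 0 (E \<times> Q) (- real M) (\<lambda>p \<xi>. of_real (fst p) ^ j * \<kappa> (fst p *\<^sub>R \<xi>))"
    if \<kappa>: "schwartz \<kappa>" and E: "\<And>\<epsilon>. \<epsilon> \<in> E \<Longrightarrow> 0 \<le> \<epsilon> \<and> \<epsilon> ^ j \<le> c * \<epsilon> ^ M" for \<kappa> :: "real^'n \<Rightarrow> complex" and j M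
  proof -
    obtain C where C: "C > 0" "\<And>u. norm u ^ M * norm (\<kappa> u) \<le> C"
      by (rule schwartz_decay[OF \<kappa>, of M]) (rule that)
    show ?thesis
    proof (rule symbol_0I[where C="\<bar>c\<bar> * C"])
      show "continuous_on ((E \<times> Q) \<times> outer) (\<lambda>(p, \<xi>). of_real (fst p) ^ j * \<kappa> (fst p *\<^sub>R \<xi>))"
        unfolding case_prod_unfold
        by (intro continuous_intros continuous_on_compose2[OF schwartz_continuous[OF \<kappa>, of UNIV]]) auto
      fix p and \<xi> :: "real^'n" assume p: "p \<in> E \<times> Q" and xi: "\<xi> \<in> outer"
      define \<epsilon> where "\<epsilon> = fst p"
      have e: "0 \<le> \<epsilon>" "\<epsilon> ^ j \<le> c * \<epsilon> ^ M" using p E by (auto simp: \<epsilon>_def)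
      have pos: "norm \<xi> > 0" using xi by auto
      have "\<epsilon> ^ j * norm (\<kappa> (\<epsilon> *\<^sub>R \<xi>)) \<le> \<bar>c\<bar> * \<epsilon> ^ M * norm (\<kappa> (\<epsilon> *\<^sub>R \<xi>))"
        using e by (intro mult_right_mono order_trans[OF e(2)] mult_right_mono) auto
      also have "\<dots> = \<bar>c\<bar> * (norm (\<epsilon> *\<^sub>R \<xi>) ^ M * norm (\<kappa> (\<epsilon> *\<^sub>R \<xi>))) * norm \<xi> powr (- real M)"
        using e pos by (simp add: powr_minus powr_realpow power_mult_distrib field_simps)
      also have "\<dots> \<le> \<bar>c\<bar> * C * norm \<xi> powr (- real M)"
        by (intro mult_right_mono mult_left_mono C) auto
      finally show "norm (of_real (fst p) ^ j * \<kappa> (fst p *\<^sub>R \<xi>)) \<le> \<bar>c\<bar> * C * norm \<xi> powr (- real M)"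
        using e(1) by (simp add: norm_mult norm_power \<epsilon>_def)
    qed
  qed
  show ?thesis using assms
  proof (induction k arbitrary: \<kappa> j M)
    case 0
    then show ?case by (rule base)
  next
    case (Suc k)
    show ?case
    proof (rule symbol_SucI[OF base[OF Suc.prems], where
          f'="\<lambda>v p \<xi>. of_real (fst p) ^ Suc j * frechet_derivative \<kappa> (at (fst p *\<^sub>R \<xi>)) v"])
      show "symbol k (E \<times> Q) (- real M - 1) (\<lambda>p \<xi>. of_real (fst p) ^ Suc j * frechet_derivative \<kappa> (at (fst p *\<^sub>R \<xi>)) v)" for v
      proof -
        have b: "0 \<le> \<epsilon> \<and> \<epsilon> ^ Suc j \<le> c * \<epsilon> ^ Suc M" if "\<epsilon> \<in> E" for \<epsilon>
          using Suc.prems(2)[OF that] mult_left_mono[of "\<epsilon> ^ j" "c * \<epsilon> ^ M" \<epsilon>] by (auto simp: mult_ac)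
        have eq: "- real (Suc M) = - real M - 1" by simp
        from Suc.IH[OF schwartz_deriv[OF Suc.prems(1), of v] b] show ?thesis unfolding eq .
      qed
      fix v p and \<xi> :: "real^'n"
      have 1: "((\<lambda>t. fst p *\<^sub>R (\<xi> + t *\<^sub>R v)) has_derivative (\<lambda>t. t *\<^sub>R (fst p *\<^sub>R v))) (at 0)"
        by (auto intro!: derivative_eq_intros simp: scaleR_add_right)
      have 2: "(\<kappa> has_derivative frechet_derivative \<kappa> (at (fst p *\<^sub>R \<xi>))) (at (fst p *\<^sub>R (\<xi> + 0 *\<^sub>R v)))"
        using schwartz_differentiable[OF Suc.prems(1)] by (simp add: frechet_derivative_works)
      have l: "linear (frechet_derivative \<kappa> (at (fst p *\<^sub>R \<xi>)))"
        using 2 has_derivative_linear by fastforce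
      have "((\<lambda>t. \<kappa> (fst p *\<^sub>R (\<xi> + t *\<^sub>R v))) has_vector_derivative fst p *\<^sub>R frechet_derivative \<kappa> (at (fst p *\<^sub>R \<xi>)) v) (at 0)"
        using has_derivative_compose[OF 1 2] unfolding has_vector_derivative_def by (simp add: linear_scale[OF l])
      then have "((\<lambda>t. of_real (fst p) ^ j * \<kappa> (fst p *\<^sub>R (\<xi> + t *\<^sub>R v))) has_vector_derivative
          of_real (fst p) ^ j * (fst p *\<^sub>R frechet_derivative \<kappa> (at (fst p *\<^sub>R \<xi>)) v)) (at 0)"
        by (rule has_vector_derivative_mult_right)
      then show "has_dir_deriv (\<lambda>p \<xi>. of_real (fst p) ^ j * \<kappa> (fst p *\<^sub>R \<xi>)) v p \<xi>
         (of_real (fst p) ^ Suc j * frechet_derivative \<kappa> (at (fst p *\<^sub>R \<xi>)) v)"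
        by (simp add: has_dir_deriv_def scaleR_conv_of_real mult_ac)
    qed
  qed
qed

section \<open>Absolutely convergent integrals\<close>

lemma dyadic_interval:
  assumes "1 \<le> (x::real)"
  obtains j :: nat where "2 ^ j \<le> x" "x < 2 ^ (j + 1)"
proof -
  define j where "j = nat \<lfloor>log 2 x\<rfloor>"
  have "0 \<le> log 2 x" using assms by simp
  then have "real j \<le> log 2 x" "log 2 x < real j + 1"
    unfolding j_def by linarith+
  then have "2 powr real j \<le> x" "x < 2 powr (real j + 1)"
    using assms by (simp_all add: le_log_iff log_less_iff)
  then show ?thesis using that[of j] by (simp add: powr_realpow powr_add)
qed

text \<open>With twice the dimension as decay exponent, the dyadic shells contribute a geometric series of ratio
\<open>2^(- DIM('v))\<close>.\<close>

lemma integrable_tail_powr: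
  "integrable lborel (\<lambda>\<xi>::'v::euclidean_space. if 1 \<le> norm \<xi> then norm \<xi> powr (- 2 * real DIM('v)) else 0)"
proof (rule integrableI_bounded)
  let ?N = "DIM('v)"
  let ?f = "\<lambda>\<xi>::'v. if 1 \<le> norm \<xi> then norm \<xi> powr (- 2 * real ?N) else 0"
  show "?f \<in> borel_measurable lborel" by measurable
  define c where "c j = (2::real) powr (- 2 * real ?N * real j)" for j
  have "ennreal (norm (?f \<xi>)) \<le> (\<Sum>j. ennreal (c j) * indicator (cball 0 (2 ^ (j + 1))) \<xi>)" for \<xi>
  proof (cases "1 \<le> norm \<xi>")
    case True
    then obtain j :: nat where j: "2 ^ j \<le> norm \<xi>" "norm \<xi> < 2 ^ (j + 1)"
      by (rule dyadic_interval)
    have "norm \<xi> powr (- 2 * real ?N) \<le> (2 ^ j) powr (- 2 * real ?N)"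
      using j by (intro powr_mono2') auto
    also have "\<dots> = c j"
      by (simp add: c_def powr_powr flip: powr_realpow)
        (simp add: mult.commute)
    moreover have le: "h j \<le> (\<Sum>i. h i)" for h :: "nat \<Rightarrow> ennreal"
      using sum_le_suminf[of h "{j}"] by simp
    ultimately have "ennreal (norm (?f \<xi>)) \<le> ennreal (c j) * indicator (cball 0 (2 ^ (j + 1))) \<xi>"
      using True j(2) by (auto intro!: ennreal_leI)
    also have "\<dots> \<le> (\<Sum>j. ennreal (c j) * indicator (cball 0 (2 ^ (j + 1))) \<xi>)"
      by (rule le)
    finally show ?thesis .
  qed auto
  then have "(\<integral>\<^sup>+ \<xi>. ennreal (norm (?f \<xi>)) \<partial>lborel) \<le> 
      (\<integral>\<^sup>+ \<xi>. (\<Sum>j. ennreal (c j) * indicator (cball 0 (2 ^ (j + 1))) \<xi>) \<partial>(lborel :: 'v measure))"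
    by (intro nn_integral_mono)
  also have "\<dots> = (\<Sum>j. \<integral>\<^sup>+ \<xi>. ennreal (c j) * indicator (cball 0 (2 ^ (j + 1))) \<xi> \<partial>(lborel :: 'v measure))"
    by (intro nn_integral_suminf borel_measurable_times_ennreal borel_measurable_const borel_measurable_indicator) auto
  also have "\<dots> = (\<Sum>j. ennreal (c j) * emeasure lborel (cball (0::'v) (2 ^ (j + 1))))"
    by (intro suminf_cong nn_integral_cmult_indicator) auto
  also have "\<dots> = (\<Sum>j. ennreal (unit_ball_vol ?N * 2 ^ ?N * (1 / 2 ^ ?N) ^ j))"
  proof (rule suminf_cong)
    fix j
    have "c j * (unit_ball_vol ?N * (2 ^ (j + 1)) ^ ?N) = unit_ball_vol ?N * 2 ^ ?N * (1 / 2 ^ ?N) ^ j"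
    proof -
      have "c j = inverse (2 ^ (2 * ?N * j))"
        unfolding c_def by (simp add: powr_minus flip: powr_realpow)
      also have "(2::real) ^ (2 * ?N * j) = 2 ^ (j * ?N) * 2 ^ (j * ?N)"
        by (simp flip: power_add add: algebra_simps)
      finally have cj: "c j = inverse (2 ^ (j * ?N) * 2 ^ (j * ?N))" .
      have e: "((2::real) ^ (j + 1)) ^ ?N = 2 ^ (j * ?N) * 2 ^ ?N"
        by (simp add: power_mult_distrib power_mult)
      have e2: "(1 / 2 ^ ?N) ^ j = inverse ((2::real) ^ (j * ?N))"
        by (simp add: power_divide power_mult [symmetric] mult.commute inverse_eq_divide)
      show ?thesis unfolding cj e e2 by (simp add: field_simps)
    qed
    then show "ennreal (c j) * emeasure lborel (cball (0::'v) (2 ^ (j + 1))) = ennreal (unit_ball_vol ?N * 2 ^ ?N * (1 / 2 ^ ?N) ^ j)"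
      by (subst emeasure_cball) (auto simp flip: ennreal_mult simp: c_def)
  qed
  also have "\<dots> < \<infinity>"
  proof -
    have "(1::real) < 2 ^ ?N" by (rule one_less_power) auto
    then have "summable (\<lambda>j. unit_ball_vol ?N * 2 ^ ?N * (1 / 2 ^ ?N) ^ j)"
      by (intro summable_mult summable_geometric) auto
    then have "(\<Sum>j. ennreal (unit_ball_vol ?N * 2 ^ ?N * (1 / 2 ^ ?N) ^ j)) \<noteq> top"
      by (intro ennreal_suminf_neq_top) auto
    then show ?thesis by (simp add: top.not_eq_extremum)
  qed
  finally show "(\<integral>\<^sup>+ \<xi>. ennreal (norm (?f \<xi>)) \<partial>lborel) < \<infinity>" .
qed

lemma continuous_on_integral_dominated:
  fixes F :: "'p::{first_countable_topology,t2_space} \<Rightarrow> 'b \<Rightarrow> complex"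
  assumes "\<And>p. p \<in> P \<Longrightarrow> F p \<in> borel_measurable M" "integrable M w"
    and "\<And>p x. p \<in> P \<Longrightarrow> x \<in> space M \<Longrightarrow> norm (F p x) \<le> w x"
    and "\<And>x. x \<in> space M \<Longrightarrow> continuous_on P (\<lambda>p. F p x)"
  shows "continuous_on P (\<lambda>p. integral\<^sup>L M (F p))"
proof (rule continuous_on_sequentiallyI)
  fix u a assume u: "\<forall>n. u n \<in> P" "a \<in> P" "u \<longlonglongrightarrow> a"
  show "(\<lambda>n. integral\<^sup>L M (F (u n))) \<longlonglongrightarrow> integral\<^sup>L M (F a)"
  proof (rule integral_dominated_convergence[where w=w])
    show "AE x in M. (\<lambda>n. F (u n) x) \<longlonglongrightarrow> F a x"
    proof (rule AE_I2)
      fix x assume "x \<in> space M"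
      then have "continuous_on P (\<lambda>p. F p x)" by (rule assms(4))
      then show "(\<lambda>n. F (u n) x) \<longlonglongrightarrow> F a x"
        using u unfolding continuous_on_sequentially o_def by blast
    qed
  qed (use assms u in auto)
qed

text \<open>The weight \<open>w\<close> is only bounded and pointwise continuous, while the amplitude \<open>a\<close> is continuous in \<open>L\<^sup>1\<close>
and need not be pointwise continuous. Fixing one factor at a time separates dominated convergence for \<open>w\<close>
from the \<open>L\<^sup>1\<close> estimate for \<open>a\<close>.\<close>

lemma continuous_on_integral_L1:
  fixes a w :: "'p::{first_countable_topology,t2_space} \<Rightarrow> 'b \<Rightarrow> complex"
  assumes "\<And>p. p \<in> P \<Longrightarrow> w p \<in> borel_measurable M" "\<And>p x. p \<in> P \<Longrightarrow> x \<in> space M \<Longrightarrow> norm (w p x) \<le> B"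
    and "AE x in M. continuous_on P (\<lambda>p. w p x)"
    and "\<And>p. p \<in> P \<Longrightarrow> integrable M (a p)"
    and "\<And>p0. p0 \<in> P \<Longrightarrow> continuous (at p0 within P) (\<lambda>p. LINT x|M. norm (a p x - a p0 x))"
  shows "continuous_on P (\<lambda>p. LINT x|M. w p x * a p x)"
proof (rule continuous_on_sequentiallyI)
  fix u p0 assume u: "\<forall>n. u n \<in> P" "p0 \<in> P" "u \<longlonglongrightarrow> p0"
  have int: "integrable M (\<lambda>x. w p x * a p' x)" if "p \<in> P" "p' \<in> P" for p p'
  proof (rule Bochner_Integration.integrable_bound[of M "\<lambda>x. B * norm (a p' x)"])
    show "AE x in M. norm (w p x * a p' x) \<le> norm (B * norm (a p' x))"
    proof (rule AE_I2)
      fix x assume "x \<in> space M"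
      then have "norm (w p x) \<le> B" using assms(2) that by blast
      then show "norm (w p x * a p' x) \<le> norm (B * norm (a p' x))"
        by (auto simp: norm_mult abs_mult intro!: mult_right_mono order_trans[OF _ abs_ge_self])
    qed
  qed (use assms(1,4) that in \<open>auto intro!: borel_measurable_times borel_measurable_integrable\<close>)
  have 1: "(\<lambda>n. LINT x|M. w (u n) x * a p0 x) \<longlonglongrightarrow> (LINT x|M. w p0 x * a p0 x)"
  proof (rule integral_dominated_convergence[where w="\<lambda>x. B * norm (a p0 x)"])
    show "AE x in M. (\<lambda>n. w (u n) x * a p0 x) \<longlonglongrightarrow> w p0 x * a p0 x"
      using assms(3)
    proof eventually_elim
      fix x assume "continuous_on P (\<lambda>p. w p x)"
      then have "(\<lambda>n. w (u n) x) \<longlonglongrightarrow> w p0 x"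
        using u unfolding continuous_on_sequentially o_def by blast
      then show "(\<lambda>n. w (u n) x * a p0 x) \<longlonglongrightarrow> w p0 x * a p0 x" by (intro tendsto_intros)
    qed
    show "AE x in M. norm (w (u n) x * a p0 x) \<le> B * norm (a p0 x)" for n
      using assms(2) u by (intro AE_I2) (auto simp: norm_mult intro!: mult_right_mono)
    show "integrable M (\<lambda>x. B * norm (a p0 x))" using assms(4) u by auto
  qed (use int u in \<open>auto intro: borel_measurable_integrable\<close>)
  have 2: "(\<lambda>n. (LINT x|M. w (u n) x * a (u n) x) - (LINT x|M. w (u n) x * a p0 x)) \<longlonglongrightarrow> 0"
  proof (rule Lim_null_comparison)
    show "\<forall>\<^sub>F n in sequentially. norm ((LINT x|M. w (u n) x * a (u n) x) - (LINT x|M. w (u n) x * a p0 x))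
        \<le> B * (LINT x|M. norm (a (u n) x - a p0 x))"
    proof (rule always_eventually, rule allI)
      fix n
      have un: "u n \<in> P" using u by blast
      have "(LINT x|M. w (u n) x * a (u n) x) - (LINT x|M. w (u n) x * a p0 x)
          = (LINT x|M. w (u n) x * (a (u n) x - a p0 x))"
        using int[OF un un] int[OF un u(2)] by (simp flip: Bochner_Integration.integral_diff add: right_diff_distrib)
      also have "norm \<dots> \<le> (LINT x|M. norm (w (u n) x * (a (u n) x - a p0 x)))"
        by (rule integral_norm_bound)
      also have "\<dots> \<le> (LINT x|M. B * norm (a (u n) x - a p0 x))"
      proof (rule integral_mono)
        show "integrable M (\<lambda>x. norm (w (u n) x * (a (u n) x - a p0 x)))"
          using int[OF un un] int[OF un u(2)] by (intro integrable_norm) (simp add: right_diff_distrib)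
        show "integrable M (\<lambda>x. B * norm (a (u n) x - a p0 x))"
          using assms(4) un u(2) by (intro integrable_mult_right integrable_norm Bochner_Integration.integrable_diff)
        fix x assume "x \<in> space M"
        then show "norm (w (u n) x * (a (u n) x - a p0 x)) \<le> B * norm (a (u n) x - a p0 x)"
          using assms(2) un by (auto simp: norm_mult intro!: mult_right_mono)
      qed
      finally show "norm ((LINT x|M. w (u n) x * a (u n) x) - (LINT x|M. w (u n) x * a p0 x))
        \<le> B * (LINT x|M. norm (a (u n) x - a p0 x))" by simp
    qed
    have "(\<lambda>n. LINT x|M. norm (a (u n) x - a p0 x)) \<longlonglongrightarrow> (LINT x|M. norm (a p0 x - a p0 x))"
      using assms(5)[OF u(2)] u unfolding continuous_within_sequentially o_def by blast
    then have "(\<lambda>n. B * (LINT x|M. norm (a (u n) x - a p0 x))) \<longlonglongrightarrow> B * 0"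
      by (intro tendsto_intros) simp
    then show "(\<lambda>n. B * (LINT x|M. norm (a (u n) x - a p0 x))) \<longlonglongrightarrow> 0" by simp
  qed
  from tendsto_add[OF 2 1] show "(\<lambda>n. LINT x|M. w (u n) x * a (u n) x) \<longlonglongrightarrow> (LINT x|M. w p0 x * a p0 x)"
    by simp
qed

section \<open>Integration by parts\<close>

lemma lborel_translation:
  fixes F :: "'v::euclidean_space \<Rightarrow> 'b::{banach, second_countable_topology}"
  assumes "integrable lborel F"
  shows "integrable lborel (\<lambda>\<xi>. F (\<xi> + c))" "(LINT \<xi>|lborel. F (\<xi> + c)) = (LINT \<xi>|lborel. F \<xi>)"
proof -
  have m: "F \<in> borel_measurable borel" using assms by auto
  have i: "integrable (distr lborel borel ((+) c)) F" using assms by (simp add: lborel_distr_plus)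
  have "integrable lborel (\<lambda>\<xi>. F (c + \<xi>))"
    by (rule integrable_distr[OF _ i]) simp
  then show "integrable lborel (\<lambda>\<xi>. F (\<xi> + c))" by (simp add: add.commute)
  have "(LINT \<xi>|lborel. F \<xi>) = (LINT \<xi>|distr lborel borel ((+) c). F \<xi>)"
    by (simp add: lborel_distr_plus)
  also have "\<dots> = (LINT \<xi>|lborel. F (c + \<xi>))"
    by (rule integral_distr) (use m in auto)
  finally show "(LINT \<xi>|lborel. F (\<xi> + c)) = (LINT \<xi>|lborel. F \<xi>)" by (simp add: add.commute)
qed

text \<open>By translation invariance the increments \<open>F (\<xi> + v) - F \<xi>\<close> integrate to zero, and by Fubini's theorem
they integrate to the same value as the derivative, of which they are averages along segments.\<close>

lemma integral_dir_deriv_eq_0: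
  fixes F F' :: "'v::euclidean_space \<Rightarrow> complex"
  assumes "\<And>\<xi>. ((\<lambda>t. F (\<xi> + t *\<^sub>R v)) has_vector_derivative F' \<xi>) (at 0)"
    and "integrable lborel F" "integrable lborel F'" "continuous_on UNIV F'"
  shows "(LINT \<xi>|lborel. F' \<xi>) = 0"
proof -
  \<comment> \<open>\<open>F (\<xi> + v) - F \<xi>\<close> is the integral of \<open>f t \<xi>\<close> over \<open>t\<close>.\<close>
  define f where "f t \<xi> = indicator {0..1::real} t *\<^sub>R F' (\<xi> + t *\<^sub>R v)" for t \<xi>
  have meas: "case_prod f \<in> borel_measurable (lborel \<Otimes>\<^sub>M lborel)"
  proof -
    have c: "continuous_on UNIV (\<lambda>p. F' (snd p + fst p *\<^sub>R v))"
      by (intro continuous_on_compose2[OF assms(4)] continuous_intros) auto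
    have "(\<lambda>p. F' (snd p + fst p *\<^sub>R v)) \<in> borel_measurable (borel \<Otimes>\<^sub>M borel)"
      unfolding borel_prod using c by (rule borel_measurable_continuous_onI)
    then have [measurable]: "(\<lambda>p. F' (snd p + fst p *\<^sub>R v)) \<in> borel_measurable (lborel \<Otimes>\<^sub>M lborel)"
      by simp
    show ?thesis unfolding f_def case_prod_unfold by measurable
  qed
  have "integrable (lborel \<Otimes>\<^sub>M lborel) (case_prod f)"
  proof (rule lborel_pair.Fubini_integrable[OF meas])
    have "(LINT \<xi>|lborel. norm (case_prod f (t, \<xi>))) = indicator {0..1} t * (LINT \<xi>|lborel. norm (F' \<xi>))" for t
    proof -
      have "(LINT \<xi>|lborel. norm (F' (\<xi> + t *\<^sub>R v))) = (LINT \<xi>|lborel. norm (F' \<xi>))"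
        using lborel_translation(2)[OF integrable_norm[OF assms(3)]] .
      then show ?thesis by (simp add: f_def)
    qed
    then show "integrable lborel (\<lambda>t. LINT \<xi>|lborel. norm (case_prod f (t, \<xi>)))"
      by simp
    show "AE t in lborel. integrable lborel (\<lambda>\<xi>. case_prod f (t, \<xi>))"
      using lborel_translation(1)[OF assms(3)] by (auto simp: f_def)
  qed
  then have "(LINT \<xi>|lborel. LINT t|lborel. f t \<xi>) = (LINT t|lborel. LINT \<xi>|lborel. f t \<xi>)"
    by (rule lborel_pair.Fubini_integral)
  also have "(LINT t|lborel. LINT \<xi>|lborel. f t \<xi>) = (LINT t|lborel. indicator {0..1::real} t *\<^sub>R (LINT \<xi>|lborel. F' \<xi>))"
    by (rule Bochner_Integration.integral_cong)
      (use lborel_translation(2)[OF assms(3)] in \<open>simp_all add: f_def\<close>)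
  also have "\<dots> = (LINT t|lborel. indicator {0..1::real} t) *\<^sub>R (LINT \<xi>|lborel. F' \<xi>)"
    by (rule Bochner_Integration.integral_scaleR_left) simp
  also have "\<dots> = (LINT \<xi>|lborel. F' \<xi>)" by simp
  also have "(LINT t|lborel. f t \<xi>) = F (\<xi> + v) - F \<xi>" for \<xi>
  proof -
    have "(LINT t|lborel. indicator {0..1} t *\<^sub>R F' (\<xi> + t *\<^sub>R v)) = F (\<xi> + 1 *\<^sub>R v) - F (\<xi> + 0 *\<^sub>R v)"
    proof (rule integral_FTC_Icc)
      show "continuous_on {0..1} (\<lambda>t. F' (\<xi> + t *\<^sub>R v))"
        by (intro continuous_on_compose2[OF assms(4)] continuous_intros) auto
      fix t :: real
      have "((\<lambda>s. F ((\<xi> + t *\<^sub>R v) + s *\<^sub>R v)) has_vector_derivative F' (\<xi> + t *\<^sub>R v)) (at (t - t))"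
        using assms(1)[of "\<xi> + t *\<^sub>R v"] by simp
      moreover have "((\<lambda>s. s - t) has_vector_derivative 1) (at t)"
        by (auto intro!: derivative_eq_intros)
      ultimately have "(((\<lambda>s. F ((\<xi> + t *\<^sub>R v) + s *\<^sub>R v)) \<circ> (\<lambda>s. s - t)) has_vector_derivative 1 *\<^sub>R F' (\<xi> + t *\<^sub>R v)) (at t)"
        by (intro vector_diff_chain_at)
      moreover have "(\<lambda>s. F ((\<xi> + t *\<^sub>R v) + s *\<^sub>R v)) \<circ> (\<lambda>s. s - t) = (\<lambda>s. F (\<xi> + s *\<^sub>R v))"
        by (auto simp: algebra_simps)
      ultimately show "((\<lambda>t. F (\<xi> + t *\<^sub>R v)) has_vector_derivative F' (\<xi> + t *\<^sub>R v)) (at t within {0..1})"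
        by (auto intro: has_vector_derivative_at_within)
    qed simp
    then show ?thesis by (simp add: f_def)
  qed
  then have "(LINT \<xi>|lborel. LINT t|lborel. f t \<xi>) = (LINT \<xi>|lborel. F (\<xi> + v) - F \<xi>)" by simp
  also have "\<dots> = 0"
    using lborel_translation[OF assms(2), of v] assms(2) by (simp add: Bochner_Integration.integral_diff)
  finally show ?thesis by simp
qed

lemma continuous_on_vanish_near_0:
  fixes f :: "'v::real_normed_vector \<Rightarrow> complex"
  assumes "continuous_on outer f" "\<And>\<xi>. norm \<xi> < 1 \<Longrightarrow> f \<xi> = 0"
  shows "continuous_on UNIV f"
proof -
  have "continuous_on (ball 0 1) f"
    using assms(2) continuous_on_cong[of "ball 0 1" "ball 0 1" f "\<lambda>_. 0"] by auto
  then have "continuous_on (outer \<union> ball 0 1) f"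
    using assms(1) by (intro continuous_on_open_Un open_outer) auto
  moreover have "outer \<union> ball 0 1 = (UNIV :: 'v set)" by auto
  ultimately show ?thesis by simp
qed

lemma symbol_slice_continuous:
  assumes "symbol 0 Q m f" "q \<in> Q"
  shows "continuous_on outer (f q)"
proof -
  have c: "continuous_on (Q \<times> outer) (\<lambda>(q, \<xi>). f q \<xi>)" using assms(1) by (simp add: symbol_0_iff)
  have "continuous_on outer (\<lambda>\<xi>. (\<lambda>(q, \<xi>). f q \<xi>) (q, \<xi>))"
    by (rule continuous_on_compose2[OF c]) (use assms(2) in \<open>auto intro!: continuous_intros\<close>)
  then show ?thesis by simp
qed

lemma symbol_integrable:
  fixes f :: "'q::topological_space \<Rightarrow> 'v::euclidean_space \<Rightarrow> complex" and m :: real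
  assumes "symbol 0 {q} m f" "\<And>\<xi>. norm \<xi> < 1 \<Longrightarrow> f q \<xi> = 0" "m \<le> - 2 * real DIM('v)"
  shows "integrable lborel (f q)"
proof -
  obtain C where C: "C > 0" "\<And>\<xi>. \<xi> \<in> outer \<Longrightarrow> norm (f q \<xi>) \<le> C * norm \<xi> powr m"
    by (rule symbol_0E[OF assms(1)]) (rule that, auto)
  show ?thesis
  proof (rule Bochner_Integration.integrable_bound)
    show "integrable lborel (\<lambda>\<xi>::'v. C * (if 1 \<le> norm \<xi> then norm \<xi> powr (- 2 * real DIM('v)) else 0))"
      by (intro integrable_mult_right integrable_tail_powr)
    have "continuous_on UNIV (f q)"
      using symbol_slice_continuous[OF assms(1)] assms(2) by (intro continuous_on_vanish_near_0) auto
    then show "f q \<in> borel_measurable lborel"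
      by (simp add: borel_measurable_continuous_onI)
    show "AE \<xi> in lborel. norm (f q \<xi>) \<le> norm (C * (if 1 \<le> norm \<xi> then norm \<xi> powr (- 2 * real DIM('v)) else 0))"
    proof (rule AE_I2)
      fix \<xi> :: 'v
      show "norm (f q \<xi>) \<le> norm (C * (if 1 \<le> norm \<xi> then norm \<xi> powr (- 2 * real DIM('v)) else 0))"
      proof (cases "norm \<xi> < 1")
        case False
        then have "norm (f q \<xi>) \<le> C * norm \<xi> powr m" using C(2) by auto
        also have "\<dots> \<le> C * norm \<xi> powr (- 2 * real DIM('v))"
          using False C(1) assms(3) by (intro mult_left_mono powr_mono) auto
        finally show ?thesis using False C(1) by simp
      qed (use assms(2) in auto)
    qed
  qed
qed

text \<open>The transpose of the operator \<open>- i (\<Sum>b. V b \<partial>\<^sub>b)\<close>, which reproduces \<open>exp (i \<theta>)\<close>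
if \<open>(\<Sum>b. V b \<partial>\<^sub>b \<theta>) = 1\<close>.\<close>

definition transposed_step :: "('v::euclidean_space \<Rightarrow> 'q \<Rightarrow> 'v \<Rightarrow> complex) \<Rightarrow> ('q \<Rightarrow> 'v \<Rightarrow> complex) \<Rightarrow> 'q \<Rightarrow> 'v \<Rightarrow> complex" where
  "transposed_step V g q \<xi> = \<i> * (\<Sum>b\<in>Basis. dir_deriv b (\<lambda>q \<xi>. g q \<xi> * V b q \<xi>) q \<xi>)"

lemma dir_deriv_vanish:
  assumes "\<And>\<xi>. norm \<xi> < 1 \<Longrightarrow> f q \<xi> = 0" "norm \<xi> < 1"
  shows "has_dir_deriv f v q \<xi> 0"
proof -
  have "has_dir_deriv (\<lambda>q \<xi>. 0) v q \<xi> 0" by (simp add: has_dir_deriv_def)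
  then show ?thesis
    using has_dir_deriv_cong[of "ball 0 1" \<xi> f q "\<lambda>q \<xi>. 0" v 0] assms by auto
qed

lemma transposed_step_vanish:
  assumes "\<And>\<xi>. norm \<xi> < 1 \<Longrightarrow> g q \<xi> = 0" "norm \<xi> < 1"
  shows "transposed_step V g q \<xi> = 0"
proof -
  have "dir_deriv b (\<lambda>q \<xi>. g q \<xi> * V b q \<xi>) q \<xi> = 0" for b
    by (rule dir_deriv_eqI[OF dir_deriv_vanish]) (use assms in auto)
  then show ?thesis by (simp add: transposed_step_def)
qed

lemma symbol_transposed_step:
  assumes "\<And>b. b \<in> Basis \<Longrightarrow> symbol (Suc k) P 0 (V b)" "symbol (Suc k) P m g"
  shows "symbol k P (m - 1) (transposed_step V g)"
proof -
  have "symbol k P (m - 1) (dir_deriv b (\<lambda>q \<xi>. g q \<xi> * V b q \<xi>))" if "b \<in> Basis" for b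
    using symbol_deriv[OF symbol_mult[OF assms(2) assms(1)[OF that]], of b] by simp
  then have "symbol k P (m - 1) (\<lambda>q \<xi>. \<i> * (\<Sum>b\<in>Basis. dir_deriv b (\<lambda>q \<xi>. g q \<xi> * V b q \<xi>) q \<xi>))"
    by (intro symbol_cmult symbol_sum) auto
  then show ?thesis by (simp add: transposed_step_def[abs_def])
qed

text \<open>The divergence of \<open>exp (i \<theta>) g V\<close> is \<open>exp (i \<theta>) div (g V) + i exp (i \<theta>) g\<close>, since the derivative of \<open>\<theta>\<close> along \<open>V\<close> is
1; it integrates to zero.\<close>

lemma integration_by_parts_step:
  fixes \<theta> :: "'q::topological_space \<Rightarrow> 'v::euclidean_space \<Rightarrow> real" and m :: real
  assumes T: "\<And>b \<xi>. b \<in> Basis \<Longrightarrow> \<xi> \<in> outer \<Longrightarrow> has_dir_deriv (\<lambda>q \<xi>. of_real (\<theta> q \<xi>)) b q \<xi> (T b q \<xi>)"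
    and Tsym: "\<And>b. b \<in> Basis \<Longrightarrow> symbol 0 {q} 0 (T b)"
    and \<theta>: "continuous_on outer (\<theta> q)"
    and V: "\<And>b. b \<in> Basis \<Longrightarrow> symbol (Suc 0) {q} 0 (V b)"
    and TV: "\<And>\<xi>. \<xi> \<in> outer \<Longrightarrow> (\<Sum>b\<in>Basis. T b q \<xi> * V b q \<xi>) = 1"
    and g: "symbol (Suc 0) {q} m g" "\<And>\<xi>. norm \<xi> < 1 \<Longrightarrow> g q \<xi> = 0"
    and m: "m \<le> - 2 * real DIM('v)"
  shows "(LINT \<xi>|lborel. exp (\<i> * of_real (\<theta> q \<xi>)) * g q \<xi>) =
         (LINT \<xi>|lborel. exp (\<i> * of_real (\<theta> q \<xi>)) * transposed_step V g q \<xi>)"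
proof -
  define e where "e q \<xi> = exp (\<i> * complex_of_real (\<theta> q \<xi>))" for q \<xi>
  have ec: "continuous_on outer (e q)" unfolding e_def by (intro continuous_intros \<theta>)
  have esym: "symbol 0 {q} 0 e"
  proof (rule symbol_0I[where C=1])
    show "continuous_on ({q} \<times> outer) (\<lambda>(q, \<xi>). e q \<xi>)"
    proof -
      have "continuous_on ({q} \<times> outer) (\<lambda>p. e q (snd p))"
        by (rule continuous_on_compose2[OF ec]) (auto intro!: continuous_intros)
      then show ?thesis
        by (rule continuous_on_cong[THEN iffD1, rotated 2]) auto
    qed
    show "norm (e q' \<xi>) \<le> 1 * norm \<xi> powr 0" if "\<xi> \<in> outer" for q' \<xi>
      using outer_nz[OF that] by (simp add: e_def)
  qed
  define G where "G b q \<xi> = g q \<xi> * V b q \<xi>" for b q \<xi>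
  have G: "symbol (Suc 0) {q} m (G b)" if "b \<in> Basis" for b
    using symbol_mult[OF g(1) V[OF that]] by (simp add: G_def[abs_def])
  have Gvan: "G b q \<xi> = 0" if "norm \<xi> < 1" for b \<xi> using g(2)[OF that] by (simp add: G_def)
  define F' where "F' b q \<xi> = e q \<xi> * dir_deriv b (G b) q \<xi> + (\<i> * T b q \<xi> * e q \<xi>) * G b q \<xi>" for b q \<xi>
  have F'sym: "symbol 0 {q} m (F' b)" if b: "b \<in> Basis" for b
  proof -
    have "symbol 0 {q} (m - 1) (dir_deriv b (G b))" using G[OF b] by (rule symbol_deriv)
    then have "symbol 0 {q} m (dir_deriv b (G b))" by (rule symbol_weaken) simp
    note 1 = symbol_mult[OF esym this]
    have "symbol 0 {q} (0 + 0) (\<lambda>q \<xi>. \<i> * T b q \<xi> * e q \<xi>)"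
      by (intro symbol_mult[OF symbol_cmult[OF Tsym[OF b]] esym])
    note 2 = symbol_mult[OF this symbol_lower[OF G[OF b]]]
    show ?thesis
      using symbol_add[OF 1[unfolded add_0_left] 2[unfolded add_0_left]] unfolding F'_def[abs_def] .
  qed
  have F'van: "F' b q \<xi> = 0" if "norm \<xi> < 1" for b \<xi>
    using dir_deriv_eqI[OF dir_deriv_vanish[of "G b" q \<xi> b, OF Gvan that]] Gvan[OF that] by (simp add: F'_def)
  have F'int: "integrable lborel (F' b q)" if "b \<in> Basis" for b
    by (rule symbol_integrable[OF F'sym[OF that] F'van m])
  have zero: "(LINT \<xi>|lborel. F' b q \<xi>) = 0" if b: "b \<in> Basis" for b
  proof (rule integral_dir_deriv_eq_0[where F="\<lambda>\<xi>. e q \<xi> * G b q \<xi>" and v=b])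
    have "symbol 0 {q} (0 + m) (\<lambda>q \<xi>. e q \<xi> * G b q \<xi>)"
      by (intro symbol_mult esym symbol_lower[OF G[OF b]])
    then show "integrable lborel (\<lambda>\<xi>. e q \<xi> * G b q \<xi>)"
      using symbol_integrable[of q m "\<lambda>q \<xi>. e q \<xi> * G b q \<xi>"] Gvan m by simp
    show "integrable lborel (F' b q)" by (rule F'int[OF b])
    show "continuous_on UNIV (F' b q)"
      by (rule continuous_on_vanish_near_0[OF symbol_slice_continuous[OF F'sym[OF b]] F'van]) auto
    fix \<xi> :: 'v
    show "((\<lambda>t. e q (\<xi> + t *\<^sub>R b) * G b q (\<xi> + t *\<^sub>R b)) has_vector_derivative F' b q \<xi>) (at 0)"
    proof (cases "norm \<xi> < 1")
      case True
      then show ?thesis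
        using dir_deriv_vanish[of "\<lambda>q \<xi>. e q \<xi> * G b q \<xi>" q \<xi> b] Gvan F'van[OF True]
        by (simp add: has_dir_deriv_def)
    next
      case False
      then have o: "\<xi> \<in> outer" by auto
      have "((\<lambda>t. \<i> * complex_of_real (\<theta> q (\<xi> + t *\<^sub>R b))) has_vector_derivative \<i> * T b q \<xi>) (at 0)"
        using T[OF b o] unfolding has_dir_deriv_def by (rule has_vector_derivative_mult_right)
      from field_vector_diff_chain_at[OF this, of exp "e q \<xi>"]
      have 1: "has_dir_deriv e b q \<xi> (\<i> * T b q \<xi> * e q \<xi>)"
        by (simp add: has_dir_deriv_def o_def e_def DERIV_exp)
      have 2: "has_dir_deriv (G b) b q \<xi> (dir_deriv b (G b) q \<xi>)"
        using symbol_has_deriv[OF G[OF b] _ o] by simp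
      show ?thesis
        using has_dir_deriv_mult[OF 1 2] by (simp add: has_dir_deriv_def F'_def)
    qed
  qed
  have "e q \<xi> * g q \<xi> - e q \<xi> * transposed_step V g q \<xi> = - \<i> * (\<Sum>b\<in>Basis. F' b q \<xi>)" for \<xi>
  proof (cases "norm \<xi> < 1")
    case True
    then show ?thesis using g(2) F'van transposed_step_vanish[of g q \<xi> V] by simp
  next
    case False
    then have o: "\<xi> \<in> outer" by auto
    have "(\<Sum>b\<in>Basis. F' b q \<xi>) = e q \<xi> * (\<Sum>b\<in>Basis. dir_deriv b (G b) q \<xi>)
        + \<i> * e q \<xi> * g q \<xi> * (\<Sum>b\<in>Basis. T b q \<xi> * V b q \<xi>)"
      by (simp add: F'_def G_def sum.distrib sum_distrib_left mult_ac)
    then show ?thesis unfolding TV[OF o] transposed_step_def G_def[abs_def] by (simp add: algebra_simps)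
  qed
  note eq = this
  have i1: "integrable lborel (\<lambda>\<xi>. e q \<xi> * g q \<xi>)"
    using symbol_integrable[of q "0 + m" "\<lambda>q \<xi>. e q \<xi> * g q \<xi>"] symbol_mult[OF esym symbol_lower[OF g(1)]] g(2) m by simp
  have eq': "e q \<xi> * transposed_step V g q \<xi> = e q \<xi> * g q \<xi> - (- \<i> * (\<Sum>b\<in>Basis. F' b q \<xi>))" for \<xi>
    unfolding eq [symmetric] by simp
  have i2: "integrable lborel (\<lambda>\<xi>. - \<i> * (\<Sum>b\<in>Basis. F' b q \<xi>))"
    using F'int by (intro integrable_mult_right Bochner_Integration.integrable_sum) auto
  have "(LINT \<xi>|lborel. e q \<xi> * transposed_step V g q \<xi>)
      = (LINT \<xi>|lborel. e q \<xi> * g q \<xi>) - (LINT \<xi>|lborel. - \<i> * (\<Sum>b\<in>Basis. F' b q \<xi>))"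
    unfolding eq' using i1 i2 by (rule Bochner_Integration.integral_diff)
  also have "(LINT \<xi>|lborel. - \<i> * (\<Sum>b\<in>Basis. F' b q \<xi>)) = - \<i> * (\<Sum>b\<in>Basis. LINT \<xi>|lborel. F' b q \<xi>)"
    using F'int by simp
  also have "\<dots> = 0" using zero by simp
  finally show ?thesis by (simp add: e_def)
qed

text \<open>Only derivatives in \<open>\<xi>\<close> are taken, so the result at a parameter depends on the data at that
parameter alone. This identifies the integrals at \<open>\<epsilon> = 0\<close> with integrals without a regularisation.\<close>

lemma iterated_step_local:
  assumes "g' p = g q" "\<And>b. V' b p = V b q"
  shows "(transposed_step V' ^^ k) g' p = (transposed_step V ^^ k) g q"
  using assms(1)
proof (induction k arbitrary: g g')
  case (Suc k)
  have "transposed_step V' g' p = transposed_step V g q"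
    unfolding transposed_step_def dir_deriv_def Suc.prems assms(2) by simp
  from Suc.IH[where g="transposed_step V g" and g'="transposed_step V' g'", OF this]
  show ?case by (simp only: funpow_Suc_right o_def)
qed simp

lemma iterated_step_vanish:
  "(\<And>\<xi>. norm \<xi> < 1 \<Longrightarrow> g q \<xi> = 0) \<Longrightarrow> norm \<xi> < 1 \<Longrightarrow> (transposed_step V ^^ k) g q \<xi> = 0"
proof (induction k arbitrary: g \<xi>)
  case (Suc k)
  have "(transposed_step V ^^ k) (transposed_step V g) q \<xi> = 0"
    by (rule Suc.IH[OF transposed_step_vanish]) (use Suc.prems in auto)
  then show ?case by (simp only: funpow_Suc_right o_def)
qed simp

text \<open>Every step lowers the order by one, at the price of one controlled derivative.\<close>

lemma symbol_iterated_step: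
  assumes "\<And>b k. b \<in> Basis \<Longrightarrow> symbol k P 0 (V b)"
  shows "symbol k P m g \<Longrightarrow> symbol 0 P (m - real k) ((transposed_step V ^^ k) g)"
proof (induction k arbitrary: m g)
  case (Suc k)
  have "symbol 0 P (m - 1 - real k) ((transposed_step V ^^ k) (transposed_step V g))"
    by (intro Suc.IH symbol_transposed_step assms Suc.prems)
  then show ?case by (simp only: funpow_Suc_right o_def) (simp add: algebra_simps)
qed simp

lemma iterated_integration_by_parts:
  fixes \<theta> :: "'q::topological_space \<Rightarrow> 'v::euclidean_space \<Rightarrow> real" and m :: real
  assumes T: "\<And>b \<xi>. b \<in> Basis \<Longrightarrow> \<xi> \<in> outer \<Longrightarrow> has_dir_deriv (\<lambda>q \<xi>. of_real (\<theta> q \<xi>)) b q \<xi> (T b q \<xi>)"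
    and Tsym: "\<And>b. b \<in> Basis \<Longrightarrow> symbol 0 {q} 0 (T b)"
    and \<theta>: "continuous_on outer (\<theta> q)"
    and V: "\<And>b k. b \<in> Basis \<Longrightarrow> symbol k {q} 0 (V b)"
    and TV: "\<And>\<xi>. \<xi> \<in> outer \<Longrightarrow> (\<Sum>b\<in>Basis. T b q \<xi> * V b q \<xi>) = 1"
  shows "symbol k {q} m g \<Longrightarrow> (\<And>\<xi>. norm \<xi> < 1 \<Longrightarrow> g q \<xi> = 0) \<Longrightarrow> m \<le> - 2 * real DIM('v) \<Longrightarrow>
         (LINT \<xi>|lborel. exp (\<i> * of_real (\<theta> q \<xi>)) * g q \<xi>) =
         (LINT \<xi>|lborel. exp (\<i> * of_real (\<theta> q \<xi>)) * (transposed_step V ^^ k) g q \<xi>)"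
proof (induction k arbitrary: m g)
  case (Suc k)
  have s1: "symbol (Suc 0) {q} m g"
    using Suc.prems(1) by (induction k) (auto dest: symbol_lower)
  have "(LINT \<xi>|lborel. exp (\<i> * of_real (\<theta> q \<xi>)) * g q \<xi>) =
        (LINT \<xi>|lborel. exp (\<i> * of_real (\<theta> q \<xi>)) * transposed_step V g q \<xi>)"
    by (rule integration_by_parts_step[OF T Tsym \<theta> V TV s1 Suc.prems(2,3)])
  also have "\<dots> = (LINT \<xi>|lborel. exp (\<i> * of_real (\<theta> q \<xi>)) * (transposed_step V ^^ k) (transposed_step V g) q \<xi>)"
  proof (rule Suc.IH)
    show "symbol k {q} (m - 1) (transposed_step V g)"
      by (intro symbol_transposed_step V Suc.prems)
    show "transposed_step V g q \<xi> = 0" if "norm \<xi> < 1" for \<xi>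
      using Suc.prems(2) that by (rule transposed_step_vanish)
  qed (use Suc.prems(3) in simp)
  finally show ?case by (simp only: funpow_Suc_right o_def)
qed simp

section \<open>Integrals of symbols outside the unit ball\<close>

lemma exterior_bound:
  fixes \<xi> :: "'v::euclidean_space" and m :: real
  assumes "norm z \<le> C * norm \<xi> powr m" "1 \<le> norm \<xi>" "m \<le> - 2 * real DIM('v)" "C > 0"
  shows "norm z \<le> C * norm \<xi> powr (- 2 * real DIM('v))"
proof -
  have "C * norm \<xi> powr m \<le> C * norm \<xi> powr (- 2 * real DIM('v))"
    using assms by (intro mult_left_mono powr_mono) auto
  then show ?thesis using assms(1) by linarith
qed

lemma exterior_measurable:
  fixes f :: "'q::topological_space \<Rightarrow> 'v::euclidean_space \<Rightarrow> complex"
  assumes "symbol 0 P m f" "p \<in> P"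
  shows "(\<lambda>\<xi>. if 1 \<le> norm \<xi> then f p \<xi> else 0) \<in> borel_measurable borel"
proof -
  have "(\<lambda>\<xi>. indicator {\<xi>. 1 \<le> norm \<xi>} \<xi> *\<^sub>R f p \<xi>) \<in> borel_measurable borel"
  proof (rule borel_measurable_continuous_on_indicator)
    show "{\<xi>::'v. 1 \<le> norm \<xi>} \<in> sets borel" by measurable
    show "continuous_on {\<xi>. 1 \<le> norm \<xi>} (f p)"
      by (rule continuous_on_subset[OF symbol_slice_continuous[OF assms]]) auto
  qed
  then show ?thesis by (rule measurable_cong[THEN iffD1, rotated]) auto
qed

lemma exterior_integrable:
  fixes f :: "'q::topological_space \<Rightarrow> 'v::euclidean_space \<Rightarrow> complex" and m :: real
  assumes "symbol 0 P m f" "p \<in> P" "m \<le> - 2 * real DIM('v)"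
  shows "integrable lborel (\<lambda>\<xi>. if 1 \<le> norm \<xi> then f p \<xi> else 0)"
proof -
  obtain C where C: "C > 0" "\<And>q \<xi>. q \<in> P \<Longrightarrow> \<xi> \<in> outer \<Longrightarrow> norm (f q \<xi>) \<le> C * norm \<xi> powr m"
    by (rule symbol_0E[OF assms(1)]) (rule that, auto)
  show ?thesis
  proof (rule Bochner_Integration.integrable_bound)
    show "integrable lborel (\<lambda>\<xi>::'v. C * (if 1 \<le> norm \<xi> then norm \<xi> powr (- 2 * real DIM('v)) else 0))"
      by (intro integrable_mult_right integrable_tail_powr)
    show "AE \<xi> in lborel. norm (if 1 \<le> norm \<xi> then f p \<xi> else 0) \<le> norm (C * (if 1 \<le> norm \<xi> then norm \<xi> powr (- 2 * real DIM('v)) else 0))"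
      using C exterior_bound[OF C(2)[OF assms(2)] _ assms(3) C(1)] by (intro AE_I2) auto
  qed (use exterior_measurable[OF assms(1,2)] in simp)
qed

lemma exterior_integral_continuous:
  fixes f :: "'q::{first_countable_topology,t2_space} \<Rightarrow> 'v::euclidean_space \<Rightarrow> complex" and m :: real
  assumes "symbol 0 P m f" "m \<le> - 2 * real DIM('v)"
  shows "continuous_on P (\<lambda>p. LINT \<xi>|lborel. (if 1 \<le> norm \<xi> then f p \<xi> else 0))"
proof -
  obtain C where C: "C > 0" "\<And>q \<xi>. q \<in> P \<Longrightarrow> \<xi> \<in> outer \<Longrightarrow> norm (f q \<xi>) \<le> C * norm \<xi> powr m"
    and cont: "continuous_on (P \<times> outer) (\<lambda>(q, \<xi>). f q \<xi>)"
    by (rule symbol_0E[OF assms(1)]) (rule that)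
  show ?thesis
  proof (rule continuous_on_integral_dominated)
    show "integrable lborel (\<lambda>\<xi>::'v. C * (if 1 \<le> norm \<xi> then norm \<xi> powr (- 2 * real DIM('v)) else 0))"
      by (intro integrable_mult_right integrable_tail_powr)
    show "(\<lambda>\<xi>. if 1 \<le> norm \<xi> then f p \<xi> else 0) \<in> borel_measurable lborel" if "p \<in> P" for p
      using exterior_measurable[OF assms(1) that] by simp
    show "norm (if 1 \<le> norm \<xi> then f p \<xi> else 0) \<le> C * (if 1 \<le> norm \<xi> then norm \<xi> powr (- 2 * real DIM('v)) else 0)"
      if "p \<in> P" for p \<xi>
      using C exterior_bound[OF C(2)[OF that] _ assms(2) C(1)] by auto
    show "continuous_on P (\<lambda>p. if 1 \<le> norm \<xi> then f p \<xi> else 0)" for \<xi>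
    proof (cases "1 \<le> norm \<xi>")
      case True
      have "continuous_on P (\<lambda>p. (\<lambda>(q, \<xi>). f q \<xi>) (p, \<xi>))"
        by (rule continuous_on_compose2[OF cont]) (use True in \<open>auto intro!: continuous_intros\<close>)
      then show ?thesis using True by simp
    qed simp
  qed
qed

section \<open>Phase functions without critical points\<close>

text \<open>Phases whose gradient in \<open>\<xi>\<close> has no zeros, over a compact set of parameters: the setting in which integration
by parts is possible everywhere.\<close>

locale nonstationary_phase =
  fixes Q :: "'q::{first_countable_topology,t2_space} set" and \<theta> :: "'q \<Rightarrow> 'v::euclidean_space \<Rightarrow> real"
  assumes compact_Q: "compact Q"
    and phase_smooth: "\<And>k. smooth_in k Q (\<lambda>q \<xi>. of_real (\<theta> q \<xi>))"
    and phase_homogeneous: "\<And>q r \<xi>. q \<in> Q \<Longrightarrow> r > 0 \<Longrightarrow> \<xi> \<noteq> 0 \<Longrightarrow> \<theta> q (r *\<^sub>R \<xi>) = r * \<theta> q \<xi>"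
    and nonstationary: "\<And>q \<xi>. q \<in> Q \<Longrightarrow> \<xi> \<noteq> 0 \<Longrightarrow> \<exists>b\<in>Basis. dir_deriv b (\<lambda>q \<xi>. complex_of_real (\<theta> q \<xi>)) q \<xi> \<noteq> 0"
begin

definition grad :: "'v \<Rightarrow> 'q \<Rightarrow> 'v \<Rightarrow> complex" where
  "grad b = dir_deriv b (\<lambda>q \<xi>. of_real (\<theta> q \<xi>))"

definition grad_sq :: "'q \<Rightarrow> 'v \<Rightarrow> complex" where
  "grad_sq q \<xi> = (\<Sum>b\<in>Basis. grad b q \<xi> * grad b q \<xi>)"

definition field :: "'v \<Rightarrow> 'q \<Rightarrow> 'v \<Rightarrow> complex" where
  "field b q \<xi> = grad b q \<xi> * inverse (grad_sq q \<xi>)"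

lemma has_dir_deriv_phase:
  "q \<in> Q \<Longrightarrow> \<xi> \<noteq> 0 \<Longrightarrow> has_dir_deriv (\<lambda>q \<xi>. of_real (\<theta> q \<xi>)) b q \<xi> (grad b q \<xi>)"
  unfolding grad_def using smooth_in_has_deriv[OF phase_smooth] .

lemma symbol_phase: "symbol k Q 1 (\<lambda>q \<xi>. of_real (\<theta> q \<xi>))"
  by (rule homogeneous_symbol[OF compact_Q phase_smooth]) (simp add: phase_homogeneous)

lemma symbol_grad: "symbol k Q 0 (grad b)"
  unfolding grad_def using symbol_deriv[OF symbol_phase, of k b] by simp

lemma symbol_grad_sq: "symbol k Q 0 grad_sq"
  unfolding grad_sq_def[abs_def] using symbol_mult[OF symbol_grad symbol_grad, of k]
  by (intro symbol_sum) auto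

lemma grad_homogeneous:
  assumes "q \<in> Q" "r > 0" "\<xi> \<noteq> 0"
  shows "grad b q (r *\<^sub>R \<xi>) = grad b q \<xi>"
  unfolding grad_def using homogeneous_dir_deriv[OF phase_smooth, of 1 q r \<xi> b] assms
  by (simp add: phase_homogeneous)

text \<open>The gradient is complex-valued here only in order to be a symbol; its components are real, so
the sum of their squares vanishes only if they all do.\<close>

lemma grad_sq_nonzero:
  assumes "q \<in> Q" "\<xi> \<noteq> 0"
  shows "grad_sq q \<xi> \<noteq> 0"
proof -
  have r: "grad b q \<xi> = of_real (Re (grad b q \<xi>))" for b
    using has_dir_deriv_phase[OF assms] by (rule has_dir_deriv_real)
  have "Re (grad_sq q \<xi>) = (\<Sum>b\<in>Basis. (Re (grad b q \<xi>))\<^sup>2)"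
    unfolding grad_sq_def Re_sum by (subst (1 2) r) (simp add: power2_eq_square)
  moreover obtain b where "b \<in> Basis" "grad b q \<xi> \<noteq> 0"
    using nonstationary[OF assms] unfolding grad_def by blast
  moreover have "Re (grad b q \<xi>) \<noteq> 0" using r[of b] \<open>grad b q \<xi> \<noteq> 0\<close> by auto
  ultimately have "Re (grad_sq q \<xi>) > 0"
    by (auto intro!: sum_pos2[of _ b])
  then show ?thesis by auto
qed

text \<open>Homogeneity of degree 0 reduces the bound to the compact set \<open>Q \<times> sphere 0 1\<close>.\<close>

lemma grad_sq_bounded_below:
  obtains c where "c > 0" "\<And>q \<xi>. q \<in> Q \<Longrightarrow> \<xi> \<in> outer \<Longrightarrow> norm (grad_sq q \<xi>) \<ge> c"
proof (cases "Q = {}")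
  case True
  then show ?thesis using that[of 1] by simp
next
  case False
  have "continuous_on (Q \<times> outer) (\<lambda>(q, \<xi>). grad_sq q \<xi>)"
    using symbol_grad_sq[of 0] by (simp add: symbol_0_iff)
  then have "continuous_on (Q \<times> outer) (\<lambda>p. norm (grad_sq (fst p) (snd p)))"
    unfolding case_prod_unfold by (rule continuous_on_norm)
  then have "continuous_on (Q \<times> sphere 0 1) (\<lambda>p. norm (grad_sq (fst p) (snd p)))"
    by (rule continuous_on_subset) auto
  moreover have "compact (Q \<times> sphere (0::'v) 1)" "Q \<times> sphere (0::'v) 1 \<noteq> {}"
    using False compact_Q by (auto intro: compact_Times)
  ultimately have "\<exists>p\<in>Q \<times> sphere 0 1. \<forall>y\<in>Q \<times> sphere 0 1. norm (grad_sq (fst p) (snd p)) \<le> norm (grad_sq (fst y) (snd y))"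
    by (intro continuous_attains_inf)
  then obtain p where p: "p \<in> Q \<times> sphere 0 1"
    "\<And>y. y \<in> Q \<times> sphere 0 1 \<Longrightarrow> norm (grad_sq (fst p) (snd p)) \<le> norm (grad_sq (fst y) (snd y))"
    by blast
  show ?thesis
  proof (rule that)
    show "norm (grad_sq (fst p) (snd p)) > 0"
    proof -
      have "fst p \<in> Q" "norm (snd p) = 1" using p(1) by auto
      then have "grad_sq (fst p) (snd p) \<noteq> 0" by (intro grad_sq_nonzero) auto
      then show ?thesis by simp
    qed
    fix q and \<xi> :: 'v assume *: "q \<in> Q" "\<xi> \<in> outer"
    have nz: "\<xi> \<noteq> 0" using outer_nz[OF *(2)] .
    have "grad_sq q \<xi> = grad_sq q (\<xi> /\<^sub>R norm \<xi>)"
      unfolding grad_sq_def using grad_homogeneous[OF *(1), of "inverse (norm \<xi>)" \<xi>] nz by simp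
    then show "norm (grad_sq (fst p) (snd p)) \<le> norm (grad_sq q \<xi>)"
      using p(2)[of "(q, \<xi> /\<^sub>R norm \<xi>)"] * nz by simp
  qed
qed

lemma symbol_field: "symbol k Q 0 (field b)"
proof -
  obtain c where c: "c > 0" "\<And>q \<xi>. q \<in> Q \<Longrightarrow> \<xi> \<in> outer \<Longrightarrow> norm (grad_sq q \<xi>) \<ge> c"
    by (rule grad_sq_bounded_below) (rule that)
  show ?thesis
    unfolding field_def[abs_def]
    using symbol_mult[OF symbol_grad symbol_inverse[OF symbol_grad_sq c]] by simp
qed

lemma grad_field: "q \<in> Q \<Longrightarrow> \<xi> \<noteq> 0 \<Longrightarrow> (\<Sum>b\<in>Basis. grad b q \<xi> * field b q \<xi>) = 1"
  using grad_sq_nonzero[of q \<xi>]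
  by (simp add: field_def sum_distrib_right[symmetric] grad_sq_def[symmetric] flip: mult.assoc)

lemma symbol_exp_phase: "symbol 0 Q 0 (\<lambda>q \<xi>. exp (\<i> * of_real (\<theta> q \<xi>)))"
proof (rule symbol_0I[where C=1])
  have "continuous_on (Q \<times> outer) (\<lambda>(q, \<xi>). complex_of_real (\<theta> q \<xi>))"
    using symbol_phase[of 0] by (simp add: symbol_0_iff)
  then show "continuous_on (Q \<times> outer) (\<lambda>(q, \<xi>). exp (\<i> * of_real (\<theta> q \<xi>)))"
    unfolding case_prod_unfold by (intro continuous_on_exp continuous_on_mult continuous_on_const)
  show "norm (exp (\<i> * complex_of_real (\<theta> q \<xi>))) \<le> 1 * norm \<xi> powr 0" if "\<xi> \<in> outer" for q \<xi>
    using outer_nz[OF that] by simp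
qed

lemma phase_slice_continuous:
  assumes "q \<in> Q"
  shows "continuous_on outer (\<theta> q)"
  using continuous_on_Re[OF symbol_slice_continuous[OF symbol_phase assms]] by simp

end

section \<open>Regularised oscillatory integrals\<close>

definition osc_reg :: "(real^'n \<Rightarrow> complex) \<Rightarrow> ('q \<Rightarrow> real^'n \<Rightarrow> real) \<Rightarrow> ('q \<Rightarrow> real^'n \<Rightarrow> complex) \<Rightarrow> real \<Rightarrow> 'q \<Rightarrow> complex" where
  "osc_reg \<kappa> \<theta> a \<epsilon> q = (LINT \<xi>|lborel. \<kappa> (\<epsilon> *\<^sub>R \<xi>) * exp (\<i> * of_real (\<theta> q \<xi>)) * a q \<xi>)"

text \<open>The function \<open>k\<close> is the continuation to \<open>\<epsilon> = 0\<close> of the regularised integrals. Joint continuity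
up to \<open>\<epsilon> = 0\<close> is a convenient form of continuity together with uniform convergence on compact sets of
parameters, and it is stable under sums, uniformly convergent series and restriction.\<close>

definition osc_continuous :: "'q::topological_space set \<Rightarrow> ('q \<Rightarrow> real^'n \<Rightarrow> real) \<Rightarrow> ('q \<Rightarrow> real^'n \<Rightarrow> complex) \<Rightarrow> ('q \<Rightarrow> complex) \<Rightarrow> bool" where
  "osc_continuous Q \<theta> a k \<longleftrightarrow> (\<forall>\<kappa>. schwartz \<kappa> \<and> \<kappa> 0 = 1 \<longrightarrow>
     (\<forall>q\<in>Q. \<forall>\<epsilon>>0. integrable lborel (\<lambda>\<xi>. \<kappa> (\<epsilon> *\<^sub>R \<xi>) * exp (\<i> * of_real (\<theta> q \<xi>)) * a q \<xi>)) \<and>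
     continuous_on ({0..} \<times> Q) (\<lambda>(\<epsilon>, q). if \<epsilon> = 0 then k q else osc_reg \<kappa> \<theta> a \<epsilon> q))"

lemma real_ex_nat_ge: "\<exists>k::nat. x - real k \<le> y"
proof -
  obtain k :: nat where "x - y \<le> real k" using real_arch_simple by blast
  then show ?thesis by (intro exI[of _ k]) linarith
qed

text \<open>Uniformly in \<open>\<epsilon> \<ge> 0\<close> the order is unchanged; for fixed \<open>\<epsilon> > 0\<close> it is arbitrary.\<close>

lemma symbol_regularized:
  fixes \<kappa> :: "real^'n \<Rightarrow> complex" and u :: "'q::topological_space \<Rightarrow> real^'n \<Rightarrow> complex"
  assumes "schwartz \<kappa>" "symbol k Q m u"
  shows "symbol k ({0..} \<times> Q) m (\<lambda>p \<xi>. \<kappa> (fst p *\<^sub>R \<xi>) * u (snd p) \<xi>)"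
    and "\<And>\<epsilon>. \<epsilon> > 0 \<Longrightarrow> symbol k ({\<epsilon>} \<times> Q) \<mu> (\<lambda>p \<xi>. \<kappa> (fst p *\<^sub>R \<xi>) * u (snd p) \<xi>)"
proof -
  have "symbol k ({0..} \<times> Q) (- real 0) (\<lambda>p \<xi>. of_real (fst p) ^ 0 * \<kappa> (fst p *\<^sub>R \<xi>))"
    by (rule symbol_scaled_schwartz[where c=1]) (use assms in auto)
  moreover have u: "symbol k (E \<times> Q) m (\<lambda>p. u (snd p))" for E :: "real set"
    by (rule symbol_reparam[OF assms(2)]) (auto intro!: continuous_intros)
  ultimately show "symbol k ({0..} \<times> Q) m (\<lambda>p \<xi>. \<kappa> (fst p *\<^sub>R \<xi>) * u (snd p) \<xi>)"
    using symbol_mult[of k "{0..} \<times> Q" 0 "\<lambda>p \<xi>. \<kappa> (fst p *\<^sub>R \<xi>)" m "\<lambda>p. u (snd p)"] by simp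
  fix \<epsilon> :: real assume e: "\<epsilon> > 0"
  obtain M :: nat where M: "m - real M \<le> \<mu>" using real_ex_nat_ge by blast
  have "symbol k ({\<epsilon>} \<times> Q) (- real M) (\<lambda>p \<xi>. of_real (fst p) ^ 0 * \<kappa> (fst p *\<^sub>R \<xi>))"
    by (rule symbol_scaled_schwartz[where c="1 / \<epsilon> ^ M"]) (use assms e in auto)
  then have "symbol k ({\<epsilon>} \<times> Q) (- real M) (\<lambda>p \<xi>. \<kappa> (fst p *\<^sub>R \<xi>))" by simp
  from symbol_mult[OF this u] show "symbol k ({\<epsilon>} \<times> Q) \<mu> (\<lambda>p \<xi>. \<kappa> (fst p *\<^sub>R \<xi>) * u (snd p) \<xi>)"
    by (rule symbol_weaken) (use M in simp)
qed

definition exterior :: "('q \<Rightarrow> 'v::real_normed_vector \<Rightarrow> complex) \<Rightarrow> 'q \<Rightarrow> 'v \<Rightarrow> complex" where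
  "exterior u q \<xi> = (if 1 \<le> norm \<xi> then u q \<xi> else 0)"

lemma symbol_one_minus_cutoff:
  assumes "M > 0"
  shows "symbol 0 Q (- M) (\<lambda>q (\<xi>::'v::euclidean_space). of_real (1 - radial_cutoff k M \<xi>))"
proof (rule symbol_0I[where C="real k + 1"])
  have "symbol 0 Q 0 (\<lambda>q (\<xi>::'v). complex_of_real (radial_cutoff k M \<xi>))"
    by (rule symbol_Suc_imp_0[OF symbol_radial_cutoff[OF assms]])
  then have "continuous_on (Q \<times> outer) (\<lambda>(q, \<xi>::'v). complex_of_real (radial_cutoff k M \<xi>))"
    by (simp add: symbol_0_iff)
  then have "continuous_on (Q \<times> outer) (\<lambda>p::_ \<times> 'v. 1 - complex_of_real (radial_cutoff k M (snd p)))"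
    unfolding case_prod_unfold by (intro continuous_on_diff continuous_on_const)
  then show "continuous_on (Q \<times> outer) (\<lambda>(q, \<xi>::'v). complex_of_real (1 - radial_cutoff k M \<xi>))"
    by (simp add: case_prod_unfold)
  fix \<xi> :: 'v assume xi: "\<xi> \<in> outer"
  show "norm (complex_of_real (1 - radial_cutoff k M \<xi>)) \<le> (real k + 1) * norm \<xi> powr (- M)"
  proof (cases "norm \<xi> < 1")
    case True
    have "1 * 1 \<le> (real k + 1) * norm \<xi> powr (- M)"
      using True outer_nz[OF xi] assms powr_mono2'[of "-M" "norm \<xi>" 1] by (intro mult_mono) auto
    then show ?thesis using True by (simp add: radial_cutoff_def)
  next
    case False
    then show ?thesis using radial_cutoff_near_1[OF assms, of \<xi> k] by (simp only: norm_of_real)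
  qed
qed

text \<open>Away from the unit sphere integration by parts lowers the order until the integral converges
absolutely, uniformly in the regularisation. Since the amplitude jumps at the unit sphere, it is first
split by a cutoff into a part that vanishes there to sufficiently high order and an integrable part.\<close>

theorem osc_continuous_symbol:
  fixes \<theta> :: "'q::{first_countable_topology,t2_space} \<Rightarrow> real^'n \<Rightarrow> real"
  assumes "nonstationary_phase Q \<theta>" and u: "\<And>k. symbol k Q m u"
  shows "\<exists>I. osc_continuous Q \<theta> (exterior u) I"
proof -
  interpret nonstationary_phase Q \<theta> by (rule assms(1))
  let ?N = "real DIM(real^'n)"
  \<comment> \<open>\<open>k\<close> integrations by parts make the cut-off part integrable, and the order \<open>- M\<close> of \<open>1 - cut\<close> does so for the rest.\<close>
  obtain k :: nat where k: "m - real k \<le> - 2 * ?N" using real_ex_nat_ge by blast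
  define M where "M = max 1 (m + 2 * ?N)"
  have M: "M > 0" "m - M \<le> - 2 * ?N" by (auto simp: M_def)
  define cut where "cut = (radial_cutoff k M :: real^'n \<Rightarrow> real)"
  define v where "v q \<xi> = of_real (cut \<xi>) * u q \<xi>" for q \<xi>
  define w where "w q \<xi> = of_real (1 - cut \<xi>) * u q \<xi>" for q \<xi>
  define e where "e q \<xi> = exp (\<i> * complex_of_real (\<theta> q \<xi>))" for q \<xi>
  have vsym: "symbol k Q m v"
    unfolding v_def[abs_def] cut_def
    using symbol_mult[OF symbol_radial_cutoff[OF M(1), of k Q] u[of k]] by simp
  have wsym: "symbol 0 Q (m - M) w"
    unfolding w_def[abs_def] cut_def
    using symbol_mult[OF symbol_one_minus_cutoff[OF M(1), of Q k] u[of 0]] by (simp add: add.commute)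
  have vvan: "v q \<xi> = 0" if "norm \<xi> < 1" for q \<xi>
    using that by (simp add: v_def cut_def radial_cutoff_def)
  have split: "exterior u q \<xi> = v q \<xi> + exterior w q \<xi>" for q \<xi>
    using vvan[of \<xi> q] by (auto simp: exterior_def v_def w_def algebra_simps)
  have esym: "symbol 0 (E \<times> Q) 0 (\<lambda>p. e (snd p))" for E :: "real set"
    unfolding e_def[abs_def]
    by (rule symbol_reparam[OF symbol_exp_phase]) (auto intro!: continuous_intros)
  define G where "G \<kappa> p \<xi> = \<kappa> (fst p *\<^sub>R \<xi>) * v (snd p) \<xi>" for \<kappa> :: "real^'n \<Rightarrow> complex" and p :: "real \<times> 'q" and \<xi>
  define H where "H \<kappa> p \<xi> = \<kappa> (fst p *\<^sub>R \<xi>) * w (snd p) \<xi>" for \<kappa> :: "real^'n \<Rightarrow> complex" and p :: "real \<times> 'q" and \<xi>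
  define V where "V b p = field b (snd p)" for b and p :: "real \<times> 'q"
  define L where "L \<kappa> = (transposed_step V ^^ k) (G \<kappa>)" for \<kappa>
  \<comment> \<open>The value must not depend on \<open>\<kappa>\<close>, so it is written down without a regularising factor.\<close>
  define I where "I q = (LINT \<xi>|lborel. e q \<xi> * (transposed_step field ^^ k) v q \<xi>) + (LINT \<xi>|lborel. e q \<xi> * exterior w q \<xi>)" for q
  have Vsym: "symbol j (E \<times> Q) 0 (V b)" for j b and E :: "real set"
    unfolding V_def[abs_def] by (rule symbol_reparam[OF symbol_field]) (auto intro!: continuous_intros)
  have main: "(\<forall>q\<in>Q. \<forall>\<epsilon>>0. integrable lborel (\<lambda>\<xi>. \<kappa> (\<epsilon> *\<^sub>R \<xi>) * exp (\<i> * of_real (\<theta> q \<xi>)) * exterior u q \<xi>)) \<and>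
     continuous_on ({0..} \<times> Q) (\<lambda>(\<epsilon>, q). if \<epsilon> = 0 then I q else osc_reg \<kappa> \<theta> (exterior u) \<epsilon> q)"
    if \<kappa>: "schwartz \<kappa>" "\<kappa> 0 = 1" for \<kappa> :: "real^'n \<Rightarrow> complex"
  proof -
    have Gvan: "G \<kappa> p \<xi> = 0" if "norm \<xi> < 1" for p \<xi> using vvan[OF that] by (simp add: G_def)
    have Lvan: "L \<kappa> p \<xi> = 0" if "norm \<xi> < 1" for p \<xi>
      unfolding L_def using Gvan that by (rule iterated_step_vanish)
    have Gsym: "symbol k ({0..} \<times> Q) m (G \<kappa>)" "\<And>\<epsilon> \<mu>. \<epsilon> > 0 \<Longrightarrow> symbol k ({\<epsilon>} \<times> Q) \<mu> (G \<kappa>)"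
      unfolding G_def[abs_def] using symbol_regularized[OF \<kappa>(1) vsym] by auto
    have Hsym: "symbol 0 ({0..} \<times> Q) (m - M) (H \<kappa>)"
      unfolding H_def[abs_def] using symbol_regularized(1)[OF \<kappa>(1) wsym] .
    have Lsym: "symbol 0 ({0..} \<times> Q) (m - real k) (L \<kappa>)"
      unfolding L_def by (rule symbol_iterated_step[OF Vsym Gsym(1)])
    have eL: "symbol 0 ({0..} \<times> Q) (m - real k) (\<lambda>p \<xi>. e (snd p) \<xi> * L \<kappa> p \<xi>)"
      using symbol_mult[OF esym Lsym] by simp
    have eH: "symbol 0 ({0..} \<times> Q) (m - M) (\<lambda>p \<xi>. e (snd p) \<xi> * H \<kappa> p \<xi>)"
      using symbol_mult[OF esym Hsym] by simp
    have c1: "continuous_on ({0..} \<times> Q) (\<lambda>p. LINT \<xi>|lborel. e (snd p) \<xi> * L \<kappa> p \<xi>)"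
    proof -
      have "(\<lambda>\<xi>. if 1 \<le> norm \<xi> then e (snd p) \<xi> * L \<kappa> p \<xi> else 0) = (\<lambda>\<xi>. e (snd p) \<xi> * L \<kappa> p \<xi>)" for p
        by (intro ext) (simp add: Lvan not_le)
      with exterior_integral_continuous[OF eL k] show ?thesis by simp
    qed
    have c2: "continuous_on ({0..} \<times> Q) (\<lambda>p. LINT \<xi>|lborel. e (snd p) \<xi> * exterior (H \<kappa>) p \<xi>)"
    proof -
      have "(\<lambda>\<xi>. if 1 \<le> norm \<xi> then e (snd p) \<xi> * H \<kappa> p \<xi> else 0) = (\<lambda>\<xi>. e (snd p) \<xi> * exterior (H \<kappa>) p \<xi>)" for p
        by (auto simp: exterior_def)
      with exterior_integral_continuous[OF eH M(2)] show ?thesis by simp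
    qed
    have int: "integrable lborel (\<lambda>\<xi>. e q \<xi> * G \<kappa> (\<epsilon>, q) \<xi>)" "integrable lborel (\<lambda>\<xi>. e q \<xi> * exterior (H \<kappa>) (\<epsilon>, q) \<xi>)"
      if "q \<in> Q" "\<epsilon> > 0" for q \<epsilon>
    proof -
      have "symbol 0 ({\<epsilon>} \<times> Q) (- 2 * ?N) (\<lambda>p \<xi>. e (snd p) \<xi> * G \<kappa> p \<xi>)"
        using symbol_mult[OF esym symbol_Suc_imp_0[OF Gsym(2)[OF that(2)]]] by simp
      from exterior_integrable[OF this, of "(\<epsilon>, q)", unfolded snd_conv] that
      have "integrable lborel (\<lambda>\<xi>. if 1 \<le> norm \<xi> then e q \<xi> * G \<kappa> (\<epsilon>, q) \<xi> else 0)" by simp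
      moreover have "(\<lambda>\<xi>. if 1 \<le> norm \<xi> then e q \<xi> * G \<kappa> (\<epsilon>, q) \<xi> else 0) = (\<lambda>\<xi>. e q \<xi> * G \<kappa> (\<epsilon>, q) \<xi>)"
        by (intro ext) (simp add: Gvan not_le)
      ultimately show "integrable lborel (\<lambda>\<xi>. e q \<xi> * G \<kappa> (\<epsilon>, q) \<xi>)" by simp
      from exterior_integrable[OF eH, of "(\<epsilon>, q)", unfolded snd_conv] that M(2)
      have "integrable lborel (\<lambda>\<xi>. if 1 \<le> norm \<xi> then e q \<xi> * H \<kappa> (\<epsilon>, q) \<xi> else 0)" by simp
      moreover have "(\<lambda>\<xi>. if 1 \<le> norm \<xi> then e q \<xi> * H \<kappa> (\<epsilon>, q) \<xi> else 0) = (\<lambda>\<xi>. e q \<xi> * exterior (H \<kappa>) (\<epsilon>, q) \<xi>)"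
        by (auto simp: exterior_def)
      ultimately show "integrable lborel (\<lambda>\<xi>. e q \<xi> * exterior (H \<kappa>) (\<epsilon>, q) \<xi>)" by simp
    qed
    have sum: "\<kappa> (\<epsilon> *\<^sub>R \<xi>) * exp (\<i> * of_real (\<theta> q \<xi>)) * exterior u q \<xi>
        = e q \<xi> * G \<kappa> (\<epsilon>, q) \<xi> + e q \<xi> * exterior (H \<kappa>) (\<epsilon>, q) \<xi>" for \<epsilon> q \<xi>
      by (subst split) (simp add: G_def H_def e_def exterior_def algebra_simps)
    \<comment> \<open>For fixed \<open>\<epsilon> > 0\<close> the amplitude has order \<open>-2 N\<close>, so every single integration by parts is between integrable functions.\<close>
    have ibp: "(LINT \<xi>|lborel. e q \<xi> * G \<kappa> (\<epsilon>, q) \<xi>) = (LINT \<xi>|lborel. e q \<xi> * L \<kappa> (\<epsilon>, q) \<xi>)"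
      if q: "q \<in> Q" and eps: "\<epsilon> > 0" for q \<epsilon>
    proof -
      have "(LINT \<xi>|lborel. exp (\<i> * of_real (\<theta> (snd (\<epsilon>, q)) \<xi>)) * G \<kappa> (\<epsilon>, q) \<xi>) =
         (LINT \<xi>|lborel. exp (\<i> * of_real (\<theta> (snd (\<epsilon>, q)) \<xi>)) * (transposed_step V ^^ k) (G \<kappa>) (\<epsilon>, q) \<xi>)"
      proof (rule iterated_integration_by_parts[where T="\<lambda>b p. grad b (snd p)" and \<theta>="\<lambda>p. \<theta> (snd p)"])
        fix b \<xi> :: "real^'n" assume "\<xi> \<in> outer"
        then show "has_dir_deriv (\<lambda>p \<xi>. of_real (\<theta> (snd p) \<xi>)) b (\<epsilon>, q) \<xi> (grad b (snd (\<epsilon>, q)) \<xi>)"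
          using has_dir_deriv_phase[OF q outer_nz, of \<xi> b] by (simp add: has_dir_deriv_def)
      next
        show "symbol 0 {(\<epsilon>, q)} 0 (\<lambda>p. grad b (snd p))" for b
          by (rule symbol_reparam[OF symbol_grad]) (use q in \<open>auto intro!: continuous_intros\<close>)
        show "continuous_on outer (\<theta> (snd (\<epsilon>, q)))" using phase_slice_continuous[OF q] by simp
        show "symbol j {(\<epsilon>, q)} 0 (V b)" for j b
          by (rule symbol_subset[OF Vsym[of j "{\<epsilon>}" b]]) (use q in auto)
        show "(\<Sum>b\<in>Basis. grad b (snd (\<epsilon>, q)) \<xi> * V b (\<epsilon>, q) \<xi>) = 1" if "\<xi> \<in> outer" for \<xi>
          using grad_field[OF q outer_nz[OF that]] by (simp add: V_def)
        show "symbol k {(\<epsilon>, q)} (- 2 * ?N) (G \<kappa>)"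
          by (rule symbol_subset[OF Gsym(2)[OF eps]]) (use q in auto)
        show "G \<kappa> (\<epsilon>, q) \<xi> = 0" if "norm \<xi> < 1" for \<xi> by (rule Gvan[OF that])
      qed simp
      then show ?thesis by (simp add: e_def L_def)
    qed
    have val: "osc_reg \<kappa> \<theta> (exterior u) \<epsilon> q = (LINT \<xi>|lborel. e q \<xi> * L \<kappa> (\<epsilon>, q) \<xi>) + (LINT \<xi>|lborel. e q \<xi> * exterior (H \<kappa>) (\<epsilon>, q) \<xi>)"
      if "q \<in> Q" "\<epsilon> > 0" for q \<epsilon>
      unfolding osc_reg_def sum ibp[OF that, symmetric] using int[OF that] by (rule Bochner_Integration.integral_add)
    \<comment> \<open>At \<open>\<epsilon> = 0\<close> the factor \<open>\<kappa> 0 = 1\<close> disappears.\<close>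
    have val0: "I q = (LINT \<xi>|lborel. e q \<xi> * L \<kappa> (0, q) \<xi>) + (LINT \<xi>|lborel. e q \<xi> * exterior (H \<kappa>) (0, q) \<xi>)" for q
    proof -
      have "L \<kappa> (0, q) = (transposed_step field ^^ k) v q"
        unfolding L_def by (rule iterated_step_local) (auto simp: G_def V_def \<kappa>(2))
      moreover have "exterior (H \<kappa>) (0, q) = exterior w q" by (auto simp: exterior_def H_def \<kappa>(2))
      ultimately show ?thesis by (simp add: I_def)
    qed
    have "continuous_on ({0..} \<times> Q) (\<lambda>p. (LINT \<xi>|lborel. e (snd p) \<xi> * L \<kappa> p \<xi>) + (LINT \<xi>|lborel. e (snd p) \<xi> * exterior (H \<kappa>) p \<xi>))"
      using c1 c2 by (rule continuous_on_add)
    moreover have "continuous_on ({0..} \<times> Q) (\<lambda>p. (LINT \<xi>|lborel. e (snd p) \<xi> * L \<kappa> p \<xi>) + (LINT \<xi>|lborel. e (snd p) \<xi> * exterior (H \<kappa>) p \<xi>))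
      \<longleftrightarrow> continuous_on ({0..} \<times> Q) (\<lambda>(\<epsilon>, q). if \<epsilon> = 0 then I q else osc_reg \<kappa> \<theta> (exterior u) \<epsilon> q)"
      by (rule continuous_on_cong) (auto simp: val val0)
    moreover have "integrable lborel (\<lambda>\<xi>. \<kappa> (\<epsilon> *\<^sub>R \<xi>) * exp (\<i> * of_real (\<theta> q \<xi>)) * exterior u q \<xi>)"
      if "q \<in> Q" "\<epsilon> > 0" for q \<epsilon>
      unfolding sum using int[OF that] by (rule Bochner_Integration.integrable_add)
    ultimately show ?thesis by blast
  qed
  then show ?thesis unfolding osc_continuous_def by (intro exI[of _ I]) blast
qed

section \<open>Limits of regularised integrals and holomorphic dependence\<close>

text \<open>Cauchy's estimate turns the local bound \<open>h\<close> on the integrand into a bound on its difference quotients, so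
dominated convergence permits differentiation under the integral.\<close>

lemma holomorphic_on_integral:
  fixes f :: "complex \<Rightarrow> 'b \<Rightarrow> complex"
  assumes S: "open S" and hol: "\<And>x. x \<in> space M \<Longrightarrow> (\<lambda>z. f z x) holomorphic_on S"
    and meas: "\<And>z. z \<in> S \<Longrightarrow> f z \<in> borel_measurable M"
    and dom: "\<And>z. z \<in> S \<Longrightarrow> \<exists>r>0. \<exists>h. cball z r \<subseteq> S \<and> integrable M h \<and>
                 (\<forall>w\<in>cball z r. \<forall>x\<in>space M. norm (f w x) \<le> h x)"
  shows "(\<lambda>z. integral\<^sup>L M (f z)) holomorphic_on S"
proof -
  have "\<exists>D. ((\<lambda>z. integral\<^sup>L M (f z)) has_field_derivative D) (at z)" if z: "z \<in> S" for z
  proof -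
    obtain r h where r: "r > 0" "cball z r \<subseteq> S" "integrable M h"
      and h: "\<And>w x. w \<in> cball z r \<Longrightarrow> x \<in> space M \<Longrightarrow> norm (f w x) \<le> h x"
      using dom[OF z] by blast
    define g where "g x = deriv (\<lambda>z. f z x) z" for x
    have int: "integrable M (f w)" if "w \<in> cball z r" for w
    proof (rule Bochner_Integration.integrable_bound[OF r(3)])
      show "f w \<in> borel_measurable M" using meas that r by auto
      show "AE x in M. norm (f w x) \<le> norm (h x)"
        using h[OF that] by (intro AE_I2) (metis abs_ge_self order_trans real_norm_def)
    qed
    have lip: "norm (f w x - f z x) \<le> (2 * h x / r) * norm (w - z)" if w: "w \<in> ball z (r/2)" and x: "x \<in> space M" for w x
    proof (rule field_differentiable_bound[of "ball z (r/2)" "\<lambda>z. f z x" "deriv (\<lambda>z. f z x)"])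
      fix y assume y: "y \<in> ball z (r/2)"
      have sub: "cball y (r/2) \<subseteq> cball z r"
      proof
        fix y' assume "y' \<in> cball y (r/2)"
        then show "y' \<in> cball z r" using y dist_triangle[of z y' y] by simp
      qed
      have subS: "cball y (r/2) \<subseteq> S" using sub r(2) by (rule order_trans)
      then have "y \<in> S" using r(1) by (simp add: subset_iff)
      then show "((\<lambda>z. f z x) has_field_derivative deriv (\<lambda>z. f z x) y) (at y within ball z (r/2))"
        using holomorphic_derivI[OF hol[OF x] S] by (blast intro: has_field_derivative_at_within)
      have "norm ((deriv ^^ 1) (\<lambda>z. f z x) y) \<le> fact 1 * h x / (r/2) ^ 1"
      proof (rule Cauchy_inequality)
        show "(\<lambda>z. f z x) holomorphic_on ball y (r/2)"
          by (rule holomorphic_on_subset[OF hol[OF x] order_trans[OF ball_subset_cball subS]])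
        show "continuous_on (cball y (r/2)) (\<lambda>z. f z x)"
          by (rule continuous_on_subset[OF holomorphic_on_imp_continuous_on[OF hol[OF x]] subS])
        fix y' assume "norm (y - y') = r/2"
        then have "y' \<in> cball z r" using sub by (auto simp: dist_norm)
        then show "norm (f y' x) \<le> h x" using h x by blast
      qed (use r in auto)
      then show "norm (deriv (\<lambda>z. f z x) y) \<le> 2 * h x / r" by (simp add: mult.commute)
    qed (use w r in auto)
    have "((\<lambda>w. (integral\<^sup>L M (f w) - integral\<^sup>L M (f z)) / (w - z)) \<longlongrightarrow> integral\<^sup>L M g) (at z within ball z (r/2))"
      unfolding tendsto_at_iff_sequentially
    proof (intro allI impI)
      fix X assume X: "\<forall>i. X i \<in> ball z (r/2) - {z}" "X \<longlonglongrightarrow> z"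
      have Xr: "X i \<in> cball z r" "X i \<noteq> z" "X i \<in> ball z (r/2)" for i
        using X(1)[rule_format, of i] r(1) by auto
      have zr: "z \<in> cball z r" using r by simp
      have gl: "(\<lambda>i. (f (X i) x - f z x) / (X i - z)) \<longlonglongrightarrow> g x" if x: "x \<in> space M" for x
      proof -
        have "((\<lambda>z. f z x) has_field_derivative g x) (at z)"
          unfolding g_def by (rule holomorphic_derivI[OF hol[OF x] S z])
        then have "((\<lambda>w. (f w x - f z x) / (w - z)) \<longlongrightarrow> g x) (at z)"
          by (simp add: has_field_derivative_iff)
        then show ?thesis
          unfolding tendsto_at_iff_sequentially o_def using X Xr by auto
      qed
      have "(\<lambda>i. LINT x|M. (f (X i) x - f z x) / (X i - z)) \<longlonglongrightarrow> integral\<^sup>L M g"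
      proof (rule integral_dominated_convergence[where w="\<lambda>x. 2 * h x / r"])
        show m: "(\<lambda>x. (f (X i) x - f z x) / (X i - z)) \<in> borel_measurable M" for i
          using int[OF Xr(1)] int[OF zr] by (auto intro!: borel_measurable_divide borel_measurable_diff)
        show "g \<in> borel_measurable M"
          by (rule borel_measurable_LIMSEQ_metric[OF m gl])
        show "integrable M (\<lambda>x. 2 * h x / r)" using r(3) by auto
        show "AE x in M. (\<lambda>i. (f (X i) x - f z x) / (X i - z)) \<longlonglongrightarrow> g x"
          using gl by (rule AE_I2)
        show "AE x in M. norm ((f (X i) x - f z x) / (X i - z)) \<le> 2 * h x / r" for i
          using lip[OF Xr(3)] Xr(2) by (intro AE_I2) (simp add: norm_divide divide_le_eq)
      qed
      moreover have "(LINT x|M. (f (X i) x - f z x) / (X i - z)) = (integral\<^sup>L M (f (X i)) - integral\<^sup>L M (f z)) / (X i - z)" for i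
        using int[OF Xr(1)] int[OF zr] by (simp add: Bochner_Integration.integral_diff)
      ultimately show "((\<lambda>w. (integral\<^sup>L M (f w) - integral\<^sup>L M (f z)) / (w - z)) \<circ> X) \<longlonglongrightarrow> integral\<^sup>L M g"
        by (simp only: o_def)
    qed
    moreover have "at z within ball z (r/2) = at z" using r by (intro at_within_open) auto
    ultimately show ?thesis unfolding has_field_derivative_iff by auto
  qed
  then show ?thesis using S by (simp add: holomorphic_on_open)
qed

lemma uniform_limit_osc:
  assumes "continuous_on ({0..} \<times> C) (\<lambda>(\<epsilon>::real, q). if \<epsilon> = 0 then I q else R \<epsilon> q :: complex)" "compact C"
  shows "uniform_limit C R I (at_right 0)"
proof (rule uniform_limitI)
  fix e :: real assume e: "e > 0"
  obtain X0 where X0: "0 \<in> X0" "open X0" "\<forall>x\<in>X0 \<inter> {0..}. \<forall>t\<in>C. 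
      dist ((\<lambda>(\<epsilon>, q). if \<epsilon> = 0 then I q else R \<epsilon> q) (x, t)) ((\<lambda>(\<epsilon>, q). if \<epsilon> = 0 then I q else R \<epsilon> q) (0, t)) \<le> e / 2"
    by (rule continuous_on_prod_compactE[OF assms, of 0 "e/2"]) (use e in auto)
  have "\<forall>\<^sub>F \<epsilon> in nhds 0. \<epsilon> \<in> X0" using X0 by (intro eventually_nhds_in_open)
  then have "\<forall>\<^sub>F \<epsilon> in at_right 0. \<epsilon> \<in> X0" by (simp add: eventually_at_filter eventually_mono)
  moreover have "\<forall>\<^sub>F \<epsilon> in at_right (0::real). \<epsilon> > 0" by (rule eventually_at_right_less)
  ultimately show "\<forall>\<^sub>F \<epsilon> in at_right 0. \<forall>q\<in>C. dist (R \<epsilon> q) (I q) < e"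
  proof eventually_elim
    case (elim \<epsilon>)
    show ?case
    proof
      fix q assume "q \<in> C"
      then have "dist (R \<epsilon> q) (I q) \<le> e / 2"
        using X0(3)[rule_format, of \<epsilon> q] elim by auto
      then show "dist (R \<epsilon> q) (I q) < e" using e by linarith
    qed
  qed
qed

lemma osc_continuousD:
  fixes \<theta> :: "'q::topological_space \<Rightarrow> real^'n \<Rightarrow> real" and \<kappa> :: "real^'n \<Rightarrow> complex"
  assumes "osc_continuous Q \<theta> a I" "schwartz \<kappa>" "\<kappa> 0 = 1"
  shows "\<And>q \<epsilon>. q \<in> Q \<Longrightarrow> \<epsilon> > 0 \<Longrightarrow> integrable lborel (\<lambda>\<xi>. \<kappa> (\<epsilon> *\<^sub>R \<xi>) * exp (\<i> * of_real (\<theta> q \<xi>)) * a q \<xi>)"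
    and "continuous_on ({0..} \<times> Q) (\<lambda>(\<epsilon>, q). if \<epsilon> = 0 then I q else osc_reg \<kappa> \<theta> a \<epsilon> q)"
  using assms unfolding osc_continuous_def by blast+

lemma osc_continuous_subset:
  fixes \<theta> :: "'q::topological_space \<Rightarrow> real^'n \<Rightarrow> real"
  assumes "osc_continuous Q \<theta> a I" "Q' \<subseteq> Q"
  shows "osc_continuous Q' \<theta> a I"
  unfolding osc_continuous_def
proof (intro allI impI conjI)
  fix \<kappa> :: "real^'n \<Rightarrow> complex" assume \<kappa>: "schwartz \<kappa> \<and> \<kappa> 0 = 1"
  show "\<forall>q\<in>Q'. \<forall>\<epsilon>>0. integrable lborel (\<lambda>\<xi>. \<kappa> (\<epsilon> *\<^sub>R \<xi>) * exp (\<i> * of_real (\<theta> q \<xi>)) * a q \<xi>)"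
    using osc_continuousD(1)[OF assms(1), of \<kappa>] \<kappa> assms(2) by blast
  show "continuous_on ({0..} \<times> Q') (\<lambda>(\<epsilon>, q). if \<epsilon> = 0 then I q else osc_reg \<kappa> \<theta> a \<epsilon> q)"
    by (rule continuous_on_subset[OF osc_continuousD(2)[OF assms(1), of \<kappa>]]) (use \<kappa> assms(2) in auto)
qed

lemma osc_limit:
  fixes \<theta> :: "'q::topological_space \<Rightarrow> real^'n \<Rightarrow> real"
  assumes "osc_continuous Q \<theta> a I" "q \<in> Q"
  shows "has_oscillatory_integral (\<theta> q) (a q) (I q)"
  unfolding has_oscillatory_integral_def
proof (intro allI impI conjI)
  fix \<kappa> :: "real^'n \<Rightarrow> complex" assume \<kappa>: "schwartz \<kappa> \<and> \<kappa> 0 = 1"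
  have o: "osc_continuous {q} \<theta> a I" by (rule osc_continuous_subset[OF assms(1)]) (use assms(2) in auto)
  show "integrable lborel (\<lambda>\<xi>. \<kappa> (\<epsilon> *\<^sub>R \<xi>) * exp (\<i> * of_real (\<theta> q \<xi>)) * a q \<xi>)" if "\<epsilon> > 0" for \<epsilon>
    using osc_continuousD(1)[OF assms(1), of \<kappa>] \<kappa> assms(2) that by blast
  have "uniform_limit {q} (osc_reg \<kappa> \<theta> a) I (at_right 0)"
    by (rule uniform_limit_osc[OF osc_continuousD(2)[OF o]]) (use \<kappa> in auto)
  then show "((\<lambda>\<epsilon>. LINT \<xi>|lborel. \<kappa> (\<epsilon> *\<^sub>R \<xi>) * exp (\<i> * of_real (\<theta> q \<xi>)) * a q \<xi>) \<longlongrightarrow> I q) (at_right 0)"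
    by (simp add: osc_reg_def)
qed

lemma osc_value_continuous:
  fixes \<theta> :: "'q::topological_space \<Rightarrow> real^'n \<Rightarrow> real" and \<kappa> :: "real^'n \<Rightarrow> complex"
  assumes "osc_continuous Q \<theta> a I" "schwartz \<kappa>" "\<kappa> 0 = 1"
  shows "continuous_on Q I"
proof -
  have "continuous_on Q (\<lambda>q. (\<lambda>(\<epsilon>::real, q). if \<epsilon> = 0 then I q else osc_reg \<kappa> \<theta> a \<epsilon> q) (0, q))"
    by (rule continuous_on_compose2[OF osc_continuousD(2)[OF assms]]) (auto intro!: continuous_intros)
  then show ?thesis by simp
qed

text \<open>The phase does not depend on \<open>z\<close>. Holomorphy is required of the regularised integrals only, because it passes to their
limit by locally uniform convergence (\<open>osc_holo_value_holomorphic\<close>).\<close>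

definition osc_holo :: "complex set \<Rightarrow> 'p::topological_space set \<Rightarrow> ('p \<Rightarrow> real^'n \<Rightarrow> real) \<Rightarrow>
    (complex \<times> 'p \<Rightarrow> real^'n \<Rightarrow> complex) \<Rightarrow> (complex \<times> 'p \<Rightarrow> complex) \<Rightarrow> bool" where
  "osc_holo Z K \<theta> a I \<longleftrightarrow> osc_continuous (Z \<times> K) (\<lambda>q. \<theta> (snd q)) a I \<and>
     (\<forall>\<kappa>. schwartz \<kappa> \<and> \<kappa> 0 = 1 \<longrightarrow> (\<forall>\<epsilon>>0. \<forall>p\<in>K.
        (\<lambda>z. osc_reg \<kappa> (\<lambda>q. \<theta> (snd q)) a \<epsilon> (z, p)) holomorphic_on interior Z))"

lemma interior_contains_cball:
  fixes z :: "'a::metric_space"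
  assumes "z \<in> interior Z"
  obtains r where "r > 0" "cball z r \<subseteq> interior Z"
  using open_interior[of Z] assms unfolding open_contains_cball by auto

lemma osc_holo_value_holomorphic:
  fixes \<theta> :: "'p::topological_space \<Rightarrow> real^'n \<Rightarrow> real" and \<kappa> :: "real^'n \<Rightarrow> complex"
  assumes "osc_holo Z K \<theta> a I" "schwartz \<kappa>" "\<kappa> 0 = 1" "p \<in> K"
  shows "(\<lambda>z. I (z, p)) holomorphic_on interior Z"
proof -
  let ?R = "\<lambda>\<epsilon> z. osc_reg \<kappa> (\<lambda>q. \<theta> (snd q)) a \<epsilon> (z, p)"
  have c: "osc_continuous (Z \<times> K) (\<lambda>q. \<theta> (snd q)) a I" using assms(1) by (simp add: osc_holo_def)
  have hol: "?R \<epsilon> holomorphic_on interior Z" if "\<epsilon> > 0" for \<epsilon>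
    using assms that unfolding osc_holo_def by blast
  have loc: "\<exists>r>0. (\<lambda>z. I (z, p)) holomorphic_on ball z r" if z: "z \<in> interior Z" for z
  proof -
    obtain r where r: "r > 0" "cball z r \<subseteq> interior Z"
      by (rule interior_contains_cball[OF z]) (rule that)
    then have rZ: "cball z r \<subseteq> Z" using order_trans[OF r(2) interior_subset] by simp
    have "continuous_on ({0..} \<times> cball z r) (\<lambda>x. (\<lambda>(\<epsilon>::real, q). if \<epsilon> = 0 then I q else osc_reg \<kappa> (\<lambda>q. \<theta> (snd q)) a \<epsilon> q) (fst x, (snd x, p)))"
    proof (rule continuous_on_compose2[OF osc_continuousD(2)[OF c assms(2,3)]])
      show "continuous_on ({0..} \<times> cball z r) (\<lambda>x. (fst x :: real, (snd x, p)))"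
        by (intro continuous_on_Pair continuous_on_fst continuous_on_snd continuous_on_id continuous_on_const)
      show "(\<lambda>x. (fst x :: real, (snd x, p))) ` ({0..} \<times> cball z r) \<subseteq> {0..} \<times> (Z \<times> K)"
        using rZ assms(4) by auto
    qed
    then have "continuous_on ({0..} \<times> cball z r) (\<lambda>(\<epsilon>::real, w). if \<epsilon> = 0 then I (w, p) else ?R \<epsilon> w)"
      by (simp add: case_prod_unfold cong: if_cong)
    then have ul: "uniform_limit (cball z r) ?R (\<lambda>w. I (w, p)) (at_right 0)"
      by (rule uniform_limit_osc) simp
    have ev: "\<forall>\<^sub>F \<epsilon> in at_right 0. continuous_on (cball z r) (?R \<epsilon>) \<and> ?R \<epsilon> holomorphic_on ball z r"
      using eventually_at_right_less[of 0]
    proof eventually_elim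
      case (elim \<epsilon>)
      have h: "?R \<epsilon> holomorphic_on cball z r" by (rule holomorphic_on_subset[OF hol[OF elim] r(2)])
      show ?case
        using holomorphic_on_imp_continuous_on[OF h] holomorphic_on_subset[OF h ball_subset_cball] by simp
    qed
    have "(\<lambda>z. I (z, p)) holomorphic_on ball z r"
      by (rule holomorphic_uniform_limit[OF ev ul]) simp_all
    then show ?thesis using r(1) by blast
  qed
  have "\<exists>D. ((\<lambda>z. I (z, p)) has_field_derivative D) (at z)" if z: "z \<in> interior Z" for z
  proof -
    obtain r where "r > 0" "(\<lambda>z. I (z, p)) holomorphic_on ball z r" using loc[OF z] by blast
    from holomorphic_derivI[OF this(2) open_ball] this(1) show ?thesis by (meson centre_in_ball)
  qed
  then show ?thesis by (simp add: holomorphic_on_open)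
qed

section \<open>Symbols and integrable functions as amplitudes\<close>

text \<open>Continuity is the principle of non-stationary phase. For holomorphy it is enough that for fixed \<open>\<epsilon> > 0\<close> the
regularised amplitude decays rapidly, locally uniformly in \<open>z\<close>.\<close>

theorem osc_holo_symbol:
  fixes \<theta> :: "'p::{first_countable_topology,t2_space} \<Rightarrow> real^'n \<Rightarrow> real"
  assumes phase: "nonstationary_phase (Z \<times> K) (\<lambda>q. \<theta> (snd q))"
    and u: "\<And>k. symbol k (Z \<times> K) m u"
    and hol: "\<And>p \<xi>. p \<in> K \<Longrightarrow> 1 \<le> norm \<xi> \<Longrightarrow> (\<lambda>z. u (z, p) \<xi>) holomorphic_on interior Z"
  shows "\<exists>I. osc_holo Z K \<theta> (exterior u) I"
proof -
  interpret nonstationary_phase "Z \<times> K" "\<lambda>q. \<theta> (snd q)" by (rule phase)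
  obtain I where I: "osc_continuous (Z \<times> K) (\<lambda>q. \<theta> (snd q)) (exterior u) I"
    using osc_continuous_symbol[OF phase u] by blast
  have "(\<lambda>z. osc_reg \<kappa> (\<lambda>q. \<theta> (snd q)) (exterior u) \<epsilon> (z, p)) holomorphic_on interior Z"
    if \<kappa>: "schwartz \<kappa>" and eps: "\<epsilon> > 0" and p: "p \<in> K" for \<kappa> :: "real^'n \<Rightarrow> complex" and \<epsilon> p
  proof -
    let ?N = "real DIM(real^'n)"
    define F where "F z \<xi> = (if 1 \<le> norm \<xi> then exp (\<i> * complex_of_real (\<theta> p \<xi>)) * (\<kappa> (\<epsilon> *\<^sub>R \<xi>) * u (z, p) \<xi>) else 0)" for z \<xi>
    have e: "symbol 0 ({\<epsilon>} \<times> (Z \<times> K)) 0 (\<lambda>s \<xi>. exp (\<i> * of_real (\<theta> (snd (snd s)) \<xi>)))"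
      by (rule symbol_reparam[OF symbol_exp_phase]) (auto intro!: continuous_intros)
    have s: "symbol 0 ({\<epsilon>} \<times> (Z \<times> K)) (- 2 * ?N) (\<lambda>s \<xi>. exp (\<i> * of_real (\<theta> (snd (snd s)) \<xi>)) * (\<kappa> (fst s *\<^sub>R \<xi>) * u (snd s) \<xi>))"
      using symbol_mult[OF e symbol_regularized(2)[OF \<kappa> u[of 0] eps]] by simp
    obtain C where C: "C > 0" "\<And>s \<xi>. s \<in> {\<epsilon>} \<times> (Z \<times> K) \<Longrightarrow> \<xi> \<in> outer \<Longrightarrow>
        norm (exp (\<i> * of_real (\<theta> (snd (snd s)) \<xi>)) * (\<kappa> (fst s *\<^sub>R \<xi>) * u (snd s) \<xi>)) \<le> C * norm \<xi> powr (- 2 * ?N)"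
      by (rule symbol_0E[OF s]) (rule that, auto)
    have "(\<lambda>z. integral\<^sup>L lborel (F z)) holomorphic_on interior Z"
    proof (rule holomorphic_on_integral)
      show "(\<lambda>z. F z \<xi>) holomorphic_on interior Z" for \<xi>
        using hol[OF p, of \<xi>] by (cases "1 \<le> norm \<xi>") (auto simp: F_def intro!: holomorphic_intros)
      fix z assume z: "z \<in> interior Z"
      then have zZ: "z \<in> Z" using interior_subset by blast
      show "F z \<in> borel_measurable lborel"
        using exterior_measurable[OF s, of "(\<epsilon>, z, p)", unfolded fst_conv snd_conv] zZ p by (simp add: F_def[abs_def])
      obtain r where r: "r > 0" "cball z r \<subseteq> interior Z"
        by (rule interior_contains_cball[OF z]) (rule that)
      have "norm (F w \<xi>) \<le> C * (if 1 \<le> norm \<xi> then norm \<xi> powr (- 2 * ?N) else 0)" if "w \<in> cball z r" for w \<xi>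
      proof (cases "1 \<le> norm \<xi>")
        case True
        have "w \<in> Z" using that r(2) interior_subset by (meson subsetD)
        then show ?thesis using C(2)[of "(\<epsilon>, w, p)" \<xi>] True p by (simp add: F_def)
      qed (use C(1) in \<open>simp add: F_def\<close>)
      moreover have "integrable lborel (\<lambda>\<xi>::real^'n. C * (if 1 \<le> norm \<xi> then norm \<xi> powr (- 2 * ?N) else 0))"
        by (intro integrable_mult_right integrable_tail_powr)
      ultimately show "\<exists>r>0. \<exists>h. cball z r \<subseteq> interior Z \<and> integrable lborel h \<and>
                 (\<forall>w\<in>cball z r. \<forall>\<xi>\<in>space lborel. norm (F w \<xi>) \<le> h \<xi>)"
        using r by blast
    qed simp
    moreover have "osc_reg \<kappa> (\<lambda>q. \<theta> (snd q)) (exterior u) \<epsilon> (z, p) = integral\<^sup>L lborel (F z)" for z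
      unfolding osc_reg_def by (intro Bochner_Integration.integral_cong) (auto simp: F_def exterior_def)
    ultimately show ?thesis by simp
  qed
  then show ?thesis using I unfolding osc_holo_def by blast
qed

lemma schwartz_bounded:
  assumes "schwartz \<kappa>"
  obtains B where "B > 0" "\<And>u. norm (\<kappa> u) \<le> B"
proof -
  obtain C where "C > 0" "\<And>u. norm u ^ 0 * norm (\<kappa> u) \<le> C"
    by (rule schwartz_decay[OF assms, of 0]) (rule that)
  then show ?thesis using that[of C] by simp
qed

lemma borel_measurable_nonzero_continuous:
  fixes f :: "'v::euclidean_space \<Rightarrow> 'b::real_normed_vector"
  assumes "continuous_on (- {0}) f"
  shows "f \<in> borel_measurable borel"
proof -
  have "(\<lambda>x. if x \<in> - {0} then f x else f 0) \<in> borel_measurable borel"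
    by (rule borel_measurable_continuous_on_if) (use assms in auto)
  then show ?thesis by (rule measurable_cong[THEN iffD1, rotated]) auto
qed

lemma weight_measurable:
  fixes \<kappa> :: "real^'n \<Rightarrow> complex"
  assumes "schwartz \<kappa>" "continuous_on (- {0}) (\<theta> :: real^'n \<Rightarrow> real)"
  shows "(\<lambda>\<xi>. \<kappa> (\<epsilon> *\<^sub>R \<xi>) * exp (\<i> * of_real (\<theta> \<xi>))) \<in> borel_measurable borel"
  by (intro borel_measurable_nonzero_continuous continuous_intros assms(2)
      continuous_on_compose2[OF schwartz_continuous[OF assms(1), of UNIV]]) auto

lemma weighted_integrable:
  fixes \<kappa> :: "real^'n \<Rightarrow> complex"
  assumes "schwartz \<kappa>" "continuous_on (- {0}) (\<theta> :: real^'n \<Rightarrow> real)" "integrable lborel a" "\<And>u. norm (\<kappa> u) \<le> B"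
  shows "integrable lborel (\<lambda>\<xi>. \<kappa> (\<epsilon> *\<^sub>R \<xi>) * exp (\<i> * of_real (\<theta> \<xi>)) * a \<xi>)"
    and "norm (LINT \<xi>|lborel. \<kappa> (\<epsilon> *\<^sub>R \<xi>) * exp (\<i> * of_real (\<theta> \<xi>)) * a \<xi>) \<le> B * (LINT \<xi>|lborel. norm (a \<xi>))"
    and "(LINT \<xi>|lborel. norm (\<kappa> (\<epsilon> *\<^sub>R \<xi>) * exp (\<i> * of_real (\<theta> \<xi>)) * a \<xi>)) \<le> B * (LINT \<xi>|lborel. norm (a \<xi>))"
proof -
  have b: "norm (\<kappa> (\<epsilon> *\<^sub>R \<xi>) * exp (\<i> * of_real (\<theta> \<xi>)) * a \<xi>) \<le> B * norm (a \<xi>)" for \<xi>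
    using assms(4) by (simp add: norm_mult mult_right_mono)
  have i: "integrable lborel (\<lambda>\<xi>. B * norm (a \<xi>))" using assms(3) by auto
  show int: "integrable lborel (\<lambda>\<xi>. \<kappa> (\<epsilon> *\<^sub>R \<xi>) * exp (\<i> * of_real (\<theta> \<xi>)) * a \<xi>)"
  proof (rule Bochner_Integration.integrable_bound[OF i])
    show "(\<lambda>\<xi>. \<kappa> (\<epsilon> *\<^sub>R \<xi>) * exp (\<i> * of_real (\<theta> \<xi>)) * a \<xi>) \<in> borel_measurable lborel"
      by (rule borel_measurable_times) (use weight_measurable[OF assms(1,2)] assms(3) in auto)
    show "AE \<xi> in lborel. norm (\<kappa> (\<epsilon> *\<^sub>R \<xi>) * exp (\<i> * of_real (\<theta> \<xi>)) * a \<xi>) \<le> norm (B * norm (a \<xi>))"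
      using b by (intro AE_I2) (metis abs_ge_self order_trans real_norm_def)
  qed
  show n: "(LINT \<xi>|lborel. norm (\<kappa> (\<epsilon> *\<^sub>R \<xi>) * exp (\<i> * of_real (\<theta> \<xi>)) * a \<xi>)) \<le> B * (LINT \<xi>|lborel. norm (a \<xi>))"
    using integral_mono[OF integrable_norm[OF int] i] b assms(3) by simp
  show "norm (LINT \<xi>|lborel. \<kappa> (\<epsilon> *\<^sub>R \<xi>) * exp (\<i> * of_real (\<theta> \<xi>)) * a \<xi>) \<le> B * (LINT \<xi>|lborel. norm (a \<xi>))"
    using integral_norm_bound n by (rule order_trans)
qed

lemma phase_slice:
  assumes "continuous_on (K \<times> (- {0})) (\<lambda>(p, \<xi>). \<theta> p \<xi>)" "p \<in> K"
  shows "continuous_on (- {0}) (\<theta> p)"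
proof -
  have "continuous_on (- {0}) (\<lambda>\<xi>. (\<lambda>(p, \<xi>). \<theta> p \<xi>) (p, \<xi>))"
    by (rule continuous_on_compose2[OF assms(1)]) (use assms(2) in \<open>auto intro!: continuous_intros\<close>)
  then show ?thesis by simp
qed

text \<open>An integrable amplitude needs no oscillation: the weight \<open>\<kappa> (\<epsilon> \<xi>) exp (i \<theta>)\<close> is bounded and continuous in
the parameters off the null set \<open>{0}\<close>.\<close>

lemma osc_holo_L1:
  fixes \<theta> :: "'p::{first_countable_topology,t2_space} \<Rightarrow> real^'n \<Rightarrow> real"
  assumes \<theta>: "continuous_on (K \<times> (- {0})) (\<lambda>(p, \<xi>). \<theta> p \<xi>)"
    and int: "\<And>q. q \<in> Z \<times> K \<Longrightarrow> integrable lborel (a q)"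
    and cont: "\<And>q0. q0 \<in> Z \<times> K \<Longrightarrow> continuous (at q0 within Z \<times> K) (\<lambda>q. LINT \<xi>|lborel. norm (a q \<xi> - a q0 \<xi>))"
    and hol: "\<And>z p. z \<in> interior Z \<Longrightarrow> p \<in> K \<Longrightarrow> \<exists>b. integrable lborel b \<and>
      ((\<lambda>w. LINT \<xi>|lborel. norm ((a (w, p) \<xi> - a (z, p) \<xi>) / (w - z) - b \<xi>)) \<longlongrightarrow> 0) (at z)"
  shows "\<exists>I. osc_holo Z K \<theta> a I"
proof -
  define I where "I q = (LINT \<xi>|lborel. exp (\<i> * of_real (\<theta> (snd q) \<xi>)) * a q \<xi>)" for q
  have ts: "continuous_on (- {0}) (\<theta> p)" if "p \<in> K" for p using phase_slice[OF \<theta> that] .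
  have "osc_continuous (Z \<times> K) (\<lambda>q. \<theta> (snd q)) a I"
    unfolding osc_continuous_def
  proof (intro allI impI conjI ballI)
    fix \<kappa> :: "real^'n \<Rightarrow> complex" assume \<kappa>: "schwartz \<kappa> \<and> \<kappa> 0 = 1"
    obtain B where B: "B > 0" "\<And>u. norm (\<kappa> u) \<le> B" by (rule schwartz_bounded[of \<kappa>]) (use \<kappa> in \<open>auto intro: that\<close>)
    show "integrable lborel (\<lambda>\<xi>. \<kappa> (\<epsilon> *\<^sub>R \<xi>) * exp (\<i> * of_real (\<theta> (snd q) \<xi>)) * a q \<xi>)"
      if "q \<in> Z \<times> K" "\<epsilon> > 0" for q \<epsilon>
      by (rule weighted_integrable(1)[OF _ ts int B(2)]) (use \<kappa> that in auto)
    let ?P = "{0::real..} \<times> (Z \<times> K)"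
    have "continuous_on ?P (\<lambda>p. LINT \<xi>|lborel. (\<kappa> (fst p *\<^sub>R \<xi>) * exp (\<i> * of_real (\<theta> (snd (snd p)) \<xi>))) * a (snd p) \<xi>)"
    proof (rule continuous_on_integral_L1)
      show "(\<lambda>\<xi>. \<kappa> (fst p *\<^sub>R \<xi>) * exp (\<i> * of_real (\<theta> (snd (snd p)) \<xi>))) \<in> borel_measurable lborel" if "p \<in> ?P" for p
        using weight_measurable[OF _ ts, of \<kappa> "snd (snd p)"] \<kappa> that by auto
      show "norm (\<kappa> (fst p *\<^sub>R \<xi>) * exp (\<i> * of_real (\<theta> (snd (snd p)) \<xi>))) \<le> B" for p :: "real \<times> complex \<times> 'p" and \<xi>
        using B(2) by (simp add: norm_mult)
      have "AE \<xi> in (lborel :: (real^'n) measure). \<xi> \<noteq> 0"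
        by (rule AE_lborel_singleton)
      then show "AE \<xi> in lborel. continuous_on ?P (\<lambda>p. \<kappa> (fst p *\<^sub>R \<xi>) * exp (\<i> * of_real (\<theta> (snd (snd p)) \<xi>)))"
      proof eventually_elim
        case (elim \<xi>)
        have k: "continuous_on ?P (\<lambda>p. \<kappa> (fst p *\<^sub>R \<xi>))"
          using \<kappa> by (intro continuous_on_compose2[OF schwartz_continuous[of \<kappa> UNIV]] continuous_intros) auto
        have "continuous_on ?P (\<lambda>p. (\<lambda>(p, \<xi>). \<theta> p \<xi>) (snd (snd p), \<xi>))"
          by (rule continuous_on_compose2[OF \<theta>]) (use elim in \<open>auto intro!: continuous_intros\<close>)
        then have "continuous_on ?P (\<lambda>p. \<theta> (snd (snd p)) \<xi>)" by simp
        with k show ?case by (intro continuous_intros)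
      qed
      show "integrable lborel (a (snd p))" if "p \<in> ?P" for p using int that by auto
      fix p0 assume p0: "p0 \<in> ?P"
      have im: "snd ` ?P = Z \<times> K" by (simp add: snd_image_times)
      have "snd p0 \<in> Z \<times> K" using p0 by (simp add: mem_Times_iff)
      then have "continuous (at (snd p0) within snd ` ?P) (\<lambda>q. LINT \<xi>|lborel. norm (a q \<xi> - a (snd p0) \<xi>))"
        unfolding im by (rule cont)
      from continuous_within_compose[OF _ this]
      show "continuous (at p0 within ?P) (\<lambda>p. LINT \<xi>|lborel. norm (a (snd p) \<xi> - a (snd p0) \<xi>))"
        by (simp add: o_def continuous_snd)
    qed
    moreover have "continuous_on ?P (\<lambda>p. LINT \<xi>|lborel. (\<kappa> (fst p *\<^sub>R \<xi>) * exp (\<i> * of_real (\<theta> (snd (snd p)) \<xi>))) * a (snd p) \<xi>)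
       \<longleftrightarrow> continuous_on ?P (\<lambda>(\<epsilon>, q). if \<epsilon> = 0 then I q else osc_reg \<kappa> (\<lambda>q. \<theta> (snd q)) a \<epsilon> q)"
      by (rule continuous_on_cong) (use \<kappa> in \<open>auto simp: I_def osc_reg_def\<close>)
    ultimately show "continuous_on ?P (\<lambda>(\<epsilon>, q). if \<epsilon> = 0 then I q else osc_reg \<kappa> (\<lambda>q. \<theta> (snd q)) a \<epsilon> q)"
      by blast
  qed
  moreover have "(\<lambda>z. osc_reg \<kappa> (\<lambda>q. \<theta> (snd q)) a \<epsilon> (z, p)) holomorphic_on interior Z"
    if \<kappa>: "schwartz \<kappa>" and p: "p \<in> K" for \<kappa> :: "real^'n \<Rightarrow> complex" and \<epsilon> p
  proof -
    obtain B where B: "B > 0" "\<And>u. norm (\<kappa> u) \<le> B" by (rule schwartz_bounded[OF \<kappa>]) (rule that)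
    define R where "R f = (LINT \<xi>|lborel. \<kappa> (\<epsilon> *\<^sub>R \<xi>) * exp (\<i> * of_real (\<theta> p \<xi>)) * f \<xi>)" for f
    have "\<exists>D. ((\<lambda>z. R (a (z, p))) has_field_derivative D) (at z)" if z: "z \<in> interior Z" for z
    proof -
      obtain b where b: "integrable lborel b"
        "((\<lambda>w. LINT \<xi>|lborel. norm ((a (w, p) \<xi> - a (z, p) \<xi>) / (w - z) - b \<xi>)) \<longlongrightarrow> 0) (at z)"
        using hol[OF z p] by blast
      have zZ: "z \<in> Z" using subsetD[OF interior_subset z] .
      have "((\<lambda>w. (R (a (w, p)) - R (a (z, p))) / (w - z) - R b) \<longlongrightarrow> 0) (at z)"
      proof (rule Lim_null_comparison)
        show "((\<lambda>w. B * (LINT \<xi>|lborel. norm ((a (w, p) \<xi> - a (z, p) \<xi>) / (w - z) - b \<xi>))) \<longlongrightarrow> 0) (at z)"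
          using tendsto_mult[OF tendsto_const[of B] b(2)] by simp
        have "\<forall>\<^sub>F w in at z. w \<in> interior Z - {z}"
          using z by (intro eventually_at_in_open) auto
        then show "\<forall>\<^sub>F w in at z. norm ((R (a (w, p)) - R (a (z, p))) / (w - z) - R b)
            \<le> B * (LINT \<xi>|lborel. norm ((a (w, p) \<xi> - a (z, p) \<xi>) / (w - z) - b \<xi>))"
        proof eventually_elim
          case (elim w)
          then have wZ: "w \<in> Z" using subsetD[OF interior_subset, of w Z] by simp
          let ?d = "\<lambda>\<xi>. (a (w, p) \<xi> - a (z, p) \<xi>) / (w - z) - b \<xi>"
          have i: "integrable lborel (a (w, p))" "integrable lborel (a (z, p))" using int wZ zZ p by auto
          then have di: "integrable lborel ?d"
            using b(1) by (intro Bochner_Integration.integrable_diff integrable_divide_zero) auto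
          have wi: "integrable lborel (\<lambda>\<xi>. \<kappa> (\<epsilon> *\<^sub>R \<xi>) * exp (\<i> * of_real (\<theta> p \<xi>)) * f \<xi>)" if "integrable lborel f" for f
            by (rule weighted_integrable(1)[OF \<kappa> ts[OF p] that B(2)])
          have "R ?d = (LINT \<xi>|lborel. (\<kappa> (\<epsilon> *\<^sub>R \<xi>) * exp (\<i> * of_real (\<theta> p \<xi>)) * a (w, p) \<xi> - \<kappa> (\<epsilon> *\<^sub>R \<xi>) * exp (\<i> * of_real (\<theta> p \<xi>)) * a (z, p) \<xi>) / (w - z)
              - \<kappa> (\<epsilon> *\<^sub>R \<xi>) * exp (\<i> * of_real (\<theta> p \<xi>)) * b \<xi>)"
            unfolding R_def by (intro Bochner_Integration.integral_cong) (auto simp: algebra_simps diff_divide_distrib)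
          also have "\<dots> = (R (a (w, p)) - R (a (z, p))) / (w - z) - R b"
            unfolding R_def using wi[OF i(1)] wi[OF i(2)] wi[OF b(1)]
            by (subst Bochner_Integration.integral_diff) (auto simp: Bochner_Integration.integral_diff)
          finally show ?case
            using weighted_integrable(2)[OF \<kappa> ts[OF p] di B(2), of \<epsilon>] by (simp add: R_def)
        qed
      qed
      then have "((\<lambda>w. (R (a (w, p)) - R (a (z, p))) / (w - z)) \<longlongrightarrow> R b) (at z)"
        by (subst (asm) LIM_zero_iff)
      then show ?thesis by (auto simp: has_field_derivative_iff)
    qed
    then show ?thesis unfolding osc_reg_def snd_conv R_def by (simp add: holomorphic_on_open)
  qed
  ultimately show ?thesis unfolding osc_holo_def by blast
qed

lemma osc_holo_add:
  assumes "osc_holo Z K \<theta> a I" "osc_holo Z K \<theta> b J"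
  shows "osc_holo Z K \<theta> (\<lambda>q \<xi>. a q \<xi> + b q \<xi>) (\<lambda>q. I q + J q)"
proof -
  have ca: "osc_continuous (Z \<times> K) (\<lambda>q. \<theta> (snd q)) a I" and cb: "osc_continuous (Z \<times> K) (\<lambda>q. \<theta> (snd q)) b J"
    using assms by (auto simp: osc_holo_def)
  have sum: "osc_reg \<kappa> (\<lambda>q. \<theta> (snd q)) (\<lambda>q \<xi>. a q \<xi> + b q \<xi>) \<epsilon> q = osc_reg \<kappa> (\<lambda>q. \<theta> (snd q)) a \<epsilon> q + osc_reg \<kappa> (\<lambda>q. \<theta> (snd q)) b \<epsilon> q"
    if "schwartz \<kappa>" "\<kappa> 0 = 1" "\<epsilon> > 0" "q \<in> Z \<times> K" for \<kappa> \<epsilon> q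
    unfolding osc_reg_def distrib_left
    by (rule Bochner_Integration.integral_add[OF osc_continuousD(1)[OF ca that(1,2,4,3)] osc_continuousD(1)[OF cb that(1,2,4,3)]])
  show ?thesis
    unfolding osc_holo_def osc_continuous_def
  proof (intro conjI allI impI ballI)
    fix \<kappa> :: "real^'b \<Rightarrow> complex" assume \<kappa>: "schwartz \<kappa> \<and> \<kappa> 0 = 1"
    show "integrable lborel (\<lambda>\<xi>. \<kappa> (\<epsilon> *\<^sub>R \<xi>) * exp (\<i> * of_real (\<theta> (snd q) \<xi>)) * (a q \<xi> + b q \<xi>))"
      if "q \<in> Z \<times> K" "\<epsilon> > 0" for q \<epsilon>
      unfolding distrib_left using \<kappa> that osc_continuousD(1)[OF ca, of \<kappa>] osc_continuousD(1)[OF cb, of \<kappa>]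
      by (intro Bochner_Integration.integrable_add) auto
    have "continuous_on ({0..} \<times> (Z \<times> K)) (\<lambda>p. (\<lambda>(\<epsilon>, q). if \<epsilon> = 0 then I q else osc_reg \<kappa> (\<lambda>q. \<theta> (snd q)) a \<epsilon> q) p
        + (\<lambda>(\<epsilon>, q). if \<epsilon> = 0 then J q else osc_reg \<kappa> (\<lambda>q. \<theta> (snd q)) b \<epsilon> q) p)"
      using \<kappa> by (intro continuous_on_add osc_continuousD(2)[OF ca] osc_continuousD(2)[OF cb]) auto
    then show "continuous_on ({0..} \<times> (Z \<times> K)) (\<lambda>(\<epsilon>, q). if \<epsilon> = 0 then I q + J q else osc_reg \<kappa> (\<lambda>q. \<theta> (snd q)) (\<lambda>q \<xi>. a q \<xi> + b q \<xi>) \<epsilon> q)"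
      by (rule continuous_on_cong[THEN iffD1, rotated 2]) (use \<kappa> in \<open>auto simp: sum\<close>)
    fix \<epsilon> :: real and p assume e: "\<epsilon> > 0" "p \<in> K"
    have "(\<lambda>z. osc_reg \<kappa> (\<lambda>q. \<theta> (snd q)) a \<epsilon> (z, p) + osc_reg \<kappa> (\<lambda>q. \<theta> (snd q)) b \<epsilon> (z, p)) holomorphic_on interior Z"
      using assms e \<kappa> unfolding osc_holo_def by (intro holomorphic_on_add) auto
    then show "(\<lambda>z. osc_reg \<kappa> (\<lambda>q. \<theta> (snd q)) (\<lambda>q \<xi>. a q \<xi> + b q \<xi>) \<epsilon> (z, p)) holomorphic_on interior Z"
      by (rule holomorphic_transform) (use \<kappa> e interior_subset[of Z] in \<open>auto simp: sum\<close>)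
  qed
qed

lemma osc_holo_zero: "osc_holo Z K \<theta> (\<lambda>q \<xi>. 0) (\<lambda>q. 0)"
  by (simp add: osc_holo_def osc_continuous_def osc_reg_def case_prod_unfold cong: if_cong)

lemma osc_holo_sum:
  assumes "finite F" "\<And>i. i \<in> F \<Longrightarrow> osc_holo Z K \<theta> (a i) (I i)"
  shows "osc_holo Z K \<theta> (\<lambda>q \<xi>. \<Sum>i\<in>F. a i q \<xi>) (\<lambda>q. \<Sum>i\<in>F. I i q)"
  using assms
proof (induction F)
  case empty
  then show ?case by (simp add: osc_holo_zero)
next
  case (insert i F)
  have "osc_holo Z K \<theta> (\<lambda>q \<xi>. a i q \<xi> + (\<Sum>i\<in>F. a i q \<xi>)) (\<lambda>q. I i q + (\<Sum>i\<in>F. I i q))"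
    using insert by (intro osc_holo_add) auto
  then show ?case using insert(1,2) by simp
qed

text \<open>Needed because an infinite sum of amplitudes is given its default value wherever it diverges, which
happens on a null set of \<open>\<xi>\<close> depending on the parameter.\<close>

lemma osc_holo_cong_AE:
  fixes \<theta> :: "'p::topological_space \<Rightarrow> real^'n \<Rightarrow> real"
  assumes "osc_holo Z K \<theta> a I" and \<theta>: "continuous_on (K \<times> (- {0})) (\<lambda>(p, \<xi>). \<theta> p \<xi>)"
    and "\<And>q. q \<in> Z \<times> K \<Longrightarrow> a q \<in> borel_measurable borel" "\<And>q. q \<in> Z \<times> K \<Longrightarrow> b q \<in> borel_measurable borel"
    and ae: "\<And>q. q \<in> Z \<times> K \<Longrightarrow> AE \<xi> in lborel. a q \<xi> = b q \<xi>"
  shows "osc_holo Z K \<theta> b I"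
proof -
  have ca: "osc_continuous (Z \<times> K) (\<lambda>q. \<theta> (snd q)) a I" using assms by (auto simp: osc_holo_def)
  have m: "(\<lambda>\<xi>. \<kappa> (\<epsilon> *\<^sub>R \<xi>) * exp (\<i> * of_real (\<theta> (snd q) \<xi>)) * c q \<xi>) \<in> borel_measurable lborel"
    if "schwartz \<kappa>" "q \<in> Z \<times> K" "c q \<in> borel_measurable borel" for \<kappa> :: "real^'n \<Rightarrow> complex" and \<epsilon> q and c :: "complex \<times> 'p \<Rightarrow> real^'n \<Rightarrow> complex"
    by (rule borel_measurable_times)
      (use weight_measurable[OF that(1) phase_slice[OF \<theta>], of "snd q" \<epsilon>] that(2,3) in auto)
  have e: "AE \<xi> in lborel. \<kappa> (\<epsilon> *\<^sub>R \<xi>) * exp (\<i> * of_real (\<theta> (snd q) \<xi>)) * a q \<xi> = \<kappa> (\<epsilon> *\<^sub>R \<xi>) * exp (\<i> * of_real (\<theta> (snd q) \<xi>)) * b q \<xi>"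
    if "q \<in> Z \<times> K" for \<kappa> :: "real^'n \<Rightarrow> complex" and \<epsilon> q
    using ae[OF that] by eventually_elim simp
  have eq: "osc_reg \<kappa> (\<lambda>q. \<theta> (snd q)) a \<epsilon> q = osc_reg \<kappa> (\<lambda>q. \<theta> (snd q)) b \<epsilon> q" if "schwartz \<kappa>" "q \<in> Z \<times> K" for \<kappa> \<epsilon> q
    unfolding osc_reg_def by (rule integral_cong_AE[OF m m e]) (use that assms in auto)
  show ?thesis
    unfolding osc_holo_def osc_continuous_def
  proof (intro conjI allI impI ballI)
    fix \<kappa> :: "real^'n \<Rightarrow> complex" assume \<kappa>: "schwartz \<kappa> \<and> \<kappa> 0 = 1"
    show "integrable lborel (\<lambda>\<xi>. \<kappa> (\<epsilon> *\<^sub>R \<xi>) * exp (\<i> * of_real (\<theta> (snd q) \<xi>)) * b q \<xi>)"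
      if "q \<in> Z \<times> K" "\<epsilon> > 0" for q \<epsilon>
      using integrable_cong_AE[OF m[of \<kappa> q a \<epsilon>] m[of \<kappa> q b \<epsilon>] e[OF that(1), of \<kappa> \<epsilon>]] osc_continuousD(1)[OF ca, of \<kappa> q \<epsilon>] \<kappa> that assms(3,4) by auto
    show "continuous_on ({0..} \<times> (Z \<times> K)) (\<lambda>(\<epsilon>, q). if \<epsilon> = 0 then I q else osc_reg \<kappa> (\<lambda>q. \<theta> (snd q)) b \<epsilon> q)"
      by (rule continuous_on_cong[THEN iffD1, rotated 2, OF osc_continuousD(2)[OF ca, of \<kappa>]]) (use \<kappa> in \<open>auto simp: eq\<close>)
    fix \<epsilon> :: real and p assume "\<epsilon> > 0" "p \<in> K"
    then have "(\<lambda>z. osc_reg \<kappa> (\<lambda>q. \<theta> (snd q)) a \<epsilon> (z, p)) holomorphic_on interior Z"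
      using assms(1) \<kappa> unfolding osc_holo_def by auto
    then show "(\<lambda>z. osc_reg \<kappa> (\<lambda>q. \<theta> (snd q)) b \<epsilon> (z, p)) holomorphic_on interior Z"
      by (rule holomorphic_transform) (use \<kappa> \<open>p \<in> K\<close> interior_subset[of Z] in \<open>auto simp: eq\<close>)
  qed
qed

section \<open>Series of amplitudes\<close>

text \<open>Extension by zero turns unordered sums over \<open>J\<close> into series over all of \<open>\<nat>\<close>, for which measurability and the
Weierstrass criterion are available.\<close>

definition zero_ext :: "nat set \<Rightarrow> (nat \<Rightarrow> 'c::zero) \<Rightarrow> nat \<Rightarrow> 'c" where
  "zero_ext J f i = (if i \<in> J then f i else 0)"

lemma summable_on_zero_ext_UNIV:
  fixes f :: "nat \<Rightarrow> 'c::{comm_monoid_add, topological_space}"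
  shows "zero_ext J f summable_on UNIV \<longleftrightarrow> f summable_on J"
  by (rule summable_on_cong_neutral) (auto simp: zero_ext_def)

lemma summable_on_zero_ext:
  fixes f :: "nat \<Rightarrow> complex"
  shows "f summable_on J \<longleftrightarrow> (\<Sum>i. ennreal (norm (zero_ext J f i))) < \<infinity>"
proof -
  have "f summable_on J \<longleftrightarrow> zero_ext J f summable_on UNIV"
    by (simp add: summable_on_zero_ext_UNIV)
  also have "\<dots> \<longleftrightarrow> (\<lambda>i. norm (zero_ext J f i)) summable_on UNIV"
    by (rule summable_on_iff_abs_summable_on_complex)
  also have "\<dots> \<longleftrightarrow> summable (\<lambda>i. norm (zero_ext J f i))"
    by (rule summable_on_UNIV_nonneg_real_iff) simp
  also have "\<dots> \<longleftrightarrow> (\<Sum>i. ennreal (norm (zero_ext J f i))) < \<infinity>"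
    unfolding infinity_ennreal_def less_top[symmetric]
    by (rule iffI[OF ennreal_suminf_neq_top summable_suminf_not_top]) simp_all
  finally show ?thesis .
qed

text \<open>The unordered sum is a measurable function of its terms in spite of its default value 0, because
summability is the finiteness of a measurable series.\<close>

lemma infsum_zero_ext:
  fixes f :: "nat \<Rightarrow> complex"
  shows "infsum f J = (if (\<Sum>i. ennreal (norm (zero_ext J f i))) < \<infinity> then suminf (zero_ext J f) else 0)"
proof (cases "f summable_on J")
  case True
  then have "zero_ext J f summable_on UNIV"
    by (simp add: summable_on_zero_ext_UNIV)
  then have "(zero_ext J f has_sum infsum (zero_ext J f) UNIV) UNIV" by simp
  then have "suminf (zero_ext J f) = infsum (zero_ext J f) UNIV"
    using has_sum_imp_sums sums_unique by metis
  also have "\<dots> = infsum f J" by (rule infsum_cong_neutral) (auto simp: zero_ext_def)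
  finally show ?thesis using True by (simp add: summable_on_zero_ext)
next
  case False
  then show ?thesis using infsum_not_exists[OF False] by (simp add: summable_on_zero_ext)
qed

lemma zero_ext_measurable:
  "(\<And>i. i \<in> J \<Longrightarrow> f i \<in> borel_measurable M) \<Longrightarrow> (\<lambda>x. zero_ext J (\<lambda>i. f i x) i) \<in> borel_measurable M"
  for f :: "nat \<Rightarrow> 'b \<Rightarrow> complex"
  by (cases "i \<in> J") (auto simp: zero_ext_def)

lemma borel_measurable_infsum:
  fixes f :: "nat \<Rightarrow> 'b \<Rightarrow> complex"
  assumes "\<And>i. i \<in> J \<Longrightarrow> f i \<in> borel_measurable M"
  shows "(\<lambda>x. \<Sum>\<^sub>\<infinity>i\<in>J. f i x) \<in> borel_measurable M"
proof -
  have [measurable]: "(\<lambda>x. zero_ext J (\<lambda>i. f i x) i) \<in> borel_measurable M" for i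
    using assms by (rule zero_ext_measurable)
  show ?thesis unfolding infsum_zero_ext by measurable
qed

lemma summable_zero_ext_abs:
  fixes M :: "nat \<Rightarrow> real"
  assumes "M summable_on J"
  shows "summable (zero_ext J (\<lambda>i. \<bar>M i\<bar>))"
proof -
  have "(\<lambda>i. \<bar>M i\<bar>) summable_on J"
    using assms summable_on_iff_abs_summable_on_real[of M J] by simp
  then have "zero_ext J (\<lambda>i. \<bar>M i\<bar>) summable_on UNIV"
    by (simp add: summable_on_zero_ext_UNIV)
  then show ?thesis by (rule summable_on_imp_summable)
qed

text \<open>Tonelli: the sum of the integrals of the norms is finite, hence so is almost everywhere the sum of
the norms.\<close>

lemma AE_summable_on:
  fixes t :: "nat \<Rightarrow> 'b \<Rightarrow> complex"
  assumes "M summable_on J" "\<And>i. i \<in> J \<Longrightarrow> integrable N (t i)" "\<And>i. i \<in> J \<Longrightarrow> (LINT x|N. norm (t i x)) \<le> M i"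
  shows "AE x in N. (\<lambda>i. t i x) summable_on J"
proof -
  let ?g = "\<lambda>i x. zero_ext J (\<lambda>i. t i x) i"
  have [measurable]: "?g i \<in> borel_measurable N" for i
    using assms(2) by (intro zero_ext_measurable) auto
  have bound: "(\<integral>\<^sup>+x. ennreal (norm (?g i x)) \<partial>N) \<le> ennreal (zero_ext J (\<lambda>i. \<bar>M i\<bar>) i)" for i
  proof (cases "i \<in> J")
    case True
    have "(\<integral>\<^sup>+x. ennreal (norm (t i x)) \<partial>N) = ennreal (LINT x|N. norm (t i x))"
      using assms(2)[OF True] by (intro nn_integral_eq_integral) auto
    also have "\<dots> \<le> ennreal \<bar>M i\<bar>" using assms(3)[OF True] by (intro ennreal_leI) linarith
    finally show ?thesis using True by (simp add: zero_ext_def)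
  qed (simp add: zero_ext_def)
  have "(\<integral>\<^sup>+x. (\<Sum>i. ennreal (norm (?g i x))) \<partial>N) = (\<Sum>i. \<integral>\<^sup>+x. ennreal (norm (?g i x)) \<partial>N)"
    by (intro nn_integral_suminf) measurable
  also have "\<dots> \<le> (\<Sum>i. ennreal (zero_ext J (\<lambda>i. \<bar>M i\<bar>) i))"
    by (intro suminf_le bound) auto
  also have "\<dots> < \<infinity>"
    using ennreal_suminf_neq_top[OF summable_zero_ext_abs[OF assms(1)]] by (simp add: zero_ext_def less_top[symmetric])
  finally have "AE x in N. (\<Sum>i. ennreal (norm (?g i x))) \<noteq> \<infinity>"
    by (intro nn_integral_PInf_AE) (auto simp: less_top[symmetric])
  then show ?thesis by eventually_elim (simp add: summable_on_zero_ext less_top[symmetric])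
qed

text \<open>The regularised integrals of the terms are bounded by a multiple of \<open>M i\<close> that does not depend on \<open>\<epsilon>\<close>, so the Weierstrass
criterion gives uniform convergence up to \<open>\<epsilon> = 0\<close>, and with it continuity and holomorphy of the sum.\<close>

theorem osc_holo_infsum:
  fixes \<theta> :: "'p::{first_countable_topology,t2_space} \<Rightarrow> real^'n \<Rightarrow> real"
    and t :: "nat \<Rightarrow> complex \<times> 'p \<Rightarrow> real^'n \<Rightarrow> complex"
  assumes \<theta>: "continuous_on (K \<times> (- {0})) (\<lambda>(p, \<xi>). \<theta> p \<xi>)"
    and M: "M summable_on J"
    and t: "\<And>i. i \<in> J \<Longrightarrow> \<exists>I. osc_holo Z K \<theta> (t i) I"
    and int: "\<And>i q. i \<in> J \<Longrightarrow> q \<in> Z \<times> K \<Longrightarrow> integrable lborel (t i q)"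
    and bound: "\<And>i q. i \<in> J \<Longrightarrow> q \<in> Z \<times> K \<Longrightarrow> (LINT \<xi>|lborel. norm (t i q \<xi>)) \<le> M i"
  shows "\<exists>I. osc_holo Z K \<theta> (\<lambda>q \<xi>. \<Sum>\<^sub>\<infinity>i\<in>J. t i q \<xi>) I"
proof -
  define s where "s i q \<xi> = zero_ext J (\<lambda>i. t i q \<xi>) i" for i q \<xi>
  define L where "L = zero_ext J (\<lambda>i. \<bar>M i\<bar>)"
  have L: "summable L" "\<And>i. 0 \<le> L i"
    using summable_zero_ext_abs[OF M] by (auto simp: L_def zero_ext_def)
  have "\<exists>I. osc_holo Z K \<theta> (s i) I" for i
  proof (cases "i \<in> J")
    case True
    then have "s i = t i" by (simp add: s_def[abs_def] zero_ext_def)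
    then show ?thesis using t[OF True] by simp
  next
    case False
    then have "s i = (\<lambda>q \<xi>. 0)" by (simp add: s_def[abs_def] zero_ext_def)
    then show ?thesis using osc_holo_zero by metis
  qed
  then obtain I where I: "\<And>i. osc_holo Z K \<theta> (s i) (I i)" by metis
  have Ic: "osc_continuous (Z \<times> K) (\<lambda>q. \<theta> (snd q)) (s i) (I i)" for i
    using I by (simp add: osc_holo_def)
  have sint: "integrable lborel (s i q)" "(LINT \<xi>|lborel. norm (s i q \<xi>)) \<le> L i" if "q \<in> Z \<times> K" for i q
    using int[of i q] bound[of i q] that by (cases "i \<in> J"; force simp: s_def[abs_def] zero_ext_def L_def)+
  define T where "T q \<xi> = (\<Sum>i. s i q \<xi>)" for q \<xi>
  have ae: "AE \<xi> in lborel. summable (\<lambda>i. norm (s i q \<xi>))" if q: "q \<in> Z \<times> K" for q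
  proof -
    have "AE \<xi> in lborel. (\<lambda>i. t i q \<xi>) summable_on J"
      using int bound q by (intro AE_summable_on[OF M]) auto
    then show ?thesis
    proof eventually_elim
      case (elim \<xi>)
      then show ?case
        using summable_suminf_not_top[of "\<lambda>i. norm (s i q \<xi>)"] by (simp add: summable_on_zero_ext s_def less_top[symmetric])
    qed
  qed
  have smeas: "s i q \<in> borel_measurable borel" if "q \<in> Z \<times> K" for i q
    using sint(1)[OF that] by auto
  have Tmeas: "T q \<in> borel_measurable borel" if "q \<in> Z \<times> K" for q
    unfolding T_def[abs_def] using smeas[OF that] by (intro borel_measurable_suminf)
  have reg: "integrable lborel (\<lambda>\<xi>. \<kappa> (\<epsilon> *\<^sub>R \<xi>) * exp (\<i> * of_real (\<theta> (snd q) \<xi>)) * T q \<xi>)"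
      "osc_reg \<kappa> (\<lambda>q. \<theta> (snd q)) T \<epsilon> q = (\<Sum>i. osc_reg \<kappa> (\<lambda>q. \<theta> (snd q)) (s i) \<epsilon> q)"
    if \<kappa>: "schwartz \<kappa>" and q: "q \<in> Z \<times> K" for \<kappa> :: "real^'n \<Rightarrow> complex" and \<epsilon> q
  proof -
    obtain B where B: "B > 0" "\<And>u. norm (\<kappa> u) \<le> B" by (rule schwartz_bounded[OF \<kappa>]) (rule that)
    have ts: "continuous_on (- {0}) (\<theta> (snd q))" using q by (intro phase_slice[OF \<theta>]) auto
    define w where "w \<xi> = \<kappa> (\<epsilon> *\<^sub>R \<xi>) * exp (\<i> * of_real (\<theta> (snd q) \<xi>))" for \<xi>
    note wi = weighted_integrable[OF \<kappa> ts sint(1)[OF q] B(2), of \<epsilon>, folded w_def]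
    have ae1: "AE \<xi> in lborel. summable (\<lambda>i. norm (w \<xi> * s i q \<xi>))"
      using ae[OF q] by eventually_elim (auto simp: norm_mult intro: summable_mult)
    have sm: "summable (\<lambda>i. LINT \<xi>|lborel. norm (w \<xi> * s i q \<xi>))"
    proof (rule summable_comparison_test')
      show "summable (\<lambda>i. B * L i)" using L(1) by (rule summable_mult)
      fix i
      have "(LINT \<xi>|lborel. norm (w \<xi> * s i q \<xi>)) \<le> B * L i"
        using wi(3)[of i] mult_left_mono[OF sint(2)[OF q, of i], of B] B(1) by linarith
      then show "norm (LINT \<xi>|lborel. norm (w \<xi> * s i q \<xi>)) \<le> B * L i" by simp
    qed
    have e: "AE \<xi> in lborel. (\<Sum>i. w \<xi> * s i q \<xi>) = w \<xi> * T q \<xi>"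
      using ae[OF q] by eventually_elim (auto simp: T_def intro: suminf_mult summable_norm_cancel)
    have wm: "w \<in> borel_measurable lborel"
      using weight_measurable[OF \<kappa> ts, of \<epsilon>] by (simp add: w_def[abs_def])
    have m1: "(\<lambda>\<xi>. w \<xi> * T q \<xi>) \<in> borel_measurable lborel"
      by (rule borel_measurable_times) (use wm Tmeas[OF q] in auto)
    have m2: "(\<lambda>\<xi>. \<Sum>i. w \<xi> * s i q \<xi>) \<in> borel_measurable lborel"
      using wi(1) by (intro borel_measurable_suminf) auto
    have "integrable lborel (\<lambda>\<xi>. \<Sum>i. w \<xi> * s i q \<xi>)"
      by (rule integrable_suminf[OF wi(1) ae1 sm])
    then show "integrable lborel (\<lambda>\<xi>. \<kappa> (\<epsilon> *\<^sub>R \<xi>) * exp (\<i> * of_real (\<theta> (snd q) \<xi>)) * T q \<xi>)"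
      using integrable_cong_AE[OF m2 m1 e] by (simp add: w_def)
    have "(LINT \<xi>|lborel. w \<xi> * T q \<xi>) = (LINT \<xi>|lborel. (\<Sum>i. w \<xi> * s i q \<xi>))"
      using integral_cong_AE[OF m2 m1 e] by simp
    also have "\<dots> = (\<Sum>i. LINT \<xi>|lborel. w \<xi> * s i q \<xi>)"
      by (rule integral_suminf[OF wi(1) ae1 sm])
    finally show "osc_reg \<kappa> (\<lambda>q. \<theta> (snd q)) T \<epsilon> q = (\<Sum>i. osc_reg \<kappa> (\<lambda>q. \<theta> (snd q)) (s i) \<epsilon> q)"
      by (simp add: osc_reg_def w_def)
  qed
  have Rb: "norm (osc_reg \<kappa> (\<lambda>q. \<theta> (snd q)) (s i) \<epsilon> q) \<le> B * L i"
    if "schwartz \<kappa>" "\<And>u. norm (\<kappa> u) \<le> B" "B > 0" "q \<in> Z \<times> K" for \<kappa> :: "real^'n \<Rightarrow> complex" and \<epsilon> q i B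
  proof -
    have ts: "continuous_on (- {0}) (\<theta> (snd q))" using that by (intro phase_slice[OF \<theta>]) auto
    show ?thesis
      using weighted_integrable(2)[OF that(1) ts sint(1)[OF that(4)] that(2), of \<epsilon> i]
        mult_left_mono[OF sint(2)[OF that(4), of i], of B] that(3) unfolding osc_reg_def by linarith
  qed
  have "osc_holo Z K \<theta> T (\<lambda>q. \<Sum>i. I i q)"
    unfolding osc_holo_def osc_continuous_def
  proof (intro conjI allI impI ballI)
    fix \<kappa> :: "real^'n \<Rightarrow> complex" assume "schwartz \<kappa> \<and> \<kappa> 0 = 1"
    then have \<kappa>: "schwartz \<kappa>" "\<kappa> 0 = 1" by auto
    obtain B where B: "B > 0" "\<And>u. norm (\<kappa> u) \<le> B" by (rule schwartz_bounded[OF \<kappa>(1)]) (rule that)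
    show "integrable lborel (\<lambda>\<xi>. \<kappa> (\<epsilon> *\<^sub>R \<xi>) * exp (\<i> * of_real (\<theta> (snd q) \<xi>)) * T q \<xi>)"
      if "q \<in> Z \<times> K" for q \<epsilon>
      by (rule reg(1)[OF \<kappa>(1) that])
    let ?A = "{0::real..} \<times> (Z \<times> K)"
    define G where "G i = (\<lambda>(\<epsilon>, q). if \<epsilon> = 0 then I i q else osc_reg \<kappa> (\<lambda>q. \<theta> (snd q)) (s i) \<epsilon> q)" for i
    \<comment> \<open>The bound persists in the limit \<open>\<epsilon> = 0\<close>.\<close>
    have Ib: "norm (I i q) \<le> B * L i" if q: "q \<in> Z \<times> K" for i q
    proof (rule Lim_norm_ubound[of "at_right (0::real)"])
      show "((\<lambda>\<epsilon>. osc_reg \<kappa> (\<lambda>q. \<theta> (snd q)) (s i) \<epsilon> q) \<longlongrightarrow> I i q) (at_right 0)"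
        using osc_limit[OF Ic q] \<kappa> unfolding has_oscillatory_integral_def osc_reg_def by blast
      show "\<forall>\<^sub>F \<epsilon> in at_right 0. norm (osc_reg \<kappa> (\<lambda>q. \<theta> (snd q)) (s i) \<epsilon> q) \<le> B * L i"
        using Rb[OF \<kappa>(1) B(2,1) q] by simp
    qed simp
    have "norm (G i p) \<le> B * L i" if "p \<in> ?A" for i p
      using that Ib Rb[OF \<kappa>(1) B(2,1)] by (auto simp: G_def)
    then have "uniform_limit ?A (\<lambda>n p. \<Sum>i<n. G i p) (\<lambda>p. suminf (\<lambda>i. G i p)) sequentially"
      using summable_mult[OF L(1), of B] by (rule Weierstrass_m_test)
    moreover have "\<forall>\<^sub>F n in sequentially. continuous_on ?A (\<lambda>p. \<Sum>i<n. G i p)"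
      unfolding G_def using osc_continuousD(2)[OF Ic \<kappa>] by (intro always_eventually allI continuous_on_sum)
    ultimately have "continuous_on ?A (\<lambda>p. suminf (\<lambda>i. G i p))"
      by (intro uniform_limit_theorem) auto
    then show "continuous_on ?A (\<lambda>(\<epsilon>, q). if \<epsilon> = 0 then (\<Sum>i. I i q) else osc_reg \<kappa> (\<lambda>q. \<theta> (snd q)) T \<epsilon> q)"
      by (rule continuous_on_cong[THEN iffD1, rotated 2]) (use reg(2)[OF \<kappa>(1)] in \<open>auto simp: G_def\<close>)
    fix \<epsilon> :: real and p assume e: "\<epsilon> > 0" and p: "p \<in> K"
    have "(\<lambda>z. \<Sum>i. osc_reg \<kappa> (\<lambda>q. \<theta> (snd q)) (s i) \<epsilon> (z, p)) holomorphic_on interior Z"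
    proof (rule holomorphic_uniform_sequence[where f="\<lambda>n z. \<Sum>i<n. osc_reg \<kappa> (\<lambda>q. \<theta> (snd q)) (s i) \<epsilon> (z, p)"])
      show "(\<lambda>z. \<Sum>i<n. osc_reg \<kappa> (\<lambda>q. \<theta> (snd q)) (s i) \<epsilon> (z, p)) holomorphic_on interior Z" for n
        using I \<kappa> e p unfolding osc_holo_def by (intro holomorphic_on_sum) blast
      fix z assume z: "z \<in> interior Z"
      obtain r where r: "r > 0" "cball z r \<subseteq> interior Z" by (rule interior_contains_cball[OF z]) (rule that)
      have rZ: "w \<in> Z" if "w \<in> cball z r" for w using subsetD[OF interior_subset subsetD[OF r(2) that]] .
      have "uniform_limit (cball z r) (\<lambda>n z. \<Sum>i<n. osc_reg \<kappa> (\<lambda>q. \<theta> (snd q)) (s i) \<epsilon> (z, p))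
          (\<lambda>z. \<Sum>i. osc_reg \<kappa> (\<lambda>q. \<theta> (snd q)) (s i) \<epsilon> (z, p)) sequentially"
        using summable_mult[OF L(1), of B]
        by (rule Weierstrass_m_test[rotated]) (rule Rb[OF \<kappa>(1) B(2,1)], use rZ p in auto)
      then show "\<exists>d>0. cball z d \<subseteq> interior Z \<and> uniform_limit (cball z d) (\<lambda>n z. \<Sum>i<n. osc_reg \<kappa> (\<lambda>q. \<theta> (snd q)) (s i) \<epsilon> (z, p))
          (\<lambda>z. \<Sum>i. osc_reg \<kappa> (\<lambda>q. \<theta> (snd q)) (s i) \<epsilon> (z, p)) sequentially"
        using r by blast
    qed simp
    then show "(\<lambda>z. osc_reg \<kappa> (\<lambda>q. \<theta> (snd q)) T \<epsilon> (z, p)) holomorphic_on interior Z"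
      by (rule holomorphic_transform) (use reg(2)[OF \<kappa>(1)] p subsetD[OF interior_subset, of _ Z] in auto)
  qed
  then have "osc_holo Z K \<theta> (\<lambda>q \<xi>. \<Sum>\<^sub>\<infinity>i\<in>J. t i q \<xi>) (\<lambda>q. \<Sum>i. I i q)"
  proof (rule osc_holo_cong_AE[OF _ \<theta> Tmeas])
    show "(\<lambda>\<xi>. \<Sum>\<^sub>\<infinity>i\<in>J. t i q \<xi>) \<in> borel_measurable borel" if "q \<in> Z \<times> K" for q
      using borel_measurable_integrable[OF int[OF _ that]] by (intro borel_measurable_infsum) simp
    show "AE \<xi> in lborel. T q \<xi> = (\<Sum>\<^sub>\<infinity>i\<in>J. t i q \<xi>)" if q: "q \<in> Z \<times> K" for q
    proof -
      have "AE \<xi> in lborel. (\<lambda>i. t i q \<xi>) summable_on J"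
        using int bound q by (intro AE_summable_on[OF M]) auto
      then show ?thesis
      proof eventually_elim
        case (elim \<xi>)
        have "T q \<xi> = suminf (zero_ext J (\<lambda>i. t i q \<xi>))" by (simp add: T_def s_def)
        with elim show ?case by (simp add: infsum_zero_ext summable_on_zero_ext)
      qed
    qed
  qed
  then show ?thesis by blast
qed

section \<open>Poly-log-homogeneous amplitudes\<close>

lemma symbol_log_homogeneous:
  fixes B :: "'q::topological_space \<Rightarrow> 'v::euclidean_space \<Rightarrow> complex"
  assumes "compact Q" "continuous_on Q \<delta>" "\<And>k. smooth_in k Q B"
    and "\<And>q r \<xi>. q \<in> Q \<Longrightarrow> r > 0 \<Longrightarrow> \<xi> \<noteq> 0 \<Longrightarrow> B q (r *\<^sub>R \<xi>) = B q \<xi>"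
  shows "\<exists>m. \<forall>k. symbol k Q m (\<lambda>q \<xi>. of_real (norm \<xi>) powr \<delta> q * of_real (ln (norm \<xi>) ^ l) * B q \<xi>)"
proof -
  have "bounded (\<delta> ` Q)"
    using assms(1,2) by (intro compact_imp_bounded compact_continuous_image)
  then obtain R where R: "\<forall>x\<in>\<delta> ` Q. norm x \<le> R" unfolding bounded_iff by blast
  have "symbol k Q (R + real l * 1 + 0) (\<lambda>q \<xi>. of_real (norm \<xi>) powr \<delta> q * of_real (ln (norm \<xi>)) ^ l * B q \<xi>)" for k
  proof (intro symbol_mult symbol_power symbol_ln_norm)
    show "symbol k Q R (\<lambda>q (\<xi>::'v). of_real (norm \<xi>) powr \<delta> q)"
    proof (rule symbol_norm_powr[OF assms(1,2)])
      fix q assume "q \<in> Q"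
      then have "norm (\<delta> q) \<le> R" using R by blast
      then show "Re (\<delta> q) \<le> R" using complex_Re_le_cmod[of "\<delta> q"] by linarith
    qed
    show "symbol k Q 0 B"
      by (rule homogeneous_symbol[OF assms(1,3)]) (use assms(4) in auto)
  qed
  then show ?thesis by (intro exI[of _ "R + real l * 1 + 0"]) simp
qed

lemma nonstationary_phase_times:
  fixes \<theta> :: "'p::{first_countable_topology,t2_space} \<Rightarrow> 'v::euclidean_space \<Rightarrow> real" and Z :: "complex set"
  assumes "nonstationary_phase K \<theta>" "compact Z"
  shows "nonstationary_phase (Z \<times> K) (\<lambda>q. \<theta> (snd q))"
proof -
  interpret nonstationary_phase K \<theta> by (rule assms(1))
  show ?thesis
  proof
    show "compact (Z \<times> K)" using assms(2) compact_Q by (rule compact_Times)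
    show "smooth_in k (Z \<times> K) (\<lambda>q \<xi>. complex_of_real (\<theta> (snd q) \<xi>))" for k
      by (rule smooth_in_reparam[OF phase_smooth]) (auto intro!: continuous_intros)
  qed (use phase_homogeneous nonstationary in \<open>auto simp: dir_deriv_def\<close>)
qed

lemma nonstationary_phase_continuous:
  assumes "nonstationary_phase K \<theta>"
  shows "continuous_on (K \<times> (- {0})) (\<lambda>(p, \<xi>). \<theta> p \<xi>)"
proof -
  interpret nonstationary_phase K \<theta> by (rule assms(1))
  have "continuous_on (K \<times> (- {0})) (\<lambda>p. complex_of_real (\<theta> (fst p) (snd p)))"
    using phase_smooth[of 0] by (simp add: case_prod_unfold)
  then have "continuous_on (K \<times> (- {0})) (\<lambda>p. Re (complex_of_real (\<theta> (fst p) (snd p))))"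
    by (rule continuous_on_Re)
  then show ?thesis by (simp add: case_prod_unfold)
qed

definition amplitude_term ::
  "complex \<Rightarrow> nat \<Rightarrow> (complex \<Rightarrow> 'a \<Rightarrow> 'a \<Rightarrow> real^'n \<Rightarrow> complex) \<Rightarrow> complex \<times> 'a \<times> 'a \<Rightarrow> real^'n \<Rightarrow> complex" where
  "amplitude_term d l b q = log_homogeneous_term (d + fst q) l (b (fst q)) (fst (snd q)) (snd (snd q))"

lemma osc_holo_amplitude_term:
  fixes \<theta> :: "'a::{first_countable_topology,t2_space} \<times> 'a \<Rightarrow> real^'n \<Rightarrow> real"
  assumes "nonstationary_phase K \<theta>" "compact Z"
    and smooth: "\<And>k. smooth_in k (Z \<times> K) (\<lambda>q \<xi>. b (fst q) (fst (snd q)) (snd (snd q)) (\<xi> /\<^sub>R norm \<xi>))"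
    and hol: "\<And>x y \<eta>. (x, y) \<in> K \<Longrightarrow> \<eta> \<in> sphere 0 1 \<Longrightarrow> (\<lambda>z. b z x y \<eta>) holomorphic_on interior Z"
  shows "\<exists>I. osc_holo Z K \<theta> (amplitude_term d l b) I"
    and "\<And>q. q \<in> Z \<times> K \<Longrightarrow> amplitude_term d l b q \<in> borel_measurable borel"
proof -
  note ph = nonstationary_phase_times[OF assms(1,2)]
  interpret nonstationary_phase "Z \<times> K" "\<lambda>q. \<theta> (snd q)" by (rule ph)
  define B where "B q \<xi> = b (fst q) (fst (snd q)) (snd (snd q)) (\<xi> /\<^sub>R norm \<xi>)" for q \<xi>
  define u where "u q \<xi> = of_real (norm \<xi>) powr (d + fst q) * of_real (ln (norm \<xi>) ^ l) * B q \<xi>" for q \<xi>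
  have "\<exists>m. \<forall>k. symbol k (Z \<times> K) m u"
    unfolding u_def[abs_def]
  proof (rule symbol_log_homogeneous[OF compact_Q])
    show "continuous_on (Z \<times> K) (\<lambda>q. d + fst q)" by (intro continuous_intros)
    show "smooth_in k (Z \<times> K) B" for k using smooth unfolding B_def[abs_def] .
    fix q and r :: real and \<xi> :: "real^'n" assume r: "r > 0"
    then have i: "inverse (r * norm \<xi>) * r = inverse (norm \<xi>)" by simp
    show "B q (r *\<^sub>R \<xi>) = B q \<xi>" unfolding B_def norm_scaleR scaleR_scaleR abs_of_pos[OF r] i ..
  qed
  then obtain m where m: "\<And>k. symbol k (Z \<times> K) m u" by blast
  have ext: "amplitude_term d l b = exterior u"
    by (intro ext) (simp add: amplitude_term_def log_homogeneous_term_def exterior_def u_def B_def)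
  show "\<exists>I. osc_holo Z K \<theta> (amplitude_term d l b) I"
    unfolding ext
  proof (rule osc_holo_symbol[OF ph m])
    fix p and \<xi> :: "real^'n" assume p: "p \<in> K" and xi: "1 \<le> norm \<xi>"
    have "norm \<xi> \<noteq> 0" using xi by linarith
    then have "\<xi> /\<^sub>R norm \<xi> \<in> sphere 0 1" by simp
    with p have "(\<lambda>z. b z (fst p) (snd p) (\<xi> /\<^sub>R norm \<xi>)) holomorphic_on interior Z"
      by (intro hol) auto
    moreover have "complex_of_real (norm \<xi>) \<noteq> 0" using xi by auto
    ultimately show "(\<lambda>z. u (z, p) \<xi>) holomorphic_on interior Z"
      unfolding u_def B_def fst_conv snd_conv by (intro holomorphic_intros) auto
  qed
  show "amplitude_term d l b q \<in> borel_measurable borel" if "q \<in> Z \<times> K" for q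
    using exterior_measurable[OF m[of 0] that] unfolding ext exterior_def[abs_def] .
qed

text \<open>The general form of both kinds of amplitudes in question: a single amplitude is the case \<open>Z = {0}\<close>.
Finitely many terms are treated as symbols, the remaining series as an
integrable amplitude.\<close>

theorem osc_holo_amplitude:
  fixes \<theta> :: "'a::{first_countable_topology,t2_space} \<times> 'a \<Rightarrow> real^'n \<Rightarrow> real" and d :: "nat \<Rightarrow> complex"
  assumes ph: "nonstationary_phase K \<theta>" "compact Z"
    and a0: "\<exists>I. osc_holo Z K \<theta> (\<lambda>q. a0 (fst q) (fst (snd q)) (snd (snd q))) I"
      "\<And>q. q \<in> Z \<times> K \<Longrightarrow> a0 (fst q) (fst (snd q)) (snd (snd q)) \<in> borel_measurable borel"
    and smooth: "\<And>k \<iota>. \<iota> \<in> J \<Longrightarrow> smooth_in k (Z \<times> K) (\<lambda>q \<xi>. b \<iota> (fst q) (fst (snd q)) (snd (snd q)) (\<xi> /\<^sub>R norm \<xi>))"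
    and hol: "\<And>\<iota> x y \<eta>. \<iota> \<in> J \<Longrightarrow> (x, y) \<in> K \<Longrightarrow> \<eta> \<in> sphere 0 1 \<Longrightarrow> (\<lambda>z. b \<iota> z x y \<eta>) holomorphic_on interior Z"
    and F: "finite F" "F \<subseteq> J" "L1_summable Z (J - F) (\<lambda>z \<iota>. log_homogeneous_term (d \<iota> + z) (l \<iota>) (b \<iota> z))"
    and a: "\<And>z x y \<xi>. z \<in> Z \<Longrightarrow> (x, y) \<in> K \<Longrightarrow>
      a z x y \<xi> = a0 z x y \<xi> + (\<Sum>\<^sub>\<infinity>\<iota>\<in>J. log_homogeneous_term (d \<iota> + z) (l \<iota>) (b \<iota> z) x y \<xi>)"
  shows "\<exists>I. osc_holo Z K \<theta> (\<lambda>q. a (fst q) (fst (snd q)) (snd (snd q))) I"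
proof -
  let ?t = "\<lambda>\<iota>. amplitude_term (d \<iota>) (l \<iota>) (b \<iota>)"
  let ?a0 = "\<lambda>q. a0 (fst q) (fst (snd q)) (snd (snd q))"
  note \<theta> = nonstationary_phase_continuous[OF ph(1)]
  have t: "\<exists>I. osc_holo Z K \<theta> (?t \<iota>) I" "\<And>q. q \<in> Z \<times> K \<Longrightarrow> ?t \<iota> q \<in> borel_measurable borel" if "\<iota> \<in> J" for \<iota>
    using osc_holo_amplitude_term[OF ph smooth hol] that by blast+
  obtain M where M: "M summable_on (J - F)"
    and M': "\<And>\<iota> z x y. \<iota> \<in> J - F \<Longrightarrow> z \<in> Z \<Longrightarrow> integrable lborel (log_homogeneous_term (d \<iota> + z) (l \<iota>) (b \<iota> z) x y) \<and>
            (LINT \<xi>|lborel. norm (log_homogeneous_term (d \<iota> + z) (l \<iota>) (b \<iota> z) x y \<xi>)) \<le> M \<iota>"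
    using F(3) unfolding L1_summable_def by blast
  have int: "integrable lborel (?t \<iota> q)" "(LINT \<xi>|lborel. norm (?t \<iota> q \<xi>)) \<le> M \<iota>" if "\<iota> \<in> J - F" "q \<in> Z \<times> K" for \<iota> q
    using M'[OF that(1), of "fst q" "fst (snd q)" "snd (snd q)"] that(2) by (auto simp: amplitude_term_def)
  obtain I0 where I0: "osc_holo Z K \<theta> ?a0 I0" using a0(1) by blast
  have "\<forall>\<iota>\<in>J. \<exists>I. osc_holo Z K \<theta> (?t \<iota>) I" using t(1) by blast
  then obtain I1 where I1: "\<And>\<iota>. \<iota> \<in> J \<Longrightarrow> osc_holo Z K \<theta> (?t \<iota>) (I1 \<iota>)" by metis
  have "\<exists>I. osc_holo Z K \<theta> (\<lambda>q \<xi>. \<Sum>\<^sub>\<infinity>\<iota>\<in>J - F. ?t \<iota> q \<xi>) I"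
  proof (rule osc_holo_infsum[where t="?t", OF \<theta> M])
    show "\<exists>I. osc_holo Z K \<theta> (?t \<iota>) I" if "\<iota> \<in> J - F" for \<iota> by (rule t(1)) (use that in simp)
    show "integrable lborel (?t \<iota> q)" "(LINT \<xi>|lborel. norm (?t \<iota> q \<xi>)) \<le> M \<iota>"
      if "\<iota> \<in> J - F" "q \<in> Z \<times> K" for \<iota> q
      using int[OF that] .
  qed
  then obtain I2 where I2: "osc_holo Z K \<theta> (\<lambda>q \<xi>. \<Sum>\<^sub>\<infinity>\<iota>\<in>J - F. ?t \<iota> q \<xi>) I2" by blast
  have IF: "osc_holo Z K \<theta> (\<lambda>q \<xi>. \<Sum>\<iota>\<in>F. ?t \<iota> q \<xi>) (\<lambda>q. \<Sum>\<iota>\<in>F. I1 \<iota> q)"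
    using F(2) by (intro osc_holo_sum[OF F(1)] I1) auto
  define c where "c q \<xi> = ?a0 q \<xi> + ((\<Sum>\<iota>\<in>F. ?t \<iota> q \<xi>) + (\<Sum>\<^sub>\<infinity>\<iota>\<in>J - F. ?t \<iota> q \<xi>))" for q \<xi>
  have C: "osc_holo Z K \<theta> c (\<lambda>q. I0 q + ((\<Sum>\<iota>\<in>F. I1 \<iota> q) + I2 q))"
    unfolding c_def[abs_def] by (rule osc_holo_add[OF I0 osc_holo_add[OF IF I2]])
  have aq: "a (fst q) (fst (snd q)) (snd (snd q)) \<xi> = ?a0 q \<xi> + (\<Sum>\<^sub>\<infinity>\<iota>\<in>J. ?t \<iota> q \<xi>)" if "q \<in> Z \<times> K" for q \<xi>
    using a[of "fst q" "fst (snd q)" "snd (snd q)" \<xi>] that by (auto simp: amplitude_term_def)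
  have cm: "c q \<in> borel_measurable borel" if q: "q \<in> Z \<times> K" for q
  proof -
    have "(\<lambda>\<xi>. \<Sum>\<iota>\<in>F. ?t \<iota> q \<xi>) \<in> borel_measurable borel"
      using t(2) q F(2) by (intro borel_measurable_sum) auto
    moreover have "(\<lambda>\<xi>. \<Sum>\<^sub>\<infinity>\<iota>\<in>J - F. ?t \<iota> q \<xi>) \<in> borel_measurable borel"
      using t(2) q by (intro borel_measurable_infsum) auto
    ultimately show ?thesis
      unfolding c_def[abs_def] using a0(2)[OF q] by (intro borel_measurable_add)
  qed
  have am: "a (fst q) (fst (snd q)) (snd (snd q)) \<in> borel_measurable borel" if q: "q \<in> Z \<times> K" for q
  proof -
    have "(\<lambda>\<xi>. ?a0 q \<xi> + (\<Sum>\<^sub>\<infinity>\<iota>\<in>J. ?t \<iota> q \<xi>)) \<in> borel_measurable borel"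
      using a0(2)[OF q] t(2) q by (intro borel_measurable_add borel_measurable_infsum) auto
    then show ?thesis using aq[OF q] by (simp cong: measurable_cong)
  qed
  have ae: "AE \<xi> in lborel. c q \<xi> = a (fst q) (fst (snd q)) (snd (snd q)) \<xi>" if q: "q \<in> Z \<times> K" for q
  proof -
    have "AE \<xi> in lborel. (\<lambda>\<iota>. ?t \<iota> q \<xi>) summable_on (J - F)"
      using int q by (intro AE_summable_on[OF M]) auto
    then show ?thesis
    proof eventually_elim
      case (elim \<xi>)
      have "(\<Sum>\<^sub>\<infinity>\<iota>\<in>F \<union> (J - F). ?t \<iota> q \<xi>) = (\<Sum>\<^sub>\<infinity>\<iota>\<in>F. ?t \<iota> q \<xi>) + (\<Sum>\<^sub>\<infinity>\<iota>\<in>J - F. ?t \<iota> q \<xi>)"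
        using F(1) elim by (intro infsum_Un_disjoint) auto
      moreover have "F \<union> (J - F) = J" using F(2) by auto
      ultimately show ?case using F(1) by (simp add: aq[OF q] c_def)
    qed
  qed
  show ?thesis using osc_holo_cong_AE[OF C \<theta> cm am ae] by blast
qed

section \<open>Gaussians and uniqueness of oscillatory integrals\<close>

text \<open>Polynomials times the Gaussian. The class is closed under differentiation, which makes its members Schwartz
functions. One regularising factor has to be exhibited: the defining property of oscillatory integrals
quantifies over all of them, and would determine no value if there were none.\<close>

inductive_set gauss_poly :: "(real^'n \<Rightarrow> complex) set" where
  gauss: "(\<lambda>u. of_real (exp (- (u \<bullet> u)))) \<in> gauss_poly"
| times: "f \<in> gauss_poly \<Longrightarrow> (\<lambda>u. of_real (u \<bullet> v) * f u) \<in> gauss_poly"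
| add: "f \<in> gauss_poly \<Longrightarrow> g \<in> gauss_poly \<Longrightarrow> (\<lambda>u. f u + g u) \<in> gauss_poly"
| cmult: "f \<in> gauss_poly \<Longrightarrow> (\<lambda>u. c * f u) \<in> gauss_poly"

lemma gauss_poly_derivative:
  fixes f :: "real^'n \<Rightarrow> complex"
  shows "f \<in> gauss_poly \<Longrightarrow> \<exists>f'. (\<forall>u. (f has_derivative f' u) (at u)) \<and> (\<forall>v. (\<lambda>u. f' u v) \<in> gauss_poly)"
proof (induction rule: gauss_poly.induct)
  case gauss
  show ?case
  proof (intro exI conjI allI)
    show "((\<lambda>u::real^'n. complex_of_real (exp (- (u \<bullet> u)))) has_derivative
        (\<lambda>w. (- 2) * (of_real (u \<bullet> w) * of_real (exp (- (u \<bullet> u)))))) (at u)" for u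
      by (auto intro!: derivative_eq_intros simp: inner_commute algebra_simps)
    show "(\<lambda>u::real^'n. (- 2) * (of_real (u \<bullet> v) * of_real (exp (- (u \<bullet> u))))) \<in> gauss_poly" for v
      by (intro gauss_poly.intros)
  qed
next
  case (times f v)
  then obtain f' where f': "\<And>u. (f has_derivative f' u) (at u)" "\<And>v. (\<lambda>u. f' u v) \<in> gauss_poly" by blast
  show ?case
  proof (intro exI conjI allI)
    show "((\<lambda>u. of_real (u \<bullet> v) * f u) has_derivative (\<lambda>w. of_real (u \<bullet> v) * f' u w + of_real (w \<bullet> v) * f u)) (at u)" for u
      by (auto intro!: derivative_eq_intros f')
    show "(\<lambda>u. of_real (u \<bullet> v) * f' u w + of_real (w \<bullet> v) * f u) \<in> gauss_poly" for w
      by (intro gauss_poly.add gauss_poly.times gauss_poly.cmult f' times)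
  qed
next
  case (add f g)
  then obtain f' g' where f': "\<And>u. (f has_derivative f' u) (at u)" "\<And>v. (\<lambda>u. f' u v) \<in> gauss_poly"
    and g': "\<And>u. (g has_derivative g' u) (at u)" "\<And>v. (\<lambda>u. g' u v) \<in> gauss_poly" by blast
  show ?case
    by (intro exI[of _ "\<lambda>u v. f' u v + g' u v"] conjI allI has_derivative_add f' g' gauss_poly.add)
next
  case (cmult f c)
  then obtain f' where f': "\<And>u. (f has_derivative f' u) (at u)" "\<And>v. (\<lambda>u. f' u v) \<in> gauss_poly" by blast
  show ?case
    by (intro exI[of _ "\<lambda>u v. c * f' u v"] conjI allI has_derivative_mult_right f' gauss_poly.cmult)
qed

lemma gauss_poly_bound:
  fixes f :: "real^'n \<Rightarrow> complex"
  shows "f \<in> gauss_poly \<Longrightarrow> \<exists>C. \<forall>u. norm u ^ m * norm (f u) \<le> C"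
proof (induction arbitrary: m rule: gauss_poly.induct)
  case gauss
  have "norm u ^ m * exp (- (u \<bullet> u)) \<le> 1 + real (m + 1) ^ (m + 1)" for u :: "real^'n"
  proof -
    define x where "x = u \<bullet> u"
    have x: "x \<ge> 0" "x = (norm u)\<^sup>2" by (auto simp: x_def power2_norm_eq_inner)
    have "(x / real (m + 1)) ^ (m + 1) \<le> (1 + x / real (m + 1)) ^ (m + 1)"
      using x by (intro power_mono) auto
    also have "\<dots> \<le> exp x"
    proof (rule exp_ge_one_plus_x_over_n_power_n)
      show "- real (m + 1) \<le> x" using x(1) by linarith
    qed simp
    finally have "x ^ (m + 1) / real (m + 1) ^ (m + 1) \<le> exp x" by (simp only: power_divide)
    moreover have "real (m + 1) ^ (m + 1) > 0" by (intro zero_less_power) simp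
    ultimately have 1: "x ^ (m + 1) \<le> real (m + 1) ^ (m + 1) * exp x"
      by (simp only: pos_divide_le_eq mult.commute)
    have "norm u ^ m \<le> 1 + x ^ (m + 1)"
    proof (cases "norm u \<le> 1")
      case True
      then have "norm u ^ m \<le> 1" by (intro power_le_one) auto
      then show ?thesis using x(1) by (smt (verit) zero_le_power)
    next
      case False
      then have "norm u ^ m \<le> norm u ^ (2 * (m + 1))" by (intro power_increasing) auto
      also have "\<dots> = x ^ (m + 1)" by (simp only: x(2) power_mult)
      finally show ?thesis by simp
    qed
    also have "\<dots> \<le> (1 + real (m + 1) ^ (m + 1)) * exp x"
    proof -
      have "1 \<le> exp x" using x(1) by simp
      then show ?thesis using 1 by (simp only: distrib_right mult_1)
    qed
    finally have "norm u ^ m * exp (- x) \<le> (1 + real (m + 1) ^ (m + 1)) * exp x * exp (- x)"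
      by (intro mult_right_mono) auto
    then show ?thesis by (simp add: x_def[symmetric] mult.assoc exp_minus_inverse)
  qed
  then show ?case by (intro exI[of _ "1 + real (m + 1) ^ (m + 1)"]) simp
next
  case (times f v)
  obtain C where C: "\<And>u. norm u ^ Suc m * norm (f u) \<le> C" using times.IH[of "Suc m"] by blast
  have "norm u ^ m * norm (of_real (u \<bullet> v) * f u) \<le> norm v * C" for u
  proof -
    have "norm u ^ m * norm (of_real (u \<bullet> v) * f u) \<le> norm u ^ m * ((norm u * norm v) * norm (f u))"
      using Cauchy_Schwarz_ineq2[of u v] by (simp add: norm_mult mult_left_mono mult_right_mono)
    also have "\<dots> = norm v * (norm u ^ Suc m * norm (f u))" by simp
    also have "\<dots> \<le> norm v * C" by (intro mult_left_mono C) auto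
    finally show ?thesis .
  qed
  then show ?case by blast
next
  case (add f g)
  obtain C D where "\<And>u. norm u ^ m * norm (f u) \<le> C" "\<And>u. norm u ^ m * norm (g u) \<le> D"
    using add.IH[of m] by blast
  moreover have "norm u ^ m * norm (f u + g u) \<le> norm u ^ m * norm (f u) + norm u ^ m * norm (g u)" for u
    using norm_triangle_ineq[of "f u" "g u"] by (simp add: mult_left_mono flip: distrib_left)
  ultimately have "norm u ^ m * norm (f u + g u) \<le> C + D" for u
    by (meson add_mono order_trans)
  then show ?case by blast
next
  case (cmult f c)
  obtain C where C: "\<And>u. norm u ^ m * norm (f u) \<le> C" using cmult.IH[of m] by blast
  have "norm u ^ m * norm (c * f u) \<le> norm c * C" for u
    using mult_left_mono[OF C[of u], of "norm c"] by (simp add: norm_mult mult_ac)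
  then show ?case by blast
qed

lemma gauss_poly_schwartz:
  fixes f :: "real^'n \<Rightarrow> complex"
  shows "f \<in> gauss_poly \<Longrightarrow> schwartz f"
proof -
  have "f \<in> gauss_poly \<Longrightarrow> rapidly_decreasing k f" for k and f :: "real^'n \<Rightarrow> complex"
  proof (induction k arbitrary: f)
    case 0
    obtain f' where f': "\<And>u. (f has_derivative f' u) (at u)" using gauss_poly_derivative[OF 0] by blast
    have "continuous_on UNIV f"
      using f' by (intro continuous_at_imp_continuous_on ballI) (blast intro: has_derivative_continuous)
    moreover have "bounded (range (\<lambda>u. norm u ^ m *\<^sub>R f u))" for m
    proof -
      obtain C where C: "\<And>u. norm u ^ m * norm (f u) \<le> C" using gauss_poly_bound[OF 0] by blast
      show ?thesis unfolding bounded_iff by (intro exI[of _ C]) (use C in auto)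
    qed
    ultimately show ?case by simp
  next
    case (Suc k)
    obtain f' where f': "\<And>u. (f has_derivative f' u) (at u)" "\<And>v. (\<lambda>u. f' u v) \<in> gauss_poly"
      using gauss_poly_derivative[OF Suc.prems] by blast
    have "frechet_derivative f (at u) = f' u" for u using frechet_derivative_at[OF f'(1)] by simp
    then show ?case using f' Suc.IH by (auto simp: differentiable_def)
  qed
  then show "f \<in> gauss_poly \<Longrightarrow> schwartz f" by (simp add: schwartz_def)
qed

definition gauss_reg :: "real^'n \<Rightarrow> complex" where
  "gauss_reg u = of_real (exp (- (u \<bullet> u)))"

lemma schwartz_gauss_reg: "schwartz gauss_reg" "gauss_reg 0 = 1"
  unfolding gauss_reg_def[abs_def] by (auto intro!: gauss_poly_schwartz gauss_poly.gauss)

text \<open>Both values are limits of the same Gaussian regularisation.\<close>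

lemma has_oscillatory_integral_unique:
  assumes "has_oscillatory_integral \<theta> a c" "has_oscillatory_integral \<theta> a d"
  shows "c = d"
proof -
  have L: "((\<lambda>\<epsilon>. LINT \<xi>|lborel. gauss_reg (\<epsilon> *\<^sub>R \<xi>) * exp (\<i> * of_real (\<theta> \<xi>)) * a \<xi>) \<longlongrightarrow> x) (at_right 0)"
    if "has_oscillatory_integral \<theta> a x" for x
    using that schwartz_gauss_reg unfolding has_oscillatory_integral_def by blast
  show ?thesis by (rule tendsto_unique[OF _ L[OF assms(1)] L[OF assms(2)]]) simp
qed

lemma fio_kernel_eq:
  "has_oscillatory_integral (\<theta> x y) (a x y) c \<Longrightarrow> fio_kernel \<theta> a x y = c"
  unfolding fio_kernel_def using has_oscillatory_integral_unique by blast

section \<open>Smooth functions on manifolds in charts\<close>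

lemma smooth_in_chart:
  fixes m :: "'s \<Rightarrow> 'e::euclidean_space" and g :: "'s \<Rightarrow> 'f::real_normed_vector" and j :: "'v::euclidean_space \<Rightarrow> 'e"
    and e :: "'q::topological_space \<Rightarrow> 'v \<Rightarrow> 's"
  assumes "smooth_fun_on (m ` (C \<inter> S)) (g \<circ> inv_into C m)" "inj_on m C" "continuous_on W c"
    and "bounded_linear j" "bounded_linear L"
    and e: "\<And>q \<xi>. q \<in> W \<Longrightarrow> \<xi> \<noteq> 0 \<Longrightarrow> e q \<xi> \<in> C \<inter> S \<and> m (e q \<xi>) = c q + j \<xi>"
  shows "smooth_in k W (\<lambda>q \<xi>. L (g (e q \<xi>)))"
proof (rule smooth_in_Ck_on[OF _ assms(3,4,5)])
  show "Ck_on k (m ` (C \<inter> S)) (g \<circ> inv_into C m)" using assms(1) by (simp add: smooth_fun_on_def)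
  fix q and \<xi> :: 'v assume *: "q \<in> W" "\<xi> \<noteq> 0"
  show "c q + j \<xi> \<in> m ` (C \<inter> S)" using e[OF *] by (metis imageI)
  have "inv_into C m (c q + j \<xi>) = e q \<xi>" using e[OF *] assms(2) by (metis IntD1 inv_into_f_f)
  then show "L (g (e q \<xi>)) = L ((g \<circ> inv_into C m) (c q + j \<xi>))" by simp
qed

lemma atlas_chart:
  assumes "smooth_atlas \<A>"
  obtains D \<phi> where "(D, \<phi>) \<in> \<A>" "p \<in> D"
proof -
  have "(\<Union>(D, \<phi>)\<in>\<A>. D) = UNIV" using assms unfolding smooth_atlas_def by (rule conjunct1)
  then have "p \<in> (\<Union>(D, \<phi>)\<in>\<A>. D)" by simp
  then show ?thesis using that by auto
qed

lemma atlas_chartD: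
  assumes "smooth_atlas \<A>" "(D, \<phi>) \<in> \<A>"
  shows "open D" "open (\<phi> ` D)" "continuous_on D \<phi>" "inj_on \<phi> D" "continuous_on (\<phi> ` D) (inv_into D \<phi>)"
proof -
  have h: "open D" "open (\<phi> ` D)" "homeomorphism D (\<phi> ` D) \<phi> (inv_into D \<phi>)"
  proof -
    have "\<forall>(D, \<phi>)\<in>\<A>. open D \<and> open (\<phi> ` D) \<and> homeomorphism D (\<phi> ` D) \<phi> (inv_into D \<phi>)"
      using assms(1) unfolding smooth_atlas_def by (elim conjE)
    from bspec[OF this assms(2)] show "open D" "open (\<phi> ` D)" "homeomorphism D (\<phi> ` D) \<phi> (inv_into D \<phi>)"
      by simp_all
  qed
  show "open D" "open (\<phi> ` D)" by (rule h)+
  show "continuous_on D \<phi>" "continuous_on (\<phi> ` D) (inv_into D \<phi>)"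
    using h(3) by (auto simp: homeomorphism_def)
  show "inj_on \<phi> D" using h(3) unfolding homeomorphism_def by (metis inj_onI)
qed

lemma inj_on_map_prod: "inj_on f A \<Longrightarrow> inj_on g B \<Longrightarrow> inj_on (map_prod f g) (A \<times> B)"
  by (auto simp: inj_on_def)

lemma prod_atlasI: "(D, \<phi>) \<in> \<A> \<Longrightarrow> (D', \<psi>) \<in> \<B> \<Longrightarrow> (D \<times> D', map_prod \<phi> \<psi>) \<in> prod_atlas \<A> \<B>"
  unfolding prod_atlas_def by blast

lemma euclidean_atlasI: "(UNIV, id) \<in> euclidean_atlas"
  by (simp add: euclidean_atlas_def)

lemma smooth_in_mfd:
  fixes \<A> :: "('a::topological_space, 'e::euclidean_space) chart set" and h :: "'a \<Rightarrow> 'a \<Rightarrow> 'v::euclidean_space \<Rightarrow> 'f::real_normed_vector"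
  assumes \<A>: "smooth_atlas \<A>"
    and h: "mfd_smooth_on (prod_atlas \<A> (prod_atlas \<A> euclidean_atlas)) (UNIV \<times> UNIV \<times> - {0}) (\<lambda>(x, y, \<xi>). h x y \<xi>)"
    and L: "bounded_linear L"
  shows "smooth_in k UNIV (\<lambda>p \<xi>. L (h (fst p) (snd p) \<xi>))"
proof -
  define \<W> where "\<W> = {D \<times> D' |D \<phi> D' \<psi>. (D, \<phi>) \<in> \<A> \<and> (D', \<psi>) \<in> \<A>}"
  have "smooth_in k (\<Union>\<W>) (\<lambda>p \<xi>. L (h (fst p) (snd p) \<xi>))"
  proof (rule smooth_in_Union)
    fix W assume "W \<in> \<W>"
    then obtain D \<phi> D' \<psi> where W: "W = D \<times> D'" and c: "(D, \<phi>) \<in> \<A>" "(D', \<psi>) \<in> \<A>" unfolding \<W>_def by blast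
    note d = atlas_chartD[OF \<A> c(1)] and d' = atlas_chartD[OF \<A> c(2)]
    let ?m = "map_prod \<phi> (map_prod \<psi> (id :: 'v \<Rightarrow> 'v))" and ?C = "D \<times> D' \<times> (UNIV :: 'v set)"
    have "(?C, ?m) \<in> prod_atlas \<A> (prod_atlas \<A> euclidean_atlas)"
      by (intro prod_atlasI c euclidean_atlasI)
    then have s: "smooth_fun_on (?m ` (?C \<inter> UNIV \<times> UNIV \<times> - {0})) ((\<lambda>(x, y, \<xi>). h x y \<xi>) \<circ> inv_into ?C ?m)"
      using h unfolding mfd_smooth_on_def by blast
    have inj: "inj_on ?m ?C" by (intro inj_on_map_prod d d') auto
    have "smooth_in k W (\<lambda>p \<xi>. L ((\<lambda>(x, y, \<xi>). h x y \<xi>) (fst p, snd p, \<xi>)))"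
    proof (rule smooth_in_chart[OF s inj _ _ L, where c="\<lambda>p. (\<phi> (fst p), \<psi> (snd p), 0)" and j="\<lambda>\<xi>. (0, 0, \<xi>)"])
      show "continuous_on W (\<lambda>p. (\<phi> (fst p), \<psi> (snd p), 0))" unfolding W
        by (intro continuous_on_Pair continuous_on_const continuous_on_compose2[OF d(3)] continuous_on_compose2[OF d'(3)] continuous_on_fst continuous_on_snd continuous_on_id) auto
      show "bounded_linear (\<lambda>\<xi>::'v. (0, 0, \<xi>))"
        by (intro bounded_linear_Pair bounded_linear_zero bounded_linear_ident)
    qed (auto simp: W)
    then show "open W \<and> smooth_in k W (\<lambda>p \<xi>. L (h (fst p) (snd p) \<xi>))"
      using d(1) d'(1) by (auto simp: W open_Times)
  qed
  moreover have "\<Union>\<W> = UNIV"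
  proof -
    have "p \<in> \<Union>\<W>" for p
    proof -
      obtain D \<phi> where "(D, \<phi>) \<in> \<A>" "fst p \<in> D" by (rule atlas_chart[OF \<A>])
      moreover obtain D' \<psi> where "(D', \<psi>) \<in> \<A>" "snd p \<in> D'" by (rule atlas_chart[OF \<A>])
      ultimately have "D \<times> D' \<in> \<W>" "p \<in> D \<times> D'" unfolding \<W>_def mem_Times_iff by blast+
      then show ?thesis by (rule UnionI)
    qed
    then show ?thesis by (intro set_eqI) simp
  qed
  ultimately show ?thesis by simp
qed

lemma smooth_in_mfd_family:
  fixes \<A> :: "('a::topological_space, 'e::euclidean_space) chart set" and h :: "complex \<Rightarrow> 'a \<Rightarrow> 'a \<Rightarrow> 'v::euclidean_space \<Rightarrow> complex"
  assumes \<A>: "smooth_atlas \<A>"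
    and h: "mfd_smooth_on (prod_atlas euclidean_atlas (prod_atlas \<A> (prod_atlas \<A> euclidean_atlas))) (UNIV \<times> UNIV \<times> UNIV \<times> - {0})
      (\<lambda>(z, x, y, \<xi>). h z x y \<xi>)"
  shows "smooth_in k UNIV (\<lambda>q \<xi>. h (fst q) (fst (snd q)) (snd (snd q)) \<xi>)"
proof -
  define \<W> where "\<W> = {(UNIV :: complex set) \<times> D \<times> D' |D \<phi> D' \<psi>. (D, \<phi>) \<in> \<A> \<and> (D', \<psi>) \<in> \<A>}"
  have "smooth_in k (\<Union>\<W>) (\<lambda>q \<xi>. h (fst q) (fst (snd q)) (snd (snd q)) \<xi>)"
  proof (rule smooth_in_Union)
    fix W assume "W \<in> \<W>"
    then obtain D \<phi> D' \<psi> where W: "W = UNIV \<times> D \<times> D'" and c: "(D, \<phi>) \<in> \<A>" "(D', \<psi>) \<in> \<A>" unfolding \<W>_def by blast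
    note d = atlas_chartD[OF \<A> c(1)] and d' = atlas_chartD[OF \<A> c(2)]
    let ?m = "map_prod (id :: complex \<Rightarrow> complex) (map_prod \<phi> (map_prod \<psi> (id :: 'v \<Rightarrow> 'v)))"
      and ?C = "(UNIV :: complex set) \<times> D \<times> D' \<times> (UNIV :: 'v set)"
    have "(?C, ?m) \<in> prod_atlas euclidean_atlas (prod_atlas \<A> (prod_atlas \<A> euclidean_atlas))"
      by (intro prod_atlasI c euclidean_atlasI)
    then have s: "smooth_fun_on (?m ` (?C \<inter> UNIV \<times> UNIV \<times> UNIV \<times> - {0})) ((\<lambda>(z, x, y, \<xi>). h z x y \<xi>) \<circ> inv_into ?C ?m)"
      using h unfolding mfd_smooth_on_def by blast
    have inj: "inj_on ?m ?C" by (intro inj_on_map_prod d d') auto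
    have "smooth_in k W (\<lambda>q \<xi>. id ((\<lambda>(z, x, y, \<xi>). h z x y \<xi>) (fst q, fst (snd q), snd (snd q), \<xi>)))"
    proof (rule smooth_in_chart[OF s inj, where c="\<lambda>q. (fst q, \<phi> (fst (snd q)), \<psi> (snd (snd q)), 0)" and j="\<lambda>\<xi>. (0, 0, 0, \<xi>)"])
      show "continuous_on W (\<lambda>q. (fst q, \<phi> (fst (snd q)), \<psi> (snd (snd q)), 0))" unfolding W
        by (intro continuous_on_Pair continuous_on_const continuous_on_compose2[OF d(3)] continuous_on_compose2[OF d'(3)] continuous_on_fst continuous_on_snd continuous_on_id) auto
      show "bounded_linear (\<lambda>\<xi>::'v. (0, 0, 0, \<xi>))"
        by (intro bounded_linear_Pair bounded_linear_zero bounded_linear_ident)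
      show "bounded_linear (id :: complex \<Rightarrow> complex)" by (simp add: id_def bounded_linear_ident)
    qed (auto simp: W)
    then show "open W \<and> smooth_in k W (\<lambda>q \<xi>. h (fst q) (fst (snd q)) (snd (snd q)) \<xi>)"
      using d(1) d'(1) by (auto simp: W open_Times)
  qed
  moreover have "\<Union>\<W> = UNIV"
  proof -
    have "q \<in> \<Union>\<W>" for q
    proof -
      obtain D \<phi> where "(D, \<phi>) \<in> \<A>" "fst (snd q) \<in> D" by (rule atlas_chart[OF \<A>])
      moreover obtain D' \<psi> where "(D', \<psi>) \<in> \<A>" "snd (snd q) \<in> D'" by (rule atlas_chart[OF \<A>])
      ultimately have "UNIV \<times> D \<times> D' \<in> \<W>" "q \<in> UNIV \<times> D \<times> D'" unfolding \<W>_def mem_Times_iff by blast+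
      then show ?thesis by (rule UnionI)
    qed
    then show ?thesis by (intro set_eqI) simp
  qed
  ultimately show ?thesis by simp
qed

section \<open>Stationary points on the sphere and critical points\<close>

lemma phase_differentiable:
  fixes \<A> :: "('a::topological_space, 'e::euclidean_space) chart set" and \<theta> :: "'a \<Rightarrow> 'a \<Rightarrow> real^'n \<Rightarrow> real"
  assumes \<A>: "smooth_atlas \<A>" and "phase_function \<A> \<theta>" and "\<xi> \<noteq> 0"
  shows "\<theta> x y differentiable (at \<xi>)"
proof -
  obtain D \<phi> where c: "(D, \<phi>) \<in> \<A>" "x \<in> D" by (rule atlas_chart[OF \<A>])
  obtain D' \<psi> where c': "(D', \<psi>) \<in> \<A>" "y \<in> D'" by (rule atlas_chart[OF \<A>])
  note d = atlas_chartD[OF \<A> c(1)] and d' = atlas_chartD[OF \<A> c'(1)]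
  let ?m = "map_prod \<phi> (map_prod \<psi> (id :: real^'n \<Rightarrow> _))" and ?C = "D \<times> D' \<times> (UNIV :: (real^'n) set)"
  let ?F = "(\<lambda>(x, y, \<xi>). \<theta> x y \<xi>) \<circ> inv_into ?C ?m"
  have "(?C, ?m) \<in> prod_atlas \<A> (prod_atlas \<A> euclidean_atlas)"
    by (intro prod_atlasI c c' euclidean_atlasI)
  then have "smooth_fun_on (?m ` (?C \<inter> UNIV \<times> UNIV \<times> - {0})) ?F"
    using assms(2) unfolding phase_function_def mfd_smooth_on_def by blast
  then have "Ck_on (Suc 0) (?m ` (?C \<inter> UNIV \<times> UNIV \<times> - {0})) ?F" unfolding smooth_fun_on_def by (rule spec)
  then have "\<forall>u\<in>?m ` (?C \<inter> UNIV \<times> UNIV \<times> - {0}). ?F differentiable (at u)"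
    unfolding Ck_on.simps by (rule conjunct1)
  moreover have "(\<phi> x, \<psi> y, \<xi>) \<in> ?m ` (?C \<inter> UNIV \<times> UNIV \<times> - {0})"
    using c c' assms(3) by (intro image_eqI[of _ _ "(x, y, \<xi>)"]) auto
  ultimately have "?F differentiable (at (\<phi> x, \<psi> y, \<xi>))" by (rule bspec)
  then obtain F' where "(?F has_derivative F') (at (\<phi> x, \<psi> y, \<xi>))" unfolding differentiable_def by blast
  moreover have "((\<lambda>\<xi>. (\<phi> x, \<psi> y, \<xi>)) has_derivative (\<lambda>w. (0, 0, w))) (at \<xi>)"
    by (intro has_derivative_Pair has_derivative_const has_derivative_ident)
  ultimately have "((\<lambda>\<xi>. ?F (\<phi> x, \<psi> y, \<xi>)) has_derivative (\<lambda>w. F' (0, 0, w))) (at \<xi>)"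
    by (rule has_derivative_compose[rotated])
  moreover have inj: "inj_on ?m ?C" by (intro inj_on_map_prod d d') auto
  have "?F (\<phi> x, \<psi> y, \<eta>) = \<theta> x y \<eta>" for \<eta>
    using inv_into_f_f[OF inj, of "(x, y, \<eta>)"] c c' by simp
  ultimately show ?thesis unfolding differentiable_def by auto
qed

text \<open>A derivative within the sphere determines its tangential part: test it along the great circle in
direction \<open>v\<close>.\<close>

lemma tangent_derivative_zero:
  fixes f :: "real^'n \<Rightarrow> real"
  assumes \<eta>: "norm \<eta> = 1" and v: "v \<bullet> \<eta> = 0"
    and d: "(f has_derivative (\<lambda>w. v \<bullet> w)) (at \<eta> within sphere 0 1)"
    and z: "(f has_derivative (\<lambda>w. 0)) (at \<eta> within sphere 0 1)"
  shows "v = 0"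
proof (rule ccontr)
  assume nz: "v \<noteq> 0"
  define e where "e = v /\<^sub>R norm v"
  \<comment> \<open>The great circle through \<open>\<eta>\<close> in direction \<open>v\<close>.\<close>
  define \<gamma> where "\<gamma> t = cos t *\<^sub>R \<eta> + sin t *\<^sub>R e" for t
  have e: "norm e = 1" "\<eta> \<bullet> e = 0" using nz v by (auto simp: e_def inner_commute)
  have "norm (\<gamma> t) = 1" for t
  proof -
    have "(norm (\<gamma> t))\<^sup>2 = (cos t)\<^sup>2 * (norm \<eta>)\<^sup>2 + (sin t)\<^sup>2 * (norm e)\<^sup>2 + 2 * (cos t * sin t * (\<eta> \<bullet> e))"
      unfolding \<gamma>_def power2_norm_eq_inner
      by (simp add: inner_add_left inner_add_right inner_commute power2_eq_square algebra_simps)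
    then have "(norm (\<gamma> t))\<^sup>2 = 1" using \<eta> e by simp
    then show ?thesis by (simp add: power2_eq_1_iff) (smt (verit) norm_ge_zero)
  qed
  then have sub: "range \<gamma> \<subseteq> sphere 0 1" by auto
  have g: "(\<gamma> has_derivative (\<lambda>t. t *\<^sub>R e)) (at 0)"
    unfolding \<gamma>_def by (auto intro!: derivative_eq_intros)
  have g0: "\<gamma> 0 = \<eta>" by (simp add: \<gamma>_def)
  have "((\<lambda>t. f (\<gamma> t)) has_derivative (\<lambda>t. v \<bullet> (t *\<^sub>R e))) (at 0)"
    using has_derivative_in_compose[OF g, of f "\<lambda>w. v \<bullet> w"] has_derivative_subset[OF d sub] by (simp add: g0)
  moreover have "((\<lambda>t. f (\<gamma> t)) has_derivative (\<lambda>t. 0)) (at 0)"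
    using has_derivative_in_compose[OF g, of f "\<lambda>w. 0"] has_derivative_subset[OF z sub] by (simp add: g0)
  ultimately have "(\<lambda>t::real. v \<bullet> (t *\<^sub>R e)) = (\<lambda>t. 0)" by (rule has_derivative_unique)
  then have "v \<bullet> (1 *\<^sub>R e) = 0" by metis
  then have "v \<bullet> v = 0" using nz by (simp add: e_def)
  then show False using nz by simp
qed

lemma stationary_points_onD:
  assumes "stationary_points_on \<A> U \<theta> n \<sigma>" "(x, y) \<in> U"
  shows "sphere_stationary (\<theta> x y) \<eta> \<longleftrightarrow> \<eta> \<in> (\<lambda>s. \<sigma> s x y) ` {1..n}"
proof -
  have "\<forall>(x, y)\<in>U. {\<eta>. sphere_stationary (\<theta> x y) \<eta>} = (\<lambda>s. \<sigma> s x y) ` {1..n} \<and> inj_on (\<lambda>s. \<sigma> s x y) {1..n}"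
    using assms(1) unfolding stationary_points_on_def by (rule conjunct2)
  from bspec[OF this assms(2)] have "{\<eta>. sphere_stationary (\<theta> x y) \<eta>} = (\<lambda>s. \<sigma> s x y) ` {1..n}"
    by (simp only: split_conv)
  then show ?thesis by (metis mem_Collect_eq)
qed

text \<open>The heart of the matter. At a critical point \<open>\<xi>\<close> the radial derivative vanishes, and by Euler's
relation so does \<open>\<theta>\<close>. Rescaled to the unit sphere, \<open>\<xi>\<close> is a stationary point of the
restriction of \<open>\<theta>\<close>, and there \<open>\<theta>\<close> is nonzero on the region considered.\<close>

lemma phase_no_critical_points:
  fixes \<A> :: "('a::topological_space, 'e::euclidean_space) chart set" and \<theta> :: "'a \<Rightarrow> 'a \<Rightarrow> real^'n \<Rightarrow> real"
  assumes \<A>: "smooth_atlas \<A>" and \<theta>: "phase_function \<A> \<theta>" and st: "stationary_points_on \<A> U \<theta> n \<sigma>"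
    and p: "p \<in> nonvanishing_region U \<theta> n \<sigma>" and \<xi>: "\<xi> \<noteq> 0"
  shows "\<exists>b\<in>Basis. dir_deriv b (\<lambda>p \<xi>. complex_of_real (\<theta> (fst p) (snd p) \<xi>)) p \<xi> \<noteq> 0"
proof (rule ccontr)
  assume "\<not> ?thesis"
  then have z: "dir_deriv b (\<lambda>p \<xi>. complex_of_real (\<theta> (fst p) (snd p) \<xi>)) p \<xi> = 0" if "b \<in> Basis" for b
    using that by blast
  let ?f = "\<theta> (fst p) (snd p)"
  have hom: "?f (r *\<^sub>R \<zeta>) = r * ?f \<zeta>" if "r > 0" "\<zeta> \<noteq> 0" for r \<zeta>
    using \<theta> that unfolding phase_function_def by blast
  obtain f' where f': "(?f has_derivative f') (at \<xi>)"
    using phase_differentiable[OF \<A> \<theta> \<xi>, of "fst p" "snd p"] unfolding differentiable_def by blast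
  have lin: "linear f'" using f' has_derivative_linear by blast
  have line: "((\<lambda>t. ?f (\<xi> + t *\<^sub>R v)) has_derivative (\<lambda>t. f' (t *\<^sub>R v))) (at 0)" for v
  proof -
    have "((\<lambda>t. \<xi> + t *\<^sub>R v) has_derivative (\<lambda>t. t *\<^sub>R v)) (at 0)"
      by (auto intro!: derivative_eq_intros)
    moreover have "(?f has_derivative f') (at (\<xi> + 0 *\<^sub>R v))" using f' by simp
    ultimately show ?thesis by (rule has_derivative_compose)
  qed
  then have lv: "((\<lambda>t. ?f (\<xi> + t *\<^sub>R v)) has_vector_derivative f' v) (at 0)" for v
    unfolding has_vector_derivative_def by (simp add: linear_scale[OF lin])
  have "f' b = 0" if "b \<in> Basis" for b
  proof -
    have "has_dir_deriv (\<lambda>p \<xi>. complex_of_real (\<theta> (fst p) (snd p) \<xi>)) b p \<xi> (of_real (f' b))"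
      unfolding has_dir_deriv_def using lv by (rule has_vector_derivative_complex_of_real)
    then show ?thesis using z[OF that] dir_deriv_eqI by fastforce
  qed
  then have f'0: "f' = (\<lambda>w. 0)"
    using linear_eq_stdbasis[OF lin linear_zero] by (auto simp: fun_eq_iff)
  have crit: "(?f has_derivative (\<lambda>w. 0)) (at \<xi>)" using f' f'0 by simp
  define \<eta> where "\<eta> = \<xi> /\<^sub>R norm \<xi>"
  have \<eta>: "norm \<eta> = 1" "\<eta> \<noteq> 0" using \<xi> by (auto simp: \<eta>_def)
  have crit\<eta>: "(?f has_derivative (\<lambda>w. 0)) (at \<eta>)"
  proof -
    have "((\<lambda>\<zeta>. norm \<xi> *\<^sub>R \<zeta>) has_derivative (\<lambda>w. norm \<xi> *\<^sub>R w)) (at \<eta>)"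
      by (auto intro!: derivative_eq_intros)
    moreover have "(?f has_derivative (\<lambda>w. 0)) (at (norm \<xi> *\<^sub>R \<eta>))" using crit \<xi> by (simp add: \<eta>_def)
    ultimately have "((\<lambda>\<zeta>. ?f (norm \<xi> *\<^sub>R \<zeta>)) has_derivative (\<lambda>w. 0)) (at \<eta>)"
      by (rule has_derivative_compose)
    from has_derivative_mult_right[OF this, of "inverse (norm \<xi>)"]
    have "((\<lambda>\<zeta>. inverse (norm \<xi>) * ?f (norm \<xi> *\<^sub>R \<zeta>)) has_derivative (\<lambda>w. 0)) (at \<eta>)" by simp
    then show ?thesis
      by (rule has_derivative_transform_within_open[where s="- {0}"]) (use \<eta> \<xi> hom in auto)
  qed
  have "sphere_gradient ?f \<eta> = 0"
    unfolding sphere_gradient_def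
  proof (rule the_equality)
    show "0 \<bullet> \<eta> = 0 \<and> (?f has_derivative (\<lambda>w. 0 \<bullet> w)) (at \<eta> within sphere 0 1)"
      using crit\<eta> by (simp add: has_derivative_at_withinI)
    fix v assume "v \<bullet> \<eta> = 0 \<and> (?f has_derivative (\<lambda>w. v \<bullet> w)) (at \<eta> within sphere 0 1)"
    then show "v = 0"
      using tangent_derivative_zero[OF \<eta>(1)] has_derivative_at_withinI[OF crit\<eta>] by blast
  qed
  then have "sphere_stationary ?f \<eta>" using \<eta> by (simp add: sphere_stationary_def)
  moreover have "p \<in> U" using p by (auto simp: nonvanishing_region_def)
  ultimately have "\<eta> \<in> (\<lambda>s. \<sigma> s (fst p) (snd p)) ` {1..n}"
    using stationary_points_onD[OF st, of "fst p" "snd p"] by simp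
  then obtain s where s: "s \<in> {1..n}" "\<eta> = \<sigma> s (fst p) (snd p)" by auto
  then have "?f \<eta> \<noteq> 0" using p unfolding nonvanishing_region_def by (cases p) auto
  moreover have "?f \<eta> = 0"
  proof -
    have a: "((\<lambda>t. t *\<^sub>R \<eta>) has_derivative (\<lambda>t. t *\<^sub>R \<eta>)) (at (1::real))"
      by (auto intro!: derivative_eq_intros)
    have b: "(?f has_derivative (\<lambda>w. 0)) (at (1 *\<^sub>R \<eta>))" using crit\<eta> by simp
    have "((\<lambda>t. ?f (t *\<^sub>R \<eta>)) has_derivative (\<lambda>t. 0)) (at (1::real))"
      using has_derivative_compose[OF a b] .
    then have "((\<lambda>t. t * ?f \<eta>) has_derivative (\<lambda>t. 0)) (at (1::real))"
      by (rule has_derivative_transform_within_open[where s="{0<..}"]) (use \<eta> hom in auto)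
    moreover have "((\<lambda>t. t * ?f \<eta>) has_derivative (\<lambda>t. t * ?f \<eta>)) (at (1::real))"
      by (auto intro!: derivative_eq_intros)
    ultimately have "(\<lambda>t::real. 0) = (\<lambda>t. t * ?f \<eta>)" by (rule has_derivative_unique)
    then have "0 = 1 * ?f \<eta>" by metis
    then show ?thesis by simp
  qed
  ultimately show False by blast
qed

lemma nonstationary_phase_region:
  fixes \<A> :: "('a::{first_countable_topology,t2_space}, 'e::euclidean_space) chart set" and \<theta> :: "'a \<Rightarrow> 'a \<Rightarrow> real^'n \<Rightarrow> real"
  assumes \<A>: "smooth_atlas \<A>" and \<theta>: "phase_function \<A> \<theta>" and st: "stationary_points_on \<A> U \<theta> n \<sigma>"
    and K: "compact K" "K \<subseteq> nonvanishing_region U \<theta> n \<sigma>"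
  shows "nonstationary_phase K (\<lambda>p. \<theta> (fst p) (snd p))"
proof
  show "compact K" by (rule K)
  have "smooth_in k UNIV (\<lambda>p \<xi>. complex_of_real (\<theta> (fst p) (snd p) \<xi>))" for k
    using \<theta> unfolding phase_function_def by (intro smooth_in_mfd[OF \<A> _ bounded_linear_of_real]) auto
  from smooth_in_reparam[OF this, of K "\<lambda>p. p"]
  show "smooth_in k K (\<lambda>p \<xi>. complex_of_real (\<theta> (fst p) (snd p) \<xi>))" for k by simp
  show "\<theta> (fst p) (snd p) (r *\<^sub>R \<xi>) = r * \<theta> (fst p) (snd p) \<xi>" if "r > 0" "\<xi> \<noteq> 0" for p r \<xi>
    using \<theta> that unfolding phase_function_def by blast
  show "\<exists>b\<in>Basis. dir_deriv b (\<lambda>p \<xi>. complex_of_real (\<theta> (fst p) (snd p) \<xi>)) p \<xi> \<noteq> 0" if "p \<in> K" "\<xi> \<noteq> 0" for p \<xi>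
    using phase_no_critical_points[OF \<A> \<theta> st] K that by blast
qed

section \<open>Amplitudes on a manifold\<close>

lemma L1_continuous_integrable: "L1_continuous b \<Longrightarrow> integrable lborel (b x y)"
  by (simp add: L1_continuous_def)

lemma L1_continuous_at:
  assumes "L1_continuous b"
  shows "isCont (\<lambda>p. LINT \<xi>|lborel. norm (b (fst p) (snd p) \<xi> - b (fst p0) (snd p0) \<xi>)) p0"
proof -
  have "((\<lambda>p. LINT \<xi>|lborel. norm (b (fst p) (snd p) \<xi> - b (fst p0) (snd p0) \<xi>)) \<longlongrightarrow> 0) (at p0)"
    using assms unfolding L1_continuous_def by (cases p0) (simp add: case_prod_unfold)
  then show ?thesis by (simp add: isCont_def)
qed

lemma L1_continuous_at_snd:
  assumes "L1_continuous b"
  shows "isCont (\<lambda>q. LINT \<xi>|lborel. norm (b (fst (snd q)) (snd (snd q)) \<xi> - b (fst (snd q0)) (snd (snd q0)) \<xi>)) q0"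
proof -
  have "isCont (\<lambda>q. (\<lambda>p. LINT \<xi>|lborel. norm (b (fst p) (snd p) \<xi> - b (fst (snd q0)) (snd (snd q0)) \<xi>)) (snd q)) q0"
    by (rule isCont_o2[OF _ L1_continuous_at[OF assms]]) (simp add: continuous_snd)
  then show ?thesis .
qed

lemma osc_holo_L1_continuous:
  fixes \<theta> :: "'a::{first_countable_topology,t2_space} \<times> 'a \<Rightarrow> real^'n \<Rightarrow> real"
  assumes \<theta>: "continuous_on (K \<times> (- {0})) (\<lambda>(p, \<xi>). \<theta> p \<xi>)" and b: "L1_continuous b"
  shows "\<exists>I. osc_holo {0} K \<theta> (\<lambda>q. b (fst (snd q)) (snd (snd q))) I"
proof (rule osc_holo_L1[OF \<theta>])
  show "integrable lborel (b (fst (snd q)) (snd (snd q)))" for q :: "complex \<times> 'a \<times> 'a"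
    using b by (simp add: L1_continuous_def)
  fix q0 :: "complex \<times> 'a \<times> 'a"
  show "continuous (at q0 within {0} \<times> K) (\<lambda>q. LINT \<xi>|lborel. norm (b (fst (snd q)) (snd (snd q)) \<xi> - b (fst (snd q0)) (snd (snd q0)) \<xi>))"
    by (rule continuous_at_imp_continuous_at_within[OF L1_continuous_at_snd[OF b]])
qed auto

text \<open>The derivative of the family in \<open>z\<close> exists uniformly in \<open>(x, y)\<close>. This gives a Lipschitz bound in \<open>z\<close> near
any point, hence joint continuity in \<open>(z, x, y)\<close>.\<close>

lemma osc_holo_L1_holomorphic:
  fixes \<theta> :: "'a::{first_countable_topology,t2_space} \<times> 'a \<Rightarrow> real^'n \<Rightarrow> real"
  assumes \<theta>: "continuous_on (K \<times> (- {0})) (\<lambda>(p, \<xi>). \<theta> p \<xi>)" and b: "L1_holomorphic b"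
  shows "\<exists>I. osc_holo Z K \<theta> (\<lambda>q. b (fst q) (fst (snd q)) (snd (snd q))) I"
proof (rule osc_holo_L1[OF \<theta>])
  have int: "integrable lborel (b z x y)" for z x y
    using b by (simp add: L1_holomorphic_def L1_continuous_def)
  then show "integrable lborel (b (fst q) (fst (snd q)) (snd (snd q)))" for q .
  have deriv: "\<exists>b'. L1_continuous b' \<and> uniform_limit UNIV
          (\<lambda>w (x, y). LINT \<xi>|lborel. norm ((b w x y \<xi> - b z x y \<xi>) / (w - z) - b' x y \<xi>)) (\<lambda>_. 0) (at z)" for z
    using b by (simp add: L1_holomorphic_def)
  show "\<exists>c. integrable lborel c \<and>
      ((\<lambda>w. LINT \<xi>|lborel. norm ((b (fst (w, p)) (fst (snd (w, p))) (snd (snd (w, p))) \<xi> - b (fst (z, p)) (fst (snd (z, p))) (snd (snd (z, p))) \<xi>) / (w - z) - c \<xi>)) \<longlongrightarrow> 0) (at z)" for z p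
  proof -
    obtain b' where b': "L1_continuous b'" "uniform_limit UNIV
          (\<lambda>w (x, y). LINT \<xi>|lborel. norm ((b w x y \<xi> - b z x y \<xi>) / (w - z) - b' x y \<xi>)) (\<lambda>_. 0) (at z)"
      using deriv by blast
    have "((\<lambda>w. LINT \<xi>|lborel. norm ((b w (fst p) (snd p) \<xi> - b z (fst p) (snd p) \<xi>) / (w - z) - b' (fst p) (snd p) \<xi>)) \<longlongrightarrow> 0) (at z)"
      using tendsto_uniform_limitI[OF b'(2), of p] by (simp add: case_prod_unfold)
    moreover have "integrable lborel (b' (fst p) (snd p))" using b'(1) by (simp add: L1_continuous_def)
    ultimately show ?thesis by auto
  qed
  fix q0 :: "complex \<times> 'a \<times> 'a"
  define z0 x0 y0 where d: "z0 = fst q0" "x0 = fst (snd q0)" "y0 = snd (snd q0)"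
  obtain b' where b': "L1_continuous b'" "uniform_limit UNIV
          (\<lambda>w (x, y). LINT \<xi>|lborel. norm ((b w x y \<xi> - b z0 x y \<xi>) / (w - z0) - b' x y \<xi>)) (\<lambda>_. 0) (at z0)"
    using deriv by blast
  have b'int: "integrable lborel (b' x y)" for x y using b'(1) by (simp add: L1_continuous_def)
  define N where "N f = (LINT \<xi>|lborel. norm (f \<xi>))" for f :: "real^'n \<Rightarrow> complex"
  \<comment> \<open>A majorant of the \<open>L\<^sup>1\<close> distance of \<open>b\<close> at \<open>q\<close> and \<open>q0\<close> that is continuous at \<open>q0\<close> and vanishes there; the summand 1 absorbs the error of the difference quotient.\<close>
  define G where "G q = norm (fst q - z0) * (1 + N (b' x0 y0) + N (\<lambda>\<xi>. b' (fst (snd q)) (snd (snd q)) \<xi> - b' x0 y0 \<xi>))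
      + N (\<lambda>\<xi>. b z0 (fst (snd q)) (snd (snd q)) \<xi> - b z0 x0 y0 \<xi>)" for q
  have c1: "isCont (\<lambda>q::complex \<times> 'a \<times> 'a. N (\<lambda>\<xi>. c (fst (snd q)) (snd (snd q)) \<xi> - c x0 y0 \<xi>)) q0" if "L1_continuous c" for c
    unfolding N_def d by (rule L1_continuous_at_snd[OF that])
  have bz: "L1_continuous (b z0)" using b by (simp add: L1_holomorphic_def)
  have "isCont G q0"
    unfolding G_def by (intro continuous_intros c1 b'(1) bz)
  moreover have "G q0 = 0" by (simp add: G_def d N_def)
  ultimately have G0: "(G \<longlongrightarrow> 0) (at q0)" by (simp add: isCont_def)
  have tri: "N (\<lambda>\<xi>. f \<xi> + g \<xi>) \<le> N f + N g" if "integrable lborel f" "integrable lborel g" for f g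
  proof -
    have "N (\<lambda>\<xi>. f \<xi> + g \<xi>) \<le> (LINT \<xi>|lborel. norm (f \<xi>) + norm (g \<xi>))"
      unfolding N_def using that by (intro integral_mono) (auto intro: norm_triangle_ineq)
    also have "\<dots> = N f + N g" unfolding N_def using that by (intro Bochner_Integration.integral_add) auto
    finally show ?thesis .
  qed
  have "\<forall>\<^sub>F w in at z0. \<forall>p\<in>UNIV. dist ((\<lambda>(x, y). LINT \<xi>|lborel. norm ((b w x y \<xi> - b z0 x y \<xi>) / (w - z0) - b' x y \<xi>)) p) 0 < 1"
    using b'(2) by (rule uniform_limitD) simp
  then have "\<forall>\<^sub>F w in nhds z0. w \<noteq> z0 \<longrightarrow> (\<forall>x y. \<bar>N (\<lambda>\<xi>. (b w x y \<xi> - b z0 x y \<xi>) / (w - z0) - b' x y \<xi>)\<bar> < 1)"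
    by (simp add: eventually_at_filter N_def)
  moreover have "filterlim fst (nhds z0) (nhds q0)"
    using tendsto_fst[OF filterlim_ident, of q0] by (simp add: d)
  ultimately have "\<forall>\<^sub>F q in nhds q0. fst q \<noteq> z0 \<longrightarrow> (\<forall>x y. \<bar>N (\<lambda>\<xi>. (b (fst q) x y \<xi> - b z0 x y \<xi>) / (fst q - z0) - b' x y \<xi>)\<bar> < 1)"
    by (rule eventually_compose_filterlim)
  then have ev: "\<forall>\<^sub>F q in at q0. norm (N (\<lambda>\<xi>. b (fst q) (fst (snd q)) (snd (snd q)) \<xi> - b z0 x0 y0 \<xi>)) \<le> G q"
    unfolding eventually_at_filter
  proof eventually_elim
    case (elim q)
    define w x y where d': "w = fst q" "x = fst (snd q)" "y = snd (snd q)"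
    have "N (\<lambda>\<xi>. b w x y \<xi> - b z0 x y \<xi>) \<le> norm (w - z0) * (1 + N (b' x0 y0) + N (\<lambda>\<xi>. b' x y \<xi> - b' x0 y0 \<xi>))"
    proof (cases "w = z0")
      case False
      let ?e = "\<lambda>\<xi>. (b w x y \<xi> - b z0 x y \<xi>) / (w - z0) - b' x y \<xi>"
      have ei: "integrable lborel ?e"
        using int b'int by (intro Bochner_Integration.integrable_diff integrable_divide_zero) auto
      have "N (\<lambda>\<xi>. ?e \<xi> + (b' x0 y0 \<xi> + (b' x y \<xi> - b' x0 y0 \<xi>))) \<le> N ?e + N (\<lambda>\<xi>. b' x0 y0 \<xi> + (b' x y \<xi> - b' x0 y0 \<xi>))"
        by (rule tri[OF ei]) (intro Bochner_Integration.integrable_add Bochner_Integration.integrable_diff b'int)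
      also have "\<dots> \<le> 1 + (N (b' x0 y0) + N (\<lambda>\<xi>. b' x y \<xi> - b' x0 y0 \<xi>))"
      proof (rule add_mono)
        show "N ?e \<le> 1"
        proof -
          have "\<forall>x y. \<bar>N (\<lambda>\<xi>. (b w x y \<xi> - b z0 x y \<xi>) / (w - z0) - b' x y \<xi>)\<bar> < 1"
            using elim False unfolding d' by (rule mp)
          then have "\<bar>N ?e\<bar> < 1" by (elim allE)
          then show ?thesis by linarith
        qed
        show "N (\<lambda>\<xi>. b' x0 y0 \<xi> + (b' x y \<xi> - b' x0 y0 \<xi>)) \<le> N (b' x0 y0) + N (\<lambda>\<xi>. b' x y \<xi> - b' x0 y0 \<xi>)"
          using b'int by (intro tri Bochner_Integration.integrable_diff)
      qed
      finally have q: "N (\<lambda>\<xi>. (b w x y \<xi> - b z0 x y \<xi>) / (w - z0)) \<le> 1 + N (b' x0 y0) + N (\<lambda>\<xi>. b' x y \<xi> - b' x0 y0 \<xi>)"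
        by simp
      have "N (\<lambda>\<xi>. b w x y \<xi> - b z0 x y \<xi>) = norm (w - z0) * N (\<lambda>\<xi>. (b w x y \<xi> - b z0 x y \<xi>) / (w - z0))"
        unfolding N_def using False by (simp add: norm_divide)
      then show ?thesis using mult_left_mono[OF q, of "norm (w - z0)"] by simp
    qed (simp add: N_def)
    moreover have "N (\<lambda>\<xi>. (b w x y \<xi> - b z0 x y \<xi>) + (b z0 x y \<xi> - b z0 x0 y0 \<xi>)) \<le> N (\<lambda>\<xi>. b w x y \<xi> - b z0 x y \<xi>) + N (\<lambda>\<xi>. b z0 x y \<xi> - b z0 x0 y0 \<xi>)"
      using int by (intro tri Bochner_Integration.integrable_diff)
    ultimately have "N (\<lambda>\<xi>. b w x y \<xi> - b z0 x0 y0 \<xi>) \<le> G q" unfolding G_def d' by simp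
    moreover have "N (\<lambda>\<xi>. b w x y \<xi> - b z0 x0 y0 \<xi>) \<ge> 0" unfolding N_def by simp
    ultimately show ?case by (simp add: d')
  qed
  have "((\<lambda>q. N (\<lambda>\<xi>. b (fst q) (fst (snd q)) (snd (snd q)) \<xi> - b z0 x0 y0 \<xi>)) \<longlongrightarrow> 0) (at q0)"
    by (rule Lim_null_comparison[OF ev G0])
  then have "isCont (\<lambda>q. N (\<lambda>\<xi>. b (fst q) (fst (snd q)) (snd (snd q)) \<xi> - b z0 x0 y0 \<xi>)) q0"
    by (simp add: isCont_def N_def d)
  then show "continuous (at q0 within Z \<times> K) (\<lambda>q. LINT \<xi>|lborel. norm (b (fst q) (fst (snd q)) (snd (snd q)) \<xi> - b (fst q0) (fst (snd q0)) (snd (snd q0)) \<xi>))"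
    unfolding N_def d by (rule continuous_at_imp_continuous_at_within)
qed

lemma osc_holo_poly_log:
  fixes \<A> :: "('a::{first_countable_topology,t2_space}, 'e::euclidean_space) chart set" and a :: "'a \<Rightarrow> 'a \<Rightarrow> real^'n \<Rightarrow> complex"
  assumes \<A>: "smooth_atlas \<A>" and a: "poly_log_homogeneous \<A> a" and ph: "nonstationary_phase K \<theta>"
  shows "\<exists>I. osc_holo {0} K \<theta> (\<lambda>q. a (fst (snd q)) (snd (snd q))) I"
proof -
  obtain J d l a0 b F where a0: "L1_continuous a0"
    and b: "\<forall>\<iota>\<in>J. mfd_smooth_on (prod_atlas \<A> (prod_atlas \<A> euclidean_atlas))
                  (UNIV \<times> UNIV \<times> - {0}) (\<lambda>(x, y, \<xi>). b \<iota> x y (\<xi> /\<^sub>R norm \<xi>))"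
    and F: "finite F" "F \<subseteq> J" "L1_summable {0} (J - F) (\<lambda>_ \<iota>. log_homogeneous_term (d \<iota>) (l \<iota>) (b \<iota>))"
    and eq: "\<forall>x y \<xi>. a x y \<xi> = a0 x y \<xi> + (\<Sum>\<^sub>\<infinity>\<iota>\<in>J. log_homogeneous_term (d \<iota>) (l \<iota>) (b \<iota>) x y \<xi>)"
    using a unfolding poly_log_homogeneous_def by (elim exE conjE) (rule that)
  show ?thesis
  proof (rule osc_holo_amplitude[OF ph, where a="\<lambda>_. a" and ?a0.0="\<lambda>_. a0" and b="\<lambda>\<iota> _. b \<iota>" and d=d and l=l and J=J and F=F])
    show "\<exists>I. osc_holo {0} K \<theta> (\<lambda>q. a0 (fst (snd q)) (snd (snd q))) I"
      by (rule osc_holo_L1_continuous[OF nonstationary_phase_continuous[OF ph] a0])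
    show "a0 (fst (snd q)) (snd (snd q)) \<in> borel_measurable borel" for q :: "complex \<times> 'a \<times> 'a"
      using borel_measurable_integrable[OF L1_continuous_integrable[OF a0]] by simp
    show "smooth_in k ({0} \<times> K) (\<lambda>q \<xi>. b \<iota> (fst (snd q)) (snd (snd q)) (\<xi> /\<^sub>R norm \<xi>))" if "\<iota> \<in> J" for k \<iota>
    proof -
      have m: "mfd_smooth_on (prod_atlas \<A> (prod_atlas \<A> euclidean_atlas))
                  (UNIV \<times> UNIV \<times> - {0}) (\<lambda>(x, y, \<xi>). b \<iota> x y (\<xi> /\<^sub>R norm \<xi>))"
        by (rule bspec[OF b that])
      have "bounded_linear (id :: complex \<Rightarrow> complex)" by (simp add: id_def bounded_linear_ident)
      note smooth_in_mfd[OF \<A> m this]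
      from smooth_in_reparam[OF this, of "{0} \<times> K" snd] show ?thesis
        by (simp add: continuous_on_snd)
    qed
    show "L1_summable {0} (J - F) (\<lambda>z \<iota>. log_homogeneous_term (d \<iota> + z) (l \<iota>) (b \<iota>))"
      using F(3) by (simp add: L1_summable_def)
  qed (use F(1,2) eq in simp_all)
qed

text \<open>The exceptional finite set of terms depends on \<open>Z\<close>, which is why only compact \<open>Z\<close> are considered
at a time.\<close>

lemma osc_holo_family:
  fixes \<A> :: "('a::{first_countable_topology,t2_space}, 'e::euclidean_space) chart set" and a :: "complex \<Rightarrow> 'a \<Rightarrow> 'a \<Rightarrow> real^'n \<Rightarrow> complex"
  assumes \<A>: "smooth_atlas \<A>" and a: "holomorphic_poly_log_family \<A> a" and ph: "nonstationary_phase K \<theta>" and Z: "compact Z"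
  shows "\<exists>I. osc_holo Z K \<theta> (\<lambda>q. a (fst q) (fst (snd q)) (snd (snd q))) I"
proof -
  obtain J d l a0 b where a0: "L1_holomorphic a0"
    and b: "\<forall>\<iota>\<in>J. mfd_smooth_on
                  (prod_atlas euclidean_atlas (prod_atlas \<A> (prod_atlas \<A> euclidean_atlas)))
                  (UNIV \<times> UNIV \<times> UNIV \<times> - {0})
                  (\<lambda>(z, x, y, \<xi>). b \<iota> z x y (\<xi> /\<^sub>R norm \<xi>)) \<and>
               (\<forall>x y. \<forall>\<eta>\<in>sphere 0 1. (\<lambda>z. b \<iota> z x y \<eta>) holomorphic_on UNIV)"
    and F: "\<forall>K. compact K \<longrightarrow> (\<exists>F. finite F \<and> F \<subseteq> J \<and>
             L1_summable K (J - F) (\<lambda>z \<iota>. log_homogeneous_term (d \<iota> + z) (l \<iota>) (b \<iota> z)))"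
    and eq: "\<forall>z x y \<xi>. a z x y \<xi> =
           a0 z x y \<xi> + (\<Sum>\<^sub>\<infinity>\<iota>\<in>J. log_homogeneous_term (d \<iota> + z) (l \<iota>) (b \<iota> z) x y \<xi>)"
    using a unfolding holomorphic_poly_log_family_def by (elim exE conjE) (rule that)
  obtain F where F: "finite F" "F \<subseteq> J" "L1_summable Z (J - F) (\<lambda>z \<iota>. log_homogeneous_term (d \<iota> + z) (l \<iota>) (b \<iota> z))"
    using F[rule_format, OF Z] by (elim exE conjE) (rule that)
  show ?thesis
  proof (rule osc_holo_amplitude[OF ph Z _ _ _ _ F])
    show "\<exists>I. osc_holo Z K \<theta> (\<lambda>q. a0 (fst q) (fst (snd q)) (snd (snd q))) I"
      by (rule osc_holo_L1_holomorphic[OF nonstationary_phase_continuous[OF ph] a0])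
    show "a0 (fst q) (fst (snd q)) (snd (snd q)) \<in> borel_measurable borel" for q
      using borel_measurable_integrable[OF L1_continuous_integrable, of "a0 (fst q)"] a0 by (simp add: L1_holomorphic_def)
    show "smooth_in k (Z \<times> K) (\<lambda>q \<xi>. b \<iota> (fst q) (fst (snd q)) (snd (snd q)) (\<xi> /\<^sub>R norm \<xi>))" if "\<iota> \<in> J" for k \<iota>
    proof -
      have "smooth_in k UNIV (\<lambda>q \<xi>. b \<iota> (fst q) (fst (snd q)) (snd (snd q)) (\<xi> /\<^sub>R norm \<xi>))"
        by (rule smooth_in_mfd_family[where h="\<lambda>z x y \<xi>. b \<iota> z x y (\<xi> /\<^sub>R norm \<xi>)", OF \<A>]) (rule conjunct1[OF bspec[OF b that]])
      from smooth_in_reparam[OF this, of "Z \<times> K" "\<lambda>q. q"] show ?thesis by simp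
    qed
    show "(\<lambda>z. b \<iota> z x y \<eta>) holomorphic_on interior Z" if "\<iota> \<in> J" "(x, y) \<in> K" "\<eta> \<in> sphere 0 1" for \<iota> x y \<eta>
    proof -
      have "(\<lambda>z. b \<iota> z x y \<eta>) holomorphic_on UNIV" using bspec[OF b that(1)] that(3) by blast
      then show ?thesis by (rule holomorphic_on_subset) simp
    qed
  qed (use eq in simp)
qed

lemma osc_holo_slice:
  fixes \<theta> :: "'p::{first_countable_topology,t2_space} \<Rightarrow> real^'n \<Rightarrow> real"
  assumes "osc_holo Z K \<theta> a I" "z \<in> Z"
  shows "osc_continuous K \<theta> (\<lambda>p. a (z, p)) (\<lambda>p. I (z, p))"
  unfolding osc_continuous_def
proof (intro allI impI conjI ballI)
  have c: "osc_continuous (Z \<times> K) (\<lambda>q. \<theta> (snd q)) a I" using assms(1) by (simp add: osc_holo_def)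
  fix \<kappa> :: "real^'n \<Rightarrow> complex" assume \<kappa>: "schwartz \<kappa> \<and> \<kappa> 0 = 1"
  show "integrable lborel (\<lambda>\<xi>. \<kappa> (\<epsilon> *\<^sub>R \<xi>) * exp (\<i> * of_real (\<theta> p \<xi>)) * a (z, p) \<xi>)" if "p \<in> K" "\<epsilon> > 0" for p \<epsilon>
    using osc_continuousD(1)[OF c, of \<kappa> "(z, p)" \<epsilon>] \<kappa> assms(2) that by simp
  have "continuous_on ({0..} \<times> Z \<times> K) (\<lambda>(\<epsilon>, q). if \<epsilon> = 0 then I q else osc_reg \<kappa> (\<lambda>q. \<theta> (snd q)) a \<epsilon> q)"
    using osc_continuousD(2)[OF c, of \<kappa>] \<kappa> by simp
  then have "continuous_on ({0..} \<times> K) (\<lambda>x. (\<lambda>(\<epsilon>, q). if \<epsilon> = 0 then I q else osc_reg \<kappa> (\<lambda>q. \<theta> (snd q)) a \<epsilon> q) (fst x, (z, snd x)))"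
    by (rule continuous_on_compose2)
      (use assms(2) in \<open>auto intro!: continuous_on_Pair continuous_on_fst continuous_on_snd continuous_on_id continuous_on_const\<close>)
  then show "continuous_on ({0..} \<times> K) (\<lambda>(\<epsilon>, q). if \<epsilon> = 0 then I (z, q) else osc_reg \<kappa> \<theta> (\<lambda>p. a (z, p)) \<epsilon> q)"
    by (rule continuous_on_cong[THEN iffD1, rotated 2]) (auto simp: osc_reg_def)
qed

section \<open>Finite volume and continuation without poles\<close>

lemma continuous_on_det:
  fixes A :: "'a::topological_space \<Rightarrow> real^'m^'m"
  assumes "continuous_on S A"
  shows "continuous_on S (\<lambda>u. det (A u))"
  unfolding det_def using assms by (intro continuous_intros)

text \<open>Every point has a neighbourhood that a chart maps onto a ball on whose closure the Riemannian density is
bounded; finitely many of these cover the manifold.\<close>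

lemma riemannian_volume_finite:
  fixes \<A> :: "('a::{t2_space, second_countable_topology}, real^'m) chart set"
  assumes "compact_riemannian_manifold \<A> g vol"
  shows "finite_measure vol" "space vol = UNIV" "sets vol = sets borel"
proof -
  have \<A>: "smooth_atlas \<A>" and cpt: "compact (UNIV :: 'a set)" and met: "riemannian_metric \<A> g" and vol: "riemannian_volume \<A> g vol"
    using assms by (auto simp: compact_riemannian_manifold_def)
  show sets: "sets vol = sets borel" using vol by (simp add: riemannian_volume_def)
  then show sp: "space vol = UNIV" using sets_eq_imp_space_eq[OF sets] by simp
  have local: "\<exists>B. open B \<and> p \<in> B \<and> emeasure vol B < \<infinity>" for p
  proof -
    obtain D \<phi> where c: "(D, \<phi>) \<in> \<A>" "p \<in> D" by (rule atlas_chart[OF \<A>])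
    note d = atlas_chartD[OF \<A> c(1)]
    have "\<phi> p \<in> \<phi> ` D" using c(2) by (rule imageI)
    from bspec[OF d(2)[unfolded open_contains_cball] this]
    obtain r where r: "r > 0" "cball (\<phi> p) r \<subseteq> \<phi> ` D" by (elim exE conjE) (rule that)
    define B where "B = \<phi> -` ball (\<phi> p) r \<inter> D"
    have oB: "open B" using continuous_on_open_vimage[OF d(1), of \<phi>] d(3) by (simp add: B_def)
    have im: "\<phi> ` B = ball (\<phi> p) r"
    proof
      show "ball (\<phi> p) r \<subseteq> \<phi> ` B"
      proof
        fix u assume u: "u \<in> ball (\<phi> p) r"
        then have "u \<in> \<phi> ` D" using subsetD[OF r(2)] by simp
        then show "u \<in> \<phi> ` B" using u by (auto simp: B_def)
      qed
    qed (auto simp: B_def)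
    let ?G = "\<lambda>u. sqrt (det (g (D, \<phi>) (inv_into D \<phi> u)))"
    have "\<forall>(D, \<phi>)\<in>\<A>. smooth_fun_on (\<phi> ` D) (g (D, \<phi>) \<circ> inv_into D \<phi>)"
      using met unfolding riemannian_metric_def by fastforce
    from bspec[OF this c(1)] have "Ck_on 0 (\<phi> ` D) (g (D, \<phi>) \<circ> inv_into D \<phi>)"
      unfolding split_conv smooth_fun_on_def by (rule spec)
    then have "continuous_on (\<phi> ` D) (\<lambda>u. g (D, \<phi>) (inv_into D \<phi> u))" by (simp add: o_def)
    then have "continuous_on (cball (\<phi> p) r) ?G"
      by (intro continuous_on_real_sqrt continuous_on_det) (rule continuous_on_subset[OF _ r(2)])
    then have "compact (?G ` cball (\<phi> p) r)" by (intro compact_continuous_image compact_cball)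
    then have "bounded (?G ` cball (\<phi> p) r)" by (rule compact_imp_bounded)
    then obtain C where "\<forall>x\<in>?G ` cball (\<phi> p) r. norm x \<le> C" unfolding bounded_iff by blast
    note C' = this
    have C: "?G u \<le> C" if "u \<in> ball (\<phi> p) r" for u
    proof -
      have "norm (?G u) \<le> C" by (rule bspec[OF C' imageI]) (use that in simp)
      then show ?thesis by simp
    qed
    have "\<forall>(D, \<phi>)\<in>\<A>. \<forall>B\<in>sets borel. B \<subseteq> D \<longrightarrow> emeasure vol B =
          (\<integral>\<^sup>+ u. ennreal (sqrt (det (g (D, \<phi>) (inv_into D \<phi> u)))) * indicator (\<phi> ` B) u \<partial>lborel)"
      using vol unfolding riemannian_volume_def by (rule conjunct2)
    from bspec[OF this c(1)] have "emeasure vol B = (\<integral>\<^sup>+ u. ennreal (?G u) * indicator (ball (\<phi> p) r) u \<partial>lborel)"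
      using oB im by (auto simp: B_def)
    also have "\<dots> \<le> (\<integral>\<^sup>+ u. ennreal C * indicator (ball (\<phi> p) r) u \<partial>lborel)"
      using C by (intro nn_integral_mono) (auto simp: indicator_def intro!: ennreal_leI)
    also have "\<dots> = ennreal C * emeasure lborel (ball (\<phi> p) r)" by (rule nn_integral_cmult_indicator) simp
    also have "\<dots> < \<infinity>" using emeasure_bounded_finite[OF bounded_ball, of "\<phi> p" r] by (simp add: ennreal_mult_less_top)
    finally show ?thesis using oB c(2) r(1) by (intro exI[of _ B]) (auto simp: B_def)
  qed
  then obtain B where B: "\<And>p. open (B p) \<and> p \<in> B p \<and> emeasure vol (B p) < \<infinity>" by metis
  have Bo: "open (B p)" "p \<in> B p" "emeasure vol (B p) < \<infinity>" for p using B[of p] by auto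
  have Bs: "B p \<in> sets vol" for p using Bo(1) by (simp add: sets)
  obtain P where P: "finite P" "UNIV \<subseteq> (\<Union>p\<in>P. B p)"
  proof (rule compactE_image[OF cpt, of UNIV B])
    show "UNIV \<subseteq> (\<Union>p\<in>UNIV. B p)" using Bo(2) by auto
  qed (use Bo(1) in auto)
  have "emeasure vol UNIV \<le> emeasure vol (\<Union>p\<in>P. B p)"
    using P(2) by (rule emeasure_mono) (intro sets.finite_UN P(1) Bs)
  also have "\<dots> \<le> (\<Sum>p\<in>P. emeasure vol (B p))"
    by (rule emeasure_subadditive_finite[OF P(1)]) (use Bs in auto)
  also have "\<dots> < \<infinity>" using Bo(3) P(1) by simp
  finally show "finite_measure vol" by (intro finite_measureI) (simp add: sp)
qed

text \<open>The identity theorem applied to the difference \<open>\<zeta> - T\<close>, with its removable singularities removed.\<close>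

lemma meromorphic_extension_no_pole:
  assumes "\<zeta> meromorphic_on UNIV" "T holomorphic_on UNIV" "\<And>z. Re z < R \<Longrightarrow> \<zeta> z = T z"
  shows "\<not> is_pole \<zeta> z"
proof -
  define D where "D z = \<zeta> z - T z" for z
  have T: "T analytic_on UNIV" using assms(2) by (simp add: analytic_on_open)
  then have "T meromorphic_on UNIV" by (rule analytic_on_imp_meromorphic_on)
  then have D: "D meromorphic_on UNIV" unfolding D_def using assms(1) by (intro meromorphic_on_diff)
  have iso: "isolated_singularity_at D w" for w
    using meromorphic_on_isolated_singularity[OF meromorphic_on_subset[OF D, of "{w}"]] by simp
  have ev: "\<forall>\<^sub>F v in at w. remove_sings D v = D v" for w
    using eventually_remove_sings_eq_at[OF iso[of w]] .
  define w where "w = complex_of_real (R - 1)"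
  have "\<forall>\<^sub>F v in at w. v \<in> {v. Re v < R}"
    by (intro eventually_at_in_open' open_halfspace_Re_lt) (simp add: w_def)
  then have "\<forall>\<^sub>F v in at w. remove_sings D v = 0"
    using ev[of w] by eventually_elim (simp add: D_def assms(3))
  then have "\<exists>\<^sub>F v in at w. remove_sings D v = 0" by (rule eventually_frequently[rotated]) simp
  then have z: "remove_sings D v = 0" for v
    by (rule frequently_eq_meromorphic_imp_constant[where f="remove_sings D" and A=UNIV and z=w])
      (use remove_sings_nicely_meromorphic[OF D] \<open>\<exists>\<^sub>F v in at w. remove_sings D v = 0\<close> in \<open>auto intro: convex_connected\<close>)
  have "\<forall>\<^sub>F v in at z. \<zeta> v = T v" using ev[of z] by eventually_elim (use z in \<open>simp add: D_def\<close>)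
  then have "is_pole \<zeta> z \<longleftrightarrow> is_pole T z" by (rule is_pole_cong) simp
  moreover have "\<not> is_pole T z"
    using not_is_pole_holomorphic[OF open_UNIV _ assms(2)] by simp
  ultimately show ?thesis by simp
qed

section \<open>Integral operators with bounded kernels\<close>

locale finite_borel_measure = finite_measure M for M :: "'a::{t2_space, second_countable_topology} measure" +
  assumes sets_M: "sets M = sets borel" and space_M: "space M = UNIV"
begin

lemma borel_measurable_M: "borel_measurable M = (borel_measurable borel :: ('a \<Rightarrow> complex) set)"
  by (rule measurable_cong_sets[OF sets_M refl])

lemma L2D: "f \<in> L2_fun M \<Longrightarrow> f \<in> borel_measurable M" "f \<in> L2_fun M \<Longrightarrow> integrable M (\<lambda>x. (norm (f x))\<^sup>2)"
  by (auto simp: L2_fun_def)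

lemma L2_product_integrable:
  assumes "f \<in> L2_fun M" "g \<in> L2_fun M"
  shows "integrable M (\<lambda>x. f x * g x)"
proof (rule Bochner_Integration.integrable_bound)
  show "integrable M (\<lambda>x. (norm (f x))\<^sup>2 + (norm (g x))\<^sup>2)" using assms by (auto simp: L2_fun_def)
  show "(\<lambda>x. f x * g x) \<in> borel_measurable M" using assms by (auto simp: L2_fun_def)
  have "norm a * norm b \<le> (norm a)\<^sup>2 + (norm b)\<^sup>2" for a b :: complex
    using sum_squares_bound[of "norm a" "norm b"] mult_nonneg_nonneg[OF norm_ge_zero[of a] norm_ge_zero[of b]] by linarith
  then show "AE x in M. norm (f x * g x) \<le> norm ((norm (f x))\<^sup>2 + (norm (g x))\<^sup>2)"
    by (intro AE_I2) (simp add: norm_mult)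
qed

lemma measurable_cnj: "f \<in> borel_measurable M \<Longrightarrow> (\<lambda>x. cnj (f x)) \<in> borel_measurable M"
  by (erule measurable_compose) (intro borel_measurable_continuous_onI continuous_intros)

lemma L2_cnj: "f \<in> L2_fun M \<Longrightarrow> (\<lambda>x. cnj (f x)) \<in> L2_fun M"
  by (auto simp: L2_fun_def measurable_cnj)

lemma L2_inner_integrable: "f \<in> L2_fun M \<Longrightarrow> g \<in> L2_fun M \<Longrightarrow> integrable M (\<lambda>x. f x * cnj (g x))"
  by (rule L2_product_integrable[OF _ L2_cnj])

lemma L2_bounded:
  assumes "f \<in> borel_measurable M" "\<And>x. norm (f x) \<le> B"
  shows "f \<in> L2_fun M"
proof -
  have "integrable M (\<lambda>x. (norm (f x))\<^sup>2)"
    by (rule integrable_const_bound[where B="B\<^sup>2"]) (use assms in \<open>auto intro!: power_mono\<close>)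
  then show ?thesis using assms(1) by (simp add: L2_fun_def)
qed

lemma L2_integrable: "f \<in> L2_fun M \<Longrightarrow> integrable M f"
  using L2_product_integrable[of f "\<lambda>_. 1"] L2_bounded[of "\<lambda>_. 1" 1] by simp

lemma L2_scale: "f \<in> L2_fun M \<Longrightarrow> (\<lambda>x. c * f x) \<in> L2_fun M"
  by (auto simp: L2_fun_def norm_mult power_mult_distrib)

lemma L2_add:
  assumes "f \<in> L2_fun M" "g \<in> L2_fun M"
  shows "(\<lambda>x. f x + g x) \<in> L2_fun M"
proof -
  have b: "(norm (a + b))\<^sup>2 \<le> 2 * (norm a)\<^sup>2 + 2 * (norm b)\<^sup>2" for a b :: complex
  proof -
    have "(norm (a + b))\<^sup>2 \<le> (norm a + norm b)\<^sup>2" by (intro power_mono norm_triangle_ineq) simp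
    also have "\<dots> = (norm a)\<^sup>2 + (norm b)\<^sup>2 + 2 * norm a * norm b" by (rule power2_sum)
    also have "\<dots> \<le> 2 * (norm a)\<^sup>2 + 2 * (norm b)\<^sup>2" using sum_squares_bound[of "norm a" "norm b"] by linarith
    finally show ?thesis .
  qed
  have m: "(\<lambda>x. f x + g x) \<in> borel_measurable M" using assms by (auto simp: L2_fun_def)
  have "integrable M (\<lambda>x. (norm (f x + g x))\<^sup>2)"
  proof (rule Bochner_Integration.integrable_bound)
    show "integrable M (\<lambda>x. 2 * (norm (f x))\<^sup>2 + 2 * (norm (g x))\<^sup>2)" using assms by (auto simp: L2_fun_def)
    show "(\<lambda>x. (norm (f x + g x))\<^sup>2) \<in> borel_measurable M" using m by measurable
    show "AE x in M. norm ((norm (f x + g x))\<^sup>2) \<le> norm (2 * (norm (f x))\<^sup>2 + 2 * (norm (g x))\<^sup>2)"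
      using b by (intro AE_I2) simp
  qed
  then show ?thesis using m by (simp add: L2_fun_def)
qed

lemma L2_sum:
  assumes "finite F" "\<And>e. e \<in> F \<Longrightarrow> e \<in> L2_fun M"
  shows "(\<lambda>x. \<Sum>e\<in>F. c e * e x) \<in> L2_fun M"
  using assms
proof (induction F)
  case empty then show ?case using L2_bounded[of "\<lambda>_. 0" 0] by simp
next
  case (insert e F)
  then show ?case using L2_add[OF L2_scale[of e "c e"]] by simp
qed

lemma L2_inner_sum:
  assumes "finite F" "\<And>e. e \<in> F \<Longrightarrow> e \<in> L2_fun M" "g \<in> L2_fun M"
  shows "L2_inner M (\<lambda>x. \<Sum>e\<in>F. c e * e x) g = (\<Sum>e\<in>F. c e * L2_inner M e g)"
proof -
  have "L2_inner M (\<lambda>x. \<Sum>e\<in>F. c e * e x) g = (LINT x|M. (\<Sum>e\<in>F. c e * (e x * cnj (g x))))"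
    by (simp add: L2_inner_def sum_distrib_right mult.assoc)
  also have "\<dots> = (\<Sum>e\<in>F. LINT x|M. c e * (e x * cnj (g x)))"
    by (intro Bochner_Integration.integral_sum integrable_mult_right L2_inner_integrable assms)
  finally show ?thesis by (simp add: L2_inner_def)
qed

lemma L2_inner_commute: "L2_inner M g f = cnj (L2_inner M f g)"
  unfolding L2_inner_def by (subst Bochner_Integration.integral_cnj[symmetric]) (simp add: mult.commute)

lemma L2_inner_self: "L2_inner M f f = of_real (LINT x|M. (norm (f x))\<^sup>2)"
  unfolding L2_inner_def complex_norm_square[symmetric] by (rule integral_complex_of_real)

text \<open>The squared norm of \<open>f\<close> minus its projection to the span of \<open>F\<close> is nonnegative.\<close>

lemma L2_bessel:
  assumes F: "finite F" "\<And>e. e \<in> F \<Longrightarrow> e \<in> L2_fun M"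
    and orth: "\<And>e e'. e \<in> F \<Longrightarrow> e' \<in> F \<Longrightarrow> L2_inner M e e' = (if e = e' then 1 else 0)"
    and f: "f \<in> L2_fun M"
  shows "(\<Sum>e\<in>F. (norm (L2_inner M f e))\<^sup>2) \<le> (LINT x|M. (norm (f x))\<^sup>2)"
proof -
  define c where "c e = L2_inner M f e" for e
  define g where "g x = (\<Sum>e\<in>F. c e * e x)" for x
  have g: "g \<in> L2_fun M" unfolding g_def[abs_def] by (rule L2_sum[OF F])
  define S where "S = (\<Sum>e\<in>F. (norm (c e))\<^sup>2)"
  have cc: "c e * cnj (c e) = of_real ((norm (c e))\<^sup>2)" for e by (rule complex_norm_square[symmetric])
  have gh: "L2_inner M g h = (\<Sum>e\<in>F. c e * L2_inner M e h)" if "h \<in> L2_fun M" for h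
    unfolding g_def[abs_def] by (rule L2_inner_sum[OF F that])
  have gf: "L2_inner M g f = of_real S"
    unfolding gh[OF f] S_def by (subst L2_inner_commute) (simp add: cc c_def[symmetric])
  have fg: "L2_inner M f g = of_real S" using L2_inner_commute[of f g] gf by simp
  have eg: "L2_inner M e g = cnj (c e)" if e: "e \<in> F" for e
  proof -
    have "L2_inner M g e = (\<Sum>e'\<in>F. c e' * (if e' = e then 1 else 0))"
      unfolding gh[OF F(2)[OF e]] by (intro sum.cong refl) (simp add: orth e)
    also have "\<dots> = c e" using F(1) e by (simp add: if_distrib cong: if_cong)
    finally show ?thesis using L2_inner_commute[of e g] by simp
  qed
  have gg: "L2_inner M g g = of_real S"
    unfolding gh[OF g] S_def using eg by (simp add: cc)
  have "(LINT x|M. (norm (f x - g x))\<^sup>2) = (LINT x|M. (norm (f x))\<^sup>2) - S"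
  proof -
    have "complex_of_real (LINT x|M. (norm (f x - g x))\<^sup>2) = L2_inner M (\<lambda>x. f x - g x) (\<lambda>x. f x - g x)"
      by (rule L2_inner_self[symmetric])
    also have "\<dots> = (LINT x|M. (f x * cnj (f x) - f x * cnj (g x)) - (g x * cnj (f x) - g x * cnj (g x)))"
      unfolding L2_inner_def by (simp add: algebra_simps)
    also have "\<dots> = (L2_inner M f f - L2_inner M f g) - (L2_inner M g f - L2_inner M g g)"
      unfolding L2_inner_def using L2_inner_integrable[OF f f] L2_inner_integrable[OF f g] L2_inner_integrable[OF g f] L2_inner_integrable[OF g g]
      by (simp add: Bochner_Integration.integral_diff)
    also have "\<dots> = complex_of_real ((LINT x|M. (norm (f x))\<^sup>2) - S)"
      unfolding fg gf gg L2_inner_self[of f] by simp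
    finally show ?thesis by (simp only: of_real_eq_iff)
  qed
  moreover have "(LINT x|M. (norm (f x - g x))\<^sup>2) \<ge> 0" by simp
  ultimately show ?thesis by (simp add: S_def c_def)
qed

text \<open>A maximal orthonormal set, which exists by Zorn's lemma, is complete: a vector orthogonal to it could be
normalised and added, and it would be new because its inner product with itself is not 0.\<close>

lemma L2_orthonormal_basis_exists: "\<exists>E. L2_orthonormal_basis M E"
proof -
  define S where "S = {E. E \<subseteq> L2_fun M \<and> (\<forall>e\<in>E. \<forall>f\<in>E. L2_inner M e f = (if e = f then 1 else 0))}"
  have "\<exists>E\<in>S. \<forall>X\<in>S. E \<subseteq> X \<longrightarrow> X = E"
  proof (rule subset_Zorn_nonempty)
    show "S \<noteq> {}" by (auto simp: S_def intro!: exI[of _ "{}"])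
    fix C assume C: "C \<noteq> {}" "subset.chain S C"
    then have CS: "C \<subseteq> S" and lin: "\<And>X Y. X \<in> C \<Longrightarrow> Y \<in> C \<Longrightarrow> X \<subseteq> Y \<or> Y \<subseteq> X"
      by (auto simp: subset_chain_def)
    have "L2_inner M e f = (if e = f then 1 else 0)" if ef: "e \<in> \<Union>C" "f \<in> \<Union>C" for e f
    proof -
      obtain X Y where XY: "X \<in> C" "e \<in> X" "Y \<in> C" "f \<in> Y" using ef by auto
      obtain Z where "Z \<in> C" "e \<in> Z" "f \<in> Z"
        using lin[OF XY(1,3)] XY by auto
      moreover from this have "Z \<in> S" using CS by auto
      ultimately show ?thesis unfolding S_def by blast
    qed
    moreover have "\<Union>C \<subseteq> L2_fun M" using CS by (auto simp: S_def)
    ultimately show "\<Union>C \<in> S" by (simp add: S_def)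
  qed
  then obtain E where E: "E \<in> S" and max: "\<And>X. X \<in> S \<Longrightarrow> E \<subseteq> X \<Longrightarrow> X = E" by blast
  have EL: "E \<subseteq> L2_fun M" and orth: "\<And>e f. e \<in> E \<Longrightarrow> f \<in> E \<Longrightarrow> L2_inner M e f = (if e = f then 1 else 0)"
    using E by (auto simp: S_def)
  have "AE x in M. f x = 0" if f: "f \<in> L2_fun M" and perp: "\<forall>e\<in>E. L2_inner M f e = 0" for f
  proof (rule ccontr)
    assume n: "\<not> (AE x in M. f x = 0)"
    define r where "r = (LINT x|M. (norm (f x))\<^sup>2)"
    have "r \<noteq> 0"
      using n integral_nonneg_eq_0_iff_AE[of M "\<lambda>x. (norm (f x))\<^sup>2"] L2D(2)[OF f] by (auto simp: r_def)
    moreover have "r \<ge> 0" by (simp add: r_def)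
    ultimately have r: "r > 0" by simp
    define c where "c = complex_of_real (1 / sqrt r)"
    define g where "g x = c * f x" for x
    have gL: "g \<in> L2_fun M" unfolding g_def[abs_def] by (rule L2_scale[OF f])
    have gi: "L2_inner M g h = c * L2_inner M f h" for h
      by (simp add: L2_inner_def g_def mult.assoc)
    have ge: "L2_inner M g e = 0" if "e \<in> E" for e using perp that by (simp add: gi)
    have fg: "L2_inner M f g = c * of_real r"
    proof -
      have "L2_inner M f g = cnj (L2_inner M g f)" by (rule L2_inner_commute)
      then show ?thesis by (simp add: gi L2_inner_self r_def[symmetric] c_def)
    qed
    have gg: "L2_inner M g g = 1"
      unfolding gi fg c_def using r by (simp add: field_simps flip: of_real_mult)
    have "insert g E \<in> S"
      unfolding S_def mem_Collect_eq
    proof (intro conjI ballI)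
      fix e e' assume "e \<in> insert g E" "e' \<in> insert g E"
      then consider "e = g" "e' = g" | "e = g" "e' \<in> E" | "e \<in> E" "e' = g" | "e \<in> E" "e' \<in> E" by blast
      then show "L2_inner M e e' = (if e = e' then 1 else 0)"
      proof cases
        case 2 then show ?thesis using ge gg by auto
      next
        case 3 then show ?thesis using ge gg L2_inner_commute[of e g] by auto
      qed (auto simp: gg orth)
    qed (use EL gL in auto)
    then have "g \<in> E" using max[of "insert g E"] by blast
    then have "L2_inner M g g = 0" by (rule ge)
    then show False using gg by simp
  qed
  then have "L2_orthonormal_basis M E" unfolding L2_orthonormal_basis_def using EL orth by blast
  then show ?thesis by blast
qed

text \<open>The quadratic polynomial \<open>t \<mapsto> LINT x|M. (norm (f x) - t)\<^sup>2\<close> is nonnegative, so its discriminant is not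
positive.\<close>

lemma L1_L2_bound:
  assumes "f \<in> L2_fun M"
  shows "(LINT x|M. norm (f x))\<^sup>2 \<le> measure M UNIV * (LINT x|M. (norm (f x))\<^sup>2)"
proof -
  define A S \<mu> where "A = (LINT x|M. norm (f x))" "S = (LINT x|M. (norm (f x))\<^sup>2)" "\<mu> = measure M UNIV"
  have i: "integrable M (\<lambda>x. norm (f x))" "integrable M (\<lambda>x. (norm (f x))\<^sup>2)"
    using L2_integrable[OF assms] L2D(2)[OF assms] by auto
  have q: "0 \<le> S - 2 * t * A + t\<^sup>2 * \<mu>" for t
  proof -
    have "0 \<le> (LINT x|M. (norm (f x) - t)\<^sup>2)" by simp
    also have "\<dots> = (LINT x|M. ((norm (f x))\<^sup>2 - 2 * t * norm (f x)) + t\<^sup>2)"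
      by (simp add: power2_diff algebra_simps)
    also have "\<dots> = S - 2 * t * A + t\<^sup>2 * \<mu>"
      using i by (simp add: A_S_\<mu>_def space_M)
    finally show ?thesis .
  qed
  have "A \<ge> 0" "S \<ge> 0" "\<mu> \<ge> 0" by (auto simp: A_S_\<mu>_def)
  have "A\<^sup>2 \<le> \<mu> * S"
  proof (cases "\<mu> = 0")
    case True
    have "A = 0"
    proof (rule ccontr)
      assume "A \<noteq> 0"
      then show False using q[of "(S + 1) / (2 * A)"] True by simp
    qed
    then show ?thesis using True by simp
  next
    case False
    then have "0 \<le> \<mu> * (S - 2 * (A / \<mu>) * A + (A / \<mu>)\<^sup>2 * \<mu>)"
      using q[of "A / \<mu>"] \<open>\<mu> \<ge> 0\<close> by simp
    also have "\<dots> = \<mu> * S - A\<^sup>2" using False by (simp add: field_simps power2_eq_square)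
    finally show ?thesis by simp
  qed
  then show ?thesis by (simp add: A_S_\<mu>_def)
qed

definition kernel_op :: "('a \<times> 'a \<Rightarrow> complex) \<Rightarrow> ('a \<Rightarrow> complex) \<Rightarrow> 'a \<Rightarrow> complex" where
  "kernel_op k f x = (LINT y|M. k (x, y) * f y)"

lemma kernel_slice_measurable:
  fixes k :: "'a \<times> 'a \<Rightarrow> complex"
  assumes "k \<in> borel_measurable borel"
  shows "(\<lambda>y. k (x, y)) \<in> borel_measurable M"
proof -
  have "(\<lambda>y. (x, y)) \<in> borel \<rightarrow>\<^sub>M (borel :: ('a \<times> 'a) measure)"
    by (intro borel_measurable_continuous_onI continuous_intros)
  from measurable_compose[OF this assms] show ?thesis by (simp add: borel_measurable_M)
qed

lemma kernel_integrable:
  assumes "k \<in> borel_measurable borel" "\<And>p. norm (k p) \<le> B" "integrable M f"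
  shows "integrable M (\<lambda>y. k (x, y) * f y)" "norm (kernel_op k f x) \<le> B * (LINT y|M. norm (f y))"
proof -
  have b: "norm (k (x, y) * f y) \<le> B * norm (f y)" for y
    using assms(2) by (simp add: norm_mult mult_right_mono)
  have i: "integrable M (\<lambda>y. B * norm (f y))" using assms(3) by auto
  show int: "integrable M (\<lambda>y. k (x, y) * f y)"
  proof (rule Bochner_Integration.integrable_bound[OF i])
    show "(\<lambda>y. k (x, y) * f y) \<in> borel_measurable M"
      using kernel_slice_measurable[OF assms(1)] assms(3) by (intro borel_measurable_times) auto
    show "AE y in M. norm (k (x, y) * f y) \<le> norm (B * norm (f y))"
      using b by (intro AE_I2) (metis abs_ge_self order_trans real_norm_def)
  qed
  have "norm (kernel_op k f x) \<le> (LINT y|M. norm (k (x, y) * f y))"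
    unfolding kernel_op_def by (rule integral_norm_bound)
  also have "\<dots> \<le> (LINT y|M. B * norm (f y))"
    by (rule integral_mono[OF integrable_norm[OF int] i b])
  finally show "norm (kernel_op k f x) \<le> B * (LINT y|M. norm (f y))" by simp
qed

lemma kernel_op_measurable:
  assumes "k \<in> borel_measurable borel" "f \<in> borel_measurable M"
  shows "kernel_op k f \<in> borel_measurable M"
proof -
  have "(\<lambda>p. k p * f (snd p)) \<in> borel_measurable (M \<Otimes>\<^sub>M M)"
  proof -
    have s: "sets (M \<Otimes>\<^sub>M M) = sets (borel :: ('a \<times> 'a) measure)"
      using sets_pair_measure_cong[OF sets_M sets_M] unfolding borel_prod .
    have "k \<in> borel_measurable (M \<Otimes>\<^sub>M M)"
      using assms(1) measurable_cong_sets[OF s refl] by blast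
    moreover have "(\<lambda>p. f (snd p)) \<in> borel_measurable (M \<Otimes>\<^sub>M M)"
      using assms(2) by measurable
    ultimately show ?thesis by (intro borel_measurable_times)
  qed
  then have "(\<lambda>(x, y). k (x, y) * f y) \<in> borel_measurable (M \<Otimes>\<^sub>M M)" by (simp add: case_prod_unfold)
  then show ?thesis unfolding kernel_op_def[abs_def] by (rule borel_measurable_lebesgue_integral)
qed

text \<open>For fixed \<open>x\<close> the values \<open>kernel_op k e x\<close> are, up to conjugation, the Fourier coefficients of \<open>cnj (k (x, y))\<close> as a
function of \<open>y\<close>. By Bessel's inequality the sum of their squared norms is at most \<open>B\<^sup>2 * measure M UNIV\<close>,
and this bound is integrable in \<open>x\<close>.\<close>

theorem kernel_op_hilbert_schmidt:
  assumes k: "k \<in> borel_measurable borel" "\<And>p. norm (k p) \<le> B"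
  shows "hilbert_schmidt M (kernel_op k)"
proof -
  have B: "B \<ge> 0" using k(2) norm_ge_zero order_trans by blast
  define \<mu> where "\<mu> = measure M UNIV"
  have L2: "kernel_op k f \<in> L2_fun M" if "f \<in> L2_fun M" for f
    by (rule L2_bounded[OF kernel_op_measurable[OF k(1) L2D(1)[OF that]] kernel_integrable(2)[OF k L2_integrable[OF that]]])
  have lin: "kernel_op k (\<lambda>x. c * f x + g x) x = c * kernel_op k f x + kernel_op k g x"
    if "f \<in> L2_fun M" "g \<in> L2_fun M" for f g c x
  proof -
    have "kernel_op k (\<lambda>x. c * f x + g x) x = (LINT y|M. c * (k (x, y) * f y) + k (x, y) * g y)"
      unfolding kernel_op_def by (simp add: algebra_simps)
    also have "\<dots> = (LINT y|M. c * (k (x, y) * f y)) + (LINT y|M. k (x, y) * g y)"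
      by (intro Bochner_Integration.integral_add integrable_mult_right kernel_integrable(1)[OF k] L2_integrable that)
    finally show ?thesis by (simp add: kernel_op_def)
  qed
  have bd: "L2_norm_fun M (kernel_op k f) \<le> (B * \<mu>) * L2_norm_fun M f" if f: "f \<in> L2_fun M" for f
  proof -
    have p: "(norm (kernel_op k f x))\<^sup>2 \<le> B\<^sup>2 * (\<mu> * (LINT x|M. (norm (f x))\<^sup>2))" for x
    proof -
      have "(norm (kernel_op k f x))\<^sup>2 \<le> (B * (LINT y|M. norm (f y)))\<^sup>2"
        using kernel_integrable(2)[OF k L2_integrable[OF f]] by (rule power_mono) simp
      also have "\<dots> \<le> B\<^sup>2 * (\<mu> * (LINT x|M. (norm (f x))\<^sup>2))"
        unfolding power_mult_distrib \<mu>_def by (intro mult_left_mono L1_L2_bound[OF f]) simp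
      finally show ?thesis .
    qed
    have "(LINT x|M. (norm (kernel_op k f x))\<^sup>2) \<le> (LINT x|M. B\<^sup>2 * (\<mu> * (LINT x|M. (norm (f x))\<^sup>2)))"
      using p L2D(2)[OF L2[OF f]] by (intro integral_mono) auto
    also have "\<dots> = (B * \<mu>)\<^sup>2 * (LINT x|M. (norm (f x))\<^sup>2)"
      by (simp add: space_M \<mu>_def power2_eq_square)
    finally have "sqrt (LINT x|M. (norm (kernel_op k f x))\<^sup>2) \<le> sqrt ((B * \<mu>)\<^sup>2 * (LINT x|M. (norm (f x))\<^sup>2))"
      by (rule real_sqrt_le_mono)
    then show ?thesis using B by (simp add: L2_norm_fun_def real_sqrt_mult \<mu>_def)
  qed
  obtain E where E: "L2_orthonormal_basis M E" using L2_orthonormal_basis_exists by blast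
  then have EL: "\<And>e. e \<in> E \<Longrightarrow> e \<in> L2_fun M" and orth: "\<And>e f. e \<in> E \<Longrightarrow> f \<in> E \<Longrightarrow> L2_inner M e f = (if e = f then 1 else 0)"
    unfolding L2_orthonormal_basis_def by blast+
  have fin: "(\<Sum>e\<in>F. (L2_norm_fun M (kernel_op k e))\<^sup>2) \<le> B\<^sup>2 * \<mu> * \<mu>" if F: "F \<subseteq> E" "finite F" for F
  proof -
    have FL: "e \<in> L2_fun M" if "e \<in> F" for e using EL that F(1) by blast
    have pt: "(\<Sum>e\<in>F. (norm (kernel_op k e x))\<^sup>2) \<le> B\<^sup>2 * \<mu>" for x
    proof -
      define h where "h y = cnj (k (x, y))" for y
      have hm: "h \<in> borel_measurable M" unfolding h_def[abs_def] by (rule measurable_cnj[OF kernel_slice_measurable[OF k(1)]])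
      have h: "h \<in> L2_fun M" by (rule L2_bounded[OF hm, of B]) (use k(2) in \<open>simp add: h_def\<close>)
      have "norm (kernel_op k e x) = norm (L2_inner M h e)" for e
      proof -
        have "L2_inner M h e = cnj (kernel_op k e x)"
          unfolding L2_inner_def kernel_op_def h_def by (subst Bochner_Integration.integral_cnj[symmetric]) simp
        then show ?thesis by simp
      qed
      then have "(\<Sum>e\<in>F. (norm (kernel_op k e x))\<^sup>2) = (\<Sum>e\<in>F. (norm (L2_inner M h e))\<^sup>2)" by simp
      also have "\<dots> \<le> (LINT y|M. (norm (h y))\<^sup>2)"
        by (rule L2_bessel[OF F(2) FL orth h]) (use F(1) in auto)
      also have "\<dots> \<le> (LINT y|M. B\<^sup>2)"
        using L2D(2)[OF h] k(2) by (intro integral_mono) (auto simp: h_def intro!: power_mono)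
      also have "\<dots> = B\<^sup>2 * \<mu>" by (simp add: space_M \<mu>_def)
      finally show ?thesis .
    qed
    have int: "integrable M (\<lambda>x. (norm (kernel_op k e x))\<^sup>2)" if "e \<in> F" for e using L2D(2)[OF L2[OF FL[OF that]]] .
    have "(\<Sum>e\<in>F. (L2_norm_fun M (kernel_op k e))\<^sup>2) = (\<Sum>e\<in>F. LINT x|M. (norm (kernel_op k e x))\<^sup>2)"
      by (simp add: L2_norm_fun_def)
    also have "\<dots> = (LINT x|M. (\<Sum>e\<in>F. (norm (kernel_op k e x))\<^sup>2))"
      using int by (intro Bochner_Integration.integral_sum[symmetric])
    also have "\<dots> \<le> (LINT x|M. B\<^sup>2 * \<mu>)"
      using pt int by (intro integral_mono Bochner_Integration.integrable_sum) auto
    also have "\<dots> = B\<^sup>2 * \<mu> * \<mu>" by (simp add: space_M \<mu>_def)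
    finally show ?thesis .
  qed
  have "(\<lambda>e. (L2_norm_fun M (kernel_op k e))\<^sup>2) summable_on E"
    by (rule nonneg_bdd_above_summable_on) (auto intro!: bdd_aboveI2[where M="B\<^sup>2 * \<mu> * \<mu>"] fin)
  then show ?thesis
    unfolding hilbert_schmidt_def L2_bounded_operator_def using L2 lin bd E by blast
qed

lemma kernel_op_diff_bound:
  assumes "k \<in> borel_measurable borel" "\<And>p. norm (k p) \<le> B" "l \<in> borel_measurable borel" "\<And>p. norm (l p) \<le> C"
    and "integrable M f" "\<And>p. norm (k p - l p) \<le> \<delta>"
  shows "norm (kernel_op k f x - kernel_op l f x) \<le> \<delta> * (LINT y|M. norm (f y))"
proof -
  have "kernel_op k f x - kernel_op l f x = kernel_op (\<lambda>p. k p - l p) f x"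
    unfolding kernel_op_def left_diff_distrib
    by (rule Bochner_Integration.integral_diff[symmetric, OF kernel_integrable(1)[OF assms(1,2,5)] kernel_integrable(1)[OF assms(3,4,5)]])
  moreover have "(\<lambda>p. k p - l p) \<in> borel_measurable borel" using assms(1,3) by (rule borel_measurable_diff)
  ultimately show ?thesis using kernel_integrable(2)[where k="\<lambda>p. k p - l p" and x=x, OF _ assms(6,5)] by simp
qed

text \<open>Uniform convergence of bounded kernels implies convergence of the pairings, as the measure is finite and
elements of \<open>L\<^sup>2\<close> are integrable.\<close>

lemma pairing_limit:
  assumes k: "k \<in> borel_measurable borel" "\<And>p. norm (k p) \<le> B"
    and R: "\<And>\<epsilon>. \<epsilon> > 0 \<Longrightarrow> R \<epsilon> \<in> borel_measurable borel" "\<And>\<epsilon>. \<epsilon> > 0 \<Longrightarrow> \<exists>C. \<forall>p. norm (R \<epsilon> p) \<le> C"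
    and lim: "\<And>\<delta>. \<delta> > 0 \<Longrightarrow> \<forall>\<^sub>F \<epsilon> in at_right (0::real). \<forall>p. norm (R \<epsilon> p - k p) \<le> \<delta>"
    and f: "f \<in> L2_fun M" and h: "h \<in> L2_fun M"
  shows "((\<lambda>\<epsilon>. LINT x|M. LINT y|M. R \<epsilon> (x, y) * f y * h x) \<longlongrightarrow> (LINT x|M. kernel_op k f x * h x)) (at_right 0)"
proof -
  define A where "A = (LINT y|M. norm (f y)) * (LINT x|M. norm (h x))"
  have A: "A \<ge> 0" unfolding A_def by (intro mult_nonneg_nonneg) simp_all
  have fi: "integrable M f" and hi: "integrable M h" using f h by (auto intro: L2_integrable)
  have eq: "(LINT x|M. LINT y|M. R \<epsilon> (x, y) * f y * h x) = (LINT x|M. kernel_op (R \<epsilon>) f x * h x)" for \<epsilon>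
    by (simp add: kernel_op_def)
  have oi: "integrable M (\<lambda>x. kernel_op l f x * h x)" if "l \<in> borel_measurable borel" "\<And>p. norm (l p) \<le> C" for l C
  proof -
    have "kernel_op l f \<in> L2_fun M"
      by (rule L2_bounded[OF kernel_op_measurable[OF that(1) L2D(1)[OF f]] kernel_integrable(2)[OF that fi]])
    then show ?thesis by (rule L2_product_integrable[OF _ h])
  qed
  show ?thesis
    unfolding eq
  proof (rule tendstoI)
    fix e :: real assume e: "e > 0"
    define \<delta> where "\<delta> = e / (2 * (A + 1))"
    have d: "\<delta> > 0" using e A by (simp add: \<delta>_def)
    have dA: "\<delta> * A < e"
    proof -
      have "\<delta> * A \<le> \<delta> * (A + 1)" using d by (intro mult_left_mono) auto
      also have "\<dots> = e / 2" using A by (simp add: \<delta>_def field_simps)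
      finally show ?thesis using e by linarith
    qed
    show "\<forall>\<^sub>F \<epsilon> in at_right 0. dist (LINT x|M. kernel_op (R \<epsilon>) f x * h x) (LINT x|M. kernel_op k f x * h x) < e"
      using lim[OF d] eventually_at_right_less[of 0]
    proof eventually_elim
      case (elim \<epsilon>)
      obtain C where C: "\<And>p. norm (R \<epsilon> p) \<le> C" using R(2)[OF elim(2)] by blast
      note Rm = R(1)[OF elim(2)]
      have b: "norm (kernel_op (R \<epsilon>) f x * h x - kernel_op k f x * h x) \<le> \<delta> * (LINT y|M. norm (f y)) * norm (h x)" for x
        unfolding left_diff_distrib[symmetric] norm_mult
        by (rule mult_right_mono[OF kernel_op_diff_bound[OF Rm C k fi]]) (use elim(1) in auto)
      have "dist (LINT x|M. kernel_op (R \<epsilon>) f x * h x) (LINT x|M. kernel_op k f x * h x)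
          = norm (LINT x|M. kernel_op (R \<epsilon>) f x * h x - kernel_op k f x * h x)"
        unfolding dist_norm using oi[OF Rm C] oi[OF k] by (simp add: Bochner_Integration.integral_diff)
      also have "\<dots> \<le> (LINT x|M. norm (kernel_op (R \<epsilon>) f x * h x - kernel_op k f x * h x))"
        by (rule integral_norm_bound)
      also have "\<dots> \<le> (LINT x|M. \<delta> * (LINT y|M. norm (f y)) * norm (h x))"
        using b hi oi[OF Rm C] oi[OF k] by (intro integral_mono integrable_norm Bochner_Integration.integrable_diff) auto
      also have "\<dots> = \<delta> * A" by (simp add: A_def)
      finally show ?case using dA by linarith
    qed
  qed
qed

end

section \<open>Kernel and trace on a compact manifold\<close>

text \<open>Stated for arbitrary families of charts in order to apply to products of atlases as well.\<close>

lemma mfd_smooth_on_continuous: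
  fixes \<A> :: "('a::t2_space, 'e::euclidean_space) chart set"
  assumes charts: "\<And>p. \<exists>(D, \<phi>)\<in>\<A>. p \<in> D \<and> open D \<and> continuous_on D \<phi> \<and> inj_on \<phi> D"
    and f: "mfd_smooth_on \<A> W f"
  shows "continuous_on W f"
proof -
  have W: "open W" using f by (simp add: mfd_smooth_on_def)
  have "isCont f p" if p: "p \<in> W" for p
  proof -
    obtain D \<phi> where c: "(D, \<phi>) \<in> \<A>" "p \<in> D" "open D" "continuous_on D \<phi>" "inj_on \<phi> D"
      using charts[of p] by auto
    have "smooth_fun_on (\<phi> ` (D \<inter> W)) (f \<circ> inv_into D \<phi>)"
      using f c(1) unfolding mfd_smooth_on_def by auto
    then have "Ck_on 0 (\<phi> ` (D \<inter> W)) (f \<circ> inv_into D \<phi>)" unfolding smooth_fun_on_def by (rule spec)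
    then have "continuous_on (\<phi> ` (D \<inter> W)) (f \<circ> inv_into D \<phi>)" by simp
    with continuous_on_subset[OF c(4)] have "continuous_on (D \<inter> W) ((f \<circ> inv_into D \<phi>) \<circ> \<phi>)"
      by (rule continuous_on_compose) simp
    then have "continuous_on (D \<inter> W) f"
      by (rule continuous_on_eq) (use c(5) in \<open>auto\<close>)
    then show ?thesis using c(2,3) W p by (simp add: continuous_on_eq_continuous_at open_Int)
  qed
  then show ?thesis by (simp add: continuous_at_imp_continuous_on)
qed

lemma smooth_atlas_charts:
  assumes "smooth_atlas \<A>"
  shows "\<exists>(D, \<phi>)\<in>\<A>. p \<in> D \<and> open D \<and> continuous_on D \<phi> \<and> inj_on \<phi> D"
proof -
  obtain D \<phi> where c: "(D, \<phi>) \<in> \<A>" "p \<in> D" by (rule atlas_chart[OF assms])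
  then show ?thesis using atlas_chartD[OF assms c(1)] by (intro bexI[of _ "(D, \<phi>)"]) auto
qed

lemma prod_atlas_charts:
  assumes "smooth_atlas \<A>" "smooth_atlas \<B>"
  shows "\<exists>(D, \<phi>)\<in>prod_atlas \<A> \<B>. p \<in> D \<and> open D \<and> continuous_on D \<phi> \<and> inj_on \<phi> D"
proof -
  obtain D \<phi> where c: "(D, \<phi>) \<in> \<A>" "fst p \<in> D" by (rule atlas_chart[OF assms(1)])
  obtain E \<psi> where e: "(E, \<psi>) \<in> \<B>" "snd p \<in> E" by (rule atlas_chart[OF assms(2)])
  note d = atlas_chartD[OF assms(1) c(1)] and f = atlas_chartD[OF assms(2) e(1)]
  have "continuous_on (D \<times> E) (map_prod \<phi> \<psi>)"
    unfolding map_prod_def case_prod_unfold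
    by (intro continuous_on_Pair continuous_on_compose2[OF d(3)] continuous_on_compose2[OF f(3)] continuous_intros) auto
  moreover have "inj_on (map_prod \<phi> \<psi>) (D \<times> E)" by (rule inj_on_map_prod[OF d(4) f(4)])
  ultimately show ?thesis
    using prod_atlasI[OF c(1) e(1)] c(2) e(2) open_Times[OF d(1) f(1)]
    by (intro bexI[of _ "(D \<times> E, map_prod \<phi> \<psi>)"]) (auto simp: mem_Times_iff)
qed

lemma phase_continuous:
  fixes \<A> :: "('a::topological_space, 'e::euclidean_space) chart set" and \<theta> :: "'a \<Rightarrow> 'a \<Rightarrow> real^'n \<Rightarrow> real"
  assumes "smooth_atlas \<A>" "phase_function \<A> \<theta>"
  shows "continuous_on (UNIV \<times> - {0}) (\<lambda>(p, \<xi>). \<theta> (fst p) (snd p) \<xi>)"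
proof -
  have "smooth_in 0 UNIV (\<lambda>p \<xi>. complex_of_real (\<theta> (fst p) (snd p) \<xi>))"
    using assms unfolding phase_function_def by (intro smooth_in_mfd[OF assms(1) _ bounded_linear_of_real]) auto
  then have "continuous_on (UNIV \<times> - {0}) (\<lambda>q. Re ((\<lambda>(p, \<xi>). complex_of_real (\<theta> (fst p) (snd p) \<xi>)) q))"
    by (intro continuous_on_Re) simp
  then show ?thesis by (simp add: case_prod_unfold)
qed

text \<open>The stationary points stay on the unit sphere, where \<open>\<theta>\<close> is continuous.\<close>

lemma open_nonvanishing_region:
  fixes \<A> :: "('a::t2_space, 'e::euclidean_space) chart set" and \<theta> :: "'a \<Rightarrow> 'a \<Rightarrow> real^'n \<Rightarrow> real"
  assumes \<A>: "smooth_atlas \<A>" and \<theta>: "phase_function \<A> \<theta>" and st: "stationary_points_on \<A> U \<theta> n \<sigma>"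
    and U: "open U"
  shows "open (nonvanishing_region U \<theta> n \<sigma>)"
proof -
  define h where "h s p = \<theta> (fst p) (snd p) (\<sigma> s (fst p) (snd p))" for s p
  have c: "continuous_on U (h s)" if s: "s \<in> {1..n}" for s
  proof -
    have "mfd_smooth_on (prod_atlas \<A> \<A>) U (\<lambda>(x, y). \<sigma> s x y)"
      using st s unfolding stationary_points_on_def by blast
    from mfd_smooth_on_continuous[OF prod_atlas_charts[OF \<A> \<A>] this]
    have \<sigma>: "continuous_on U (\<lambda>p. \<sigma> s (fst p) (snd p))" by (simp add: case_prod_unfold)
    have nz: "\<sigma> s (fst p) (snd p) \<noteq> 0" if p: "p \<in> U" for p
    proof -
      have "sphere_stationary (\<theta> (fst p) (snd p)) (\<sigma> s (fst p) (snd p))"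
        using stationary_points_onD[OF st, of "fst p" "snd p"] p s by auto
      then show ?thesis by (auto simp: sphere_stationary_def)
    qed
    have "continuous_on U (\<lambda>p. (\<lambda>(p, \<xi>). \<theta> (fst p) (snd p) \<xi>) (p, \<sigma> s (fst p) (snd p)))"
      by (rule continuous_on_compose2[OF phase_continuous[OF \<A> \<theta>]])
        (use nz in \<open>auto intro!: continuous_on_Pair continuous_on_id \<sigma>\<close>)
    then show ?thesis by (simp add: h_def[abs_def])
  qed
  have "open (U \<inter> h s -` (- {0}))" if "s \<in> {1..n}" for s
    using c[OF that] unfolding continuous_on_open_vimage[OF U] by (simp add: open_nonzero Int_commute)
  then have "open (U \<inter> (\<Inter>s\<in>{1..n}. U \<inter> h s -` (- {0})))"
    by (intro open_Int[OF U] open_INT) auto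
  moreover have "nonvanishing_region U \<theta> n \<sigma> = U \<inter> (\<Inter>s\<in>{1..n}. U \<inter> h s -` (- {0}))"
    unfolding nonvanishing_region_def h_def by auto
  ultimately show ?thesis by simp
qed

lemma compact_diagonal: "compact (UNIV :: 'a::topological_space set) \<Longrightarrow> compact (range (\<lambda>x::'a. (x, x)))"
  by (rule compact_continuous_image) (intro continuous_intros)

context finite_borel_measure begin

lemma continuous_bounded_L2:
  assumes "compact (UNIV :: 'a set)" "continuous_on UNIV (f :: 'a \<Rightarrow> complex)"
  shows "f \<in> L2_fun M"
proof -
  have "bounded (range f)" by (rule compact_imp_bounded[OF compact_continuous_image[OF assms(2,1)]])
  then obtain B where B: "\<And>x. norm (f x) \<le> B" by (auto simp: bounded_iff)
  have "f \<in> borel_measurable M" unfolding borel_measurable_M by (rule borel_measurable_continuous_onI[OF assms(2)])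
  then show ?thesis using B by (rule L2_bounded)
qed

lemma osc_continuous_diagonal:
  fixes \<theta> :: "'a \<Rightarrow> 'a \<Rightarrow> real^'n \<Rightarrow> real"
  assumes cpt: "compact (UNIV :: 'a set)"
    and osc: "osc_continuous (range (\<lambda>x. (x, x))) (\<lambda>p. \<theta> (fst p) (snd p)) (\<lambda>p. a (fst p) (snd p)) I"
  shows "has_oscillatory_integral (\<theta> x x) (a x x) (I (x, x))"
    and "fio_kernel \<theta> a x x = I (x, x)"
    and "continuous_on UNIV (\<lambda>x. fio_kernel \<theta> a x x)"
    and "fio_trace_exists M \<theta> a"
proof -
  show h: "has_oscillatory_integral (\<theta> x x) (a x x) (I (x, x))" for x
    using osc_limit[OF osc, of "(x, x)"] by simp
  show k: "fio_kernel \<theta> a x x = I (x, x)" for x by (rule fio_kernel_eq[OF h])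
  have "continuous_on (range (\<lambda>x. (x, x))) I"
    by (rule osc_value_continuous[OF osc schwartz_gauss_reg])
  then have "continuous_on UNIV (\<lambda>x. I (x, x))"
    by (rule continuous_on_compose2) (auto intro!: continuous_intros)
  then show c: "continuous_on UNIV (\<lambda>x. fio_kernel \<theta> a x x)" by (simp add: k)
  show "fio_trace_exists M \<theta> a"
    unfolding fio_trace_exists_def using h L2_integrable[OF continuous_bounded_L2[OF cpt c]] by blast
qed

lemma continuous_extension_by_zero:
  fixes f :: "'a \<times> 'a \<Rightarrow> complex"
  assumes "compact K" "continuous_on K f"
  shows "(\<lambda>p. indicator K p *\<^sub>R f p) \<in> borel_measurable borel" "\<exists>C. \<forall>p. norm (indicator K p *\<^sub>R f p) \<le> C"
proof -
  have "K \<in> sets borel" by (rule borel_closed[OF compact_imp_closed[OF assms(1)]])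
  then show "(\<lambda>p. indicator K p *\<^sub>R f p) \<in> borel_measurable borel"
    using assms(2) by (rule borel_measurable_continuous_on_indicator)
  have "bounded (f ` K)" by (rule compact_imp_bounded[OF compact_continuous_image[OF assms(2,1)]])
  then obtain C where C: "\<And>p. p \<in> K \<Longrightarrow> norm (f p) \<le> C" by (auto simp: bounded_iff)
  have "norm (indicator K p *\<^sub>R f p) \<le> max C 0" for p
    using C[of p] by (auto simp: indicator_def)
  then show "\<exists>C. \<forall>p. norm (indicator K p *\<^sub>R f p) \<le> C" by blast
qed

text \<open>The factor \<open>\<rho>\<close> confines the operator to \<open>K\<close>. It need not be continuous, so it can also be the indicator
function of \<open>K\<close>, which leaves amplitudes supported over \<open>K\<close> unchanged.\<close>

lemma osc_continuous_hilbert_schmidt: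
  fixes \<theta> :: "'a \<Rightarrow> 'a \<Rightarrow> real^'n \<Rightarrow> real" and \<A> :: "('a, 'e::euclidean_space) chart set"
  assumes cpt: "compact (UNIV :: 'a set)" and \<A>: "smooth_atlas \<A>" and K: "compact K"
    and osc: "osc_continuous K (\<lambda>p. \<theta> (fst p) (snd p)) (\<lambda>p. a (fst p) (snd p)) I"
    and \<rho>: "\<rho> \<in> borel_measurable borel" "\<And>p. norm (\<rho> p) \<le> C" "\<And>p. p \<notin> K \<Longrightarrow> \<rho> p = (0::complex)"
  shows "fio_hilbert_schmidt \<A> M \<theta> (\<lambda>x y \<xi>. \<rho> (x, y) * a x y \<xi>)"
proof -
  let ?\<theta> = "\<lambda>p. \<theta> (fst p) (snd p)" and ?a = "\<lambda>p. a (fst p) (snd p)"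
  have C: "C \<ge> 0" using \<rho>(2)[of undefined] norm_ge_zero[of "\<rho> undefined"] by linarith
  define ext where "ext f p = \<rho> p * (indicator K p *\<^sub>R f p)" for f :: "'a \<times> 'a \<Rightarrow> complex" and p
  have ext: "ext f \<in> borel_measurable borel" "\<exists>B. \<forall>p. norm (ext f p) \<le> B" if "continuous_on K f" for f
  proof -
    note e = continuous_extension_by_zero[OF K that]
    show "ext f \<in> borel_measurable borel" unfolding ext_def[abs_def] by (intro borel_measurable_times \<rho>(1) e(1))
    obtain B where B: "\<And>p. norm (indicator K p *\<^sub>R f p) \<le> B" using e(2) by blast
    have "norm (ext f p) \<le> C * B" for p
      unfolding ext_def norm_mult using \<rho>(2) B C by (intro mult_mono) auto
    then show "\<exists>B. \<forall>p. norm (ext f p) \<le> B" by blast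
  qed
  have I: "continuous_on K I" by (rule osc_value_continuous[OF osc schwartz_gauss_reg])
  obtain B where B: "\<And>p. norm (ext I p) \<le> B" using ext(2)[OF I] by blast
  have lim: "((\<lambda>\<epsilon>. fio_pairing M \<theta> (\<lambda>x y \<xi>. \<rho> (x, y) * a x y \<xi>) \<kappa> \<epsilon> f h) \<longlongrightarrow>
      (LINT x|M. kernel_op (ext I) f x * h x)) (at_right 0)"
    if fh: "mfd_smooth_on \<A> UNIV f" "mfd_smooth_on \<A> UNIV h" and \<kappa>: "schwartz \<kappa>" "\<kappa> 0 = 1" for f h \<kappa>
  proof -
    have f: "f \<in> L2_fun M" and h: "h \<in> L2_fun M"
      using fh by (auto intro!: continuous_bounded_L2[OF cpt] mfd_smooth_on_continuous[OF smooth_atlas_charts[OF \<A>]])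
    note oc = osc_continuousD[OF osc \<kappa>]
    have Rc: "continuous_on K (osc_reg \<kappa> ?\<theta> ?a \<epsilon>)" if e: "\<epsilon> > 0" for \<epsilon>
    proof -
      have "continuous_on K (\<lambda>q. (\<lambda>(\<epsilon>, q). if \<epsilon> = 0 then I q else osc_reg \<kappa> ?\<theta> ?a \<epsilon> q) (\<epsilon>, q))"
        by (rule continuous_on_compose2[OF oc(2)]) (use e in \<open>auto intro!: continuous_intros\<close>)
      then show ?thesis using e by simp
    qed
    have eq: "fio_pairing M \<theta> (\<lambda>x y \<xi>. \<rho> (x, y) * a x y \<xi>) \<kappa> \<epsilon> f h =
        (LINT x|M. LINT y|M. ext (osc_reg \<kappa> ?\<theta> ?a \<epsilon>) (x, y) * f y * h x)" for \<epsilon>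
    proof -
      have "(LINT \<xi>|lborel. \<kappa> (\<epsilon> *\<^sub>R \<xi>) * exp (\<i> * of_real (\<theta> x y \<xi>)) * (\<rho> (x, y) * a x y \<xi>) * f y * h x) =
          ext (osc_reg \<kappa> ?\<theta> ?a \<epsilon>) (x, y) * f y * h x" for x y
      proof -
        have "(LINT \<xi>|lborel. \<kappa> (\<epsilon> *\<^sub>R \<xi>) * exp (\<i> * of_real (\<theta> x y \<xi>)) * (\<rho> (x, y) * a x y \<xi>) * f y * h x) =
          (LINT \<xi>|lborel. (\<rho> (x, y) * f y * h x) * (\<kappa> (\<epsilon> *\<^sub>R \<xi>) * exp (\<i> * of_real (\<theta> x y \<xi>)) * a x y \<xi>))"
          by (simp add: mult_ac)
        also have "\<dots> = (\<rho> (x, y) * f y * h x) * osc_reg \<kappa> ?\<theta> ?a \<epsilon> (x, y)"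
          by (simp add: osc_reg_def)
        also have "\<dots> = ext (osc_reg \<kappa> ?\<theta> ?a \<epsilon>) (x, y) * f y * h x"
          using \<rho>(3)[of "(x, y)"] by (simp add: ext_def indicator_def mult_ac)
        finally show ?thesis .
      qed
      then show ?thesis unfolding fio_pairing_def by (simp only:)
    qed
    show ?thesis
      unfolding eq
    proof (rule pairing_limit[OF ext(1)[OF I] B _ _ _ f h])
      show "ext (osc_reg \<kappa> ?\<theta> ?a \<epsilon>) \<in> borel_measurable borel" if "\<epsilon> > 0" for \<epsilon>
        by (rule ext(1)[OF Rc[OF that]])
      show "\<exists>B. \<forall>p. norm (ext (osc_reg \<kappa> ?\<theta> ?a \<epsilon>) p) \<le> B" if "\<epsilon> > 0" for \<epsilon>
        by (rule ext(2)[OF Rc[OF that]])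
      fix \<delta> :: real assume d: "\<delta> > 0"
      have "uniform_limit K (osc_reg \<kappa> ?\<theta> ?a) I (at_right 0)"
        by (rule uniform_limit_osc[OF oc(2) K])
      then have "\<forall>\<^sub>F \<epsilon> in at_right 0. \<forall>p\<in>K. dist (osc_reg \<kappa> ?\<theta> ?a \<epsilon> p) (I p) < \<delta> / (C + 1)"
        by (rule uniform_limitD) (use d C in simp)
      then show "\<forall>\<^sub>F \<epsilon> in at_right 0. \<forall>p. norm (ext (osc_reg \<kappa> ?\<theta> ?a \<epsilon>) p - ext I p) \<le> \<delta>"
      proof eventually_elim
        case (elim \<epsilon>)
        show ?case
        proof
          fix p
          show "norm (ext (osc_reg \<kappa> ?\<theta> ?a \<epsilon>) p - ext I p) \<le> \<delta>"
          proof (cases "p \<in> K")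
            case True
            have "norm (ext (osc_reg \<kappa> ?\<theta> ?a \<epsilon>) p - ext I p) = norm (\<rho> p) * dist (osc_reg \<kappa> ?\<theta> ?a \<epsilon> p) (I p)"
              using True by (simp add: ext_def dist_norm norm_mult flip: right_diff_distrib)
            also have "\<dots> \<le> (C + 1) * (\<delta> / (C + 1))"
              using \<rho>(2)[of p] C elim True by (intro mult_mono) (auto intro: less_imp_le add_increasing2)
            finally show ?thesis using C by simp
          qed (use d in \<open>simp add: ext_def\<close>)
        qed
      qed
    qed
  qed
  show ?thesis
    unfolding fio_hilbert_schmidt_def
    using kernel_op_hilbert_schmidt[OF ext(1)[OF I] B] lim by blast
qed

text \<open>The kernel is bounded on the compact set \<open>Z \<times> range (\<lambda>x. (x, x))\<close>, which dominates the integral over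
the manifold.\<close>

lemma osc_holo_diagonal_trace:
  fixes \<theta> :: "'a \<Rightarrow> 'a \<Rightarrow> real^'n \<Rightarrow> real"
  assumes cpt: "compact (UNIV :: 'a set)" and Z: "compact Z"
    and osc: "osc_holo Z (range (\<lambda>x. (x, x))) (\<lambda>p. \<theta> (fst p) (snd p)) (\<lambda>q. A (fst q) (fst (snd q)) (snd (snd q))) I"
  shows "z \<in> Z \<Longrightarrow> fio_trace_exists M \<theta> (A z)"
    and "(\<lambda>z. fio_trace M \<theta> (A z)) holomorphic_on interior Z"
proof -
  let ?\<Delta> = "range (\<lambda>x::'a. (x, x))" and ?\<theta> = "\<lambda>p. \<theta> (fst p) (snd p)"
  have sl: "osc_continuous ?\<Delta> ?\<theta> (\<lambda>p. A z (fst p) (snd p)) (\<lambda>p. I (z, p))" if "z \<in> Z" for z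
    using osc_holo_slice[OF osc that] by simp
  show "fio_trace_exists M \<theta> (A z)" if "z \<in> Z" for z
    by (rule osc_continuous_diagonal(4)[OF cpt sl[OF that]])
  have k: "fio_kernel \<theta> (A z) x x = I (z, (x, x))" if "z \<in> Z" for z x
    by (rule osc_continuous_diagonal(2)[OF cpt sl[OF that]])
  have zZ: "z \<in> Z" if "z \<in> interior Z" for z using subsetD[OF interior_subset that] .
  have "osc_continuous (Z \<times> ?\<Delta>) (\<lambda>q. ?\<theta> (snd q)) (\<lambda>q. A (fst q) (fst (snd q)) (snd (snd q))) I"
    using osc by (simp add: osc_holo_def)
  then have "continuous_on (Z \<times> ?\<Delta>) I" by (rule osc_value_continuous[OF _ schwartz_gauss_reg])
  then have "bounded (I ` (Z \<times> ?\<Delta>))"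
    by (intro compact_imp_bounded compact_continuous_image compact_Times Z compact_diagonal cpt)
  then obtain C where C: "\<And>z x. z \<in> Z \<Longrightarrow> norm (I (z, (x, x))) \<le> C" by (auto simp: bounded_iff)
  have "(\<lambda>z. LINT x|M. fio_kernel \<theta> (A z) x x) holomorphic_on interior Z"
  proof (rule holomorphic_on_integral[OF open_interior])
    fix x :: 'a
    have "(\<lambda>z. I (z, (x, x))) holomorphic_on interior Z"
      by (rule osc_holo_value_holomorphic[OF osc schwartz_gauss_reg]) simp
    then show "(\<lambda>z. fio_kernel \<theta> (A z) x x) holomorphic_on interior Z"
      by (rule holomorphic_transform) (simp add: k zZ)
  next
    fix z assume "z \<in> interior Z"
    then show "(\<lambda>x. fio_kernel \<theta> (A z) x x) \<in> borel_measurable M"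
      unfolding borel_measurable_M
      by (intro borel_measurable_continuous_onI osc_continuous_diagonal(3)[OF cpt sl] zZ)
  next
    fix z assume "z \<in> interior Z"
    then obtain r where r: "r > 0" "cball z r \<subseteq> interior Z" by (rule interior_contains_cball)
    have "norm (fio_kernel \<theta> (A w) x x) \<le> C" if "w \<in> cball z r" for w x
      using C[of w x] k[of w x] zZ[OF subsetD[OF r(2) that]] by simp
    then show "\<exists>r>0. \<exists>h. cball z r \<subseteq> interior Z \<and> integrable M h \<and>
        (\<forall>w\<in>cball z r. \<forall>x\<in>space M. norm (fio_kernel \<theta> (A w) x x) \<le> h x)"
      using r by (intro exI[of _ r] conjI exI[of _ "\<lambda>_. C"]) auto
  qed
  then show "(\<lambda>z. fio_trace M \<theta> (A z)) holomorphic_on interior Z" by (simp add: fio_trace_def)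
qed

end

theorem theorem6p5:
  fixes \<A> :: "('a::{t2_space, second_countable_topology}, real^'m) chart set"
    and g :: "('a, real^'m) chart \<Rightarrow> 'a \<Rightarrow> real^'m^'m"
    and vol :: "'a measure"
    and \<theta> :: "'a \<Rightarrow> 'a \<Rightarrow> real^'n \<Rightarrow> real"
    and a :: "'a \<Rightarrow> 'a \<Rightarrow> real^'n \<Rightarrow> complex"
    and U :: "('a \<times> 'a) set"
    and n :: nat
    and \<sigma> :: "nat \<Rightarrow> 'a \<Rightarrow> 'a \<Rightarrow> real^'n"
  assumes manifold: "compact_riemannian_manifold \<A> g vol"
    and phase: "phase_function \<A> \<theta>"
    and amplitude: "poly_log_homogeneous \<A> a"
    and nbhd: "open U" "\<And>x. (x, x) \<in> U"
    and nondegenerate: "\<And>x y \<eta>. (x, y) \<in> U \<Longrightarrow> sphere_stationary (\<theta> x y) \<eta> \<Longrightarrow>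
                          sphere_hessian_invertible (\<theta> x y) \<eta>"
    and stationary: "stationary_points_on \<A> U \<theta> n \<sigma>"
    and nonzero: "\<And>x s. s \<in> {1..n} \<Longrightarrow> \<theta> x x (\<sigma> s x x) \<noteq> 0"
  shows "(\<forall>x. \<exists>c. has_oscillatory_integral (\<theta> x x) (a x x) c) \<and>
         continuous_on UNIV (\<lambda>x. fio_kernel \<theta> a x x) \<and>
         fio_trace_exists vol \<theta> a \<and>
         open (nonvanishing_region U \<theta> n \<sigma>) \<and>
         (\<forall>x. (x, x) \<in> nonvanishing_region U \<theta> n \<sigma>) \<and>
         (\<forall>K. compact K \<and> K \<subseteq> nonvanishing_region U \<theta> n \<sigma> \<and>
              (\<forall>x y \<xi>. (x, y) \<notin> K \<longrightarrow> a x y \<xi> = 0) \<longrightarrow>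
            fio_hilbert_schmidt \<A> vol \<theta> a) \<and>
         (\<forall>K \<rho>. compact K \<and> K \<subseteq> nonvanishing_region U \<theta> n \<sigma> \<and>
              continuous_on UNIV \<rho> \<and> (\<forall>p. p \<notin> K \<longrightarrow> \<rho> p = 0) \<longrightarrow>
            fio_hilbert_schmidt \<A> vol \<theta> (\<lambda>x y \<xi>. \<rho> (x, y) * a x y \<xi>)) \<and>
         (\<forall>A. holomorphic_poly_log_family \<A> A \<longrightarrow>
            (\<forall>z. fio_trace_exists vol \<theta> (A z)) \<and>
            (\<lambda>z. fio_trace vol \<theta> (A z)) holomorphic_on UNIV \<and>
            is_zeta_function vol \<theta> A (\<lambda>z. fio_trace vol \<theta> (A z)) \<and>
            (\<forall>\<zeta>. is_zeta_function vol \<theta> A \<zeta> \<longrightarrow> (\<forall>z. \<not> is_pole \<zeta> z)))"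
proof -
  have \<A>: "smooth_atlas \<A>" and cpt: "compact (UNIV :: 'a set)"
    using manifold by (auto simp: compact_riemannian_manifold_def)
  interpret finite_borel_measure vol
    using riemannian_volume_finite[OF manifold]
    by (auto simp: finite_borel_measure_def finite_borel_measure_axioms_def)
  let ?N = "nonvanishing_region U \<theta> n \<sigma>" and ?\<Delta> = "range (\<lambda>x::'a. (x, x))"
  let ?\<theta> = "\<lambda>p. \<theta> (fst p) (snd p)"
  have opn: "open ?N" by (rule open_nonvanishing_region[OF \<A> phase stationary nbhd(1)])
  have diag: "(x, x) \<in> ?N" for x using nbhd(2) nonzero by (simp add: nonvanishing_region_def)
  have ph: "nonstationary_phase K ?\<theta>" if "compact K" "K \<subseteq> ?N" for K
    by (rule nonstationary_phase_region[OF \<A> phase stationary that])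
  have osc: "\<exists>I. osc_continuous K ?\<theta> (\<lambda>p. a (fst p) (snd p)) I" if K: "compact K" "K \<subseteq> ?N" for K
  proof -
    obtain I where "osc_holo {0} K ?\<theta> (\<lambda>q. a (fst (snd q)) (snd (snd q))) I"
      using osc_holo_poly_log[OF \<A> amplitude ph[OF K]] by blast
    from osc_holo_slice[OF this, of 0] show ?thesis by auto
  qed
  have ph\<Delta>: "nonstationary_phase ?\<Delta> ?\<theta>" using diag by (intro ph compact_diagonal cpt) auto
  obtain I where I: "osc_continuous ?\<Delta> ?\<theta> (\<lambda>p. a (fst p) (snd p)) I"
    using osc[of ?\<Delta>] diag compact_diagonal[OF cpt] by blast
  note kernel = osc_continuous_diagonal[OF cpt I]
  have hs: "fio_hilbert_schmidt \<A> vol \<theta> (\<lambda>x y \<xi>. \<rho> (x, y) * a x y \<xi>)"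
    if K: "compact K" "K \<subseteq> ?N" and \<rho>: "\<rho> \<in> borel_measurable borel" "\<And>p. norm (\<rho> p) \<le> C" "\<And>p. p \<notin> K \<Longrightarrow> \<rho> p = 0"
    for K \<rho> C
  proof -
    obtain I where "osc_continuous K ?\<theta> (\<lambda>p. a (fst p) (snd p)) I" using osc[OF K] by blast
    then show ?thesis by (rule osc_continuous_hilbert_schmidt[OF cpt \<A> K(1) _ \<rho>])
  qed
  have hs1: "fio_hilbert_schmidt \<A> vol \<theta> a"
    if K: "compact K" "K \<subseteq> ?N" and z: "\<forall>x y \<xi>. (x, y) \<notin> K \<longrightarrow> a x y \<xi> = 0" for K
  proof -
    have Kb: "K \<in> sets borel" by (rule borel_closed[OF compact_imp_closed[OF K(1)]])
    have "fio_hilbert_schmidt \<A> vol \<theta> (\<lambda>x y \<xi>. indicator K (x, y) * a x y \<xi>)"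
      by (rule hs[OF K, of _ 1]) (use Kb in \<open>auto simp: indicator_def[abs_def] intro: borel_measurable_indicator\<close>)
    moreover have "(\<lambda>x y \<xi>. indicator K (x, y) * a x y \<xi>) = a"
      using z by (auto simp: fun_eq_iff indicator_def)
    ultimately show ?thesis by simp
  qed
  have hs2: "fio_hilbert_schmidt \<A> vol \<theta> (\<lambda>x y \<xi>. \<rho> (x, y) * a x y \<xi>)"
    if K: "compact K" "K \<subseteq> ?N" and \<rho>: "continuous_on UNIV \<rho>" "\<forall>p. p \<notin> K \<longrightarrow> \<rho> p = 0" for K \<rho>
  proof -
    have "bounded (\<rho> ` K)"
      by (intro compact_imp_bounded compact_continuous_image continuous_on_subset[OF \<rho>(1)] K(1)) simp
    then obtain B where B: "\<And>p. p \<in> K \<Longrightarrow> norm (\<rho> p) \<le> B" by (auto simp: bounded_iff)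
    have "norm (\<rho> p) \<le> max B 0" for p using B[of p] spec[OF \<rho>(2), of p] by (cases "p \<in> K") auto
    then show ?thesis by (rule hs[OF K borel_measurable_continuous_onI[OF \<rho>(1)]]) (use \<rho>(2) in blast)
  qed
  have family: "(\<forall>z. fio_trace_exists vol \<theta> (A z)) \<and>
            (\<lambda>z. fio_trace vol \<theta> (A z)) holomorphic_on UNIV \<and>
            is_zeta_function vol \<theta> A (\<lambda>z. fio_trace vol \<theta> (A z)) \<and>
            (\<forall>\<zeta>. is_zeta_function vol \<theta> A \<zeta> \<longrightarrow> (\<forall>z. \<not> is_pole \<zeta> z))"
    if A: "holomorphic_poly_log_family \<A> A" for A
  proof -
    have ball: "fio_trace_exists vol \<theta> (A z)" "(\<lambda>z. fio_trace vol \<theta> (A z)) holomorphic_on ball 0 R" if "norm z \<le> R" for z R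
    proof -
      obtain I where I: "osc_holo (cball 0 R) ?\<Delta> ?\<theta> (\<lambda>q. A (fst q) (fst (snd q)) (snd (snd q))) I"
        using osc_holo_family[OF \<A> A ph\<Delta> compact_cball] by blast
      note t = osc_holo_diagonal_trace[OF cpt compact_cball I]
      show "fio_trace_exists vol \<theta> (A z)" by (rule t(1)) (use that in simp)
      show "(\<lambda>z. fio_trace vol \<theta> (A z)) holomorphic_on ball 0 R" using t(2) by simp
    qed
    have ex: "fio_trace_exists vol \<theta> (A z)" for z by (rule ball(1)[OF order_refl])
    \<comment> \<open>Each ball has its own finite set of exceptional terms; the trace itself does not depend on the ball.\<close>
    have "(\<lambda>z. fio_trace vol \<theta> (A z)) holomorphic_on (\<Union>R\<in>UNIV. ball 0 (norm (R::complex)))"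
      by (intro holomorphic_on_UN_open ball(2)[OF order_refl]) auto
    moreover have "(\<Union>R\<in>UNIV. ball 0 (norm (R::complex))) = (UNIV :: complex set)"
    proof -
      have "z \<in> ball 0 (norm (of_real (norm z + 1) :: complex))" for z :: complex
        by (simp add: abs_if add_nonneg_pos not_less)
      then show ?thesis by blast
    qed
    ultimately have hol: "(\<lambda>z. fio_trace vol \<theta> (A z)) holomorphic_on UNIV" by simp
    then have "(\<lambda>z. fio_trace vol \<theta> (A z)) meromorphic_on UNIV"
      by (intro analytic_on_imp_meromorphic_on) (simp add: analytic_on_open)
    then have zeta: "is_zeta_function vol \<theta> A (\<lambda>z. fio_trace vol \<theta> (A z))"
      using ex by (auto simp: is_zeta_function_def)
    have "\<not> is_pole \<zeta> z" if \<zeta>: "is_zeta_function vol \<theta> A \<zeta>" for \<zeta> z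
    proof -
      obtain R where R: "\<And>z. Re z < R \<Longrightarrow> \<zeta> z = fio_trace vol \<theta> (A z)"
        using \<zeta> unfolding is_zeta_function_def by blast
      have "\<zeta> meromorphic_on UNIV" using \<zeta> by (simp add: is_zeta_function_def)
      from meromorphic_extension_no_pole[OF this hol R] show ?thesis .
    qed
    then show ?thesis using ex hol zeta by blast
  qed
  show ?thesis
    using kernel(1) kernel(3,4) opn diag hs1 hs2 family by blast
qed

end
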